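(* Let $n\ge 2$. (i) Let $\Omega\subsetneq\mathbb{R}^n$ be a domain with boundary of class $\mathcal{C}^2$ satisfying a uniform interior sphere condition, let $\mathcal{H}(y)$ be the mean curvature of $\partial\Omega$ at $y\in\partial\Omega$ and let $\underline{\mathcal{H}}:=\inf_{y\in\partial\Omega}\mathcal{H}(y)$. Then there exists $\mathcal{B}_1\ge (n-1)\underline{\mathcal{H}}$ such that for all $u\in C_c^\infty(\Omega)$ and all $s\ge 1$ $$\int_\Omega \frac{|\nabla u|}{d^{s-1}}\,dx \;\ge\; (s-1)\int_\Omega\frac{|u|}{d^s}\,dx+\mathcal{B}_1\int_\Omega\frac{|u|}{d^{s-1}}\,dx. \qquad ( * )$$ (ii) Let $s\ge 2$ and let $\Omega\subset\mathbb{R}^n$ be a bounded domain with boundary of class $\mathcal{C}^2$ having strictly positive mean curvature. Then the constant $s-1$ in the first term on the right-hand side of $( * )$ and the exponent $s-1$ on the distance function in the last term of $( * )$ are optimal, that is: (a) $\displaystyle\inf_{u\in C_c^\infty(\Omega)\setminus\{0\}}\frac{\int_\Omega |\nabla u|\,d^{1-s}dx}{\int_\Omega |u|\,d^{-s}dx}=s-1$; (b) for every $q>s-1$ there is no constant $c>0$ such that $\int_\Omega |\nabla u|\,d^{1-s}dx\ge (s-1)\int_\Omega |u|\,d^{-s}dx+c\int_\Omega |u|\,d^{-q}dx$ for all $u\in C_c^\infty(\Omega)$. In addition, the best (largest) constant $\mathcal{B}_1$ for which $( * )$ holds for all $u\in C_c^\infty(\Omega)$ (for this fixed $s$) satisfies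 $$(n-1)\underline{\mathcal{H}}\;\le\;\mathcal{B}_1\;\le\;\frac{n-1}{|\partial\Omega|}\int_{\partial\Omega}\mathcal{H}(y)\,dS_y,\qquad \underline{\mathcal{H}}=\min_{y\in\partial\Omega}\mathcal{H}(y).$$
   Context: A domain is an open connected subset of $\mathbb{R}^n$. $d=d(x):=\operatorname{dist}(x,\mathbb{R}^n\setminus\Omega)$. Mean curvature: $\mathcal{H}(y):=\frac{1}{n-1}\sum_{i=1}^{n-1}\kappa_i(y)$, where $\kappa_1(y),\dots,\kappa_{n-1}(y)$ are the principal curvatures of $\partial\Omega$ at $y$, with the sign convention that they equal $1/R$ when $\Omega$ is a ball of radius $R$. $\Omega$ satisfies a uniform interior sphere condition if there is $r_0>0$ such that for every $y\in\partial\Omega$ there is an open ball $B\subset\Omega$ of radius at least $r_0$ with $\overline{B}\cap(\mathbb{R}^n\setminus\Omega)=\{y\}$. $|\partial\Omega|$ is the surface area of $\partial\Omega$. If $\underline{\mathcal{H}}=-\infty$ in (i), the value $\mathcal{B}_1=-\infty$ is allowed and the statement is empty. *)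

theory Defs
  imports "HOL-Analysis.Analysis"
begin

definition gradient :: "('a::euclidean_space \<Rightarrow> real) \<Rightarrow> 'a \<Rightarrow> 'a" where
  "gradient f x = (THE D. GDERIV f x :> D)"

text \<open>\<open>C_diff k f\<close>: the function \<open>f\<close> is of class \<open>C\<^sup>k\<close> on the whole space.\<close>

primrec C_diff :: "nat \<Rightarrow> ('a::euclidean_space \<Rightarrow> real) \<Rightarrow> bool" where
  "C_diff 0 f \<longleftrightarrow> continuous_on UNIV f"
| "C_diff (Suc k) f \<longleftrightarrow>
     (\<forall>x. f differentiable (at x)) \<and> (\<forall>v. C_diff k (\<lambda>x. frechet_derivative f (at x) v))"

definition Cc_infinity :: "'a::euclidean_space set \<Rightarrow> ('a \<Rightarrow> real) set" where
  "Cc_infinity \<Omega> = {u. (\<forall>k. C_diff k u) \<and>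
     compact (closure {x. u x \<noteq> 0}) \<and> closure {x. u x \<noteq> 0} \<subseteq> \<Omega>}"

definition domain :: "'a::euclidean_space set \<Rightarrow> bool" where
  "domain \<Omega> \<longleftrightarrow> open \<Omega> \<and> connected \<Omega> \<and> \<Omega> \<noteq> {}"

abbreviation bdist :: "'a::euclidean_space set \<Rightarrow> 'a \<Rightarrow> real" where
  "bdist \<Omega> x \<equiv> infdist x (- \<Omega>)"

definition interior_sphere_condition :: "'a::euclidean_space set \<Rightarrow> bool" where
  "interior_sphere_condition \<Omega> \<longleftrightarrow>
     (\<exists>r0>0. \<forall>y\<in>frontier \<Omega>. \<exists>c r. r \<ge> r0 \<and> ball c r \<subseteq> \<Omega> \<and>
        closure (ball c r) \<inter> (- \<Omega>) = {y})"

text \<open>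
  In \<open>ball y r\<close> the set \<open>\<Omega>\<close> is the part above the graph of a \<open>C\<^sup>2\<close> function \<open>\<gamma>\<close> over
  the hyperplane orthogonal to the unit vector \<open>\<nu>\<close>.  A function on that hyperplane is
  represented by its extension to the whole space that is constant in direction \<open>\<nu>\<close>; its
  gradient and Hessian are then those of the function on the hyperplane.
\<close>

definition graph_chart ::
  "'a::euclidean_space set \<Rightarrow> 'a \<Rightarrow> real \<Rightarrow> 'a \<Rightarrow> ('a \<Rightarrow> real) \<Rightarrow> bool" where
  "graph_chart \<Omega> y r \<nu> \<gamma> \<longleftrightarrow>
     r > 0 \<and> norm \<nu> = 1 \<and> C_diff 2 \<gamma> \<and>
     (\<forall>x t. \<gamma> (x + t *\<^sub>R \<nu>) = \<gamma> x) \<and>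
     (\<forall>x\<in>ball y r. x \<in> \<Omega> \<longleftrightarrow> \<gamma> x < x \<bullet> \<nu>)"

definition C2_boundary :: "'a::euclidean_space set \<Rightarrow> bool" where
  "C2_boundary \<Omega> \<longleftrightarrow> (\<forall>y\<in>frontier \<Omega>. \<exists>r \<nu> \<gamma>. graph_chart \<Omega> y r \<nu> \<gamma>)"

text \<open>
  Principal curvatures at \<open>y\<close>, listed as \<open>\<kappa> 0, \<dots>, \<kappa> (n - 2)\<close> with multiplicity: the
  eigenvalues of the Hessian at \<open>y\<close> of a graph function over the tangent hyperplane at \<open>y\<close>
  (so its gradient vanishes at \<open>y\<close> and \<open>\<nu>\<close> is the inner unit normal).  For a ball of
  radius \<open>R\<close> the graph function is \<open>x' \<mapsto> c - sqrt (R\<^sup>2 - \<bar>x'\<bar>\<^sup>2)\<close> near \<open>0\<close>, so that all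
  \<open>\<kappa> i\<close> are \<open>1 / R\<close>.
\<close>

definition principal_curvatures ::
  "'a::euclidean_space set \<Rightarrow> 'a \<Rightarrow> (nat \<Rightarrow> real) \<Rightarrow> bool" where
  "principal_curvatures \<Omega> y \<kappa> \<longleftrightarrow>
     (\<exists>r \<nu> \<gamma> e. graph_chart \<Omega> y r \<nu> \<gamma> \<and> gradient \<gamma> y = 0 \<and>
        (\<forall>i<DIM('a) - 1. e i \<bullet> \<nu> = 0) \<and>
        (\<forall>i<DIM('a) - 1. \<forall>j<DIM('a) - 1. e i \<bullet> e j = (if i = j then 1 else 0)) \<and>
        (\<forall>i<DIM('a) - 1. frechet_derivative (gradient \<gamma>) (at y) (e i) = \<kappa> i *\<^sub>R e i))"

definition mean_curvature :: "'a::euclidean_space set \<Rightarrow> 'a \<Rightarrow> real" where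
  "mean_curvature \<Omega> y =
     (THE h. \<exists>\<kappa>. principal_curvatures \<Omega> y \<kappa> \<and>
        h = (\<Sum>i<DIM('a) - 1. \<kappa> i) / real (DIM('a) - 1))"

definition inf_mean_curvature :: "'a::euclidean_space set \<Rightarrow> ereal" where
  "inf_mean_curvature \<Omega> = (INF y\<in>frontier \<Omega>. ereal (mean_curvature \<Omega> y))"

text \<open>
  The surface measure on the boundary: the Borel measure concentrated on \<open>frontier \<Omega>\<close> which
  in every chart is \<open>sqrt (1 + \<bar>\<nabla>\<gamma>\<bar>\<^sup>2) dx'\<close>, where \<open>dx'\<close> is \<open>(n-1)\<close>-dimensional Lebesgue
  measure on the hyperplane orthogonal to \<open>\<nu>\<close>.  As the integrand below is constant in
  direction \<open>\<nu>\<close>, its integral over the hyperplane equals, by Fubini, its integral over the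
  slab \<open>{x. 0 \<le> x \<bullet> \<nu> \<and> x \<bullet> \<nu> \<le> 1}\<close> of thickness \<open>1\<close>.  The point
  \<open>x + (\<gamma> x - x \<bullet> \<nu>) *\<^sub>R \<nu>\<close> is the point of the graph on the line \<open>x + \<real> \<nu>\<close>.
\<close>

definition is_surface_measure :: "'a::euclidean_space set \<Rightarrow> 'a measure \<Rightarrow> bool" where
  "is_surface_measure \<Omega> \<sigma> \<longleftrightarrow>
     sets \<sigma> = sets borel \<and> emeasure \<sigma> (- frontier \<Omega>) = 0 \<and>
     (\<forall>y\<in>frontier \<Omega>. \<forall>r \<nu> \<gamma>. graph_chart \<Omega> y r \<nu> \<gamma> \<longrightarrow>
        (\<forall>A\<in>sets borel. A \<subseteq> frontier \<Omega> \<inter> ball y r \<longrightarrow>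
           emeasure \<sigma> A =
             (\<integral>\<^sup>+x\<in>{x. 0 \<le> x \<bullet> \<nu> \<and> x \<bullet> \<nu> \<le> 1}.
                ennreal (sqrt (1 + (norm (gradient \<gamma> x))\<^sup>2)) *
                indicator A (x + (\<gamma> x - x \<bullet> \<nu>) *\<^sub>R \<nu>) \<partial>lborel)))"

definition surface_measure :: "'a::euclidean_space set \<Rightarrow> 'a measure" where
  "surface_measure \<Omega> = (THE \<sigma>. is_surface_measure \<Omega> \<sigma>)"

definition weighted_L1 :: "'a::euclidean_space set \<Rightarrow> real \<Rightarrow> ('a \<Rightarrow> real) \<Rightarrow> real" where
  "weighted_L1 \<Omega> p u = (LINT x:\<Omega>|lborel. \<bar>u x\<bar> / bdist \<Omega> x powr p)"

definition weighted_grad_L1 :: "'a::euclidean_space set \<Rightarrow> real \<Rightarrow> ('a \<Rightarrow> real) \<Rightarrow> real" where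
  "weighted_grad_L1 \<Omega> p u = (LINT x:\<Omega>|lborel. norm (gradient u x) / bdist \<Omega> x powr p)"

text \<open>
  The constant \<open>B\<close> is extended real to allow \<open>B = - \<infinity>\<close>, for which the inequality carries no
  information (in \<open>ereal\<close>, \<open>- \<infinity> * 0 = 0\<close>, which only concerns \<open>u = 0\<close>).
\<close>

definition L1_hardy :: "'a::euclidean_space set \<Rightarrow> real \<Rightarrow> ereal \<Rightarrow> ('a \<Rightarrow> real) \<Rightarrow> bool" where
  "L1_hardy \<Omega> s B u \<longleftrightarrow>
     ereal (weighted_grad_L1 \<Omega> (s - 1) u) \<ge>
       ereal ((s - 1) * weighted_L1 \<Omega> s u) + B * ereal (weighted_L1 \<Omega> (s - 1) u)"

end

theory Submission
  imports Defs
begin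

text \<open>
  (i) At a point \<open>x\<close> with nearest boundary point \<open>y\<close> the distance \<open>d\<close> is touched from above by the
  height over a tangent chart, so its discrete Laplacian is at most \<open>- (n - 1) H(y)\<close> up to a small
  error.  Summation by parts against \<open>\<bar>u\<bar> d\<^sup>1\<^sup>-\<^sup>s\<close> and \<open>\<bar>\<nabla>d\<bar> = 1\<close> give the inequality.

  (ii) Functions approximating \<open>d\<^sup>s\<^sup>-\<^sup>1 \<phi>(d)\<close> with a cut-off \<open>\<phi>\<close> of \<open>1 / t\<close> near \<open>0\<close> turn an inequality
  with remainder \<open>c d\<^sup>-\<^sup>q\<close> into \<open>c \<integral>\<phi>(d) d\<^sup>s\<^sup>-\<^sup>1\<^sup>-\<^sup>q \<le> \<integral>\<phi>'(d)\<close>.  By the divergence theorem for a smooth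
  extension of the unit normal, with divergence \<open>- (n - 1) H\<close> on the boundary, the right-hand side is
  \<open>\<integral>\<phi>(d) h\<close> up to a bounded error, where \<open>h = (n - 1) H\<close> on the boundary.  For continuous \<open>p\<close> the
  integral \<open>\<integral>\<phi>(d) p\<close> diverges logarithmically with coefficient \<open>\<integral>p\<close> over the boundary, which
  forces \<open>c \<le> 0\<close> if \<open>q > s - 1\<close>, and bounds \<open>c\<close> by the mean of \<open>(n - 1) H\<close> if \<open>q = s - 1\<close>.
\<close>

section \<open>Functions of class \<open>C\<^sup>k\<close>\<close>

text \<open>No neighbourhood of the boundary in which \<open>d\<close> is of class C2 is
  constructed. The distance is used only as a 1-Lipschitz function whose second differences are
  bounded above; its gradient field \<open>E\<close> is found almost everywhere, along a sequence of
  step sizes. This suffices because \<open>E\<close> differs from the Lipschitz normal field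
  \<open>N\<close> of a chart by O(d), so that \<open>1 - E \<bullet> N\<close> is O(d^2) and
  cancels the 1/d^2 in the derivative of the cut-off. Hence the error in the divergence theorem is
  bounded independently of the cut-off. Mean curvature and surface measure are definite
  descriptions, so existence and uniqueness must be proved for both. Independence of the chart comes
  from the trace of the derivative of the unit normal in the first case and from volumes of thin
  layers in the second. Mollified test functions come only with an upper bound for their gradients.
  That is enough, since the gradient stands on the larger side of the inequality. The assumption
  \<open>s \<ge> 2\<close> makes \<open>d powr (s - 1)\<close> times the cut-off increasing in
  \<open>d\<close>, so its derivative needs no absolute value.\<close>

lemma C_diff_SucI:
  assumes "\<And>x. (f has_derivative f' x) (at x)" "\<And>v. C_diff k (\<lambda>x. f' x v)"
  shows "C_diff (Suc k) f"
proof -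
  have "frechet_derivative f (at x) = f' x" for x
    using frechet_derivative_at[OF assms(1)[of x]] by simp
  then show ?thesis
    using assms by (auto simp: differentiable_def)
qed

lemma C_diff_Suc_has_derivative:
  "C_diff (Suc k) f \<Longrightarrow> (f has_derivative frechet_derivative f (at x)) (at x)"
  by (simp add: frechet_derivative_works)

lemma C_diff_SucD: "C_diff (Suc k) f \<Longrightarrow> C_diff k f"
proof (induction k arbitrary: f)
  case 0
  then show ?case
    by (auto intro!: continuous_at_imp_continuous_on differentiable_imp_continuous_within)
next
  case (Suc k)
  then show ?case by (metis C_diff.simps(2))
qed

lemma C_diff_mono: "C_diff k f \<Longrightarrow> j \<le> k \<Longrightarrow> C_diff j f"
proof (induction k)
  case (Suc k)
  then show ?case by (metis C_diff_SucD le_Suc_eq)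
qed auto

lemma C_diff_continuous_on: "C_diff k f \<Longrightarrow> continuous_on S f"
  using C_diff_mono[of k f 0] continuous_on_subset[of UNIV f S] by auto

lemma C_diff_const [simp]: "C_diff k (\<lambda>x. c)"
  by (induction k arbitrary: c) auto

lemma C_diff_bounded_linear:
  assumes "bounded_linear f" shows "C_diff k f"
proof (cases k)
  case 0
  then show ?thesis using assms by (simp add: linear_continuous_on)
next
  case (Suc j)
  show ?thesis unfolding Suc
    by (rule C_diff_SucI[where f'="\<lambda>_. f"])
      (simp_all add: assms bounded_linear_imp_has_derivative)
qed

lemma C_diff_add: "C_diff k f \<Longrightarrow> C_diff k g \<Longrightarrow> C_diff k (\<lambda>x. f x + g x)"
proof (induction k arbitrary: f g)
  case 0
  then show ?case by (auto intro: continuous_on_add)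
next
  case (Suc k)
  show ?case
  proof (rule C_diff_SucI)
    show "((\<lambda>x. f x + g x) has_derivative
        (\<lambda>v. frechet_derivative f (at x) v + frechet_derivative g (at x) v)) (at x)" for x
      using Suc.prems by (auto intro!: has_derivative_add C_diff_Suc_has_derivative)
    show "C_diff k (\<lambda>x. frechet_derivative f (at x) v + frechet_derivative g (at x) v)" for v
      using Suc by auto
  qed
qed

lemma C_diff_mult: "C_diff k f \<Longrightarrow> C_diff k g \<Longrightarrow> C_diff k (\<lambda>x. f x * g x)"
proof (induction k arbitrary: f g)
  case 0
  then show ?case by (auto intro: continuous_on_mult)
next
  case (Suc k)
  have fg: "C_diff k f" "C_diff k g" using Suc.prems C_diff_SucD by blast+
  show ?case
  proof (rule C_diff_SucI)
    show "((\<lambda>x. f x * g x) has_derivative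
        (\<lambda>v. f x * frechet_derivative g (at x) v + frechet_derivative f (at x) v * g x)) (at x)" for x
      using Suc.prems by (auto intro!: has_derivative_mult C_diff_Suc_has_derivative)
    show "C_diff k (\<lambda>x. f x * frechet_derivative g (at x) v + frechet_derivative f (at x) v * g x)" for v
      using Suc fg by (auto intro!: C_diff_add)
  qed
qed

lemma C_diff_minus: "C_diff k f \<Longrightarrow> C_diff k (\<lambda>x. - f x)"
  using C_diff_mult[of k "\<lambda>_. -1" f] by simp

lemma C_diff_diff: "C_diff k f \<Longrightarrow> C_diff k g \<Longrightarrow> C_diff k (\<lambda>x. f x - g x)"
  using C_diff_add[of k f "\<lambda>x. - g x"] C_diff_minus by auto

lemma C_diff_sum: "(\<And>i. i \<in> I \<Longrightarrow> C_diff k (f i)) \<Longrightarrow> C_diff k (\<lambda>x. \<Sum>i\<in>I. f i x)"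
  by (induction I rule: infinite_finite_induct) (auto intro: C_diff_add)

lemma C_diff_prod: "(\<And>i. i \<in> I \<Longrightarrow> C_diff k (f i)) \<Longrightarrow> C_diff k (\<lambda>x. \<Prod>i\<in>I. f i x)"
  by (induction I rule: infinite_finite_induct) (auto intro: C_diff_mult)

text \<open>With a scalar outer function the chain rule gives the product of a directional
  derivative of \<open>f\<close> with \<open>h'(f x)\<close>. The second factor is again a
  composition, so the induction must run over all pairs \<open>h\<close>, \<open>f\<close>, and
  \<open>C_diff_mult\<close> closes it.\<close>

lemma C_diff_compose:
  fixes h :: "real \<Rightarrow> real"
  shows "C_diff k h \<Longrightarrow> C_diff k f \<Longrightarrow> C_diff k (\<lambda>x. h (f x))"
proof (induction k arbitrary: h f)
  case 0
  then show ?case by (auto intro: continuous_on_compose2)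
next
  case (Suc k)
  have f: "C_diff k f" using Suc.prems C_diff_SucD by blast
  show ?case
  proof (rule C_diff_SucI)
    fix x
    have "linear (frechet_derivative h (at (f x)))"
      using Suc.prems(1) by (simp add: linear_frechet_derivative)
    then have *: "frechet_derivative h (at (f x)) w = w * frechet_derivative h (at (f x)) 1" for w
      by (metis linear_scale mult.right_neutral real_scaleR_def)
    have "((\<lambda>x. h (f x)) has_derivative
        (\<lambda>v. frechet_derivative h (at (f x)) (frechet_derivative f (at x) v))) (at x)"
      using has_derivative_compose[OF C_diff_Suc_has_derivative[OF Suc.prems(2)]
          C_diff_Suc_has_derivative[OF Suc.prems(1)]] .
    moreover have "(\<lambda>v. frechet_derivative h (at (f x)) (frechet_derivative f (at x) v)) =
        (\<lambda>v. frechet_derivative f (at x) v * frechet_derivative h (at (f x)) 1)"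
      by (rule ext) (rule *)
    ultimately show "((\<lambda>x. h (f x)) has_derivative
        (\<lambda>v. frechet_derivative f (at x) v * frechet_derivative h (at (f x)) 1)) (at x)"
      by (simp only:)
    show "C_diff k (\<lambda>x. frechet_derivative f (at x) v * frechet_derivative h (at (f x)) 1)" for v
      using Suc f by (auto intro!: C_diff_mult)
  qed
qed

lemma C_diff_real_SucI:
  fixes h :: "real \<Rightarrow> real"
  assumes "\<And>x. (h has_real_derivative h' x) (at x)" "C_diff k h'"
  shows "C_diff (Suc k) h"
proof (rule C_diff_SucI)
  show "(h has_derivative (\<lambda>v. h' x * v)) (at x)" for x
    using assms(1)[of x] by (simp add: has_field_derivative_def)
  show "C_diff k (\<lambda>x. h' x * v)" for v
    using assms(2) by (auto intro: C_diff_mult)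
qed

lemma C_diff_inner: "C_diff k (\<lambda>x. x \<bullet> a)"
  by (rule C_diff_bounded_linear) (rule bounded_linear_inner_left)

lemma C_diff_norm_power2: "C_diff k (\<lambda>x::'a::euclidean_space. (norm (x - a))\<^sup>2)"
proof -
  have "(\<lambda>x. (norm (x - a))\<^sup>2) = (\<lambda>x::'a. \<Sum>b\<in>Basis. (x \<bullet> b - a \<bullet> b) * (x \<bullet> b - a \<bullet> b))"
    by (rule ext) (subst power2_norm_eq_inner, subst euclidean_inner, simp add: inner_diff_left)
  then show ?thesis
    by (auto intro!: C_diff_sum C_diff_mult C_diff_diff C_diff_inner)
qed

section \<open>Gradients and Hessians of scalar functions\<close>

lemma inner_left_ext:
  fixes x y :: "'a::real_inner"
  assumes "\<And>h. h \<bullet> x = h \<bullet> y" shows "x = y"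
proof -
  have "(x - y) \<bullet> (x - y) = 0"
    using assms[of "x - y"] by (simp add: inner_diff_right)
  then show ?thesis by simp
qed

text \<open>\<open>gradient\<close> is a definite description. The vector of partial derivatives is
  exhibited as a witness, and uniqueness of the derivative turns the description into this
  vector.\<close>

lemma GDERIV_gradient:
  fixes f :: "'a::euclidean_space \<Rightarrow> real"
  assumes "f differentiable (at x)"
  shows "GDERIV f x :> gradient f x"
    and "frechet_derivative f (at x) v = gradient f x \<bullet> v"
proof -
  let ?D = "\<Sum>b\<in>Basis. frechet_derivative f (at x) b *\<^sub>R b"
  have lin: "linear (frechet_derivative f (at x))"
    using assms by (rule linear_frechet_derivative)
  have eq: "frechet_derivative f (at x) v = v \<bullet> ?D" for v
  proof -
    have "frechet_derivative f (at x) v = frechet_derivative f (at x) (\<Sum>b\<in>Basis. (v \<bullet> b) *\<^sub>R b)"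
      by (simp add: euclidean_representation)
    also have "\<dots> = (\<Sum>b\<in>Basis. (v \<bullet> b) * frechet_derivative f (at x) b)"
      using lin by (simp add: linear_sum linear_scale)
    finally show ?thesis by (simp add: inner_sum_right mult.commute)
  qed
  have D: "GDERIV f x :> ?D"
  proof -
    have "frechet_derivative f (at x) = (\<lambda>v. v \<bullet> ?D)" by (rule ext) (rule eq)
    then show ?thesis
      using assms unfolding gderiv_def frechet_derivative_works by metis
  qed
  have "E = ?D" if "GDERIV f x :> E" for E
  proof -
    have "(\<lambda>h. h \<bullet> E) = (\<lambda>h. h \<bullet> ?D)"
      using has_derivative_unique that D unfolding gderiv_def by blast
    then have "h \<bullet> E = h \<bullet> ?D" for h by (rule fun_cong)
    then show ?thesis by (rule inner_left_ext)
  qed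
  then have g: "gradient f x = ?D"
    unfolding gradient_def using D by blast
  show "GDERIV f x :> gradient f x" unfolding g by (rule D)
  show "frechet_derivative f (at x) v = gradient f x \<bullet> v"
    unfolding g by (subst inner_commute) (rule eq)
qed

lemma gradient_unique:
  fixes f :: "'a::euclidean_space \<Rightarrow> real"
  assumes "(f has_derivative (\<lambda>h. h \<bullet> D)) (at x)"
  shows "gradient f x = D"
proof -
  have "f differentiable (at x)" using assms differentiable_def by blast
  note GDERIV_gradient(1)[OF this]
  then have "(\<lambda>h. h \<bullet> gradient f x) = (\<lambda>h. h \<bullet> D)"
    using assms has_derivative_unique unfolding gderiv_def by blast
  then have "h \<bullet> gradient f x = h \<bullet> D" for h by (rule fun_cong)
  then show ?thesis by (rule inner_left_ext)
qed

lemma gradient_conv_sum: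
  fixes f :: "'a::euclidean_space \<Rightarrow> real"
  assumes "f differentiable (at x)"
  shows "gradient f x = (\<Sum>b\<in>Basis. frechet_derivative f (at x) b *\<^sub>R b)"
  by (rule euclidean_eqI) (simp add: GDERIV_gradient(2)[OF assms] inner_sum_left inner_Basis if_distrib sum.If_cases cong: if_cong)

lemma has_derivative_gradient:
  fixes f :: "'a::euclidean_space \<Rightarrow> real"
  assumes "C_diff (Suc k) f"
  shows "(f has_derivative (\<lambda>h. gradient f x \<bullet> h)) (at x)"
  using GDERIV_gradient(1)[of f x] assms unfolding gderiv_def by (simp add: inner_commute)

lemma continuous_on_gradient:
  fixes f :: "'a::euclidean_space \<Rightarrow> real"
  assumes "C_diff (Suc k) f"
  shows "continuous_on S (gradient f)"
proof -
  have "C_diff k (\<lambda>x. frechet_derivative f (at x) b)" for b using assms by simp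
  then have "continuous_on S (\<lambda>x. \<Sum>b\<in>Basis. frechet_derivative f (at x) b *\<^sub>R b)"
    by (intro continuous_intros C_diff_continuous_on)
  moreover have "gradient f = (\<lambda>x. \<Sum>b\<in>Basis. frechet_derivative f (at x) b *\<^sub>R b)"
    using assms by (auto intro!: gradient_conv_sum)
  ultimately show ?thesis by simp
qed

text \<open>\<open>C_diff\<close> controls one directional derivative at a time. Writing the
  gradient as a finite sum over \<open>Basis\<close> makes it a differentiable vector field, whose
  derivative is the Hessian used in the definition of principal curvatures.\<close>

lemma has_derivative_gradient_Suc:
  fixes f :: "'a::euclidean_space \<Rightarrow> real"
  assumes "C_diff (Suc (Suc k)) f"
  shows "(gradient f has_derivative frechet_derivative (gradient f) (at x)) (at x)"
    and "frechet_derivative (gradient f) (at x) v \<bullet> w =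
      frechet_derivative (\<lambda>x. frechet_derivative f (at x) w) (at x) v"
    and "continuous_on S (\<lambda>x. frechet_derivative (gradient f) (at x) v)"
proof -
  let ?f = "\<lambda>b x. frechet_derivative f (at x) b"
  have C: "C_diff (Suc k) (?f b)" for b using assms by simp
  have d: "(?f b has_derivative frechet_derivative (?f b) (at x)) (at x)" for b x
    by (rule C_diff_Suc_has_derivative[OF C])
  have gr: "gradient f = (\<lambda>x. \<Sum>b\<in>Basis. ?f b x *\<^sub>R b)"
    using assms by (auto intro!: gradient_conv_sum)
  have gd: "(gradient f has_derivative (\<lambda>v. \<Sum>b\<in>Basis. frechet_derivative (?f b) (at x) v *\<^sub>R b)) (at x)" for x
    unfolding gr by (intro has_derivative_sum has_derivative_scaleR_left d)
  note eq = frechet_derivative_at[OF gd, symmetric]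
  show gd': "(gradient f has_derivative frechet_derivative (gradient f) (at x)) (at x)"
    unfolding eq by (rule gd)
  show "continuous_on S (\<lambda>x. frechet_derivative (gradient f) (at x) v)"
    unfolding eq using C
    by (auto intro!: continuous_intros C_diff_continuous_on[of k])
  have fw: "?f w = (\<lambda>x. gradient f x \<bullet> w)"
    using assms by (auto intro: GDERIV_gradient(2))
  have "((\<lambda>x. gradient f x \<bullet> w) has_derivative (\<lambda>v. frechet_derivative (gradient f) (at x) v \<bullet> w)) (at x)"
    by (rule has_derivative_inner_left[OF gd'])
  from frechet_derivative_at[OF this] show "frechet_derivative (gradient f) (at x) v \<bullet> w =
      frechet_derivative (?f w) (at x) v"
    unfolding fw by metis
qed

text \<open>\<open>1 - pcube (1 - pcube t)\<close> is a \<open>C\<^sup>2\<close> step from \<open>0\<close> to \<open>1\<close>.\<close>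

definition pcube :: "real \<Rightarrow> real" where "pcube t = (max 0 t) ^ 3"

lemma has_real_derivative_max_power:
  "((\<lambda>t::real. (max 0 t) ^ Suc (Suc k)) has_real_derivative real (Suc (Suc k)) * (max 0 t) ^ Suc k) (at t)"
proof -
  consider "t > 0" | "t < 0" | "t = 0" by linarith
  then show ?thesis
  proof cases
    case 1
    have "((\<lambda>t::real. t ^ Suc (Suc k)) has_real_derivative real (Suc (Suc k)) * t ^ Suc k) (at t)"
      using DERIV_pow[of "Suc (Suc k)" t] by simp
    then have "((\<lambda>t::real. (max 0 t) ^ Suc (Suc k)) has_real_derivative real (Suc (Suc k)) * t ^ Suc k) (at t)"
      by (rule has_field_derivative_transform_within_open[where S="{0<..}"]) (use 1 in auto)
    then show ?thesis using 1 by simp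
  next
    case 2
    have "((\<lambda>t::real. 0) has_real_derivative 0) (at t)" by simp
    then have "((\<lambda>t::real. (max 0 t) ^ Suc (Suc k)) has_real_derivative 0) (at t)"
      by (rule has_field_derivative_transform_within_open[where S="{..<0}"]) (use 2 in auto)
    then show ?thesis using 2 by simp
  next
    case 3
    have "((\<lambda>h::real. (max 0 h) ^ Suc (Suc k) / h) \<longlongrightarrow> 0) (at 0)"
    proof (rule Lim_null_comparison)
      show "\<forall>\<^sub>F h::real in at 0. norm ((max 0 h) ^ Suc (Suc k) / h) \<le> (max 0 h) ^ Suc k"
        by (auto intro!: always_eventually simp: max_def)
      show "((\<lambda>h::real. (max 0 h) ^ Suc k) \<longlongrightarrow> 0) (at 0)"
        by (auto intro!: tendsto_eq_intros)
    qed
    then show ?thesis using 3 by (simp add: DERIV_def)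
  qed
qed

lemma pcube_deriv: "(pcube has_real_derivative 3 * (max 0 t)\<^sup>2) (at t)"
  using has_real_derivative_max_power[of 1 t]
  by (simp add: pcube_def[abs_def] numeral_3_eq_3 power2_eq_square)

lemma C_diff_pcube: "C_diff 2 pcube"
  unfolding numeral_2_eq_2
proof (rule C_diff_real_SucI[OF pcube_deriv])
  have *: "((\<lambda>t::real. (max 0 t)\<^sup>2) has_real_derivative 2 * max 0 t) (at t)" for t
    using has_real_derivative_max_power[of 0 t] by (simp add: power2_eq_square)
  have "C_diff (Suc 0) (\<lambda>t::real. (max 0 t)\<^sup>2)"
    by (rule C_diff_real_SucI[OF *]) (auto intro!: continuous_intros)
  then show "C_diff (Suc 0) (\<lambda>t::real. 3 * (max 0 t)\<^sup>2)"
    by (intro C_diff_mult) auto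
qed

definition step :: "real \<Rightarrow> real" where "step t = 1 - pcube (1 - pcube t)"

lemma step_props:
  "t \<le> 0 \<Longrightarrow> step t = 0" "t \<ge> 1 \<Longrightarrow> step t = 1" "0 \<le> step t" "step t \<le> 1"
proof -
  show "t \<le> 0 \<Longrightarrow> step t = 0" by (simp add: step_def pcube_def)
  show "t \<ge> 1 \<Longrightarrow> step t = 1"
    using one_le_power[of t 3] by (simp add: step_def pcube_def)
  show "step t \<le> 1" by (simp add: step_def pcube_def)
  have "0 \<le> pcube t" by (simp add: pcube_def)
  then have "max 0 (1 - pcube t) \<le> 1" by simp
  then show "0 \<le> step t"
    by (simp add: step_def pcube_def[of "1 - _"] power_le_one)
qed

lemma C_diff_step: "C_diff 2 step"
  unfolding step_def[abs_def]
  by (intro C_diff_diff C_diff_const C_diff_compose[OF C_diff_pcube] C_diff_pcube)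

text \<open>The chain rule for the two nested cubes gives the factor 3 * 3. The resulting bound 9 in
  \<open>dstep_le\<close> is the source of the constants 36, 18, 19 and 27 in the later
  estimates.\<close>

definition dstep :: "real \<Rightarrow> real" where
  "dstep t = 9 * (max 0 (1 - pcube t))\<^sup>2 * (max 0 t)\<^sup>2"

lemma step_deriv: "(step has_real_derivative dstep t) (at t)"
proof -
  have "((\<lambda>t. 1 - pcube t) has_real_derivative - (3 * (max 0 t)\<^sup>2)) (at t)"
    by (auto intro!: derivative_eq_intros pcube_deriv)
  from DERIV_chain2[OF pcube_deriv this]
  show ?thesis unfolding step_def[abs_def] dstep_def
    by (auto intro!: derivative_eq_intros)
qed

lemma dstep_nonneg: "0 \<le> dstep t" by (simp add: dstep_def)

lemma continuous_on_pcube: "continuous_on S pcube"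
  using C_diff_continuous_on C_diff_pcube by blast

lemma continuous_on_step: "continuous_on S step"
  using C_diff_continuous_on C_diff_step by blast

lemma continuous_on_dstep: "continuous_on S dstep"
  unfolding dstep_def[abs_def] by (intro continuous_intros continuous_on_pcube)

lemma dstep_eq_0: "t \<le> 0 \<or> t \<ge> 1 \<Longrightarrow> dstep t = 0"
  using one_le_power[of t 3] by (auto simp: dstep_def pcube_def)

lemma dstep_le: "dstep t \<le> 9"
proof (cases "0 \<le> t \<and> t \<le> 1")
  case True
  then have "(max 0 (1 - pcube t))\<^sup>2 \<le> 1" "(max 0 t)\<^sup>2 \<le> 1"
    by (auto intro!: power_le_one simp: pcube_def)
  then show ?thesis unfolding dstep_def
    using mult_mono[of "(max 0 (1 - pcube t))\<^sup>2" 1 "(max 0 t)\<^sup>2" 1] by simp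
qed (use dstep_eq_0[of t] in auto)

text \<open>The family of flat functions is closed under differentiation, hence smooth.\<close>

definition flat :: "nat \<Rightarrow> real \<Rightarrow> real" where
  "flat k t = (if t > 0 then exp (- (1 / t)) / t ^ k else 0)"

lemma flat_nonneg: "0 \<le> flat k t" by (simp add: flat_def)

text \<open>The exponential series dominates each of its terms; the term of order
  \<open>Suc k\<close> at \<open>1 / t\<close> absorbs \<open>t ^ k\<close> and leaves one spare
  factor \<open>t\<close>.\<close>

lemma flat_le: "t > 0 \<Longrightarrow> flat k t \<le> fact (Suc k) * t"
proof -
  assume t: "t > 0"
  have "(1 / t) ^ Suc k /\<^sub>R fact (Suc k) \<le> (\<Sum>n<Suc (Suc k). (1/t) ^ n /\<^sub>R fact n)"
    using t by (intro member_le_sum[where f="\<lambda>n. (1/t) ^ n /\<^sub>R fact n"]) auto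
  also have "\<dots> \<le> exp (1/t)"
    unfolding exp_def using t by (intro sum_le_suminf summable_exp_generic) auto
  finally have "(1 / t) ^ Suc k / fact (Suc k) \<le> exp (1/t)"
    by (simp add: divide_inverse mult.commute del: fact_Suc)
  then have "1 \<le> exp (1/t) * (t ^ Suc k * fact (Suc k))"
    using t by (simp add: power_divide pos_divide_le_eq del: fact_Suc power_Suc)
  then have "1 / (exp (1/t) * t ^ k) \<le> t * fact (Suc k)"
    using t by (simp add: pos_divide_le_eq mult_ac del: fact_Suc)
  then show ?thesis using t
    by (simp add: flat_def exp_minus divide_inverse mult_ac del: fact_Suc)
qed

lemma flat_deriv: "(flat k has_real_derivative (flat (k + 2) t - real k * flat (k + 1) t)) (at t)"
proof -
  consider "t > 0" | "t < 0" | "t = 0" by linarith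
  then show ?thesis
  proof cases
    case 1
    have "((\<lambda>t. exp (- (1 / t)) / t ^ k) has_real_derivative
        (flat (k + 2) t - real k * flat (k + 1) t)) (at t)"
    \<comment> \<open>The quotient rule produces \<open>t ^ (k - 1)\<close>, where natural
      subtraction truncates at \<open>k = 0\<close>, so this case is treated separately.\<close>
    proof (cases k)
      case 0
      then show ?thesis using 1
        by (auto intro!: derivative_eq_intros simp: flat_def divide_simps power2_eq_square)
    next
      case (Suc j)
      have "((\<lambda>t. exp (- (1 / t)) / t ^ k) has_real_derivative
          ((exp (- (1/t)) * (1 / t\<^sup>2)) * t ^ k - exp (- (1/t)) * (real k * t ^ (k - 1))) / (t^k * t^k)) (at t)"
        using 1 by (auto intro!: derivative_eq_intros simp: power2_eq_square)
      moreover have "((exp (- (1/t)) * (1 / t\<^sup>2)) * t ^ k - exp (- (1/t)) * (real k * t ^ (k - 1))) / (t^k * t^k)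
          = flat (k + 2) t - real k * flat (k + 1) t"
        using 1 Suc by (simp add: flat_def field_simps power2_eq_square)
      ultimately show ?thesis by simp
    qed
    then show ?thesis
      by (rule has_field_derivative_transform_within_open[where S="{0<..}"]) (use 1 in \<open>auto simp: flat_def\<close>)
  next
    case 2
    have "((\<lambda>t::real. 0) has_real_derivative 0) (at t)" by simp
    then have "(flat k has_real_derivative 0) (at t)"
      by (rule has_field_derivative_transform_within_open[where S="{..<0}"]) (use 2 in \<open>auto simp: flat_def\<close>)
    then show ?thesis using 2 by (simp add: flat_def)
  next
    case 3
    have "((\<lambda>h. flat k h / h) \<longlongrightarrow> 0) (at 0)"
    proof (rule Lim_null_comparison)
      have "norm (flat k h / h) \<le> fact (Suc (Suc k)) * \<bar>h\<bar>" for h :: real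
      proof (cases "h > 0")
        case True
        then have "flat k h / h = flat (Suc k) h" by (simp add: flat_def)
        then show ?thesis using flat_le[OF True, of "Suc k"] flat_nonneg[of "Suc k" h] True by simp
      next
        case False
        then have "norm (flat k h / h) = 0" by (simp add: flat_def)
        moreover have "0 \<le> fact (Suc (Suc k)) * \<bar>h\<bar>"
          by (intro mult_nonneg_nonneg) auto
        ultimately show ?thesis by (simp only:)
      qed
      then show "\<forall>\<^sub>F h::real in at 0. norm (flat k h / h) \<le> fact (Suc (Suc k)) * \<bar>h\<bar>"
        by simp
      show "((\<lambda>h::real. fact (Suc (Suc k)) * \<bar>h\<bar>) \<longlongrightarrow> 0) (at 0)"
        by (auto intro!: tendsto_eq_intros)
    qed
    then show ?thesis using 3 by (simp add: DERIV_def flat_def)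
  qed
qed

lemma C_diff_flat: "C_diff j (flat k)"
proof (induction j arbitrary: k)
  case 0
  have "isCont (flat k) t" for t using flat_deriv DERIV_isCont by blast
  then show ?case by (simp add: continuous_at_imp_continuous_on)
next
  case (Suc j)
  show ?case
    by (rule C_diff_real_SucI[OF flat_deriv]) (intro C_diff_diff C_diff_mult Suc C_diff_const)
qed

section \<open>Symmetry of the Hessian, the spectral theorem and implicit functions\<close>

text \<open>The mean value theorem is applied in direction \<open>v\<close> to a difference in
  direction \<open>w\<close>, then in direction \<open>w\<close> to the derivative along
  \<open>v\<close>. The left side is symmetric in \<open>v\<close> and \<open>w\<close>, while the
  order of differentiation on the right is not.\<close>

lemma mixed_difference_mvt:
  fixes f :: "'a::euclidean_space \<Rightarrow> real"
  assumes f: "C_diff (Suc (Suc 0)) f" and h: "h > 0"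
  shows "\<exists>s t. 0 < s \<and> s < h \<and> 0 < t \<and> t < h \<and>
    f (x + h *\<^sub>R v + h *\<^sub>R w) - f (x + h *\<^sub>R v) - f (x + h *\<^sub>R w) + f x =
    h * h * frechet_derivative (\<lambda>y. frechet_derivative f (at y) v) (at (x + s *\<^sub>R v + t *\<^sub>R w)) w"
proof -
  let ?fv = "\<lambda>y. frechet_derivative f (at y) v"
  have fd: "(f has_derivative frechet_derivative f (at y)) (at y)" for y
    by (rule C_diff_Suc_has_derivative[OF f])
  have fv: "C_diff (Suc 0) ?fv" using f by simp
  have fvd: "(?fv has_derivative frechet_derivative ?fv (at y)) (at y)" for y
    by (rule C_diff_Suc_has_derivative[OF fv])
  have sc: "frechet_derivative f (at y) (r *\<^sub>R u) = r * frechet_derivative f (at y) u" for y r u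
    using fd[of y] by (simp add: has_derivative_linear linear_scale)
  have scv: "frechet_derivative ?fv (at y) (r *\<^sub>R u) = r * frechet_derivative ?fv (at y) u" for y r u
    using has_derivative_linear[OF fvd[of y]] by (simp add: linear_scale)
  have path: "((\<lambda>s. f (z + s *\<^sub>R v)) has_real_derivative ?fv (z + s *\<^sub>R v)) (at s)" for z s
  proof -
    have "((\<lambda>s. f (z + s *\<^sub>R v)) has_derivative
        (\<lambda>r. frechet_derivative f (at (z + s *\<^sub>R v)) (r *\<^sub>R v))) (at s)"
      by (rule has_derivative_compose[OF _ fd]) (auto intro!: derivative_eq_intros)
    then show ?thesis by (simp add: has_field_derivative_def sc mult_commute_abs)
  qed
  have pathv: "((\<lambda>t. ?fv (z + t *\<^sub>R w)) has_real_derivative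
      frechet_derivative ?fv (at (z + t *\<^sub>R w)) w) (at t)" for z t
  proof -
    have "((\<lambda>t. ?fv (z + t *\<^sub>R w)) has_derivative
        (\<lambda>r. frechet_derivative ?fv (at (z + t *\<^sub>R w)) (r *\<^sub>R w))) (at t)"
      by (rule has_derivative_compose[OF _ fvd]) (auto intro!: derivative_eq_intros)
    then show ?thesis by (simp add: has_field_derivative_def scv mult_commute_abs)
  qed
  let ?g = "\<lambda>s. f ((x + h *\<^sub>R w) + s *\<^sub>R v) - f (x + s *\<^sub>R v)"
  have "\<exists>s. 0 < s \<and> s < h \<and> ?g h - ?g 0 = (h - 0) * (?fv ((x + h *\<^sub>R w) + s *\<^sub>R v) - ?fv (x + s *\<^sub>R v))"
    by (rule MVT2[OF h]) (intro DERIV_diff path)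
  then obtain s where s: "0 < s" "s < h"
    and gs: "?g h - ?g 0 = h * (?fv ((x + h *\<^sub>R w) + s *\<^sub>R v) - ?fv (x + s *\<^sub>R v))" by auto
  have "\<exists>t. 0 < t \<and> t < h \<and> ?fv ((x + s *\<^sub>R v) + h *\<^sub>R w) - ?fv ((x + s *\<^sub>R v) + 0 *\<^sub>R w) =
      (h - 0) * frechet_derivative ?fv (at ((x + s *\<^sub>R v) + t *\<^sub>R w)) w"
    by (rule MVT2[OF h]) (rule pathv)
  then obtain t where t: "0 < t" "t < h"
    and ft: "?fv ((x + s *\<^sub>R v) + h *\<^sub>R w) - ?fv (x + s *\<^sub>R v) =
      h * frechet_derivative ?fv (at ((x + s *\<^sub>R v) + t *\<^sub>R w)) w" by auto
  have "f (x + h *\<^sub>R v + h *\<^sub>R w) - f (x + h *\<^sub>R v) - f (x + h *\<^sub>R w) + f x = ?g h - ?g 0"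
    by (simp add: add_ac)
  also have "\<dots> = h * (h * frechet_derivative ?fv (at ((x + s *\<^sub>R v) + t *\<^sub>R w)) w)"
    using gs ft by (simp add: add_ac)
  finally have "f (x + h *\<^sub>R v + h *\<^sub>R w) - f (x + h *\<^sub>R v) - f (x + h *\<^sub>R w) + f x =
      h * h * frechet_derivative ?fv (at (x + s *\<^sub>R v + t *\<^sub>R w)) w"
    by (simp only: mult.assoc)
  then show ?thesis using s t by blast
qed

text \<open>The same mixed difference equals \<open>h * h\<close> times either mixed derivative,
  each at a point that tends to \<open>x\<close> with \<open>h\<close>. Cancelling
  \<open>h * h\<close> and using continuity identifies the two limits.\<close>

lemma second_derivative_symmetric:
  fixes f :: "'a::euclidean_space \<Rightarrow> real"
  assumes f: "C_diff (Suc (Suc 0)) f"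
  shows "frechet_derivative (\<lambda>y. frechet_derivative f (at y) v) (at x) w =
         frechet_derivative (\<lambda>y. frechet_derivative f (at y) w) (at x) v"
proof -
  define D where "D v w y = frechet_derivative (\<lambda>y. frechet_derivative f (at y) v) (at y) w" for v w y
  have cont: "isCont (D v w) y" for v w y
    using f by (simp add: D_def[abs_def] continuous_on_eq_continuous_at)
  define h where "h n = 1 / real (Suc n)" for n
  have hpos: "h n > 0" for n by (simp add: h_def)
  have h0: "h \<longlonglongrightarrow> 0" unfolding h_def by (rule LIMSEQ_Suc[OF lim_1_over_n])
  have lim: "\<exists>p. (\<lambda>n. p n) \<longlonglongrightarrow> x \<and> (\<forall>n. f (x + h n *\<^sub>R v + h n *\<^sub>R w) - f (x + h n *\<^sub>R v) - f (x + h n *\<^sub>R w) + f x =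
      h n * h n * D v w (p n))" for v w
  proof -
    have "\<forall>n. \<exists>s t. 0 < s \<and> s < h n \<and> 0 < t \<and> t < h n \<and>
      f (x + h n *\<^sub>R v + h n *\<^sub>R w) - f (x + h n *\<^sub>R v) - f (x + h n *\<^sub>R w) + f x =
      h n * h n * D v w (x + s *\<^sub>R v + t *\<^sub>R w)"
      unfolding D_def using mixed_difference_mvt[OF f hpos] by blast
    then obtain s t where st: "\<And>n. 0 < s n \<and> s n < h n \<and> 0 < t n \<and> t n < h n \<and>
      f (x + h n *\<^sub>R v + h n *\<^sub>R w) - f (x + h n *\<^sub>R v) - f (x + h n *\<^sub>R w) + f x =
      h n * h n * D v w (x + s n *\<^sub>R v + t n *\<^sub>R w)" by metis
    have "s \<longlonglongrightarrow> 0" "t \<longlonglongrightarrow> 0"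
      using st by (auto intro!: tendsto_sandwich[OF _ _ tendsto_const h0] always_eventually less_imp_le)
    then have "(\<lambda>n. x + s n *\<^sub>R v + t n *\<^sub>R w) \<longlonglongrightarrow> x + 0 *\<^sub>R v + 0 *\<^sub>R w"
      by (intro tendsto_intros)
    then show ?thesis using st by auto
  qed
  obtain p where p: "p \<longlonglongrightarrow> x" "\<And>n. f (x + h n *\<^sub>R v + h n *\<^sub>R w) - f (x + h n *\<^sub>R v) - f (x + h n *\<^sub>R w) + f x =
      h n * h n * D v w (p n)" using lim[of v w] by blast
  obtain q where q: "q \<longlonglongrightarrow> x" "\<And>n. f (x + h n *\<^sub>R w + h n *\<^sub>R v) - f (x + h n *\<^sub>R w) - f (x + h n *\<^sub>R v) + f x =
      h n * h n * D w v (q n)" using lim[of w v] by blast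
  have "D v w (p n) = D w v (q n)" for n
  proof -
    have "h n * h n * D v w (p n) = h n * h n * D w v (q n)"
    proof -
      have eq: "x + h n *\<^sub>R w + h n *\<^sub>R v = x + h n *\<^sub>R v + h n *\<^sub>R w" by simp
      show ?thesis using p(2)[of n] q(2)[of n, unfolded eq] by linarith
    qed
    then show ?thesis using hpos[of n] by simp
  qed
  moreover have "(\<lambda>n. D v w (p n)) \<longlonglongrightarrow> D v w x" "(\<lambda>n. D w v (q n)) \<longlonglongrightarrow> D w v x"
    using p(1) q(1) cont by (auto intro: isCont_tendsto_compose)
  ultimately show ?thesis using LIMSEQ_unique unfolding D_def by auto
qed

lemma hessian_symmetric:
  fixes f :: "'a::euclidean_space \<Rightarrow> real"
  assumes f: "C_diff 2 f"
  shows "frechet_derivative (gradient f) (at x) v \<bullet> w = frechet_derivative (gradient f) (at x) w \<bullet> v"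
  using f has_derivative_gradient_Suc(2)[of 0 f x] second_derivative_symmetric[of f]
  by (simp add: numeral_2_eq_2)

text \<open>A maximiser of the quadratic form on the unit sphere of \<open>V\<close> is an
  eigenvector, and its orthogonal complement in \<open>V\<close> is invariant. Working in a subspace
  permits the induction on dimension and fits the later use on a tangent hyperplane.\<close>

lemma spectral_theorem_subspace:
  fixes A :: "'a::euclidean_space \<Rightarrow> 'a"
  assumes "linear A" "subspace V" "dim V = n"
    and "\<And>v. v \<in> V \<Longrightarrow> A v \<in> V" "\<And>v w. A v \<bullet> w = v \<bullet> A w"
  shows "\<exists>e \<kappa>. (\<forall>i<n. e i \<in> V) \<and> (\<forall>i<n. \<forall>j<n. e i \<bullet> e j = (if i = j then 1 else 0)) \<and>
    (\<forall>i<n. A (e i) = \<kappa> i *\<^sub>R e i)"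
  using assms(2-4)
proof (induction n arbitrary: V)
  case 0
  then show ?case by auto
next
  case (Suc n)
  let ?S = "V \<inter> sphere 0 1"
  have comp: "compact ?S"
    using Suc.prems(1) by (simp add: closed_Int_compact closed_subspace)
  have "V \<noteq> {0}" using Suc.prems(2) by auto
  then obtain v where v: "v \<in> V" "v \<noteq> 0" using Suc.prems(1) subspace_0 by blast
  have "v /\<^sub>R norm v \<in> ?S"
    using v Suc.prems(1) by (auto simp: subspace_scale)
  then have ne: "?S \<noteq> {}" by blast
  have "continuous_on ?S (\<lambda>x. x \<bullet> A x)"
    using assms(1) by (intro continuous_intros linear_continuous_on) (simp add: linear_conv_bounded_linear)
  from continuous_attains_sup[OF comp ne this] obtain e where e: "e \<in> ?S"
    and emax: "\<And>x. x \<in> ?S \<Longrightarrow> x \<bullet> A x \<le> e \<bullet> A e" by blast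
  define \<mu> where "\<mu> = e \<bullet> A e"
  have eV: "e \<in> V" and ee: "e \<bullet> e = 1" using e by (auto simp: dot_square_norm)
  have le: "x \<bullet> A x \<le> \<mu> * (x \<bullet> x)" if "x \<in> V" for x
  proof (cases "x = 0")
    case False
    have "x /\<^sub>R norm x \<in> ?S" using False that Suc.prems(1) by (auto simp: subspace_scale)
    from emax[OF this] have "inverse (norm x) * (inverse (norm x) * (x \<bullet> A x)) \<le> \<mu>"
      using assms(1) by (simp add: linear_scale \<mu>_def)
    then have "x \<bullet> A x / (norm x)\<^sup>2 \<le> \<mu>" by (simp add: divide_inverse power2_eq_square mult_ac)
    then show ?thesis using False by (simp add: pos_divide_le_eq dot_square_norm)
  qed (simp add: assms(1) linear_0)
  \<comment> \<open>First variation at the maximiser: \<open>le\<close> is evaluated at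
    \<open>e + t w\<close>. The term linear in \<open>t\<close> must be dominated by the quadratic
    one for every real \<open>t\<close>.\<close>
  have orth: "A e \<bullet> w = 0" if w: "w \<in> V" "w \<bullet> e = 0" for w
  proof -
    let ?c = "\<mu> * (w \<bullet> w) - w \<bullet> A w"
    have *: "2 * t * (A e \<bullet> w) \<le> t\<^sup>2 * ?c" for t
    proof -
      have "e + t *\<^sub>R w \<in> V" using eV w Suc.prems(1) by (simp add: subspace_add subspace_scale)
      note l = le[OF this]
      have "A (e + t *\<^sub>R w) = A e + t *\<^sub>R A w"
        using assms(1) by (simp add: linear_add linear_scale)
      then have "(e + t *\<^sub>R w) \<bullet> A (e + t *\<^sub>R w) =
          e \<bullet> A e + t * (e \<bullet> A w) + (t * (w \<bullet> A e) + t * (t * (w \<bullet> A w)))"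
        by (simp only: inner_add_left inner_add_right inner_scaleR_left inner_scaleR_right distrib_left)
      also have "e \<bullet> A w = A e \<bullet> w" using assms(5) by metis
      also have "w \<bullet> A e = A e \<bullet> w" by (rule inner_commute)
      finally have 1: "(e + t *\<^sub>R w) \<bullet> A (e + t *\<^sub>R w) = \<mu> + 2 * t * (A e \<bullet> w) + t\<^sup>2 * (w \<bullet> A w)"
        by (simp add: \<mu>_def power2_eq_square)
      have "e \<bullet> w = 0" using w(2) by (simp add: inner_commute)
      then have "(e + t *\<^sub>R w) \<bullet> (e + t *\<^sub>R w) = 1 + t\<^sup>2 * (w \<bullet> w)"
        using w(2) ee by (simp add: inner_add_left inner_add_right power2_eq_square)
      then have "\<mu> + 2 * t * (A e \<bullet> w) + t\<^sup>2 * (w \<bullet> A w) \<le> \<mu> * (1 + t\<^sup>2 * (w \<bullet> w))"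
        using l 1 by metis
      then show ?thesis by (simp add: algebra_simps)
    qed
    show ?thesis
    proof (rule ccontr)
      assume a: "A e \<bullet> w \<noteq> 0"
      \<comment> \<open>The maximum with 1 makes the divisor positive. With \<open>t\<close> as
        defined next, the variational inequality collapses to \<open>2 * (A e \<bullet> w)\<^sup>2
        \<le> (A e \<bullet> w)\<^sup>2\<close>.\<close>
      define c where "c = max 1 ?c"
      define t where "t = (A e \<bullet> w) / c"
      have c: "c > 0" "?c \<le> c" by (auto simp: c_def)
      have "2 * t * (A e \<bullet> w) \<le> t\<^sup>2 * c" using *[of t] c(2) mult_left_mono[OF c(2), of "t\<^sup>2"] by simp
      then have "2 * (A e \<bullet> w)\<^sup>2 \<le> (A e \<bullet> w)\<^sup>2"
        using c(1) by (simp add: t_def power2_eq_square field_simps)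
      then show False using a by simp
    qed
  qed
  \<comment> \<open>The vector \<open>?w\<close> lies in \<open>V\<close> and is orthogonal to
    \<open>e\<close>; by \<open>orth\<close> it is then orthogonal to \<open>A e\<close> as well,
    hence to itself.\<close>
  have Ae: "A e = \<mu> *\<^sub>R e"
  proof -
    let ?w = "A e - \<mu> *\<^sub>R e"
    have wV: "?w \<in> V" using eV Suc.prems by (simp add: subspace_diff subspace_scale)
    have we: "?w \<bullet> e = 0" using ee by (simp add: inner_commute[of "A e" e] inner_diff_left \<mu>_def)
    have "?w \<bullet> ?w = A e \<bullet> ?w - \<mu> * (?w \<bullet> e)"
      by (subst inner_diff_left) (simp add: inner_commute[of e])
    then have "?w \<bullet> ?w = 0" unfolding we orth[OF wV we] by simp
    then show ?thesis by simp
  qed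
  let ?W = "{y \<in> V. \<forall>x\<in>span {e}. orthogonal x y}"
  have orth_span: "(\<forall>x\<in>span {e}. orthogonal x y) \<longleftrightarrow> e \<bullet> y = 0" for y
    by (auto simp: span_singleton orthogonal_def)
  have "span {e} \<subseteq> V" by (rule span_minimal) (use eV Suc.prems(1) in auto)
  then have "dim ?W + dim (span {e}) = dim V"
    by (intro dim_subspace_orthogonal_to_vectors subspace_span Suc.prems(1))
  moreover have "dim (span {e}) = 1" using ee by (auto simp: dim_span)
  ultimately have dW: "dim ?W = n" using Suc.prems(2) by simp
  have sW: "subspace ?W"
    using Suc.prems(1) unfolding orth_span by (auto simp: subspace_def inner_add_right)
  have AW: "A v \<in> ?W" if "v \<in> ?W" for v
    using that Suc.prems(3) assms(5)[of v e] Ae unfolding orth_span by (auto simp: inner_commute)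
  have "\<exists>e \<kappa>. (\<forall>i<n. e i \<in> ?W) \<and> (\<forall>i<n. \<forall>j<n. e i \<bullet> e j = (if i = j then 1 else 0)) \<and>
    (\<forall>i<n. A (e i) = \<kappa> i *\<^sub>R e i)"
    by (rule Suc.IH[OF sW dW AW])
  then obtain f \<kappa> where f: "\<forall>i<n. f i \<in> ?W"
    "\<forall>i<n. \<forall>j<n. f i \<bullet> f j = (if i = j then 1 else 0)" "\<forall>i<n. A (f i) = \<kappa> i *\<^sub>R f i"
    by (elim exE conjE)
  have fe: "e \<bullet> f i = 0" "f i \<bullet> e = 0" if "i < n" for i
    using f(1) that unfolding orth_span by (auto simp: inner_commute)
  show ?case
    by (rule exI[of _ "case_nat e f"], rule exI[of _ "case_nat \<mu> \<kappa>"])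
      (use f fe ee Ae eV in \<open>auto simp: less_Suc_eq_0_disj split: nat.splits\<close>)
qed

lemma trace_orthonormal:
  fixes A :: "'a::euclidean_space \<Rightarrow> 'a"
  assumes "linear A" "finite B" "pairwise orthogonal B" "\<And>b. b \<in> B \<Longrightarrow> norm b = 1" "span B = UNIV"
  shows "(\<Sum>b\<in>Basis. A b \<bullet> b) = (\<Sum>e\<in>B. A e \<bullet> e)"
proof -
  have ex: "(\<Sum>e\<in>B. (x \<bullet> e) *\<^sub>R e) = x" for x
    using orthonormal_basis_expand[of B x] assms by auto
  have Ab: "A b = (\<Sum>e\<in>B. (b \<bullet> e) *\<^sub>R A e)" for b
    using arg_cong[OF ex[of b], of A] assms(1) by (simp add: linear_sum linear_scale)
  have "(\<Sum>b\<in>Basis. A b \<bullet> b) = (\<Sum>b\<in>Basis. (\<Sum>e\<in>B. (b \<bullet> e) *\<^sub>R A e) \<bullet> b)"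
    by (intro sum.cong refl) (subst Ab, rule refl)
  also have "\<dots> = (\<Sum>b\<in>Basis. \<Sum>e\<in>B. (b \<bullet> e) * (A e \<bullet> b))"
    by (simp only: inner_sum_left inner_scaleR_left)
  also have "\<dots> = (\<Sum>e\<in>B. \<Sum>b\<in>Basis. (A e \<bullet> b) * (e \<bullet> b))"
    by (subst sum.swap) (simp add: inner_commute mult.commute)
  also have "\<dots> = (\<Sum>e\<in>B. A e \<bullet> e)"
    by (subst (2) euclidean_inner) simp
  finally show ?thesis .
qed

lemma C_diff_Suc0_I:
  assumes "\<And>x. (f has_derivative f' x) (at x)" "\<And>v. continuous_on UNIV (\<lambda>x. f' x v)"
  shows "C_diff (Suc 0) f"
  using C_diff_SucI[of f f' 0] assms by simp

lemma C_diff_Suc0_divide: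
  assumes f: "C_diff (Suc 0) f" and g: "C_diff (Suc 0) g" and nz: "\<And>x. g x \<noteq> 0"
  shows "C_diff (Suc 0) (\<lambda>x. f x / g x)"
proof (rule C_diff_Suc0_I)
  show "((\<lambda>x. f x / g x) has_derivative
      (\<lambda>v. (frechet_derivative f (at x) v * g x - f x * frechet_derivative g (at x) v) / (g x * g x))) (at x)" for x
    by (rule has_derivative_divide'[OF C_diff_Suc_has_derivative[OF f] C_diff_Suc_has_derivative[OF g] nz])
  show "continuous_on UNIV (\<lambda>x. (frechet_derivative f (at x) v * g x - f x * frechet_derivative g (at x) v) / (g x * g x))" for v
    using f g nz C_diff_continuous_on[OF f] C_diff_continuous_on[OF g]
    by (intro continuous_intros) auto
qed

text \<open>The squeeze by monotonicity in direction \<open>n\<close> yields differentiability of the implicit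
  function directly, without first proving a Lipschitz bound.\<close>

lemma implicit_function_C2:
  fixes g :: "'a::euclidean_space \<Rightarrow> real"
  assumes g: "C_diff 2 g" and c: "c > 0" and lower: "\<And>z. frechet_derivative g (at z) n \<ge> c"
  obtains t where "C_diff 2 t" "\<And>z s. g (z + s *\<^sub>R n) > 0 \<longleftrightarrow> s > t z" "\<And>z. g (z + t z *\<^sub>R n) = 0"
    "\<And>z v. frechet_derivative t (at z) v =
       - frechet_derivative g (at (z + t z *\<^sub>R n)) v / frechet_derivative g (at (z + t z *\<^sub>R n)) n"
proof -
  let ?D = "\<lambda>v z. frechet_derivative g (at z) v"
  have g1: "C_diff (Suc (Suc 0)) g" using g by (simp only: numeral_2_eq_2)
  have gd: "(g has_derivative frechet_derivative g (at z)) (at z)" for z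
    by (rule C_diff_Suc_has_derivative[OF g1])
  have lin: "linear (frechet_derivative g (at z))" for z
    using gd has_derivative_linear by blast
  have path: "((\<lambda>s. g (z + s *\<^sub>R n)) has_real_derivative ?D n (z + s *\<^sub>R n)) (at s)" for z s
  proof -
    have "((\<lambda>s. g (z + s *\<^sub>R n)) has_derivative (\<lambda>r. frechet_derivative g (at (z + s *\<^sub>R n)) (r *\<^sub>R n))) (at s)"
      by (rule has_derivative_compose[OF _ gd]) (auto intro!: derivative_eq_intros)
    then show ?thesis by (simp add: has_field_derivative_def linear_scale[OF lin] mult_commute_abs)
  qed
  have mono: "g (z + s *\<^sub>R n) - g (z + s' *\<^sub>R n) \<ge> c * (s - s')" if ss: "s' < s" for z s s'
  proof -
    obtain u where "g (z + s *\<^sub>R n) - g (z + s' *\<^sub>R n) = (s - s') * ?D n (z + u *\<^sub>R n)"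
      using MVT2[OF ss, of "\<lambda>s. g (z + s *\<^sub>R n)" "\<lambda>s. ?D n (z + s *\<^sub>R n)"] path by blast
    moreover have "(s - s') * ?D n (z + u *\<^sub>R n) \<ge> (s - s') * c"
      using ss lower by (intro mult_left_mono) auto
    ultimately show ?thesis by (simp add: mult.commute)
  qed
  have ex: "\<exists>s. g (z + s *\<^sub>R n) = 0" for z
  proof -
    \<comment> \<open>Since \<open>g\<close> grows with slope at least \<open>c\<close> along
      \<open>n\<close>, moving by \<open>\<bar>g z\<bar> / c\<close> either way brackets a zero. The
      summand 1 keeps the bracket nondegenerate when \<open>g z = 0\<close>.\<close>
    define M where "M = \<bar>g z\<bar> / c + 1"
    have M: "M > 0" using c by (auto simp: M_def intro: add_nonneg_pos)
    have cM: "c * M \<ge> \<bar>g z\<bar>" using c by (simp add: M_def distrib_left)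
    have "g (z + M *\<^sub>R n) \<ge> 0" using mono[OF M, of z] cM by simp
    moreover have "g (z + (- M) *\<^sub>R n) \<le> 0"
      using mono[of "- M" 0 z] M cM by simp
    moreover have "isCont (\<lambda>s. g (z + s *\<^sub>R n)) s" for s using path DERIV_isCont by blast
    ultimately have "\<exists>s. - M \<le> s \<and> s \<le> M \<and> g (z + s *\<^sub>R n) = 0"
      using M by (intro IVT) auto
    then show ?thesis by blast
  qed
  then obtain t where t0: "\<And>z. g (z + t z *\<^sub>R n) = 0" by metis
  have tpos: "g (z + s *\<^sub>R n) > 0 \<longleftrightarrow> s > t z" for z s
  proof -
    consider "s > t z" | "s = t z" | "s < t z" by linarith
    then show ?thesis
    proof cases
      case 1
      then have "c * (s - t z) > 0" using c by simp
      then show ?thesis using mono[OF 1, of z] t0[of z] 1 by linarith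
    next
      case 3
      then have "c * (t z - s) > 0" using c by simp
      then show ?thesis using mono[OF 3, of z] t0[of z] 3 by linarith
    qed (simp add: t0)
  qed
  have tneg: "g (z + s *\<^sub>R n) < 0 \<longleftrightarrow> s < t z" for z s
    using tpos[of z s] t0[of z] mono[of s "t z" z] c
    by (smt (verit) mult_pos_pos)
  let ?t' = "\<lambda>z v. - ?D v (z + t z *\<^sub>R n) / ?D n (z + t z *\<^sub>R n)"
  have td: "(t has_derivative ?t' z) (at z)" for z
  proof -
    let ?p = "z + t z *\<^sub>R n" and ?A = "frechet_derivative g (at (z + t z *\<^sub>R n))"
    define \<alpha> where "\<alpha> = ?A n"
    have \<alpha>: "\<alpha> \<ge> c" "\<alpha> > 0" using lower[of ?p] c by (auto simp: \<alpha>_def)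
    have bl: "bounded_linear (\<lambda>v. - ?A v / \<alpha>)"
      using has_derivative_bounded_linear[OF gd[of ?p]]
      by (intro bounded_linear_minus bounded_linear_divide[THEN bounded_linear_compose]
          bounded_linear_compose[OF bounded_linear_divide] ) (auto intro: bounded_linear_minus)
    obtain K where K: "K > 0" "\<And>v. norm (?A v) \<le> norm v * K"
      using bounded_linear.pos_bounded[OF has_derivative_bounded_linear[OF gd[of ?p]]] by blast
    have "\<exists>d>0. \<forall>h. norm h < d \<longrightarrow> norm (t (z + h) - t z - (- ?A h / \<alpha>)) \<le> e * norm h"
      if e: "e > 0" for e
    proof -
      \<comment> \<open>\<open>K\<close> bounds the derivative at \<open>?p\<close>, so
        \<open>B * norm h\<close> bounds the distance from \<open>?p\<close> to both comparison
        points used below. \<open>e'\<close> is then chosen to make the linearisation error half of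
        the gain \<open>\<alpha> * e * norm h\<close>.\<close>
      define B where "B = 1 + (K / \<alpha> + e) * norm n"
      have B: "B > 0" unfolding B_def using K \<alpha> e by (intro add_pos_nonneg mult_nonneg_nonneg) auto
      define e' where "e' = e * \<alpha> / (2 * B)"
      have e': "e' > 0" using e \<alpha> B by (simp add: e'_def)
      obtain d where d: "d > 0" "\<And>q. norm (q - ?p) < d \<Longrightarrow>
          norm (g q - g ?p - ?A (q - ?p)) \<le> e' * norm (q - ?p)"
        using has_derivative_at_alt[THEN iffD1, OF gd[of ?p]] e' by blast
      show ?thesis
      proof (intro exI conjI allI impI)
        show "d / B > 0" using d B by simp
        fix h :: 'a assume h: "norm h < d / B"
        \<comment> \<open>The comparison heights are the value predicted by the derivative, shifted
          by \<open>e * norm h\<close> up or down. The derivative of \<open>g\<close> at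
          \<open>?p\<close> cancels the prediction and leaves only the shift, which decides the sign
          of \<open>g\<close>.\<close>
        have side: "\<bar>g (z + h + s *\<^sub>R n) - (\<alpha> * \<sigma> * norm h)\<bar> \<le> e' * (B * norm h)"
          if s: "s = t z - ?A h / \<alpha> + \<sigma> * norm h" and \<sigma>: "\<bar>\<sigma>\<bar> = e" for s \<sigma>
        proof -
          let ?q = "z + h + s *\<^sub>R n"
          have qp: "?q - ?p = h + (\<sigma> * norm h - ?A h / \<alpha>) *\<^sub>R n"
            unfolding s by (simp add: algebra_simps)
          have "\<bar>\<sigma> * norm h - ?A h / \<alpha>\<bar> \<le> \<bar>\<sigma> * norm h\<bar> + \<bar>?A h / \<alpha>\<bar>" by (rule abs_triangle_ineq4)
          also have "\<dots> \<le> e * norm h + norm h * K / \<alpha>"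
            using K(2)[of h] \<alpha> \<sigma> by (intro add_mono) (auto simp: abs_mult divide_right_mono)
          finally have "\<bar>\<sigma> * norm h - ?A h / \<alpha>\<bar> * norm n \<le> (e * norm h + norm h * K / \<alpha>) * norm n"
            by (rule mult_right_mono) simp
          then have "norm (?q - ?p) \<le> norm h + (e * norm h + norm h * K / \<alpha>) * norm n"
            unfolding qp using norm_triangle_ineq[of h "(\<sigma> * norm h - ?A h / \<alpha>) *\<^sub>R n"] by simp
          also have "\<dots> = B * norm h" by (simp add: B_def algebra_simps)
          finally have n: "norm (?q - ?p) \<le> B * norm h" .
          also have "\<dots> < d" using h B by (simp add: field_simps)
          finally have "norm (g ?q - g ?p - ?A (?q - ?p)) \<le> e' * norm (?q - ?p)" using d(2) by blast
          also have "\<dots> \<le> e' * (B * norm h)" using n e' by simp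
          finally have 1: "norm (g ?q - g ?p - ?A (?q - ?p)) \<le> e' * (B * norm h)" .
          have "?A (?q - ?p) = ?A h + (\<sigma> * norm h - ?A h / \<alpha>) * \<alpha>"
            unfolding qp by (simp add: linear_add[OF lin] linear_scale[OF lin] \<alpha>_def)
          also have "\<dots> = \<alpha> * \<sigma> * norm h" using \<alpha> by (simp add: field_simps)
          finally show ?thesis using 1 t0[of z] by simp
        qed
        have eB: "e' * (B * norm h) = \<alpha> * e * norm h / 2"
          using B by (simp add: e'_def field_simps)
        have am: "\<alpha> * (- e) * norm h = - (\<alpha> * e * norm h)" by simp
        have ae: "\<bar>- e\<bar> = e" using e by simp
        have upper: "t (z + h) \<le> t z - ?A h / \<alpha> + e * norm h"
        proof (cases "h = 0")
          case False
          then have "\<alpha> * e * norm h > 0" using \<alpha> e by simp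
          then have "g (z + h + (t z - ?A h / \<alpha> + e * norm h) *\<^sub>R n) > 0"
            using side[OF refl abs_of_pos[OF e]] unfolding eB by linarith
          then show ?thesis using tpos[of "z + h"] by (meson less_imp_le)
        qed (simp add: linear_0[OF lin])
        have lower': "t (z + h) \<ge> t z - ?A h / \<alpha> + (- e) * norm h"
        proof (cases "h = 0")
          case False
          then have "\<alpha> * e * norm h > 0" using \<alpha> e by simp
          then have "g (z + h + (t z - ?A h / \<alpha> + (- e) * norm h) *\<^sub>R n) < 0"
            using side[OF refl ae] unfolding eB am by linarith
          then show ?thesis using tneg[of "z + h"] by (meson less_imp_le)
        qed (simp add: linear_0[OF lin])
        show "norm (t (z + h) - t z - (- ?A h / \<alpha>)) \<le> e * norm h"
          using upper lower' by (simp add: abs_le_iff)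
      qed
    qed
    then have "\<exists>d>0. \<forall>y. norm (y - z) < d \<longrightarrow> norm (t y - t z - (- ?A (y - z) / \<alpha>)) \<le> e * norm (y - z)"
      if "e > 0" for e
      using that by (metis add.commute diff_add_cancel)
    then show ?thesis
      unfolding has_derivative_at_alt using bl unfolding \<alpha>_def by blast
  qed
  have tc: "continuous_on UNIV t"
    by (intro continuous_at_imp_continuous_on ballI has_derivative_continuous[OF td])
  have pc: "continuous_on UNIV (\<lambda>z. z + t z *\<^sub>R n)"
    using tc by (intro continuous_intros)
  have Dc: "continuous_on UNIV (?D v)" for v
  proof -
    have "C_diff (Suc 0) (?D v)" using g1 by simp
    then show ?thesis by (rule C_diff_continuous_on)
  qed
  have Dn0: "?D n z \<noteq> 0" for z using lower[of z] c by linarith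
  have Dpc: "continuous_on UNIV (\<lambda>z. ?D v (z + t z *\<^sub>R n))" for v
    using continuous_on_compose2[OF Dc pc] by simp
  have t'c: "continuous_on UNIV (\<lambda>z. ?t' z v)" for v
    using Dn0 by (intro continuous_intros Dpc) auto
  \<comment> \<open>The derivative \<open>?t'\<close> is a quotient of functions of this form.
    Composing them with the now C1 map \<open>z + t z *\<^sub>R n\<close> raises the regularity of
    \<open>t\<close> from one to two derivatives.\<close>
  have comp: "C_diff (Suc 0) (\<lambda>z. h (z + t z *\<^sub>R n))" if h: "C_diff (Suc 0) h" for h
  proof (rule C_diff_Suc0_I)
    let ?H = "\<lambda>z. frechet_derivative h (at z)"
    have hd: "(h has_derivative ?H z) (at z)" for z by (rule C_diff_Suc_has_derivative[OF h])
    have hl: "linear (?H z)" for z using hd has_derivative_linear by blast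
    have "((\<lambda>z. h (z + t z *\<^sub>R n)) has_derivative (\<lambda>v. ?H (z + t z *\<^sub>R n) (v + ?t' z v *\<^sub>R n))) (at z)" for z
      by (rule has_derivative_compose[OF _ hd]) (auto intro!: derivative_eq_intros td)
    then show "((\<lambda>z. h (z + t z *\<^sub>R n)) has_derivative
        (\<lambda>v. ?H (z + t z *\<^sub>R n) v + ?t' z v * ?H (z + t z *\<^sub>R n) n)) (at z)" for z
      by (simp only: linear_add[OF hl] linear_scale[OF hl] real_scaleR_def)
    have "continuous_on UNIV (\<lambda>z. ?H z v)" for v using h by simp
    then have "continuous_on UNIV (\<lambda>z. ?H (z + t z *\<^sub>R n) v)" for v
      using continuous_on_compose2[OF _ pc] by blast
    then show "continuous_on UNIV (\<lambda>z. ?H (z + t z *\<^sub>R n) v + ?t' z v * ?H (z + t z *\<^sub>R n) n)" for v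
      using t'c by (intro continuous_on_add continuous_on_mult)
  qed
  have "C_diff (Suc (Suc 0)) t"
  proof (rule C_diff_SucI[OF td])
    fix v
    show "C_diff (Suc 0) (\<lambda>z. ?t' z v)"
      using g1 Dn0 by (intro C_diff_Suc0_divide C_diff_minus comp) auto
  qed
  moreover have "frechet_derivative t (at z) v = ?t' z v" for z v
    using frechet_derivative_at[OF td[of z]] by metis
  ultimately show ?thesis using that tpos t0 by (simp add: numeral_2_eq_2)
qed

text \<open>A component of \<open>a\<close> orthogonal to \<open>u\<close> can be subtracted from
  \<open>u\<close> with any multiple without leaving the half-space, which would drive the
  functional negative. Hence \<open>a\<close> is a positive multiple of \<open>u\<close>.\<close>

lemma halfspace_normal:
  fixes a u :: "'a::real_inner"
  assumes "\<And>v. v \<bullet> u > 0 \<Longrightarrow> a \<bullet> v \<ge> 0" "u \<noteq> 0" "a \<noteq> 0"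
  shows "a /\<^sub>R norm a = u /\<^sub>R norm u"
proof -
  define c where "c = (a \<bullet> u) / (u \<bullet> u)"
  define a' where "a' = a - c *\<^sub>R u"
  have uu: "u \<bullet> u > 0" using assms(2) by simp
  have a'u: "a' \<bullet> u = 0" using uu by (simp add: a'_def c_def inner_diff_left)
  have aa': "a \<bullet> a' = a' \<bullet> a'"
    using a'u by (simp add: a'_def[of] inner_diff_left inner_commute)
  have "a' = 0"
  proof (rule ccontr)
    assume "a' \<noteq> 0"
    then have p: "a' \<bullet> a' > 0" by simp
    \<comment> \<open>With this multiple the functional takes the value -1 at
      \<open>u - M *\<^sub>R a'\<close>.\<close>
    define M where "M = (a \<bullet> u + 1) / (a' \<bullet> a')"
    have "a \<bullet> (u - M *\<^sub>R a') \<ge> 0"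
      by (rule assms(1)) (use uu a'u in \<open>simp add: inner_diff_left\<close>)
    then have "a \<bullet> u - M * (a' \<bullet> a') \<ge> 0" by (simp add: inner_diff_right aa')
    then show False using p by (simp add: M_def)
  qed
  then have ac: "a = c *\<^sub>R u" by (simp add: a'_def)
  have "c \<ge> 0" using assms(1)[of u] uu by (simp add: c_def)
  moreover have "c \<noteq> 0" using ac assms(3) by auto
  ultimately have "c > 0" by simp
  then show ?thesis by (simp add: ac)
qed

section \<open>Graph charts and curvature\<close>

lemma norm_diff_scaleR_power2:
  fixes w v :: "'a::real_inner"
  shows "(norm (w - t *\<^sub>R v))\<^sup>2 = (norm w)\<^sup>2 - t * (2 * (v \<bullet> w)) + t * (t * (v \<bullet> v))"
  unfolding power2_norm_eq_inner
  by (simp add: inner_diff_left inner_diff_right inner_commute[of w v] right_diff_distrib)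

definition chart_fun :: "'a::euclidean_space \<Rightarrow> ('a \<Rightarrow> real) \<Rightarrow> 'a \<Rightarrow> real" where
  "chart_fun \<nu> \<gamma> x = x \<bullet> \<nu> - \<gamma> x"

definition chart_grad :: "'a::euclidean_space \<Rightarrow> ('a \<Rightarrow> real) \<Rightarrow> 'a \<Rightarrow> 'a" where
  "chart_grad \<nu> \<gamma> x = \<nu> - gradient \<gamma> x"

text \<open>On the boundary this is the inner unit normal. Off the boundary it is continued
  constantly along \<open>\<nu>\<close>, so it is in general not the gradient of the
  distance.\<close>

definition chart_normal :: "'a::euclidean_space \<Rightarrow> ('a \<Rightarrow> real) \<Rightarrow> 'a \<Rightarrow> 'a" where
  "chart_normal \<nu> \<gamma> x = chart_grad \<nu> \<gamma> x /\<^sub>R norm (chart_grad \<nu> \<gamma> x)"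

definition chart_dnormal :: "'a::euclidean_space \<Rightarrow> ('a \<Rightarrow> real) \<Rightarrow> 'a \<Rightarrow> 'a \<Rightarrow> 'a" where
  "chart_dnormal \<nu> \<gamma> x v =
    (let a = chart_grad \<nu> \<gamma> x; w = - frechet_derivative (gradient \<gamma>) (at x) v
     in w /\<^sub>R norm a - ((a \<bullet> w) / norm a ^ 3) *\<^sub>R a)"

text \<open>The divergence of the extended normal field. Only its values on the boundary are
  intrinsic; there they equal minus the sum of the principal curvatures.\<close>

definition chart_div :: "'a::euclidean_space \<Rightarrow> ('a \<Rightarrow> real) \<Rightarrow> 'a \<Rightarrow> real" where
  "chart_div \<nu> \<gamma> x = (\<Sum>b\<in>Basis. chart_dnormal \<nu> \<gamma> x b \<bullet> b)"

definition chart_proj :: "'a::euclidean_space \<Rightarrow> ('a \<Rightarrow> real) \<Rightarrow> 'a \<Rightarrow> 'a" where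
  "chart_proj \<nu> \<gamma> x = x + (\<gamma> x - x \<bullet> \<nu>) *\<^sub>R \<nu>"

locale chart =
  fixes \<Omega> :: "'a::euclidean_space set" and y r \<nu> \<gamma>
  assumes graph_chart: "graph_chart \<Omega> y r \<nu> \<gamma>" and open_\<Omega>: "open \<Omega>"
begin

abbreviation "G \<equiv> chart_fun \<nu> \<gamma>"
abbreviation "a \<equiv> chart_grad \<nu> \<gamma>"
abbreviation "N \<equiv> chart_normal \<nu> \<gamma>"
abbreviation "DN \<equiv> chart_dnormal \<nu> \<gamma>"
abbreviation "P \<equiv> chart_proj \<nu> \<gamma>"
abbreviation "Hs x \<equiv> frechet_derivative (gradient \<gamma>) (at x)"

lemma r_pos: "r > 0" and norm_\<nu> [simp]: "norm \<nu> = 1" and C2: "C_diff 2 \<gamma>"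
  and \<gamma>_shift [simp]: "\<gamma> (x + t *\<^sub>R \<nu>) = \<gamma> x"
  and mem_iff: "x \<in> ball y r \<Longrightarrow> x \<in> \<Omega> \<longleftrightarrow> G x > 0"
  using graph_chart by (auto simp: graph_chart_def chart_fun_def)

lemma \<nu>\<nu> [simp]: "\<nu> \<bullet> \<nu> = 1"
  by (simp add: dot_square_norm)

lemma C2': "C_diff (Suc (Suc 0)) \<gamma>"
  using C2 by (simp only: numeral_2_eq_2)

lemma G_shift [simp]: "G (x + t *\<^sub>R \<nu>) = G x + t"
  by (simp add: chart_fun_def inner_add_left)

lemma P_eq: "P x = x + (- G x) *\<^sub>R \<nu>"
  by (simp add: chart_proj_def chart_fun_def)

lemma G_P [simp]: "G (P x) = 0"
  by (simp only: P_eq G_shift)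

lemma \<gamma>_deriv: "(\<gamma> has_derivative (\<lambda>h. gradient \<gamma> x \<bullet> h)) (at x)"
  by (rule has_derivative_gradient[OF C2'])

lemma gradient_\<nu> [simp]: "gradient \<gamma> x \<bullet> \<nu> = 0"
proof -
  have "((\<lambda>t. \<gamma> (x + t *\<^sub>R \<nu>)) has_derivative (\<lambda>h. gradient \<gamma> (x + 0 *\<^sub>R \<nu>) \<bullet> (h *\<^sub>R \<nu>))) (at 0)"
    by (rule has_derivative_compose[OF _ \<gamma>_deriv]) (auto intro!: derivative_eq_intros)
  moreover have "((\<lambda>t. \<gamma> (x + t *\<^sub>R \<nu>)) has_derivative (\<lambda>h. 0)) (at 0)" by simp
  ultimately have "(\<lambda>h. gradient \<gamma> (x + 0 *\<^sub>R \<nu>) \<bullet> (h *\<^sub>R \<nu>)) = (\<lambda>h::real. 0)"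
    by (rule has_derivative_unique)
  from fun_cong[OF this, of 1] show ?thesis by simp
qed

lemma a_\<nu> [simp]: "a x \<bullet> \<nu> = 1"
  by (simp add: chart_grad_def inner_diff_left)

text \<open>The gradient of \<open>\<gamma>\<close> is orthogonal to the unit vector
  \<open>\<nu>\<close>, so this is Pythagoras. It identifies the length of \<open>a\<close> with the
  area density of the graph.\<close>

lemma norm_a: "norm (a x) = sqrt (1 + (norm (gradient \<gamma> x))\<^sup>2)"
proof -
  have "a x \<bullet> a x = 1 + gradient \<gamma> x \<bullet> gradient \<gamma> x"
    using gradient_\<nu>[of x]
    by (simp add: chart_grad_def inner_diff_left inner_diff_right inner_commute[of \<nu> "gradient \<gamma> x"])
  then show ?thesis by (simp add: norm_eq_sqrt_inner[of "a x"] power2_norm_eq_inner)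
qed

lemma norm_a_ge_1: "norm (a x) \<ge> 1"
  by (simp add: norm_a)

lemma a_nonzero [simp]: "a x \<noteq> 0"
  using norm_a_ge_1[of x] by auto

lemma norm_N [simp]: "norm (N x) = 1"
  by (simp add: chart_normal_def)

lemma a_eq: "a x = norm (a x) *\<^sub>R N x"
  by (simp add: chart_normal_def)

lemma G_deriv: "(G has_derivative (\<lambda>h. a x \<bullet> h)) (at x)"
  unfolding chart_fun_def[abs_def] chart_grad_def
  by (auto intro!: derivative_eq_intros \<gamma>_deriv simp: inner_diff_right inner_commute)

lemma continuous_on_\<gamma>: "continuous_on S \<gamma>"
  by (rule C_diff_continuous_on[OF C2])

lemma continuous_on_G: "continuous_on S G"
  unfolding chart_fun_def[abs_def] by (intro continuous_intros continuous_on_\<gamma>)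

lemma continuous_on_P: "continuous_on S P"
  unfolding chart_proj_def[abs_def] by (intro continuous_intros continuous_on_\<gamma>)

lemma continuous_on_a: "continuous_on S a"
  unfolding chart_grad_def[abs_def] by (intro continuous_intros continuous_on_gradient[OF C2'])

lemma continuous_on_N: "continuous_on S N"
  unfolding chart_normal_def[abs_def] by (intro continuous_intros continuous_on_a) auto

lemma a_deriv: "(a has_derivative (\<lambda>v. - Hs x v)) (at x)"
  unfolding chart_grad_def[abs_def]
  using has_derivative_gradient_Suc(1)[OF C2', of x] by (auto intro!: derivative_eq_intros)

lemma N_deriv: "(N has_derivative DN x) (at x)"
proof -
  have n: "((\<lambda>x. norm (a x)) has_derivative (\<lambda>v. sgn (a x) \<bullet> (- Hs x v))) (at x)"
    using has_derivative_compose[OF a_deriv has_derivative_norm[of "a x"]]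
    by (simp add: inner_commute)
  have i: "((\<lambda>x. inverse (norm (a x))) has_derivative
      (\<lambda>v. - (inverse (norm (a x)) * (sgn (a x) \<bullet> (- Hs x v)) * inverse (norm (a x))))) (at x)"
    by (rule Deriv.has_derivative_inverse[OF _ n]) simp
  have "((\<lambda>x. inverse (norm (a x)) *\<^sub>R a x) has_derivative
      (\<lambda>v. inverse (norm (a x)) *\<^sub>R (- Hs x v) +
        (- (inverse (norm (a x)) * (sgn (a x) \<bullet> (- Hs x v)) * inverse (norm (a x)))) *\<^sub>R a x)) (at x)"
    by (rule has_derivative_scaleR[OF i a_deriv])
  moreover have "inverse (norm (a x)) *\<^sub>R (- Hs x v) +
        (- (inverse (norm (a x)) * (sgn (a x) \<bullet> (- Hs x v)) * inverse (norm (a x)))) *\<^sub>R a x = DN x v" for v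
    by (simp add: chart_dnormal_def Let_def sgn_div_norm divide_inverse power3_eq_cube mult_ac)
  ultimately show ?thesis by (simp add: chart_normal_def[abs_def])
qed

lemma continuous_on_DN: "continuous_on S (\<lambda>x. DN x v)"
  unfolding chart_dnormal_def Let_def
  by (intro continuous_intros continuous_on_a has_derivative_gradient_Suc(3)[OF C2']) auto

lemma continuous_on_div: "continuous_on S (chart_div \<nu> \<gamma>)"
  unfolding chart_div_def[abs_def] by (intro continuous_intros continuous_on_DN)

lemma DN_perp: "DN x v \<bullet> N x = 0"
proof -
  have "a x \<bullet> a x = norm (a x) * norm (a x)" by (simp add: dot_square_norm power2_eq_square)
  then show ?thesis
    by (simp add: chart_dnormal_def chart_normal_def Let_def inner_diff_left inner_commute[of "Hs x v"]
        power3_eq_cube field_simps)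
qed

text \<open>A chart describes only membership in \<open>\<Omega>\<close>. The open set where
  \<open>G\<close> is negative misses the closure of \<open>\<Omega>\<close>, whereas a zero of
  \<open>G\<close> is approached from inside by moving up along \<open>\<nu>\<close>, along which
  \<open>G\<close> has slope 1.\<close>

lemma frontier_iff: "x \<in> ball y r \<Longrightarrow> x \<in> frontier \<Omega> \<longleftrightarrow> G x = 0"
proof -
  assume x: "x \<in> ball y r"
  have fr: "frontier \<Omega> = closure \<Omega> - \<Omega>"
    using open_\<Omega> by (simp add: frontier_def interior_open)
  consider "G x > 0" | "G x < 0" | "G x = 0" by linarith
  then show ?thesis
  proof cases
    case 1
    then show ?thesis using mem_iff[OF x] fr by auto
  next
    case 2
    have "open ({z. G z < 0} \<inter> ball y r)"
      by (intro open_Int open_Collect_less continuous_on_G) auto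
    moreover have "({z. G z < 0} \<inter> ball y r) \<inter> \<Omega> = {}" using mem_iff by fastforce
    ultimately have "({z. G z < 0} \<inter> ball y r) \<inter> closure \<Omega> = {}"
      using open_Int_closure_eq_empty by blast
    then show ?thesis using 2 x fr by auto
  next
    case 3
      obtain N0 where N0: "\<And>n. n \<ge> N0 \<Longrightarrow> x + (1 / real (Suc n)) *\<^sub>R \<nu> \<in> ball y r"
      proof -
        have "(\<lambda>n. x + (1 / real (Suc n)) *\<^sub>R \<nu>) \<longlonglongrightarrow> x + 0 *\<^sub>R \<nu>"
          by (intro tendsto_intros LIMSEQ_Suc[OF lim_1_over_n])
        then have "eventually (\<lambda>n. x + (1 / real (Suc n)) *\<^sub>R \<nu> \<in> ball y r) sequentially"
          using x by (intro topological_tendstoD) auto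
        then obtain N0 where "\<forall>n\<ge>N0. x + (1 / real (Suc n)) *\<^sub>R \<nu> \<in> ball y r"
          unfolding eventually_sequentially by blast
        then show ?thesis using that by blast
      qed
    have "x \<in> closure \<Omega>"
    proof (rule closure_sequential[THEN iffD2], intro exI conjI allI)
      show "x + (1 / real (Suc (n + N0))) *\<^sub>R \<nu> \<in> \<Omega>" for n
      proof -
        have "G (x + (1 / real (Suc (n + N0))) *\<^sub>R \<nu>) > 0" using 3 by (simp only: G_shift) simp
        then show ?thesis using mem_iff[OF N0[of "n + N0"]] by simp
      qed
      have "(\<lambda>n. x + (1 / real (Suc n)) *\<^sub>R \<nu>) \<longlonglongrightarrow> x + 0 *\<^sub>R \<nu>"
        by (intro tendsto_intros LIMSEQ_Suc[OF lim_1_over_n])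
      from LIMSEQ_ignore_initial_segment[OF this, of N0]
      show "(\<lambda>n. x + (1 / real (Suc (n + N0))) *\<^sub>R \<nu>) \<longlonglongrightarrow> x" by simp
    qed
    then show ?thesis using 3 mem_iff[OF x] fr by auto
  qed
qed

lemma G_dir_deriv: "((\<lambda>t. G (p + t *\<^sub>R v)) has_real_derivative a p \<bullet> v) (at 0)"
proof -
  have "((\<lambda>t. G (p + t *\<^sub>R v)) has_derivative (\<lambda>h. a (p + 0 *\<^sub>R v) \<bullet> (h *\<^sub>R v))) (at 0)"
    by (rule has_derivative_compose[OF _ G_deriv]) (auto intro!: derivative_eq_intros)
  then show ?thesis by (simp add: has_field_derivative_def mult_commute_abs)
qed

lemma eventually_G_pos:
  assumes "G p = 0" "a p \<bullet> v > 0"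
  shows "\<exists>d>0. \<forall>t. 0 < t \<and> t < d \<longrightarrow> G (p + t *\<^sub>R v) > 0"
  using has_real_derivative_pos_inc_right[OF G_dir_deriv[of p v]] assms by auto

lemma a_inner_nonneg:
  assumes "G p = 0" "d > 0" "\<And>t. 0 < t \<Longrightarrow> t < d \<Longrightarrow> G (p + t *\<^sub>R v) \<ge> 0"
  shows "a p \<bullet> v \<ge> 0"
proof (rule ccontr)
  assume "\<not> a p \<bullet> v \<ge> 0"
  then obtain e where e: "e > 0" "\<And>h. 0 < h \<Longrightarrow> h < e \<Longrightarrow> G (p + h *\<^sub>R v) < G p"
    using has_real_derivative_neg_dec_right[OF G_dir_deriv[of p v]] by auto
  have "min d e / 2 > 0" "min d e / 2 < d" "min d e / 2 < e" using e(1) assms(2) by auto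
  then show False using e(2)[of "min d e / 2"] assms(3)[of "min d e / 2"] assms(1) by auto
qed

text \<open>The ball around \<open>x\<close> touches the complement at \<open>p\<close>. Directions
  entering this ball enter \<open>\<Omega>\<close>, so \<open>G\<close> cannot decrease along them,
  and \<open>halfspace_normal\<close> applies to the open half-space of these directions.\<close>

lemma nearest_normal:
  assumes p: "p \<in> ball y r" "p \<notin> \<Omega>" and x: "x \<noteq> p" and sub: "ball x (dist x p) \<subseteq> \<Omega>"
  shows "p \<in> frontier \<Omega>" "N p = (x - p) /\<^sub>R norm (x - p)"
proof -
  have "p \<in> closure (ball x (dist x p))" using x by (simp add: closure_ball dist_commute)
  then have "p \<in> closure \<Omega>" using closure_mono[OF sub] by blast
  then show pf: "p \<in> frontier \<Omega>" using p open_\<Omega> by (simp add: frontier_def interior_open)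
  then have G0: "G p = 0" using frontier_iff[OF p(1)] by simp
  have "a p /\<^sub>R norm (a p) = (x - p) /\<^sub>R norm (x - p)"
  proof (rule halfspace_normal)
    fix v assume v: "v \<bullet> (x - p) > 0"
    have "v \<noteq> 0" using v by auto
    \<comment> \<open>Below \<open>d1\<close> the point \<open>p + t *\<^sub>R v\<close> is strictly
      closer to \<open>x\<close> than \<open>p\<close> is; below \<open>d2\<close> it stays in the
      chart ball.\<close>
    define d1 where "d1 = 2 * (v \<bullet> (x - p)) / (v \<bullet> v)"
    define d2 where "d2 = (r - dist y p) / norm v"
    have d: "d1 > 0" "d2 > 0" using v \<open>v \<noteq> 0\<close> p(1) by (auto simp: d1_def d2_def)
    show "a p \<bullet> v \<ge> 0"
    proof (rule a_inner_nonneg[OF G0, of "min d1 d2"])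
      show "min d1 d2 > 0" using d by simp
      fix t :: real assume t: "0 < t" "t < min d1 d2"
      have "t * (v \<bullet> v) < 2 * (v \<bullet> (x - p))"
        using t \<open>v \<noteq> 0\<close> by (simp add: d1_def field_simps)
      then have "t * (t * (v \<bullet> v)) < t * (2 * (v \<bullet> (x - p)))" using t by simp
      moreover have "(norm ((x - p) - t *\<^sub>R v))\<^sup>2 = (norm (x - p))\<^sup>2 - t * (2 * (v \<bullet> (x - p))) + t * (t * (v \<bullet> v))"
        by (rule norm_diff_scaleR_power2)
      ultimately have "(norm ((x - p) - t *\<^sub>R v))\<^sup>2 < (norm (x - p))\<^sup>2" by linarith
      then have "norm ((x - p) - t *\<^sub>R v) < norm (x - p)"
        by (rule power2_less_imp_less) simp
      then have "p + t *\<^sub>R v \<in> ball x (dist x p)"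
        by (simp add: dist_norm diff_diff_add)
      then have O: "p + t *\<^sub>R v \<in> \<Omega>" using sub by blast
      have "t * norm v < r - dist y p" using t \<open>v \<noteq> 0\<close> by (simp add: d2_def field_simps)
      moreover have "dist y (p + t *\<^sub>R v) \<le> dist y p + t * norm v"
        using dist_triangle[of y "p + t *\<^sub>R v" p] t by (simp add: dist_norm)
      ultimately have "p + t *\<^sub>R v \<in> ball y r" by simp
      then show "G (p + t *\<^sub>R v) \<ge> 0" using O mem_iff by fastforce
    qed
  qed (use x in auto)
  then show "N p = (x - p) /\<^sub>R norm (x - p)" by (simp add: chart_normal_def)
qed

text \<open>Projecting a straight line along \<open>\<nu>\<close> gives a curve in the zero set of
  \<open>G\<close>. If \<open>\<tau>\<close> is orthogonal to \<open>a p\<close>, its velocity at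
  the start is \<open>\<tau>\<close> itself.\<close>

lemma P_curve: "((\<lambda>t. P (p + t *\<^sub>R \<tau>)) has_derivative (\<lambda>h. h *\<^sub>R (\<tau> - (a p \<bullet> \<tau>) *\<^sub>R \<nu>))) (at 0)"
proof -
  have G': "((\<lambda>t. G (p + t *\<^sub>R \<tau>)) has_derivative (\<lambda>h. h * (a p \<bullet> \<tau>))) (at 0)"
    using G_dir_deriv[of p \<tau>] by (simp add: has_field_derivative_def mult_commute_abs)
  show ?thesis unfolding P_eq
    by (auto intro!: derivative_eq_intros G' simp: algebra_simps)
qed

end

text \<open>A direction that enters \<open>\<Omega>\<close> strictly according to one chart cannot
  leave it according to the other. Thus each defining function has nonnegative derivative on the
  half-space of the other.\<close>

lemma charts_normal_eq:
  assumes "chart \<Omega> y1 r1 \<nu>1 \<gamma>1" "chart \<Omega> y2 r2 \<nu>2 \<gamma>2"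
    and p: "p \<in> frontier \<Omega>" "p \<in> ball y1 r1" "p \<in> ball y2 r2"
  shows "chart_normal \<nu>1 \<gamma>1 p = chart_normal \<nu>2 \<gamma>2 p"
proof -
  interpret c1: chart \<Omega> y1 r1 \<nu>1 \<gamma>1 by fact
  interpret c2: chart \<Omega> y2 r2 \<nu>2 \<gamma>2 by fact
  have G0: "c1.G p = 0" "c2.G p = 0" using c1.frontier_iff c2.frontier_iff p by auto
  have "c1.a p /\<^sub>R norm (c1.a p) = c2.a p /\<^sub>R norm (c2.a p)"
  proof (rule halfspace_normal)
    fix v assume "v \<bullet> c2.a p > 0"
    then obtain d where d: "d > 0" "\<And>t. 0 < t \<Longrightarrow> t < d \<Longrightarrow> c2.G (p + t *\<^sub>R v) > 0"
      using c2.eventually_G_pos[OF G0(2)] by (metis inner_commute)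
    have "((\<lambda>t. p + t *\<^sub>R v) \<longlongrightarrow> p + 0 *\<^sub>R v) (at_right 0)"
      by (intro tendsto_intros)
    then have "eventually (\<lambda>t. p + t *\<^sub>R v \<in> ball y1 r1 \<inter> ball y2 r2) (at_right 0)"
      using p by (intro topological_tendstoD) auto
    then obtain e where e: "e > 0" "\<And>t. 0 < t \<Longrightarrow> t < e \<Longrightarrow> p + t *\<^sub>R v \<in> ball y1 r1 \<inter> ball y2 r2"
      unfolding eventually_at_right_field by auto
    show "c1.a p \<bullet> v \<ge> 0"
    proof (rule c1.a_inner_nonneg[OF G0(1), of "min d e"])
      show "min d e > 0" using d e by simp
      fix t :: real assume t: "0 < t" "t < min d e"
      then have "p + t *\<^sub>R v \<in> \<Omega>" using d(2) e(2) c2.mem_iff by auto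
      then show "c1.G (p + t *\<^sub>R v) \<ge> 0" using e(2)[of t] t c1.mem_iff by fastforce
    qed
  qed auto
  then show ?thesis by (simp add: chart_normal_def)
qed

text \<open>The difference \<open>W\<close> of the two unit fields vanishes along the boundary, so its derivative kills
  the tangent space; on the normal it is orthogonal to the normal because both fields have unit
  length.  Hence the trace of its derivative is zero.\<close>

lemma charts_div_eq:
  assumes "chart \<Omega> y1 r1 \<nu>1 \<gamma>1" "chart \<Omega> y2 r2 \<nu>2 \<gamma>2"
    and p: "p \<in> frontier \<Omega>" "p \<in> ball y1 r1" "p \<in> ball y2 r2"
  shows "chart_div \<nu>1 \<gamma>1 p = chart_div \<nu>2 \<gamma>2 p"
proof -
  interpret c1: chart \<Omega> y1 r1 \<nu>1 \<gamma>1 by fact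
  interpret c2: chart \<Omega> y2 r2 \<nu>2 \<gamma>2 by fact
  have G0: "c1.G p = 0" using c1.frontier_iff p by auto
  define n where "n = c1.N p"
  have nn: "n \<bullet> n = 1" "n = c2.N p"
    using charts_normal_eq[OF assms] by (auto simp: n_def dot_square_norm)
  let ?W = "\<lambda>x. c1.N x - c2.N x" and ?DW = "\<lambda>v. c1.DN p v - c2.DN p v"
  have Wd: "(?W has_derivative ?DW) (at p)"
    by (intro has_derivative_diff c1.N_deriv c2.N_deriv)
  have lin: "linear ?DW" using Wd has_derivative_linear by blast
  have tang: "?DW \<tau> = 0" if "\<tau> \<bullet> n = 0" for \<tau>
  proof -
    have at: "c1.a p \<bullet> \<tau> = 0" using that by (subst c1.a_eq) (simp add: n_def inner_commute)
    have P0: "c1.P (p + 0 *\<^sub>R \<tau>) = p" using G0 by (simp add: c1.P_eq)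
    \<comment> \<open>The difference is followed along a curve in the boundary with velocity
      \<open>\<tau>\<close>, where both unit normals agree, so this derivative must vanish.\<close>
    have "((\<lambda>t. ?W (c1.P (p + t *\<^sub>R \<tau>))) has_derivative (\<lambda>h. ?DW (h *\<^sub>R (\<tau> - (c1.a p \<bullet> \<tau>) *\<^sub>R \<nu>1)))) (at 0)"
      by (rule has_derivative_compose[OF c1.P_curve]) (use Wd P0 in simp)
    then have d1: "((\<lambda>t. ?W (c1.P (p + t *\<^sub>R \<tau>))) has_derivative (\<lambda>h. ?DW (h *\<^sub>R \<tau>))) (at 0)"
      by (simp add: at)
    have "isCont (\<lambda>t. c1.P (p + t *\<^sub>R \<tau>)) 0"
      using c1.P_curve has_derivative_continuous by blast
    then have "((\<lambda>t. c1.P (p + t *\<^sub>R \<tau>)) \<longlongrightarrow> c1.P (p + 0 *\<^sub>R \<tau>)) (nhds 0)"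
      unfolding isCont_def
      using iffD1[OF tendsto_at_iff_tendsto_nhds[of "\<lambda>t. c1.P (p + t *\<^sub>R \<tau>)" 0]] by blast
    then have "((\<lambda>t. c1.P (p + t *\<^sub>R \<tau>)) \<longlongrightarrow> p) (nhds 0)" by (simp only: P0)
    then have "eventually (\<lambda>t. c1.P (p + t *\<^sub>R \<tau>) \<in> ball y1 r1 \<inter> ball y2 r2) (nhds 0)"
      using p by (intro topological_tendstoD) auto
    then obtain S where S: "open S" "0 \<in> S" "\<And>t. t \<in> S \<Longrightarrow> c1.P (p + t *\<^sub>R \<tau>) \<in> ball y1 r1 \<inter> ball y2 r2"
      unfolding eventually_nhds by blast
    have W0: "?W (c1.P (p + t *\<^sub>R \<tau>)) = 0" if "t \<in> S" for t
      using S(3)[OF that] c1.frontier_iff[of "c1.P (p + t *\<^sub>R \<tau>)"]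
        charts_normal_eq[OF assms(1,2), of "c1.P (p + t *\<^sub>R \<tau>)"] by simp
    have "((\<lambda>t::real. 0::'a) has_derivative (\<lambda>h. 0)) (at 0)" by simp
    then have d2: "((\<lambda>t. ?W (c1.P (p + t *\<^sub>R \<tau>))) has_derivative (\<lambda>h. 0)) (at 0)"
      by (rule has_derivative_transform_within_open[OF _ S(1,2)]) (simp only: W0)
    have "(\<lambda>h. ?DW (h *\<^sub>R \<tau>)) = (\<lambda>h. 0)" by (rule has_derivative_unique[OF d1 d2])
    from fun_cong[OF this, of 1] show ?thesis by simp
  qed
  \<comment> \<open>The derivative has rank at most one: it factors through the normal component.
    Its trace is therefore the single number \<open>?DW n \<bullet> n\<close>.\<close>
  have DWb: "?DW b = (b \<bullet> n) *\<^sub>R ?DW n" for b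
  proof -
    have "?DW (b - (b \<bullet> n) *\<^sub>R n) = 0"
      by (rule tang) (simp add: inner_diff_left nn(1))
    then show ?thesis using linear_diff[OF lin, of b "(b \<bullet> n) *\<^sub>R n"] linear_scale[OF lin, of "b \<bullet> n" n] by simp
  qed
  have "chart_div \<nu>1 \<gamma>1 p - chart_div \<nu>2 \<gamma>2 p = (\<Sum>b\<in>Basis. ?DW b \<bullet> b)"
    by (simp add: chart_div_def sum_subtractf inner_diff_left)
  also have "\<dots> = (\<Sum>b\<in>Basis. (?DW n \<bullet> b) * (n \<bullet> b))"
    by (subst DWb) (simp add: inner_commute mult.commute)
  also have "\<dots> = ?DW n \<bullet> n" by (rule euclidean_inner[symmetric])
  also have "\<dots> = 0"
    using c1.DN_perp[of p n] c2.DN_perp[of p n] nn by (simp add: n_def inner_diff_left)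
  finally show ?thesis by simp
qed

section \<open>Mean curvature as the divergence of the unit normal\<close>

context chart begin

lemma Hs_linear: "linear (Hs x)"
  using has_derivative_gradient_Suc(1)[OF C2', of x] has_derivative_linear by blast

lemma Hs_sym: "Hs x v \<bullet> w = Hs x w \<bullet> v"
  by (rule hessian_symmetric[OF C2])

lemma Hs_\<nu>: "Hs x v \<bullet> \<nu> = 0" "Hs x \<nu> = 0"
proof -
  show *: "Hs x v \<bullet> \<nu> = 0" for v
  proof -
    have "((\<lambda>x. gradient \<gamma> x \<bullet> \<nu>) has_derivative (\<lambda>v. Hs x v \<bullet> \<nu>)) (at x)"
      by (intro has_derivative_inner_left has_derivative_gradient_Suc(1)[OF C2'])
    moreover have "((\<lambda>x. gradient \<gamma> x \<bullet> \<nu>) has_derivative (\<lambda>v. 0)) (at x)" by simp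
    ultimately have "(\<lambda>v. Hs x v \<bullet> \<nu>) = (\<lambda>v. 0)" by (rule has_derivative_unique)
    then show ?thesis by (rule fun_cong)
  qed
  have "w \<bullet> Hs x \<nu> = w \<bullet> 0" for w
    using *[of w] Hs_sym[of x \<nu> w] by (simp add: inner_commute)
  then show "Hs x \<nu> = 0" by (rule inner_left_ext)
qed

text \<open>At such a point \<open>a = \<nu>\<close> has length 1, and the correction from
  normalising drops out because the Hessian has no component along \<open>\<nu>\<close>.\<close>

lemma div_tangent:
  assumes "gradient \<gamma> p = 0"
  shows "chart_div \<nu> \<gamma> p = - (\<Sum>b\<in>Basis. Hs p b \<bullet> b)"
  using assms Hs_\<nu>(1)
  by (simp add: chart_div_def chart_dnormal_def Let_def chart_grad_def inner_diff_left
      inner_commute[of \<nu>] sum_negf)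

text \<open>Adjoining \<open>\<nu>\<close> to the vectors \<open>e i\<close> gives an orthonormal
  basis of the whole space, and \<open>\<nu>\<close> contributes nothing to the trace because it
  lies in the kernel of the Hessian.\<close>

lemma \<nu>_basis_trace:
  assumes "\<forall>i<DIM('a) - 1. e i \<bullet> \<nu> = 0"
    and "\<forall>i<DIM('a) - 1. \<forall>j<DIM('a) - 1. e i \<bullet> e j = (if i = j then 1 else 0)"
  shows "(\<Sum>b\<in>Basis. Hs p b \<bullet> b) = (\<Sum>i<DIM('a) - 1. Hs p (e i) \<bullet> e i)"
proof -
  let ?I = "{..<DIM('a) - 1}" let ?B = "insert \<nu> (e ` ?I)"
  have inj: "inj_on e ?I" using assms(2) by (intro inj_onI) (metis lessThan_iff zero_neq_one)
  have nin: "\<nu> \<notin> e ` ?I" using assms(1) \<nu>\<nu> by (metis imageE lessThan_iff zero_neq_one)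
  have card: "card ?B = DIM('a)" using nin inj by (simp add: card_image)
  have ne: "norm (e i) = 1" if "i < DIM('a) - 1" for i
    using assms(2) that by (simp add: norm_eq_sqrt_inner)
  have po: "pairwise orthogonal ?B"
    using assms by (auto simp: pairwise_def orthogonal_def inner_commute)
  have "0 \<notin> ?B"
  proof
    assume "0 \<in> ?B"
    then consider "\<nu> = 0" | i where "i < DIM('a) - 1" "e i = 0" by fastforce
    then show False
      by cases (metis norm_\<nu> norm_zero zero_neq_one, metis ne norm_zero zero_neq_one)
  qed
  then have "independent ?B" using po by (intro pairwise_orthogonal_independent)
  then have "UNIV \<subseteq> span ?B"
    using card by (intro card_ge_dim_independent) auto
  then have "(\<Sum>b\<in>Basis. Hs p b \<bullet> b) = (\<Sum>b\<in>?B. Hs p b \<bullet> b)"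
    using po ne by (intro trace_orthonormal Hs_linear) auto
  also have "\<dots> = (\<Sum>i<DIM('a) - 1. Hs p (e i) \<bullet> e i)"
    using nin inj by (simp add: Hs_\<nu> sum.reindex)
  finally show ?thesis .
qed

text \<open>The curvatures come with a tangent chart of their own. The sum is computed there as a
  divergence and carried to the given chart by \<open>charts_div_eq\<close>; this is the uniqueness
  required by the description of \<open>mean_curvature\<close>.\<close>

lemma principal_curvatures_sum:
  assumes p: "p \<in> frontier \<Omega>" "p \<in> ball y r" and \<kappa>: "principal_curvatures \<Omega> p \<kappa>"
  shows "(\<Sum>i<DIM('a) - 1. \<kappa> i) = - chart_div \<nu> \<gamma> p"
proof -
  obtain r' \<nu>' \<gamma>' e where c: "graph_chart \<Omega> p r' \<nu>' \<gamma>'" and g0: "gradient \<gamma>' p = 0"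
    and e: "\<forall>i<DIM('a) - 1. e i \<bullet> \<nu>' = 0"
      "\<forall>i<DIM('a) - 1. \<forall>j<DIM('a) - 1. e i \<bullet> e j = (if i = j then 1 else 0)"
    and ev: "\<forall>i<DIM('a) - 1. frechet_derivative (gradient \<gamma>') (at p) (e i) = \<kappa> i *\<^sub>R e i"
    using \<kappa> unfolding principal_curvatures_def by blast
  interpret c': chart \<Omega> p r' \<nu>' \<gamma>' by unfold_locales (use c open_\<Omega> in auto)
  have "chart_div \<nu> \<gamma> p = chart_div \<nu>' \<gamma>' p"
    by (rule charts_div_eq[OF chart_axioms c'.chart_axioms p]) (use c'.r_pos in simp)
  also have "\<dots> = - (\<Sum>i<DIM('a) - 1. c'.Hs p (e i) \<bullet> e i)"
    by (simp only: c'.div_tangent[OF g0] c'.\<nu>_basis_trace[OF e])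
  also have "\<dots> = - (\<Sum>i<DIM('a) - 1. \<kappa> i)"
    using ev e(2) by simp
  finally show ?thesis by simp
qed

text \<open>Charts require a function of class C2 on the whole space, while the given chart is steep
  along \<open>N p\<close> only near \<open>p\<close>. The defining function is therefore blended
  with its linearisation at \<open>p\<close>, which keeps its slope along \<open>N p\<close> at
  least 1/2 everywhere, and the global implicit function theorem is applied.\<close>

lemma tangent_chart:
  assumes p: "p \<in> frontier \<Omega>" "p \<in> ball y r"
  obtains r' \<gamma>' where "graph_chart \<Omega> p r' (N p) \<gamma>'" "gradient \<gamma>' p = 0"
proof -
  define J where "J = norm (a p)"
  define n where "n = N p"
  have J: "J \<ge> 1" using norm_a_ge_1 by (simp add: J_def)
  have an: "a p = J *\<^sub>R n" "norm n = 1" by (simp_all add: J_def n_def a_eq[symmetric])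
  have nn: "n \<bullet> n = 1" using an(2) by (simp add: dot_square_norm)
  have G0: "G p = 0" using frontier_iff p by simp
  have "isCont a p" using continuous_on_a[of UNIV] by (simp add: continuous_on_eq_continuous_at)
  \<comment> \<open>The constant 74 balances the slope estimate: the remainder contributes 1/74
    directly and 36/74 through the derivative of the cut-off, in total 1/2, while the linear part
    has slope \<open>J \<ge> 1\<close>.\<close>
  then obtain \<rho>0 where \<rho>0: "\<rho>0 > 0" "\<And>z. dist z p < \<rho>0 \<Longrightarrow> dist (a z) (a p) < 1 / 74"
    unfolding continuous_at_eps_delta by (metis zero_less_divide_1_iff zero_less_numeral)
  define \<rho> where "\<rho> = \<rho>0 / 2"
  have \<rho>: "\<rho> > 0" "\<And>z. norm (z - p) \<le> \<rho> \<Longrightarrow> norm (a z - a p) \<le> 1 / 74"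
    using \<rho>0 by (auto simp: \<rho>_def dist_norm intro!: less_imp_le)
  define L where "L z = (z - p) \<bullet> a p" for z
  define R where "R z = G z - L z" for z
  \<comment> \<open>The cut-off is 1 where the squared distance to \<open>p\<close> is at most
    \<open>\<rho>\<^sup>2 / 2\<close> and 0 from distance \<open>\<rho>\<close> on. Its derivative
    in a unit direction is at most
    \<open>9 * (2 / \<rho>\<^sup>2) * (2 * \<rho>) = 36 / \<rho>\<close>.\<close>
  define cu where "cu z = 1 - step (2 / \<rho>\<^sup>2 * (norm (z - p))\<^sup>2 - 1)" for z
  define g where "g z = L z + cu z * R z" for z
  have C_G: "C_diff 2 G"
    unfolding chart_fun_def[abs_def] by (intro C_diff_diff C_diff_inner C2)
  have C_L: "C_diff 2 L"
    unfolding L_def[abs_def] inner_diff_left by (intro C_diff_diff C_diff_inner C_diff_const)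
  have C_cu: "C_diff 2 cu"
    unfolding cu_def[abs_def]
    by (intro C_diff_diff C_diff_const C_diff_compose[OF C_diff_step] C_diff_mult C_diff_norm_power2)
  have C_g: "C_diff 2 g"
    unfolding g_def[abs_def] R_def by (intro C_diff_add C_diff_mult C_diff_diff C_G C_L C_cu)
  have Ld: "(L has_derivative (\<lambda>h. h \<bullet> a p)) (at z)" for z
    unfolding L_def[abs_def] by (auto intro!: derivative_eq_intros)
  have Rd: "(R has_derivative (\<lambda>h. (a z - a p) \<bullet> h)) (at z)" for z
    unfolding R_def[abs_def]
    by (rule has_derivative_eq_rhs[OF has_derivative_diff[OF G_deriv Ld]])
      (simp only: inner_diff_left inner_commute[of "a p"])
  have sq: "((\<lambda>z. (norm (z - p))\<^sup>2) has_derivative (\<lambda>h. 2 * (h \<bullet> (z - p)))) (at z)" for z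
    unfolding power2_norm_eq_inner
    by (auto intro!: derivative_eq_intros simp: inner_commute)
  define cut' where "cut' z h = - (dstep (2 / \<rho>\<^sup>2 * (norm (z - p))\<^sup>2 - 1) * (2 / \<rho>\<^sup>2 * (2 * (h \<bullet> (z - p)))))" for z h
  have cud: "(cu has_derivative cut' z) (at z)" for z
  proof -
    have "((\<lambda>z. 2 / \<rho>\<^sup>2 * (norm (z - p))\<^sup>2 - 1) has_derivative (\<lambda>h. 2 / \<rho>\<^sup>2 * (2 * (h \<bullet> (z - p))))) (at z)"
      by (rule has_derivative_eq_rhs[OF has_derivative_diff[OF has_derivative_mult_right[OF sq] has_derivative_const]]) simp
    from has_derivative_compose[OF this step_deriv[unfolded has_field_derivative_def]]
    show ?thesis unfolding cu_def[abs_def] cut'_def[abs_def]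
      by (rule has_derivative_eq_rhs[OF has_derivative_diff[OF has_derivative_const]]) simp
  qed
  have gd: "(g has_derivative (\<lambda>h. h \<bullet> a p + (cu z * ((a z - a p) \<bullet> h) + cut' z h * R z))) (at z)" for z
    unfolding g_def[abs_def] by (intro has_derivative_add has_derivative_mult Ld cud Rd)
  have lower: "frechet_derivative g (at z) n \<ge> 1 / 2" for z
  proof -
    have eq: "frechet_derivative g (at z) n = J + (cu z * ((a z - a p) \<bullet> n) + cut' z n * R z)"
      using frechet_derivative_at[OF gd[of z], symmetric] nn by (simp add: an(1))
    show ?thesis
    proof (cases "norm (z - p) \<le> \<rho>")
      case True
      have "\<bar>(a z - a p) \<bullet> n\<bar> \<le> 1 / 74"
        using Cauchy_Schwarz_ineq2[of "a z - a p" n] \<rho>(2)[OF True] an(2) by simp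
      moreover have "0 \<le> cu z" "cu z \<le> 1" using step_props by (auto simp: cu_def)
      ultimately have 1: "\<bar>cu z * ((a z - a p) \<bullet> n)\<bar> \<le> 1 / 74"
        using mult_mono[of "cu z" 1 "\<bar>(a z - a p) \<bullet> n\<bar>" "1/74"] by (simp add: abs_mult)
      have "norm (R z - R p) \<le> 1 / 74 * norm (z - p)"
      proof (rule differentiable_bound[where S="cball p \<rho>" and f'="\<lambda>z h. (a z - a p) \<bullet> h"])
        show "(R has_derivative (\<lambda>h. (a x - a p) \<bullet> h)) (at x within cball p \<rho>)" for x
          using Rd has_derivative_at_withinI by blast
        fix x assume "x \<in> cball p \<rho>"
        then have "norm (x - p) \<le> \<rho>" by (simp add: dist_norm norm_minus_commute)
        then have le: "norm (a x - a p) \<le> 1 / 74" by (rule \<rho>(2))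
        show "onorm (\<lambda>h. (a x - a p) \<bullet> h) \<le> 1 / 74"
        proof (rule onorm_bound)
          fix h
          have "\<bar>(a x - a p) \<bullet> h\<bar> \<le> norm (a x - a p) * norm h" by (rule Cauchy_Schwarz_ineq2)
          also have "\<dots> \<le> 1 / 74 * norm h" using le by (rule mult_right_mono) simp
          finally show "norm ((a x - a p) \<bullet> h) \<le> 1 / 74 * norm h" by simp
        qed simp
      qed (use True \<rho>(1) in \<open>auto simp: dist_norm norm_minus_commute\<close>)
      then have R: "\<bar>R z\<bar> \<le> \<rho> / 74" using True G0 by (simp add: R_def L_def)
      have "\<bar>n \<bullet> (z - p)\<bar> \<le> \<rho>"
        using Cauchy_Schwarz_ineq2[of n "z - p"] True an(2) by simp
      then have "\<bar>cut' z n\<bar> \<le> 9 * (2 / \<rho>\<^sup>2 * (2 * \<rho>))"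
        unfolding cut'_def abs_minus_cancel abs_mult
        using dstep_le dstep_nonneg \<rho>(1) by (intro mult_mono) auto
      also have "\<dots> = 36 / \<rho>" using \<rho>(1) by (simp add: power2_eq_square)
      finally have "\<bar>cut' z n\<bar> * \<bar>R z\<bar> \<le> 36 / \<rho> * (\<rho> / 74)"
        using R \<rho>(1) by (intro mult_mono) auto
      then have 2: "\<bar>cut' z n * R z\<bar> \<le> 36 / 74" using \<rho>(1) by (simp add: abs_mult)
      show ?thesis unfolding eq using 1 2 J by linarith
    next
      case False
      then have "\<rho>\<^sup>2 < (norm (z - p))\<^sup>2" using \<rho>(1) by (intro power_strict_mono) auto
      then have "1 \<le> (norm (z - p))\<^sup>2 / \<rho>\<^sup>2" using \<rho>(1) False by (subst le_divide_eq_1_pos) auto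
      then have ge: "2 / \<rho>\<^sup>2 * (norm (z - p))\<^sup>2 - 1 \<ge> 1" by simp
      then have "cu z = 0" "cut' z n = 0" using step_props(2) dstep_eq_0 by (auto simp: cu_def cut'_def)
      then show ?thesis using eq J by simp
    qed
  qed
  obtain t where t: "C_diff 2 t" "\<And>z s. g (z + s *\<^sub>R n) > 0 \<longleftrightarrow> s > t z" "\<And>z. g (z + t z *\<^sub>R n) = 0"
    "\<And>z v. frechet_derivative t (at z) v =
       - frechet_derivative g (at (z + t z *\<^sub>R n)) v / frechet_derivative g (at (z + t z *\<^sub>R n)) n"
    using implicit_function_C2[OF C_g, of "1/2" n] lower by (metis half_gt_zero_iff zero_less_one)
  \<comment> \<open>The zero of \<open>g\<close> on the line through \<open>z\<close> in direction
    \<open>n\<close> is \<open>z + t z *\<^sub>R n\<close>; this is its height over the hyperplane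
    orthogonal to \<open>n\<close>.\<close>
  define \<gamma>' where "\<gamma>' z = z \<bullet> n + t z" for z
  \<comment> \<open>Both values describe the same zero on one line, measured from different base
    points. This makes \<open>\<gamma>'\<close> constant in direction \<open>n\<close>, as a chart
    demands.\<close>
  have ts: "t (z + s *\<^sub>R n) = t z - s" for z s
  proof -
    have 1: "u > t (z + s *\<^sub>R n) \<longleftrightarrow> s + u > t z" for u
      using t(2)[of "z + s *\<^sub>R n" u] t(2)[of z "s + u"] by (simp add: scaleR_add_left add.assoc)
    show ?thesis
      using 1[of "t z - s"] 1[of "t (z + s *\<^sub>R n)"] by linarith
  qed
  have gp: "g p = 0" using G0 by (simp add: g_def R_def L_def)
  \<comment> \<open>If \<open>t p\<close> were positive, \<open>g\<close> would be nonpositive just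
    above \<open>p\<close>, although it vanishes at \<open>p\<close> and increases strictly along
    \<open>n\<close>.\<close>
  have tp: "t p = 0"
  proof -
    have "\<not> 0 > t p" using t(2)[of p 0] gp by simp
    moreover have "\<not> t p > 0"
    proof
      assume tp: "t p > 0"
      have "((\<lambda>s. g (p + s *\<^sub>R n)) has_derivative (\<lambda>h. frechet_derivative g (at (p + 0 *\<^sub>R n)) (h *\<^sub>R n))) (at 0)"
        by (rule has_derivative_compose[OF _ C_diff_Suc_has_derivative[OF C_g[unfolded numeral_2_eq_2]]])
          (auto intro!: derivative_eq_intros)
      moreover have "linear (frechet_derivative g (at p))"
        using gd[of p] by (intro linear_frechet_derivative) (auto simp: differentiable_def)
      ultimately have "((\<lambda>s. g (p + s *\<^sub>R n)) has_real_derivative frechet_derivative g (at p) n) (at 0)"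
        by (simp add: has_field_derivative_def linear_scale mult_commute_abs)
      moreover have "frechet_derivative g (at p) n > 0" using lower[of p] by linarith
      ultimately obtain d where d: "d > 0" "\<And>h. 0 < h \<Longrightarrow> h < d \<Longrightarrow> g (p + h *\<^sub>R n) > g p"
        using has_real_derivative_pos_inc_right[of "\<lambda>s. g (p + s *\<^sub>R n)" "frechet_derivative g (at p) n" 0 UNIV]
        by auto
      have "min d (t p) / 2 > 0" "min d (t p) / 2 < d" "min d (t p) / 2 < t p" using d tp by auto
      then show False using d(2)[of "min d (t p) / 2"] t(2)[of p "min d (t p) / 2"] gp by auto
    qed
    ultimately show ?thesis by simp
  qed
  have C_\<gamma>': "C_diff 2 \<gamma>'"
    unfolding \<gamma>'_def[abs_def] by (intro C_diff_add C_diff_inner t(1))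
  define r' where "r' = min (r - dist y p) (\<rho> / 2)"
  have r': "r' > 0" using p(2) \<rho>(1) by (simp add: r'_def)
  have mem: "x \<in> \<Omega> \<longleftrightarrow> \<gamma>' x < x \<bullet> n" if x: "x \<in> ball p r'" for x
  proof -
    have "dist y x < r" using x dist_triangle[of y x p] by (simp add: r'_def)
    then have "x \<in> \<Omega> \<longleftrightarrow> G x > 0" using mem_iff by simp
    also have "G x = g x"
    proof -
      have "norm (x - p) \<le> \<rho> / 2" using x by (simp add: r'_def dist_norm norm_minus_commute)
      then have "(norm (x - p))\<^sup>2 \<le> (\<rho> / 2)\<^sup>2" by (intro power_mono) auto
      then have "(norm (x - p))\<^sup>2 / \<rho>\<^sup>2 \<le> 1 / 4"
        using \<rho>(1) by (subst pos_divide_le_eq) (auto simp: power_divide)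
      moreover have "2 / \<rho>\<^sup>2 * (norm (x - p))\<^sup>2 = 2 * ((norm (x - p))\<^sup>2 / \<rho>\<^sup>2)" by simp
      ultimately have "2 / \<rho>\<^sup>2 * (norm (x - p))\<^sup>2 - 1 \<le> 0" by linarith
      then have "cu x = 1" using step_props(1) by (simp add: cu_def)
      then show ?thesis by (simp add: g_def R_def)
    qed
    also have "g x > 0 \<longleftrightarrow> \<gamma>' x < x \<bullet> n" using t(2)[of x 0] by (simp add: \<gamma>'_def)
    finally show ?thesis .
  qed
  have "graph_chart \<Omega> p r' n \<gamma>'"
    unfolding graph_chart_def
    using r' an(2) C_\<gamma>' mem nn by (auto simp: \<gamma>'_def ts inner_add_left)
  moreover have "gradient \<gamma>' p = 0"
  proof (rule gradient_unique)
    have td: "(t has_derivative frechet_derivative t (at p)) (at p)"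
      using t(1) by (intro C_diff_Suc_has_derivative[of "Suc 0"]) (simp only: numeral_2_eq_2)
    have R0: "R p = 0" using G0 by (simp add: R_def L_def)
    have "frechet_derivative g (at p) v = v \<bullet> a p" for v
      using frechet_derivative_at[OF gd[of p], symmetric] R0 by simp
    then have "frechet_derivative t (at p) v = - (v \<bullet> n)" for v
      using t(4)[of p v] tp J nn by (simp add: an(1))
    then show "(\<gamma>' has_derivative (\<lambda>h. h \<bullet> 0)) (at p)"
      unfolding \<gamma>'_def[abs_def] using td by (auto intro!: derivative_eq_intros)
  qed
  ultimately show ?thesis using that by (simp add: n_def)
qed

text \<open>The Hessian in a tangent chart is a symmetric map that preserves the hyperplane
  orthogonal to \<open>N p\<close>, which has dimension \<open>DIM('a) - 1\<close>. Its eigenvalues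
  there are the curvatures; this is the existence half for the description.\<close>

lemma principal_curvatures_exist:
  assumes p: "p \<in> frontier \<Omega>" "p \<in> ball y r"
  shows "\<exists>\<kappa>. principal_curvatures \<Omega> p \<kappa>"
proof -
  obtain r' \<gamma>' where c: "graph_chart \<Omega> p r' (N p) \<gamma>'" and g0: "gradient \<gamma>' p = 0"
    using tangent_chart[OF p] .
  interpret c': chart \<Omega> p r' "N p" \<gamma>' by unfold_locales (use c open_\<Omega> in auto)
  let ?V = "{v. N p \<bullet> v = 0}"
  have dV: "dim ?V = DIM('a) - 1" by (rule dim_hyperplane) (use norm_N[of p] in force)
  have sV: "subspace ?V" by (rule subspace_hyperplane)
  have AV: "c'.Hs p v \<in> ?V" for v using c'.Hs_\<nu>(1) by (simp add: inner_commute)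
  have sym: "c'.Hs p v \<bullet> w = v \<bullet> c'.Hs p w" for v w
    using c'.Hs_sym by (simp add: inner_commute)
  have "\<exists>e \<kappa>. (\<forall>i<DIM('a) - 1. e i \<in> ?V) \<and>
      (\<forall>i<DIM('a) - 1. \<forall>j<DIM('a) - 1. e i \<bullet> e j = (if i = j then 1 else 0)) \<and>
      (\<forall>i<DIM('a) - 1. c'.Hs p (e i) = \<kappa> i *\<^sub>R e i)"
    by (rule spectral_theorem_subspace[OF c'.Hs_linear sV dV AV sym])
  then obtain e \<kappa> where e: "\<forall>i<DIM('a) - 1. e i \<in> ?V"
      "\<forall>i<DIM('a) - 1. \<forall>j<DIM('a) - 1. e i \<bullet> e j = (if i = j then 1 else 0)"
      "\<forall>i<DIM('a) - 1. c'.Hs p (e i) = \<kappa> i *\<^sub>R e i" by (elim exE conjE)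
  have "\<forall>i<DIM('a) - 1. e i \<bullet> N p = 0" using e(1) by (simp add: inner_commute)
  then show ?thesis unfolding principal_curvatures_def using c g0 e(2,3) by blast
qed

text \<open>The formula holds at every boundary point of the chart ball. Hence mean curvature is
  locally the restriction of one continuous function.\<close>

lemma mean_curvature_eq:
  assumes p: "p \<in> frontier \<Omega>" "p \<in> ball y r"
  shows "mean_curvature \<Omega> p = - chart_div \<nu> \<gamma> p / real (DIM('a) - 1)"
proof -
  obtain \<kappa> where "principal_curvatures \<Omega> p \<kappa>" using principal_curvatures_exist[OF p] by blast
  then show ?thesis unfolding mean_curvature_def
    by (intro the_equality exI[of _ \<kappa>] conjI, assumption, simp only: principal_curvatures_sum[OF p],
        elim exE conjE, simp only: principal_curvatures_sum[OF p])
qed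

end

section \<open>The distance function and the Hardy inequality\<close>

lemma integrable_lborel_compact_support:
  fixes f :: "'a::euclidean_space \<Rightarrow> real"
  assumes "compact S" "continuous_on S f" "\<And>x. x \<notin> S \<Longrightarrow> f x = 0"
  shows "integrable lborel f"
proof -
  have "(\<lambda>x. indicator S x *\<^sub>R f x) = f"
  proof
    fix x show "indicator S x *\<^sub>R f x = f x" using assms(3)[of x] by (cases "x \<in> S") auto
  qed
  then show ?thesis using borel_integrable_compact[OF assms(1,2)] by simp
qed

lemma integrable_indicator_compact:
  fixes S :: "'a::euclidean_space set"
  assumes "compact S" shows "integrable lborel (indicator S :: 'a \<Rightarrow> real)"
  by (rule integrable_lborel_compact_support[OF assms])
    (auto intro: continuous_on_eq[OF continuous_on_const[of _ 1]])

lemma lborel_shift: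
  fixes f :: "'a::euclidean_space \<Rightarrow> real"
  shows "integral\<^sup>L lborel (\<lambda>x. f (x + b)) = integral\<^sup>L lborel f"
    and "integrable lborel (\<lambda>x. f (x + b)) \<longleftrightarrow> integrable lborel f"
proof -
  have int: "integrable lborel (\<lambda>x. f (x + b))" if "integrable lborel f" for f :: "'a \<Rightarrow> real" and b
  proof -
    have "integrable (distr lborel borel ((+) b)) f" using that by (simp add: lborel_distr_plus)
    then have "integrable lborel (\<lambda>x. f (b + x))"
      by (subst (asm) integrable_distr_eq) (use that in auto)
    then show ?thesis by (simp add: add.commute)
  qed
  show iff: "integrable lborel (\<lambda>x. f (x + b)) \<longleftrightarrow> integrable lborel f"
    using int[of f b] int[of "\<lambda>x. f (x + b)" "- b"] by auto
  show "integral\<^sup>L lborel (\<lambda>x. f (x + b)) = integral\<^sup>L lborel f"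
  proof (cases "integrable lborel f")
    case True
    have "integral\<^sup>L lborel f = integral\<^sup>L (distr lborel borel ((+) b)) f" by (simp add: lborel_distr_plus)
    also have "\<dots> = integral\<^sup>L lborel (\<lambda>x. f (b + x))"
      using True by (intro integral_distr) auto
    finally show ?thesis by (simp add: add.commute)
  next
    case False
    then show ?thesis using iff by (simp add: not_integrable_integral_eq)
  qed
qed

lemma nearest_point_exists:
  fixes C :: "'a::euclidean_space set"
  assumes "closed C" "C \<noteq> {}"
  obtains y where "y \<in> C" "infdist x C = dist x y"
proof -
  obtain y where y: "y \<in> C" "\<And>z. z \<in> C \<Longrightarrow> dist x y \<le> dist x z"
    using distance_attains_inf[OF assms] by metis
  have "infdist x C = dist x y"
    using y assms(2) by (intro antisym infdist_le) (auto simp: infdist_def intro: cINF_greatest)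
  then show ?thesis using that y by blast
qed

lemma infdist_pos_iff:
  assumes "closed C" "C \<noteq> {}" shows "infdist x C > 0 \<longleftrightarrow> x \<notin> C"
  using in_closed_iff_infdist_zero[OF assms, of x] infdist_nonneg[of x C] by linarith

text \<open>The inequality \<open>2 * A * B \<le> A\<^sup>2 + B\<^sup>2\<close> linearises the
  square root in the expansion of the squared norm.\<close>

lemma norm_add_le_quadratic:
  fixes u w :: "'a::real_inner"
  assumes "u \<noteq> 0"
  shows "norm (u + w) \<le> norm u + (u \<bullet> w) / norm u + (norm w)\<^sup>2 / (2 * norm u)"
proof -
  let ?A = "norm u" and ?B = "norm (u + w)"
  have A: "?A > 0" using assms by simp
  have "?B\<^sup>2 = ?A\<^sup>2 + 2 * (u \<bullet> w) + (norm w)\<^sup>2"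
    by (simp add: power2_norm_eq_inner inner_add_left inner_add_right inner_commute[of w u])
  moreover have "2 * ?A * ?B \<le> ?A\<^sup>2 + ?B\<^sup>2" using sum_squares_bound by blast
  ultimately have "?B * (2 * ?A) \<le> 2 * ?A\<^sup>2 + 2 * (u \<bullet> w) + (norm w)\<^sup>2" by (simp add: mult_ac)
  then have "?B \<le> (2 * ?A\<^sup>2 + 2 * (u \<bullet> w) + (norm w)\<^sup>2) / (2 * ?A)"
    using A by (simp add: pos_le_divide_eq)
  also have "\<dots> = ?A + (u \<bullet> w) / ?A + (norm w)\<^sup>2 / (2 * ?A)"
    using A by (simp add: add_divide_distrib power2_eq_square)
  finally show ?thesis .
qed

text \<open>The distance to one fixed nearest point \<open>y\<close> bounds the distance to
  \<open>C\<close> from above, with equality at \<open>x\<close>. Adding the bounds for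
  \<open>w\<close> and \<open>- w\<close> cancels the linear terms, which gives semiconcavity away
  from \<open>C\<close>.\<close>

lemma infdist_superdifferential:
  fixes C :: "'a::euclidean_space set"
  assumes "y \<in> C" "infdist x C = dist x y" "x \<noteq> y"
  shows "infdist (x + w) C \<le> infdist x C + ((x - y) /\<^sub>R infdist x C) \<bullet> w + (norm w)\<^sup>2 / (2 * infdist x C)"
proof -
  have "infdist (x + w) C \<le> dist (x + w) y" using assms(1) by (rule infdist_le)
  also have "dist (x + w) y = norm ((x - y) + w)" by (simp add: dist_norm algebra_simps)
  also have "\<dots> \<le> norm (x - y) + ((x - y) \<bullet> w) / norm (x - y) + (norm w)\<^sup>2 / (2 * norm (x - y))"
    by (rule norm_add_le_quadratic) (use assms in simp)
  finally have *: "infdist (x + w) C \<le> norm (x - y) + ((x - y) \<bullet> w) / norm (x - y) + (norm w)\<^sup>2 / (2 * norm (x - y))" .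
  have "((x - y) /\<^sub>R norm (x - y)) \<bullet> w = ((x - y) \<bullet> w) / norm (x - y)"
    by (simp only: inner_scaleR_left divide_inverse mult.commute)
  then show ?thesis unfolding assms(2) dist_norm using * by (simp only:)
qed

lemma infdist_second_difference_le:
  fixes C :: "'a::euclidean_space set"
  assumes "closed C" "C \<noteq> {}" "x \<notin> C"
  shows "infdist (x + w) C + infdist (x - w) C - 2 * infdist x C \<le> (norm w)\<^sup>2 / infdist x C"
proof -
  obtain y where y: "y \<in> C" "infdist x C = dist x y" using nearest_point_exists[OF assms(1,2)] .
  have "x \<noteq> y" using assms(3) y by auto
  note i = infdist_superdifferential[OF y this]
  show ?thesis using i[of w] i[of "- w"] by (simp add: inner_minus_right)
qed

text \<open>A discrete Green formula. It uses translation invariance alone, so \<open>f\<close> may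
  be merely continuous and only \<open>\<phi>\<close> has compact support.\<close>

lemma summation_by_parts:
  fixes f \<phi> :: "'a::euclidean_space \<Rightarrow> real"
  assumes f: "continuous_on UNIV f" and \<phi>: "continuous_on UNIV \<phi>"
    and S: "compact S" "\<And>x. x \<notin> S \<Longrightarrow> \<phi> x = 0"
  shows "integrable lborel (\<lambda>x. \<phi> x * (f (x + b) + f (x - b) - 2 * f x))"
    "integrable lborel (\<lambda>x. (f (x + b) - f x) * (\<phi> (x + b) - \<phi> x))"
    "(\<integral>x. \<phi> x * (f (x + b) + f (x - b) - 2 * f x) \<partial>lborel) =
       - (\<integral>x. (f (x + b) - f x) * (\<phi> (x + b) - \<phi> x) \<partial>lborel)"
proof -
  have cc: "continuous_on A (\<lambda>x. f (x + c))" "continuous_on A (\<lambda>x. \<phi> (x + c))" for A c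
    by (auto intro!: continuous_on_compose2[OF f] continuous_on_compose2[OF \<phi>] continuous_intros)
  note [continuous_intros] = cc cc(1)[of _ "- b", simplified] cc(1)[of _ 0, simplified] cc(2)[of _ 0, simplified]
  have i1: "integrable lborel (\<lambda>x. \<phi> x * (f (x + b) - f x))"
    by (rule integrable_lborel_compact_support[OF S(1)]) (auto intro!: continuous_intros simp: S(2))
  have i2: "integrable lborel (\<lambda>x. \<phi> x * (f (x - b) - f x))"
    by (rule integrable_lborel_compact_support[OF S(1)]) (auto intro!: continuous_intros simp: S(2))
  have eq2: "(\<lambda>x. \<phi> (x + b) * (f x - f (x + b))) = (\<lambda>x. (\<lambda>x. \<phi> x * (f (x - b) - f x)) (x + b))" by auto
  have i3: "integrable lborel (\<lambda>x. \<phi> (x + b) * (f x - f (x + b)))"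
    unfolding eq2 using i2 by (subst lborel_shift(2))
  have e3: "(\<integral>x. \<phi> (x + b) * (f x - f (x + b)) \<partial>lborel) = (\<integral>x. \<phi> x * (f (x - b) - f x) \<partial>lborel)"
    unfolding eq2 by (rule lborel_shift(1))
  have s1: "(\<lambda>x. \<phi> x * (f (x + b) + f (x - b) - 2 * f x)) =
      (\<lambda>x. \<phi> x * (f (x + b) - f x) + \<phi> x * (f (x - b) - f x))" by (auto simp: algebra_simps)
  have s2: "(\<lambda>x. (f (x + b) - f x) * (\<phi> (x + b) - \<phi> x)) =
      (\<lambda>x. - (\<phi> (x + b) * (f x - f (x + b))) - \<phi> x * (f (x + b) - f x))" by (auto simp: algebra_simps)
  show "integrable lborel (\<lambda>x. \<phi> x * (f (x + b) + f (x - b) - 2 * f x))"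
    unfolding s1 using i1 i2 by simp
  show "integrable lborel (\<lambda>x. (f (x + b) - f x) * (\<phi> (x + b) - \<phi> x))"
    unfolding s2 using i1 i3 by simp
  show "(\<integral>x. \<phi> x * (f (x + b) + f (x - b) - 2 * f x) \<partial>lborel) =
       - (\<integral>x. (f (x + b) - f x) * (\<phi> (x + b) - \<phi> x) \<partial>lborel)"
    unfolding s1 s2 using i1 i2 i3 e3 by simp
qed

text \<open>The factor 2 leaves room for a \<open>\<delta>\<close>-neighbourhood of \<open>K\<close>
  whose points still have distance at least \<open>\<delta>\<close> from \<open>C\<close>.\<close>

lemma compact_positive_distance:
  fixes K C :: "'a::euclidean_space set"
  assumes "compact K" "closed C" "C \<noteq> {}" "K \<inter> C = {}"
  obtains \<delta> where "\<delta> > 0" "\<And>x. x \<in> K \<Longrightarrow> infdist x C \<ge> 2 * \<delta>"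
proof (cases "K = {}")
  case True
  then show ?thesis using that[of 1] by simp
next
  case False
  have "continuous_on K (\<lambda>x. infdist x C)" by (intro continuous_intros)
  then obtain x0 where x0: "x0 \<in> K" "\<And>x. x \<in> K \<Longrightarrow> infdist x0 C \<le> infdist x C"
    using continuous_attains_inf[OF assms(1) False] by metis
  have "infdist x0 C > 0" using infdist_pos_iff[OF assms(2,3)] x0(1) assms(4) by blast
  then show ?thesis using that[of "infdist x0 C / 2"] x0 by simp
qed

text \<open>The second differences of \<open>d\<close> are bounded above by \<open>O(h)\<close> and their integral is \<open>O(h)\<close> as
  well, so they tend to zero in \<open>L\<^sup>1\<close>.  Together with the superdifferential this identifies the
  directional derivatives almost everywhere without Rademacher's theorem.\<close>

lemma infdist_gradient_AE:
  fixes C K :: "'a::euclidean_space set"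
  assumes C: "closed C" "C \<noteq> {}" and K: "compact K" "K \<inter> C = {}"
  obtains h :: "nat \<Rightarrow> real" where "\<And>k. h k > 0" "h \<longlonglongrightarrow> 0"
    "AE x in lborel. x \<in> K \<longrightarrow> (\<forall>y\<in>C. infdist x C = dist x y \<longrightarrow> (\<forall>b\<in>Basis.
       (\<lambda>k. (infdist (x + h k *\<^sub>R b) C - infdist x C) / h k) \<longlonglongrightarrow> ((x - y) /\<^sub>R infdist x C) \<bullet> b))"
proof (cases "K = {}")
  case True
  show ?thesis
  proof (rule that)
    show "0 < 1 / real (Suc k)" for k by simp
    show "(\<lambda>k. 1 / real (Suc k)) \<longlonglongrightarrow> 0" by (rule LIMSEQ_Suc[OF lim_1_over_n])
  qed (simp add: True)
next
  case False
  let ?d = "\<lambda>x. infdist x C"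
  obtain \<delta> where \<delta>: "\<delta> > 0" "\<And>x. x \<in> K \<Longrightarrow> ?d x \<ge> 2 * \<delta>"
    using compact_positive_distance[OF K(1) C K(2)] by metis
  define S where "S = {x. infdist x K \<le> \<delta>}"
  have S: "compact S" unfolding S_def by (rule compact_infdist_le[OF False K(1) \<delta>(1)])
  have dS: "?d x \<ge> \<delta>" if "x \<in> S" for x
  proof -
    obtain z where z: "z \<in> K" "infdist x K = dist x z"
      using nearest_point_exists[OF compact_imp_closed[OF K(1)] False] .
    have "\<bar>?d x - ?d z\<bar> \<le> dist x z" by (rule infdist_triangle_abs)
    then show ?thesis using \<delta>(2)[OF z(1)] z(2) that by (auto simp: S_def)
  qed
  \<comment> \<open>A tent function: 1 on \<open>K\<close>, zero outside the
    \<open>\<delta>\<close>-neighbourhood \<open>S\<close>, with Lipschitz constant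
    \<open>1 / \<delta>\<close>.\<close>
  define \<phi> where "\<phi> x = max 0 (1 - infdist x K / \<delta>)" for x
  have \<phi>0: "\<phi> x = 0" if "x \<notin> S" for x
    using that \<delta>(1) by (auto simp: S_def \<phi>_def max_def)
  have \<phi>nn: "\<phi> x \<ge> 0" for x by (simp add: \<phi>_def)
  have \<phi>K: "\<phi> x = 1" if "x \<in> K" for x using that by (simp add: \<phi>_def)
  have \<phi>c: "continuous_on A \<phi>" for A unfolding \<phi>_def[abs_def] using \<delta>(1) by (intro continuous_intros) auto
  have \<phi>L: "\<bar>\<phi> x - \<phi> z\<bar> \<le> dist x z / \<delta>" for x z
  proof -
    have "\<bar>\<phi> x - \<phi> z\<bar> \<le> \<bar>infdist x K / \<delta> - infdist z K / \<delta>\<bar>" by (auto simp: \<phi>_def max_def)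
    also have "\<dots> = \<bar>infdist x K - infdist z K\<bar> / \<delta>"
      using \<delta>(1) by (simp add: diff_divide_distrib[symmetric])
    also have "\<dots> \<le> dist x z / \<delta>" using infdist_triangle_abs \<delta>(1) by (intro divide_right_mono) auto
    finally show ?thesis .
  qed
  have dc: "continuous_on A ?d" for A by (intro continuous_intros)
  define h where "h k = 1 / real (Suc k)" for k
  have h: "h k > 0" "h k \<le> 1" for k by (auto simp: h_def)
  have h0: "h \<longlonglongrightarrow> 0" unfolding h_def by (rule LIMSEQ_Suc[OF lim_1_over_n])
  define D2 where "D2 k b x = ?d (x + h k *\<^sub>R b) + ?d (x - h k *\<^sub>R b) - 2 * ?d x" for k b x
  have D2le: "D2 k b x \<le> (h k)\<^sup>2 / \<delta>" if "x \<in> S" "b \<in> Basis" for k b x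
  proof -
    have "?d x > 0" using dS[OF that(1)] \<delta>(1) by linarith
    then have "x \<notin> C" using infdist_pos_iff[OF C] by blast
    from infdist_second_difference_le[OF C this, of "h k *\<^sub>R b"]
    have "D2 k b x \<le> (h k)\<^sup>2 / ?d x" using that(2) by (simp add: D2_def)
    also have "\<dots> \<le> (h k)\<^sup>2 / \<delta>" using dS[OF that(1)] \<delta>(1) by (intro divide_left_mono) auto
    finally show ?thesis .
  qed
  define S1 where "S1 = {x. infdist x S \<le> 1}"
  have KS: "K \<subseteq> S" using \<delta>(1) by (auto simp: S_def)
  then have Sne: "S \<noteq> {}" using False by blast
  have S1: "compact S1" unfolding S1_def by (rule compact_infdist_le[OF Sne S]) simp
  have ind: "integrable lborel (indicator S1 :: _ \<Rightarrow> real)" "integrable lborel (indicator S :: _ \<Rightarrow> real)"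
    by (rule integrable_indicator_compact[OF S1], rule integrable_indicator_compact[OF S])
  \<comment> \<open>The gap between the second differences and their upper bound, divided by
    \<open>h k\<close>. It is nonnegative, so a bound on its integral is a bound in the L1
    norm.\<close>
  define Z where "Z k x = (\<Sum>b\<in>Basis. \<phi> x * ((h k)\<^sup>2 / \<delta> - D2 k b x)) / h k" for k x
  have Znn: "Z k x \<ge> 0" for k x
    unfolding Z_def using h[of k] D2le[of x] \<phi>nn[of x] \<phi>0[of x]
    by (cases "x \<in> S") (auto intro!: divide_nonneg_pos sum_nonneg mult_nonneg_nonneg)
  have sbp: "integrable lborel (\<lambda>x. \<phi> x * D2 k b x)"
    "(\<integral>x. \<phi> x * D2 k b x \<partial>lborel) \<ge> - ((h k)\<^sup>2 / \<delta> * measure lborel S1)" if b: "b \<in> Basis" for k b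
  proof -
    note s = summation_by_parts[OF dc \<phi>c S \<phi>0, of "h k *\<^sub>R b"]
    show "integrable lborel (\<lambda>x. \<phi> x * D2 k b x)" using s(1) by (simp add: D2_def)
    \<comment> \<open>After summation by parts each factor is a first difference of a Lipschitz
      function, so the product is O(h^2). Dividing by \<open>h k\<close> in \<open>Z\<close> still
      leaves an integral of order \<open>h k\<close>.\<close>
    let ?F = "\<lambda>x. (?d (x + h k *\<^sub>R b) - ?d x) * (\<phi> (x + h k *\<^sub>R b) - \<phi> x)"
    have le: "?F x \<le> (h k)\<^sup>2 / \<delta> * indicator S1 x" for x
    proof (cases "x \<in> S1")
      case True
      have n: "dist (x + h k *\<^sub>R b) x = h k" using b h[of k] by (simp add: dist_norm)
      have "\<bar>?d (x + h k *\<^sub>R b) - ?d x\<bar> * \<bar>\<phi> (x + h k *\<^sub>R b) - \<phi> x\<bar> \<le> h k * (h k / \<delta>)"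
        using infdist_triangle_abs[of "x + h k *\<^sub>R b" C x] \<phi>L[of "x + h k *\<^sub>R b" x] unfolding n
        by (intro mult_mono) auto
      then have "\<bar>?F x\<bar> \<le> (h k)\<^sup>2 / \<delta>" by (simp add: abs_mult power2_eq_square)
      then show ?thesis using True by simp
    next
      case False
      then have "x \<notin> S" "x + h k *\<^sub>R b \<notin> S"
      proof -
        have S0: "infdist z S = 0" if "z \<in> S" for z using that by simp
        show "x \<notin> S" using False S0 by (auto simp: S1_def)
        show "x + h k *\<^sub>R b \<notin> S"
        proof
          assume "x + h k *\<^sub>R b \<in> S"
          then have "infdist x S \<le> dist x (x + h k *\<^sub>R b)" by (rule infdist_le)
          also have "\<dots> \<le> 1" using b h[of k] by (simp add: dist_norm)
          finally show False using False by (simp add: S1_def)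
        qed
      qed
      then show ?thesis using \<phi>0 False by simp
    qed
    have "(\<integral>x. ?F x \<partial>lborel) \<le> (\<integral>x. (h k)\<^sup>2 / \<delta> * indicator S1 x \<partial>lborel)"
      using s(2) ind le by (intro integral_mono) auto
    also have "\<dots> = (h k)\<^sup>2 / \<delta> * measure lborel S1" using S1 by simp
    finally show "(\<integral>x. \<phi> x * D2 k b x \<partial>lborel) \<ge> - ((h k)\<^sup>2 / \<delta> * measure lborel S1)"
      using s(3) by (simp add: D2_def)
  qed
  have \<phi>i: "integrable lborel \<phi>" by (rule integrable_lborel_compact_support[OF S \<phi>c \<phi>0])
  have Zi: "integrable lborel (Z k)" for k
    unfolding Z_def[abs_def] right_diff_distrib using sbp(1) \<phi>i by auto
  define c where "c = DIM('a) * (integral\<^sup>L lborel \<phi> / \<delta> + measure lborel S1 / \<delta>)"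
  have Zle: "(\<integral>x. Z k x \<partial>lborel) \<le> c * h k" for k
  proof -
    have "(\<integral>x. Z k x \<partial>lborel) = (\<Sum>b\<in>Basis. integral\<^sup>L lborel \<phi> * ((h k)\<^sup>2 / \<delta>) - (\<integral>x. \<phi> x * D2 k b x \<partial>lborel)) / h k"
      unfolding Z_def right_diff_distrib using sbp(1) \<phi>i by (simp add: Bochner_Integration.integral_sum)
    also have "\<dots> \<le> (\<Sum>b\<in>(Basis::'a set). integral\<^sup>L lborel \<phi> * ((h k)\<^sup>2 / \<delta>) + (h k)\<^sup>2 / \<delta> * measure lborel S1) / h k"
    proof (intro divide_right_mono sum_mono)
      fix b :: 'a assume "b \<in> Basis"
      from sbp(2)[OF this, of k]
      show "integral\<^sup>L lborel \<phi> * ((h k)\<^sup>2 / \<delta>) - (\<integral>x. \<phi> x * D2 k b x \<partial>lborel)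
          \<le> integral\<^sup>L lborel \<phi> * ((h k)\<^sup>2 / \<delta>) + (h k)\<^sup>2 / \<delta> * measure lborel S1" by linarith
    qed (use h(1)[of k] in simp)
    also have "\<dots> = c * h k" using h(1)[of k] by (simp add: c_def power2_eq_square field_simps)
    finally show ?thesis .
  qed
  have "(\<lambda>k. \<integral>x. norm (Z k x) \<partial>lborel) \<longlonglongrightarrow> 0"
  proof (rule tendsto_sandwich[OF _ _ tendsto_const])
    show "eventually (\<lambda>k. 0 \<le> (\<integral>x. norm (Z k x) \<partial>lborel)) sequentially" by simp
    show "eventually (\<lambda>k. (\<integral>x. norm (Z k x) \<partial>lborel) \<le> c * h k) sequentially"
      using Zle Znn by simp
    show "(\<lambda>k. c * h k) \<longlonglongrightarrow> 0" using tendsto_mult_right_zero[OF h0, of c] by simp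
  qed
  \<comment> \<open>Convergence in L1 yields convergence almost everywhere only for a subsequence.
    For this reason the gradient is asserted along a sequence of step sizes.\<close>
  then obtain r where r: "strict_mono r" "AE x in lborel. (\<lambda>k. Z (r k) x) \<longlonglongrightarrow> 0"
    using tendsto_L1_AE_subseq[of lborel Z, OF Zi] by blast
  have hr0: "(\<lambda>k. h (r k)) \<longlonglongrightarrow> 0" using LIMSEQ_subseq_LIMSEQ[OF h0 r(1)] by (simp add: o_def)
  show ?thesis
  proof (rule that[of "\<lambda>k. h (r k)"])
    show "0 < h (r k)" for k by (rule h)
    show "(\<lambda>k. h (r k)) \<longlonglongrightarrow> 0" by (rule hr0)
    show "AE x in lborel. x \<in> K \<longrightarrow> (\<forall>y\<in>C. ?d x = dist x y \<longrightarrow> (\<forall>b\<in>Basis.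
       (\<lambda>k. (?d (x + h (r k) *\<^sub>R b) - ?d x) / h (r k)) \<longlonglongrightarrow> ((x - y) /\<^sub>R ?d x) \<bullet> b))"
      using r(2)
    proof (eventually_elim, intro impI ballI)
      fix x y b assume Z0: "(\<lambda>k. Z (r k) x) \<longlonglongrightarrow> 0" and xK: "x \<in> K" and y: "y \<in> C" "?d x = dist x y"
        and b: "(b::'a) \<in> Basis"
      have xS: "x \<in> S" using xK \<delta>(1) by (simp add: S_def)
      have dx: "?d x > 0" using dS[OF xS] \<delta>(1) by simp
      then have xy: "x \<noteq> y" using y by auto
      define e where "e = ((x - y) /\<^sub>R ?d x) \<bullet> b"
      have bound: "(h (r k))\<^sup>2 / \<delta> - D2 (r k) b x \<le> h (r k) * Z (r k) x" for k
      proof -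
        have "(h (r k))\<^sup>2 / \<delta> - D2 (r k) b x \<le> (\<Sum>b\<in>Basis. (h (r k))\<^sup>2 / \<delta> - D2 (r k) b x)"
          by (rule member_le_sum[OF b]) (use D2le[OF xS] in auto)
        also have "\<dots> = h (r k) * Z (r k) x" using h(1)[of "r k"] by (simp add: Z_def \<phi>K[OF xK])
        finally show ?thesis .
      qed
      have up: "(?d (x + h (r k) *\<^sub>R b) - ?d x) / h (r k) \<le> e + h (r k) / (2 * ?d x)" for k
      proof -
        have "?d (x + h (r k) *\<^sub>R b) - ?d x \<le> h (r k) * e + (h (r k))\<^sup>2 / (2 * ?d x)"
          using infdist_superdifferential[OF y xy, of "h (r k) *\<^sub>R b"] b h(1)[of "r k"] by (simp add: e_def)
        then have "(?d (x + h (r k) *\<^sub>R b) - ?d x) / h (r k) \<le> (h (r k) * e + (h (r k))\<^sup>2 / (2 * ?d x)) / h (r k)"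
          using h(1)[of "r k"] by (intro divide_right_mono) auto
        also have "\<dots> = e + h (r k) / (2 * ?d x)" using h(1)[of "r k"] by (simp add: add_divide_distrib power2_eq_square)
        finally show ?thesis .
      qed
      \<comment> \<open>The superdifferential bounds the backward difference from above. Since the
        second difference is nearly zero, this turns into a lower bound for the forward
        difference.\<close>
      have lo: "e - h (r k) / (2 * ?d x) - Z (r k) x \<le> (?d (x + h (r k) *\<^sub>R b) - ?d x) / h (r k)" for k
      proof -
        have 1: "?d (x - h (r k) *\<^sub>R b) - ?d x \<le> - (h (r k) * e) + (h (r k))\<^sup>2 / (2 * ?d x)"
          using infdist_superdifferential[OF y xy, of "- (h (r k) *\<^sub>R b)"] b h(1)[of "r k"] by (simp add: e_def)
        have "0 \<le> (h (r k))\<^sup>2 / \<delta>" using \<delta>(1) by simp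
        then have "?d (x + h (r k) *\<^sub>R b) - ?d x \<ge> h (r k) * e - (h (r k))\<^sup>2 / (2 * ?d x) - h (r k) * Z (r k) x"
          using 1 bound[of k] unfolding D2_def by linarith
        then have "(?d (x + h (r k) *\<^sub>R b) - ?d x) / h (r k) \<ge>
            (h (r k) * e - (h (r k))\<^sup>2 / (2 * ?d x) - h (r k) * Z (r k) x) / h (r k)"
          using h(1)[of "r k"] by (intro divide_right_mono) auto
        also have "(h (r k) * e - (h (r k))\<^sup>2 / (2 * ?d x) - h (r k) * Z (r k) x) / h (r k) =
            e - h (r k) / (2 * ?d x) - Z (r k) x"
          using h(1)[of "r k"] by (simp add: diff_divide_distrib power2_eq_square)
        finally show ?thesis .
      qed
      have "(\<lambda>k. e - h (r k) / (2 * ?d x) - Z (r k) x) \<longlonglongrightarrow> e - 0 / (2 * ?d x) - 0"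
        using dx by (intro tendsto_intros hr0 Z0) auto
      then have l: "(\<lambda>k. e - h (r k) / (2 * ?d x) - Z (r k) x) \<longlonglongrightarrow> e" by simp
      have "(\<lambda>k. e + h (r k) / (2 * ?d x)) \<longlonglongrightarrow> e + 0 / (2 * ?d x)"
        using dx by (intro tendsto_intros hr0) auto
      then have u: "(\<lambda>k. e + h (r k) / (2 * ?d x)) \<longlonglongrightarrow> e" by simp
      have "(\<lambda>k. (?d (x + h (r k) *\<^sub>R b) - ?d x) / h (r k)) \<longlonglongrightarrow> e"
        by (rule tendsto_sandwich[OF always_eventually always_eventually l u]) (use lo up in blast)+
      then show "(\<lambda>k. (?d (x + h (r k) *\<^sub>R b) - ?d x) / h (r k)) \<longlonglongrightarrow> ((x - y) /\<^sub>R ?d x) \<bullet> b"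
        by (simp add: e_def)
    qed
  qed
qed

text \<open>Nearest points are not chosen measurably in \<open>x\<close>. Defining \<open>E\<close>
  through limits of continuous difference quotients gives measurability, and almost everywhere
  \<open>E\<close> equals \<open>(x - y) /\<^sub>R infdist x C\<close> for every nearest point
  \<open>y\<close>. A tail of the step sizes is taken so that all of them stay below
  \<open>\<delta>\<close>.\<close>

lemma infdist_gradient_field:
  fixes C K :: "'a::euclidean_space set"
  assumes C: "closed C" "C \<noteq> {}" and K: "compact K" "K \<inter> C = {}" and \<delta>: "\<delta> > 0"
  obtains h :: "nat \<Rightarrow> real" and E :: "'a \<Rightarrow> 'a" where "\<And>k. 0 < h k" "\<And>k. h k < \<delta>" "h \<longlonglongrightarrow> 0"
    "E \<in> borel_measurable lborel"
    "AE x in lborel. x \<in> K \<longrightarrow> norm (E x) = 1 \<and> (\<forall>y\<in>C. infdist x C = dist x y \<longrightarrow> E x = (x - y) /\<^sub>R infdist x C) \<and>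
       (\<forall>b\<in>Basis. (\<lambda>k. (infdist (x + h k *\<^sub>R b) C - infdist x C) / h k) \<longlonglongrightarrow> E x \<bullet> b)"
proof -
  obtain h' :: "nat \<Rightarrow> real" where h': "\<And>k. h' k > 0" "h' \<longlonglongrightarrow> 0" and ae:
    "AE x in lborel. x \<in> K \<longrightarrow> (\<forall>y\<in>C. infdist x C = dist x y \<longrightarrow> (\<forall>b\<in>Basis.
       (\<lambda>k. (infdist (x + h' k *\<^sub>R b) C - infdist x C) / h' k) \<longlonglongrightarrow> ((x - y) /\<^sub>R infdist x C) \<bullet> b))"
    by (rule infdist_gradient_AE[OF C K], rule that)
  have "eventually (\<lambda>k. h' k < \<delta>) sequentially" using order_tendstoD(2)[OF h'(2) \<delta>] .
  then obtain k0 where k0: "\<And>k. k \<ge> k0 \<Longrightarrow> h' k < \<delta>" unfolding eventually_sequentially by blast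
  define h where "h k = h' (k + k0)" for k
  define q where "q k b x = (infdist (x + h k *\<^sub>R b) C - infdist x C) / h k" for k x and b :: 'a
  define E where "E x = (\<Sum>b\<in>Basis. lim (\<lambda>k. q k b x) *\<^sub>R b)" for x
  have qm: "q k b \<in> borel_measurable lborel" for k b
  proof -
    have "continuous_on UNIV (q k b)"
      unfolding q_def[abs_def] using h'(1)[of "k + k0"] by (intro continuous_intros) (auto simp: h_def)
    then show ?thesis by (simp add: borel_measurable_continuous_onI)
  qed
  have Em: "E \<in> borel_measurable lborel"
    unfolding E_def[abs_def] using qm by (intro borel_measurable_sum borel_measurable_scaleR borel_measurable_lim_metric) auto
  have "AE x in lborel. x \<in> K \<longrightarrow> norm (E x) = 1 \<and> (\<forall>y\<in>C. infdist x C = dist x y \<longrightarrow> E x = (x - y) /\<^sub>R infdist x C) \<and>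
       (\<forall>b\<in>Basis. (\<lambda>k. q k b x) \<longlonglongrightarrow> E x \<bullet> b)"
    using ae
  proof (eventually_elim, intro impI)
    fix x assume *: "x \<in> K \<longrightarrow> (\<forall>y\<in>C. infdist x C = dist x y \<longrightarrow> (\<forall>b\<in>Basis.
       (\<lambda>k. (infdist (x + h' k *\<^sub>R b) C - infdist x C) / h' k) \<longlonglongrightarrow> ((x - y) /\<^sub>R infdist x C) \<bullet> b))" and x: "x \<in> K"
    have lim: "(\<lambda>k. q k b x) \<longlonglongrightarrow> ((x - y) /\<^sub>R infdist x C) \<bullet> b"
      if "y \<in> C" "infdist x C = dist x y" "b \<in> Basis" for y b
    proof -
      have "(\<lambda>k. (infdist (x + h' k *\<^sub>R b) C - infdist x C) / h' k) \<longlonglongrightarrow> ((x - y) /\<^sub>R infdist x C) \<bullet> b"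
        using * x that by blast
      from LIMSEQ_ignore_initial_segment[OF this, of k0] show ?thesis by (simp only: q_def h_def)
    qed
    have Ey: "E x = (x - y) /\<^sub>R infdist x C" if "y \<in> C" "infdist x C = dist x y" for y
    proof -
      have "E x = (\<Sum>b\<in>Basis. (((x - y) /\<^sub>R infdist x C) \<bullet> b) *\<^sub>R b)"
        unfolding E_def by (intro sum.cong refl arg_cong[where f="\<lambda>r. r *\<^sub>R _"] limI lim that)
      then show ?thesis by (simp only: euclidean_representation)
    qed
    obtain y where y: "y \<in> C" "infdist x C = dist x y" using nearest_point_exists[OF C] .
    have "x \<notin> C" using x K(2) by blast
    then have "infdist x C > 0" using infdist_pos_iff[OF C] by blast
    then have "norm (E x) = 1" unfolding Ey[OF y] using y(2) by (simp add: dist_norm)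
    moreover have "\<forall>b\<in>Basis. (\<lambda>k. q k b x) \<longlonglongrightarrow> E x \<bullet> b" using lim[OF y] unfolding Ey[OF y] by blast
    ultimately show "norm (E x) = 1 \<and> (\<forall>y\<in>C. infdist x C = dist x y \<longrightarrow> E x = (x - y) /\<^sub>R infdist x C) \<and>
       (\<forall>b\<in>Basis. (\<lambda>k. q k b x) \<longlonglongrightarrow> E x \<bullet> b)" using Ey by blast
  qed
  moreover have "h \<longlonglongrightarrow> 0" using LIMSEQ_ignore_initial_segment[OF h'(2), of k0] by (simp only: h_def[abs_def])
  moreover have "0 < h k" "h k < \<delta>" for k using h'(1) k0 by (auto simp: h_def)
  ultimately show ?thesis using that[of h E] Em unfolding q_def by blast
qed

section \<open>Test functions, difference quotients and weights\<close>

lemma Cc_infinityD: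
  assumes "u \<in> Cc_infinity \<Omega>"
  shows "C_diff k u" "compact (closure {x. u x \<noteq> 0})" "closure {x. u x \<noteq> 0} \<subseteq> \<Omega>"
    "x \<notin> closure {x. u x \<noteq> 0} \<Longrightarrow> u x = 0"
    "x \<notin> closure {x. u x \<noteq> 0} \<Longrightarrow> gradient u x = 0"
proof -
  show "C_diff k u" "compact (closure {x. u x \<noteq> 0})" "closure {x. u x \<noteq> 0} \<subseteq> \<Omega>"
    using assms by (auto simp: Cc_infinity_def)
  show z: "x \<notin> closure {x. u x \<noteq> 0} \<Longrightarrow> u x = 0" for x
    using closure_subset[of "{x. u x \<noteq> 0}"] by blast
  assume x: "x \<notin> closure {x. u x \<noteq> 0}"
  show "gradient u x = 0"
  proof (rule gradient_unique)
    show "(u has_derivative (\<lambda>h. h \<bullet> 0)) (at x)"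
    proof (rule has_derivative_transform_within_open[OF _ open_Compl[OF closed_closure]])
      show "((\<lambda>x. 0) has_derivative (\<lambda>h. h \<bullet> 0)) (at x)" by simp
      show "x \<in> - closure {x. u x \<noteq> 0}" using x by blast
      show "0 = u x'" if "x' \<in> - closure {x. u x \<noteq> 0}" for x'
        using z[of x'] that by (metis ComplD)
    qed
  qed
qed

lemma C1_compact_support_lipschitz:
  fixes u :: "'a::euclidean_space \<Rightarrow> real"
  assumes u: "C_diff (Suc 0) u" and K: "compact K" "\<And>x. x \<notin> K \<Longrightarrow> gradient u x = 0"
  obtains L where "L \<ge> 0" "\<And>x y. \<bar>u x - u y\<bar> \<le> L * dist x y" "\<And>x. norm (gradient u x) \<le> L"
proof -
  have "compact ((\<lambda>x. norm (gradient u x)) ` K)"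
    by (intro compact_continuous_image continuous_intros continuous_on_gradient[OF u] K)
  then have "bounded ((\<lambda>x. norm (gradient u x)) ` K)" by (rule compact_imp_bounded)
  then obtain L where L: "L > 0" "\<And>x. x \<in> K \<Longrightarrow> norm (gradient u x) \<le> L"
    unfolding bounded_pos by fastforce
  have le: "norm (gradient u x) \<le> L" for x using L K(2)[of x] by (cases "x \<in> K") auto
  have "norm (u x - u y) \<le> L * norm (x - y)" for x y
  proof (rule differentiable_bound[where S=UNIV and f'="\<lambda>x h. gradient u x \<bullet> h"])
    show "(u has_derivative (\<lambda>h. gradient u x \<bullet> h)) (at x within UNIV)" for x
      using has_derivative_gradient[OF u] by simp
    show "onorm (\<lambda>h. gradient u x \<bullet> h) \<le> L" for x
    proof (rule onorm_bound)
      fix h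
      have "\<bar>gradient u x \<bullet> h\<bar> \<le> norm (gradient u x) * norm h" by (rule Cauchy_Schwarz_ineq2)
      also have "\<dots> \<le> L * norm h" using le by (rule mult_right_mono) simp
      finally show "norm (gradient u x \<bullet> h) \<le> L * norm h" by simp
    qed (use L in simp)
  qed auto
  then show ?thesis using that[of L] L(1) le by (simp add: dist_norm)
qed

lemma powr_lipschitz:
  fixes \<delta> s :: real
  assumes "\<delta> > 0" "s \<ge> 1" "x \<ge> \<delta>" "y \<ge> \<delta>"
  shows "\<bar>x powr (1 - s) - y powr (1 - s)\<bar> \<le> (s - 1) * \<delta> powr (- s) * \<bar>x - y\<bar>"
proof -
  have "norm (x powr (1 - s) - y powr (1 - s)) \<le> ((s - 1) * \<delta> powr (- s)) * norm (x - y)"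
  proof (rule field_differentiable_bound[where S="{\<delta>..}" and f'="\<lambda>t. (1 - s) * t powr (- s)"])
    fix z assume "z \<in> {\<delta>..}"
    then have z: "z \<ge> \<delta>" "z > 0" using assms(1) by auto
    have "((\<lambda>t. t powr (1 - s)) has_real_derivative (1 - s) * z powr (1 - s - 1)) (at z)"
      by (rule has_real_derivative_powr[OF z(2)])
    moreover have "1 - s - 1 = - s" by simp
    ultimately have "((\<lambda>t. t powr (1 - s)) has_real_derivative (1 - s) * z powr (- s)) (at z)" by (simp only:)
    then show "((\<lambda>t. t powr (1 - s)) has_field_derivative (1 - s) * z powr (- s)) (at z within {\<delta>..})"
      by (rule has_field_derivative_at_within)
    have "z powr (- s) \<le> \<delta> powr (- s)" by (rule powr_mono2') (use z assms in auto)
    then have "(s - 1) * z powr (- s) \<le> (s - 1) * \<delta> powr (- s)"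
      by (rule mult_left_mono) (use assms(2) in simp)
    then show "norm ((1 - s) * z powr (- s)) \<le> (s - 1) * \<delta> powr (- s)"
      using assms(2) by (simp add: abs_mult)
  qed (use assms in auto)
  then show ?thesis by (simp only: real_norm_def)
qed

text \<open>The factorisation \<open>W z - W t = g z * (z - t)\<close> avoids dividing by
  \<open>t' k - t\<close>, which may vanish for infinitely many \<open>k\<close>.\<close>

lemma sequential_chain:
  fixes W :: "real \<Rightarrow> real"
  assumes W: "(W has_real_derivative D) (at t)" and t: "t' \<longlonglongrightarrow> t"
    and e: "(\<lambda>k. (t' k - t) / h k) \<longlonglongrightarrow> e"
  shows "(\<lambda>k. (W (t' k) - W t) / h k) \<longlonglongrightarrow> D * e"
proof -
  obtain g where g: "\<And>z. W z - W t = g z * (z - t)" "isCont g t" "g t = D"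
    using W unfolding CARAT_DERIV by blast
  have "(\<lambda>k. g (t' k) * ((t' k - t) / h k)) \<longlonglongrightarrow> g t * e"
    by (intro tendsto_mult isCont_tendsto_compose[OF g(2) t] e)
  then show ?thesis by (simp add: g(1,3))
qed

lemma gradient_difference_quotient:
  fixes u :: "'a::euclidean_space \<Rightarrow> real"
  assumes u: "C_diff (Suc 0) u" and h: "h \<longlonglongrightarrow> 0" "\<And>k. h k \<noteq> (0::real)"
  shows "(\<lambda>k. (u (x + h k *\<^sub>R b) - u x) / h k) \<longlonglongrightarrow> gradient u x \<bullet> b"
proof -
  have "((\<lambda>t. u (x + t *\<^sub>R b)) has_derivative (\<lambda>r. gradient u (x + 0 *\<^sub>R b) \<bullet> (r *\<^sub>R b))) (at 0)"
    by (rule has_derivative_compose[OF _ has_derivative_gradient[OF u]]) (auto intro!: derivative_eq_intros)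
  then have "((\<lambda>t. u (x + t *\<^sub>R b)) has_real_derivative gradient u x \<bullet> b) (at 0)"
    by (simp add: has_field_derivative_def mult_commute_abs)
  moreover have "(\<lambda>k. (h k - 0) / h k) \<longlonglongrightarrow> 1" using h(2) by simp
  ultimately have "(\<lambda>k. (u (x + h k *\<^sub>R b) - u (x + 0 *\<^sub>R b)) / h k) \<longlonglongrightarrow> gradient u x \<bullet> b * 1"
    by (rule sequential_chain[OF _ h(1)])
  then show ?thesis by simp
qed

lemma sum_abs_inner_le_norm:
  fixes x y :: "'a::euclidean_space"
  shows "(\<Sum>b\<in>Basis. \<bar>x \<bullet> b\<bar> * \<bar>y \<bullet> b\<bar>) \<le> norm x * norm y"
proof -
  have "L2_set (\<lambda>b. z \<bullet> b) Basis = norm z" for z :: 'a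
    by (simp add: L2_set_def norm_eq_sqrt_inner euclidean_inner[of z z] power2_eq_square)
  then show ?thesis using L2_set_mult_ineq[of "\<lambda>b. x \<bullet> b" "\<lambda>b. y \<bullet> b" Basis] by simp
qed

text \<open>On the support of the test functions this is the power of the distance. Clamping at
  \<open>\<delta>\<close> makes the weight continuous on the whole space, including points where the
  distance is 0.\<close>

definition clamped_powr :: "'a::euclidean_space set \<Rightarrow> real \<Rightarrow> real \<Rightarrow> 'a \<Rightarrow> real" where
  "clamped_powr \<Omega> \<delta> p x = (max \<delta> (bdist \<Omega> x)) powr p"

lemma weighted_L1_clamped:
  assumes "\<And>x. u x \<noteq> 0 \<Longrightarrow> x \<in> \<Omega> \<and> bdist \<Omega> x \<ge> \<delta>"
  shows "weighted_L1 \<Omega> p u = (\<integral>x. \<bar>u x\<bar> * clamped_powr \<Omega> \<delta> (- p) x \<partial>lborel)"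
  unfolding weighted_L1_def set_lebesgue_integral_def
proof (rule Bochner_Integration.integral_cong[OF refl])
  fix x
  show "indicat_real \<Omega> x *\<^sub>R (\<bar>u x\<bar> / bdist \<Omega> x powr p) = \<bar>u x\<bar> * clamped_powr \<Omega> \<delta> (- p) x"
    using assms[of x] by (cases "u x = 0") (auto simp: clamped_powr_def powr_minus_divide max_def)
qed

lemma weighted_grad_L1_clamped:
  assumes "\<And>x. gradient u x \<noteq> 0 \<Longrightarrow> x \<in> \<Omega> \<and> bdist \<Omega> x \<ge> \<delta>"
  shows "weighted_grad_L1 \<Omega> p u = (\<integral>x. norm (gradient u x) * clamped_powr \<Omega> \<delta> (- p) x \<partial>lborel)"
  unfolding weighted_grad_L1_def set_lebesgue_integral_def
proof (rule Bochner_Integration.integral_cong[OF refl])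
  fix x
  show "indicat_real \<Omega> x *\<^sub>R (norm (gradient u x) / bdist \<Omega> x powr p) = norm (gradient u x) * clamped_powr \<Omega> \<delta> (- p) x"
    using assms[of x] by (cases "gradient u x = 0") (auto simp: clamped_powr_def powr_minus_divide max_def)
qed

lemma continuous_on_clamped_powr:
  assumes "\<delta> > 0" shows "continuous_on S (clamped_powr \<Omega> \<delta> p)"
  unfolding clamped_powr_def[abs_def] using assms by (intro continuous_intros) auto

text \<open>The inequality is obtained from finite differences: summation by parts turns the pointwise
  bound on the discrete Laplacian of \<open>d\<close> into a bound on \<open>\<integral>\<nabla>d \<bullet> \<nabla>(|u| d\<^sup>1\<^sup>-\<^sup>s)\<close>, and the
  latter is evaluated by dominated convergence.\<close>

lemma weak_hardy:
  fixes \<Omega> :: "'a::euclidean_space set"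
  assumes \<Omega>: "open \<Omega>" "\<Omega> \<noteq> UNIV" and u: "u \<in> Cc_infinity \<Omega>" and s: "s \<ge> 1"
    and lap: "\<And>x \<eta>. x \<in> \<Omega> \<Longrightarrow> \<eta> > 0 \<Longrightarrow> \<exists>\<rho>>0. \<forall>h. 0 < h \<and> h < \<rho> \<longrightarrow>
      (\<Sum>b\<in>Basis. bdist \<Omega> (x + h *\<^sub>R b) + bdist \<Omega> (x - h *\<^sub>R b) - 2 * bdist \<Omega> x) / h\<^sup>2 \<le> - B + \<eta>"
  shows "weighted_grad_L1 \<Omega> (s - 1) u \<ge> (s - 1) * weighted_L1 \<Omega> s u + B * weighted_L1 \<Omega> (s - 1) u"
proof (cases "closure {x. u x \<noteq> 0} = {}")
  case True
  then have "u x = 0" "gradient u x = 0" for x using Cc_infinityD(4,5)[OF u, of x] by auto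
  then show ?thesis by (simp add: weighted_L1_def weighted_grad_L1_def)
next
  case False
  define K0 where "K0 = closure {x. u x \<noteq> 0}"
  have K0: "compact K0" "K0 \<subseteq> \<Omega>" "K0 \<noteq> {}" using Cc_infinityD(2,3)[OF u] False by (auto simp: K0_def)
  have u0: "u x = 0" "gradient u x = 0" if "x \<notin> K0" for x
    using Cc_infinityD(4,5)[OF u, of x] that by (auto simp: K0_def)
  have C: "closed (- \<Omega>)" "- \<Omega> \<noteq> {}" using \<Omega> by auto
  let ?d = "bdist \<Omega>"
  have "K0 \<inter> - \<Omega> = {}" using K0(2) by blast
  then obtain \<delta> where \<delta>: "\<delta> > 0" "\<And>x. x \<in> K0 \<Longrightarrow> ?d x \<ge> 2 * \<delta>"
    using compact_positive_distance[OF K0(1) C] by metis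
  \<comment> \<open>The \<open>\<delta>\<close>-neighbourhood of the support: shifts by less than
    \<open>\<delta>\<close> starting outside \<open>K\<close> do not reach the support, while on
    \<open>K\<close> the distance is still at least \<open>\<delta>\<close>.\<close>
  define K where "K = {x. infdist x K0 \<le> \<delta>}"
  have K: "compact K" unfolding K_def by (rule compact_infdist_le[OF K0(3,1) \<delta>(1)])
  have dK: "?d x \<ge> \<delta>" if "x \<in> K" for x
  proof -
    obtain z where z: "z \<in> K0" "infdist x K0 = dist x z"
      using nearest_point_exists[OF compact_imp_closed[OF K0(1)] K0(3)] .
    have "\<bar>?d x - ?d z\<bar> \<le> dist x z" by (rule infdist_triangle_abs)
    then show ?thesis using \<delta>(2)[OF z(1)] z(2) that by (auto simp: K_def)
  qed
  have K\<Omega>: "K \<inter> - \<Omega> = {}"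
  proof -
    have "x \<in> \<Omega>" if "x \<in> K" for x
      using dK[OF that] \<delta>(1) infdist_pos_iff[OF C, of x] by auto
    then show ?thesis by blast
  qed
  have K0K: "K0 \<subseteq> K" using \<delta>(1) by (auto simp: K_def)
  have gK: "gradient u x = 0" if "x \<notin> K" for x using u0(2)[of x] K0K that by blast
  obtain h :: "nat \<Rightarrow> real" and E :: "'a \<Rightarrow> 'a" where h: "\<And>k. 0 < h k" "\<And>k. h k < \<delta>" "h \<longlonglongrightarrow> 0"
    and Em: "E \<in> borel_measurable lborel" and E:
    "AE x in lborel. x \<in> K \<longrightarrow> norm (E x) = 1 \<and> (\<forall>y\<in>- \<Omega>. ?d x = dist x y \<longrightarrow> E x = (x - y) /\<^sub>R ?d x) \<and>
       (\<forall>b\<in>Basis. (\<lambda>k. (?d (x + h k *\<^sub>R b) - ?d x) / h k) \<longlonglongrightarrow> E x \<bullet> b)"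
    by (rule infdist_gradient_field[OF C K K\<Omega> \<delta>(1)], rule that)
  have uC: "C_diff (Suc 0) u" using Cc_infinityD(1)[OF u] .
  obtain L where L: "L \<ge> 0" "\<And>x y. \<bar>u x - u y\<bar> \<le> L * dist x y" "\<And>x. norm (gradient u x) \<le> L"
    by (rule C1_compact_support_lipschitz[OF uC K0(1) u0(2)], assumption, rule that)
  have uc: "continuous_on A u" for A using uC by (rule C_diff_continuous_on)
  define v where "v x = \<bar>u x\<bar>" for x
  define w where "w = clamped_powr \<Omega> \<delta> (1 - s)"
  define \<phi> where "\<phi> x = v x * w x" for x
  have vc: "continuous_on A v" for A unfolding v_def[abs_def] by (intro continuous_intros uc)
  have wc: "continuous_on A w" for A unfolding w_def by (rule continuous_on_clamped_powr[OF \<delta>(1)])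
  have \<phi>c: "continuous_on A \<phi>" for A unfolding \<phi>_def[abs_def] by (intro continuous_intros vc wc)
  have dc: "continuous_on A ?d" for A by (intro continuous_intros)
  have v0: "v x = 0" if "x \<notin> K0" for x using u0(1)[OF that] by (simp add: v_def)
  have \<phi>0: "\<phi> x = 0" if "x \<notin> K0" for x using v0[OF that] by (simp add: \<phi>_def)
  have nn: "v x \<ge> 0" "w x \<ge> 0" "\<phi> x \<ge> 0" for x by (auto simp: v_def w_def \<phi>_def clamped_powr_def)
  have wle: "w x \<le> \<delta> powr (1 - s)" for x
    unfolding w_def clamped_powr_def by (rule powr_mono2') (use s \<delta>(1) in auto)
  define Lw where "Lw = (s - 1) * \<delta> powr (- s)"
  have Lw: "\<bar>w x - w y\<bar> \<le> Lw * dist x y" "Lw \<ge> 0" for x y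
  proof -
    show Lw0: "Lw \<ge> 0" using s by (simp add: Lw_def)
    have "\<bar>w x - w y\<bar> \<le> Lw * \<bar>max \<delta> (?d x) - max \<delta> (?d y)\<bar>"
      unfolding w_def clamped_powr_def Lw_def by (rule powr_lipschitz[OF \<delta>(1) s]) auto
    also have "\<bar>max \<delta> (?d x) - max \<delta> (?d y)\<bar> \<le> \<bar>?d x - ?d y\<bar>" by (auto simp: max_def)
    then have "Lw * \<bar>max \<delta> (?d x) - max \<delta> (?d y)\<bar> \<le> Lw * dist x y"
      using infdist_triangle_abs[of x "- \<Omega>" y] Lw0 by (intro mult_left_mono) linarith+
    finally show "\<bar>w x - w y\<bar> \<le> Lw * dist x y" .
  qed
  have shift_nK: "x \<notin> K0" "x + h k *\<^sub>R b \<notin> K0" if "x \<notin> K" "b \<in> Basis" for x b k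
  proof -
    show "x \<notin> K0" using that(1) K0K by blast
    show "x + h k *\<^sub>R b \<notin> K0"
    proof
      assume "x + h k *\<^sub>R b \<in> K0"
      then have "infdist x K0 \<le> dist x (x + h k *\<^sub>R b)" by (rule infdist_le)
      also have "\<dots> \<le> \<delta>" using that(2) h(1,2)[of k] by (simp add: dist_norm)
      finally show False using that(1) by (simp add: K_def)
    qed
  qed
  define dd where "dd k b x = (?d (x + h k *\<^sub>R b) - ?d x) / h k" for k b x
  define du where "du k b x = (u (x + h k *\<^sub>R b) - u x) / h k" for k b x
  define dv where "dv k b x = (v (x + h k *\<^sub>R b) - v x) / h k" for k b x
  define dw where "dw k b x = (w (x + h k *\<^sub>R b) - w x) / h k" for k b x
  have dist_h: "dist (x + h k *\<^sub>R b) x = h k" if "b \<in> Basis" for x b k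
    using that h(1)[of k] by (simp add: dist_norm)
  have quot: "\<bar>r / h k\<bar> \<le> M" if "\<bar>r\<bar> \<le> M * h k" for r M k
    using that h(1)[of k] by (simp add: pos_divide_le_eq)
  have dd_le: "\<bar>dd k b x\<bar> \<le> 1" and du_le: "\<bar>du k b x\<bar> \<le> L" and dw_le: "\<bar>dw k b x\<bar> \<le> Lw"
    if "b \<in> Basis" for k b x
  proof -
    show "\<bar>dd k b x\<bar> \<le> 1" unfolding dd_def
      by (rule quot) (use infdist_triangle_abs[of "x + h k *\<^sub>R b" "- \<Omega>" x] dist_h[OF that, of x k] in simp)
    show "\<bar>du k b x\<bar> \<le> L" unfolding du_def
      by (rule quot) (use L(2)[of "x + h k *\<^sub>R b" x] dist_h[OF that, of x k] in simp)
    show "\<bar>dw k b x\<bar> \<le> Lw" unfolding dw_def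
      by (rule quot) (use Lw(1)[of "x + h k *\<^sub>R b" x] dist_h[OF that, of x k] in simp)
  qed
  \<comment> \<open>The absolute value of \<open>u\<close> is not differentiated. By the reverse
    triangle inequality its quotients are dominated by those of \<open>u\<close>, which
    converge.\<close>
  have dv_le: "\<bar>dv k b x\<bar> \<le> \<bar>du k b x\<bar>" for k b x
    using h(1)[of k] unfolding dv_def du_def v_def by (auto simp: abs_divide intro!: divide_right_mono)
  have shc: "continuous_on A (\<lambda>x. f (x + c))" if "\<And>A. continuous_on A f" for A c and f :: "'a \<Rightarrow> real"
    by (rule continuous_on_compose2[OF that[of UNIV]]) (auto intro!: continuous_intros)
  have hne: "h k \<noteq> 0" for k using h(1)[of k] by simp
  have dcs: "continuous_on A (dd k b)" "continuous_on A (du k b)" "continuous_on A (dv k b)" "continuous_on A (dw k b)"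
     "continuous_on A (\<lambda>x. w (x + h k *\<^sub>R b))" for A k b
    unfolding dd_def[abs_def] du_def[abs_def] dv_def[abs_def] dw_def[abs_def]
    using hne by (auto intro!: continuous_on_divide continuous_on_diff continuous_on_const shc dc uc vc wc)
  define Q where "Q k x = (\<Sum>b\<in>Basis. ?d (x + h k *\<^sub>R b) + ?d (x - h k *\<^sub>R b) - 2 * ?d x) / (h k)\<^sup>2" for k x
  \<comment> \<open>The first summand dominates the discrete Laplacian \<open>Q\<close> on
    \<open>K\<close>; adding the absolute value of \<open>B\<close> also makes \<open>c + B\<close>
    nonnegative.\<close>
  define c where "c = DIM('a) / \<delta> + \<bar>B\<bar>"
  have Qle: "Q k x \<le> DIM('a) / \<delta>" if "x \<in> K" for k x
  proof -
    have "x \<notin> - \<Omega>" using K\<Omega> that by blast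
    have "(\<Sum>b\<in>Basis. ?d (x + h k *\<^sub>R b) + ?d (x - h k *\<^sub>R b) - 2 * ?d x) \<le> (\<Sum>b\<in>(Basis::'a set). (h k)\<^sup>2 / \<delta>)"
    proof (rule sum_mono)
      fix b :: 'a assume "b \<in> Basis"
      then have "?d (x + h k *\<^sub>R b) + ?d (x - h k *\<^sub>R b) - 2 * ?d x \<le> (h k)\<^sup>2 / ?d x"
        using infdist_second_difference_le[OF C \<open>x \<notin> - \<Omega>\<close>, of "h k *\<^sub>R b"] by simp
      also have "\<dots> \<le> (h k)\<^sup>2 / \<delta>" using dK[OF that] \<delta>(1) by (intro divide_left_mono) auto
      finally show "?d (x + h k *\<^sub>R b) + ?d (x - h k *\<^sub>R b) - 2 * ?d x \<le> (h k)\<^sup>2 / \<delta>" .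
    qed
    then have "(\<Sum>b\<in>Basis. ?d (x + h k *\<^sub>R b) + ?d (x - h k *\<^sub>R b) - 2 * ?d x) \<le> DIM('a) / \<delta> * (h k)\<^sup>2" by simp
    then show ?thesis unfolding Q_def by (subst pos_divide_le_eq) (use h(1)[of k] in auto)
  qed
  have \<phi>i: "integrable lborel \<phi>" by (rule integrable_lborel_compact_support[OF K0(1) \<phi>c \<phi>0])
  define I where "I k x = (\<Sum>b\<in>Basis. dd k b x * ((\<phi> (x + h k *\<^sub>R b) - \<phi> x) / h k))" for k x
  have Q\<phi>: "integrable lborel (\<lambda>x. Q k x * \<phi> x)" "integrable lborel (I k)"
    "(\<integral>x. Q k x * \<phi> x \<partial>lborel) = - (\<integral>x. I k x \<partial>lborel)" for k
  proof -
    note p = summation_by_parts[OF dc \<phi>c K0(1) \<phi>0, where b="h k *\<^sub>R _"]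
    have q: "(\<lambda>x. Q k x * \<phi> x) = (\<lambda>x. (\<Sum>b\<in>Basis. \<phi> x * (?d (x + h k *\<^sub>R b) + ?d (x - h k *\<^sub>R b) - 2 * ?d x)) / (h k)\<^sup>2)"
      by (simp add: Q_def sum_distrib_left mult.commute)
    have i: "I k = (\<lambda>x. (\<Sum>b\<in>Basis. (?d (x + h k *\<^sub>R b) - ?d x) * (\<phi> (x + h k *\<^sub>R b) - \<phi> x)) / (h k)\<^sup>2)"
      by (rule ext) (simp add: I_def dd_def sum_divide_distrib power2_eq_square)
    show "integrable lborel (\<lambda>x. Q k x * \<phi> x)" unfolding q by (intro Bochner_Integration.integrable_divide Bochner_Integration.integrable_sum p(1))
    show "integrable lborel (I k)" unfolding i by (intro Bochner_Integration.integrable_divide Bochner_Integration.integrable_sum p(2))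
    show "(\<integral>x. Q k x * \<phi> x \<partial>lborel) = - (\<integral>x. I k x \<partial>lborel)"
      unfolding q i using p by (simp add: Bochner_Integration.integral_sum sum_negf)
  qed
  \<comment> \<open>The two terms of the discrete product rule for \<open>v x * w x\<close>:
    \<open>A\<close> carries the difference of \<open>u\<close> and is estimated from above,
    \<open>Bk\<close> carries the difference of the weight and keeps its sign.\<close>
  define A where "A k x = (\<Sum>b\<in>Basis. \<bar>dd k b x\<bar> * \<bar>du k b x\<bar> * w (x + h k *\<^sub>R b))" for k x
  define Bk where "Bk k x = v x * (\<Sum>b\<in>Basis. dd k b x * dw k b x)" for k x
  have IAB: "I k x \<le> A k x + Bk k x" for k x
  proof -
    have "I k x = (\<Sum>b\<in>Basis. dd k b x * dv k b x * w (x + h k *\<^sub>R b) + v x * (dd k b x * dw k b x))"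
      unfolding I_def dv_def dw_def \<phi>_def using h(1)[of k] by (intro sum.cong refl) (simp add: field_simps)
    also have "\<dots> \<le> (\<Sum>b\<in>Basis. \<bar>dd k b x\<bar> * \<bar>du k b x\<bar> * w (x + h k *\<^sub>R b) + v x * (dd k b x * dw k b x))"
    proof (intro sum_mono add_mono order_refl mult_right_mono nn)
      fix b :: 'a
      have "dd k b x * dv k b x \<le> \<bar>dd k b x\<bar> * \<bar>dv k b x\<bar>" by (simp flip: abs_mult)
      also have "\<dots> \<le> \<bar>dd k b x\<bar> * \<bar>du k b x\<bar>" using dv_le by (intro mult_left_mono) auto
      finally show "dd k b x * dv k b x \<le> \<bar>dd k b x\<bar> * \<bar>du k b x\<bar>" .
    qed
    finally show ?thesis by (simp add: A_def Bk_def sum.distrib sum_distrib_left)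
  qed
  define Al where "Al x = (\<Sum>b\<in>Basis. \<bar>E x \<bullet> b\<bar> * \<bar>gradient u x \<bullet> b\<bar> * w x)" for x
  \<comment> \<open>In the limit the weight contributes \<open>(1 - s) * d powr (- s)\<close> times
    the squared length of \<open>E\<close>, which is 1. This is the origin of the constant
    \<open>s - 1\<close> in the Hardy term.\<close>
  define Bl where "Bl x = (1 - s) * (v x * clamped_powr \<Omega> \<delta> (- s) x)" for x
  have Akm: "A k \<in> borel_measurable lborel" "Bk k \<in> borel_measurable lborel" for k
  proof -
    have "continuous_on UNIV (A k)" "continuous_on UNIV (Bk k)"
      unfolding A_def[abs_def] Bk_def[abs_def] by (intro continuous_intros dcs vc)+
    then show "A k \<in> borel_measurable lborel" "Bk k \<in> borel_measurable lborel"
      by (simp_all add: borel_measurable_continuous_onI)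
  qed
  have Alm: "Al \<in> borel_measurable lborel"
  proof -
    have [measurable]: "gradient u \<in> borel_measurable borel" "w \<in> borel_measurable borel" "E \<in> borel_measurable borel"
      using continuous_on_gradient[OF uC] wc Em by (auto intro: borel_measurable_continuous_onI)
    show ?thesis unfolding Al_def[abs_def] measurable_lborel2 by measurable
  qed
  have Blc: "continuous_on UNIV Bl"
    unfolding Bl_def[abs_def] by (intro continuous_intros vc continuous_on_clamped_powr \<delta>(1))
  have Bl0: "Bl x = 0" if "x \<notin> K0" for x using v0[OF that] by (simp add: Bl_def)
  have Bli: "integrable lborel Bl"
    by (rule integrable_lborel_compact_support[OF K0(1) _ Bl0]) (use Blc continuous_on_subset in blast)
  have indK: "integrable lborel (indicator K :: _ \<Rightarrow> real)" by (rule integrable_indicator_compact[OF K])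
  have A0: "A k x = 0" "Bk k x = 0" if "x \<notin> K" for k x
  proof -
    have "x \<notin> K0" using that K0K by blast
    then show "A k x = 0" "Bk k x = 0"
      using shift_nK(2)[OF that] u0(1) v0 by (auto simp: A_def Bk_def du_def)
  qed
  have limA: "(\<lambda>k. integral\<^sup>L lborel (A k)) \<longlonglongrightarrow> integral\<^sup>L lborel Al"
  proof (rule integral_dominated_convergence[where w="\<lambda>x. DIM('a) * (1 * L * \<delta> powr (1 - s)) * indicator K x"])
    show "integrable lborel (\<lambda>x. real DIM('a) * (1 * L * \<delta> powr (1 - s)) * indicator K x)" using indK by simp
    show "AE x in lborel. (\<lambda>k. A k x) \<longlonglongrightarrow> Al x"
      using E
    proof eventually_elim
      fix x assume E: "x \<in> K \<longrightarrow> norm (E x) = 1 \<and> (\<forall>y\<in>- \<Omega>. ?d x = dist x y \<longrightarrow> E x = (x - y) /\<^sub>R ?d x) \<and>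
       (\<forall>b\<in>Basis. (\<lambda>k. (?d (x + h k *\<^sub>R b) - ?d x) / h k) \<longlonglongrightarrow> E x \<bullet> b)"
      show "(\<lambda>k. A k x) \<longlonglongrightarrow> Al x"
      proof (cases "x \<in> K")
        case True
        have wl: "(\<lambda>k. w (x + h k *\<^sub>R b)) \<longlonglongrightarrow> w x" for b
        proof -
          have "(\<lambda>k. x + h k *\<^sub>R b) \<longlonglongrightarrow> x + 0 *\<^sub>R b" by (intro tendsto_intros h(3))
          moreover have "isCont w x" using wc[of UNIV] by (simp add: continuous_on_eq_continuous_at)
          ultimately show ?thesis using isCont_tendsto_compose[of x w] by simp
        qed
        show ?thesis unfolding A_def Al_def dd_def du_def
          using E True by (intro tendsto_sum tendsto_mult tendsto_rabs wl gradient_difference_quotient[OF uC h(3) hne]) auto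
      next
        case False
        then have "Al x = 0" using gK by (simp add: Al_def)
        then show ?thesis using A0(1)[OF False] by simp
      qed
    qed
    show "AE x in lborel. norm (A k x) \<le> real DIM('a) * (1 * L * \<delta> powr (1 - s)) * indicator K x" for k
    proof (rule AE_I2)
      fix x
      show "norm (A k x) \<le> real DIM('a) * (1 * L * \<delta> powr (1 - s)) * indicator K x"
      proof (cases "x \<in> K")
        case True
        have "norm (A k x) \<le> (\<Sum>b\<in>Basis. norm (\<bar>dd k b x\<bar> * \<bar>du k b x\<bar> * w (x + h k *\<^sub>R b)))"
          unfolding A_def by (rule norm_sum)
        also have "\<dots> \<le> (\<Sum>b\<in>(Basis::'a set). 1 * L * \<delta> powr (1 - s))"
        proof (rule sum_mono)
          fix b :: 'a assume b: "b \<in> Basis"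
          have "\<bar>dd k b x\<bar> * \<bar>du k b x\<bar> * w (x + h k *\<^sub>R b) \<le> 1 * L * \<delta> powr (1 - s)"
            using dd_le[OF b] du_le[OF b] wle nn(2) L(1) by (intro mult_mono) auto
          then show "norm (\<bar>dd k b x\<bar> * \<bar>du k b x\<bar> * w (x + h k *\<^sub>R b)) \<le> 1 * L * \<delta> powr (1 - s)"
            using nn(2) by (simp add: abs_mult)
        qed
        finally show ?thesis using True by simp
      qed (simp add: A0)
    qed
  qed (use Alm Akm in auto)
  obtain V where V: "V \<ge> 0" "\<And>x. v x \<le> V"
  proof -
    have "compact (v ` K0)" by (intro compact_continuous_image vc K0)
    then have "bounded (v ` K0)" by (rule compact_imp_bounded)
    then obtain V where "V > 0" and V: "\<And>x. x \<in> K0 \<Longrightarrow> norm (v x) \<le> V" unfolding bounded_pos by fastforce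
    have "v x \<le> V" for x
    proof (cases "x \<in> K0")
      case True
      then show ?thesis using V[OF True] by simp
    next
      case False
      then show ?thesis using v0[OF False] \<open>V > 0\<close> by simp
    qed
    then show ?thesis using that[of V] \<open>V > 0\<close> by simp
  qed
  have limB: "(\<lambda>k. integral\<^sup>L lborel (Bk k)) \<longlonglongrightarrow> integral\<^sup>L lborel Bl"
  proof (rule integral_dominated_convergence[where w="\<lambda>x. V * (DIM('a) * (1 * Lw)) * indicator K x"])
    show "integrable lborel (\<lambda>x. V * (DIM('a) * (1 * Lw)) * indicator K x)" using indK by simp
    show "AE x in lborel. (\<lambda>k. Bk k x) \<longlonglongrightarrow> Bl x"
      using E
    proof eventually_elim
      fix x assume E: "x \<in> K \<longrightarrow> norm (E x) = 1 \<and> (\<forall>y\<in>- \<Omega>. ?d x = dist x y \<longrightarrow> E x = (x - y) /\<^sub>R ?d x) \<and>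
       (\<forall>b\<in>Basis. (\<lambda>k. (?d (x + h k *\<^sub>R b) - ?d x) / h k) \<longlonglongrightarrow> E x \<bullet> b)"
      show "(\<lambda>k. Bk k x) \<longlonglongrightarrow> Bl x"
      proof (cases "x \<in> K0")
        case True
        then have xK: "x \<in> K" using K0K by blast
        have dx: "?d x \<ge> 2 * \<delta>" by (rule \<delta>(2)[OF True])
        have ddl: "(\<lambda>k. dd k b x) \<longlonglongrightarrow> E x \<bullet> b" if "b \<in> Basis" for b
          using E xK that unfolding dd_def by blast
        have dwl: "(\<lambda>k. dw k b x) \<longlonglongrightarrow> ((1 - s) * ?d x powr (- s)) * (E x \<bullet> b)" if b: "b \<in> Basis" for b
        proof -
          have "(\<lambda>k. ((?d (x + h k *\<^sub>R b)) powr (1 - s) - (?d x) powr (1 - s)) / h k) \<longlonglongrightarrow>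
              ((1 - s) * ?d x powr (1 - s - 1)) * (E x \<bullet> b)"
          proof (rule sequential_chain[where W="\<lambda>t. t powr (1 - s)"])
            show "((\<lambda>t. t powr (1 - s)) has_real_derivative (1 - s) * ?d x powr (1 - s - 1)) (at (?d x))"
              by (rule has_real_derivative_powr) (use dx \<delta>(1) in linarith)
            have "(\<lambda>k. x + h k *\<^sub>R b) \<longlonglongrightarrow> x + 0 *\<^sub>R b" by (intro tendsto_intros h(3))
            then show "(\<lambda>k. ?d (x + h k *\<^sub>R b)) \<longlonglongrightarrow> ?d x"
              using tendsto_infdist[of "\<lambda>k. x + h k *\<^sub>R b" x] by simp
            show "(\<lambda>k. (?d (x + h k *\<^sub>R b) - ?d x) / h k) \<longlonglongrightarrow> E x \<bullet> b"
              using E xK b by blast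
          qed
          moreover have "((?d (x + h k *\<^sub>R b)) powr (1 - s) - (?d x) powr (1 - s)) / h k = dw k b x" for k
          proof -
            have "\<bar>?d (x + h k *\<^sub>R b) - ?d x\<bar> \<le> h k"
              using infdist_triangle_abs[of "x + h k *\<^sub>R b" "- \<Omega>" x] dist_h[OF b, of x k] by simp
            then have "?d (x + h k *\<^sub>R b) \<ge> \<delta>" using dx h(2)[of k] by linarith
            then show ?thesis using dx \<delta>(1) by (simp add: dw_def w_def clamped_powr_def max_def)
          qed
          ultimately show ?thesis by simp
        qed
        have "(\<lambda>k. Bk k x) \<longlonglongrightarrow> v x * (\<Sum>b\<in>Basis. (E x \<bullet> b) * (((1 - s) * ?d x powr (- s)) * (E x \<bullet> b)))"
          unfolding Bk_def by (intro tendsto_intros ddl dwl)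
        also have "(\<Sum>b\<in>Basis. (E x \<bullet> b) * (((1 - s) * ?d x powr (- s)) * (E x \<bullet> b))) =
            ((1 - s) * ?d x powr (- s)) * (E x \<bullet> E x)"
          by (simp add: euclidean_inner[of "E x" "E x"] sum_distrib_left mult_ac)
        also have "E x \<bullet> E x = 1" using E xK by (simp add: dot_square_norm)
        finally show ?thesis using dx \<delta>(1) by (simp add: Bl_def clamped_powr_def max_def mult_ac)
      next
        case False
        then show ?thesis using v0[OF False] by (simp add: Bk_def Bl_def)
      qed
    qed
    show "AE x in lborel. norm (Bk k x) \<le> V * (DIM('a) * (1 * Lw)) * indicator K x" for k
    proof (rule AE_I2)
      fix x
      show "norm (Bk k x) \<le> V * (DIM('a) * (1 * Lw)) * indicator K x"
      proof (cases "x \<in> K")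
        case True
        have "norm (\<Sum>b\<in>Basis. dd k b x * dw k b x) \<le> (\<Sum>b\<in>Basis. norm (dd k b x * dw k b x))" by (rule norm_sum)
        also have "\<dots> \<le> (\<Sum>b\<in>(Basis::'a set). 1 * Lw)"
        proof (rule sum_mono)
          fix b :: 'a assume b: "b \<in> Basis"
          show "norm (dd k b x * dw k b x) \<le> 1 * Lw"
            unfolding real_norm_def abs_mult using dd_le[OF b] dw_le[OF b] by (intro mult_mono) auto
        qed
        finally have "norm (\<Sum>b\<in>Basis. dd k b x * dw k b x) \<le> DIM('a) * (1 * Lw)" by simp
        then have "norm (Bk k x) \<le> V * (DIM('a) * (1 * Lw))"
          unfolding Bk_def norm_mult using V nn(1)[of x] by (intro mult_mono) auto
        then show ?thesis using True by simp
      qed (simp add: A0)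
    qed
  qed (use Akm Blc in \<open>auto intro: borel_measurable_continuous_onI\<close>)
  \<comment> \<open>Cauchy-Schwarz over the coordinates with \<open>norm (E x) = 1\<close> recovers
    the full Euclidean norm of the gradient.\<close>
  have Alint: "integral\<^sup>L lborel Al \<le> (\<integral>x. norm (gradient u x) * w x \<partial>lborel)"
  proof (rule integral_mono_AE)
    have gi: "integrable lborel (\<lambda>x. norm (gradient u x) * w x)"
      by (rule integrable_lborel_compact_support[OF K0(1)])
        (auto intro!: continuous_intros continuous_on_gradient[OF uC] wc simp: u0)
    show "integrable lborel (\<lambda>x. norm (gradient u x) * w x)" by (rule gi)
    have le: "AE x in lborel. 0 \<le> Al x \<and> Al x \<le> norm (gradient u x) * w x"
      using E
    proof eventually_elim
      fix x assume E: "x \<in> K \<longrightarrow> norm (E x) = 1 \<and> (\<forall>y\<in>- \<Omega>. ?d x = dist x y \<longrightarrow> E x = (x - y) /\<^sub>R ?d x) \<and>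
       (\<forall>b\<in>Basis. (\<lambda>k. (?d (x + h k *\<^sub>R b) - ?d x) / h k) \<longlonglongrightarrow> E x \<bullet> b)"
      have A: "Al x = (\<Sum>b\<in>Basis. \<bar>E x \<bullet> b\<bar> * \<bar>gradient u x \<bullet> b\<bar>) * w x"
        by (simp add: Al_def sum_distrib_right)
      have "0 \<le> Al x" unfolding A using nn(2) by (intro mult_nonneg_nonneg sum_nonneg) auto
      moreover have "Al x \<le> norm (gradient u x) * w x"
      proof (cases "x \<in> K")
        case True
        then have "(\<Sum>b\<in>Basis. \<bar>E x \<bullet> b\<bar> * \<bar>gradient u x \<bullet> b\<bar>) \<le> norm (gradient u x)"
          using E sum_abs_inner_le_norm[of "E x" "gradient u x"] by simp
        then show ?thesis unfolding A using nn(2) by (intro mult_right_mono) auto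
      next
        case False
        then show ?thesis using gK by (simp add: Al_def)
      qed
      ultimately show "0 \<le> Al x \<and> Al x \<le> norm (gradient u x) * w x" by blast
    qed
    then show "AE x in lborel. Al x \<le> norm (gradient u x) * w x" by eventually_elim simp
    show "integrable lborel Al"
      by (rule Bochner_Integration.integrable_bound[OF gi Alm]) (use le in \<open>eventually_elim, auto\<close>)
  qed
  define f where "f k x = (c - Q k x) * \<phi> x" for k x
  \<comment> \<open>\<open>Q\<close> is bounded only from above, so \<open>(c - Q) \<phi>\<close> is
    nonnegative but lacks a dominating function. Truncating at the expected lower limit
    \<open>(c + B) \<phi>\<close> supplies one and loses nothing in the inequality.\<close>
  define m where "m k x = min (f k x) ((c + B) * \<phi> x)" for k x
  have cB: "c + B \<ge> 0"
  proof -
    have "real DIM('a) / \<delta> \<ge> 0" using \<delta>(1) by simp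
    then show ?thesis unfolding c_def by linarith
  qed
  have fnn: "f k x \<ge> 0" for k x
  proof (cases "x \<in> K0")
    case True
    then have "Q k x \<le> c" using Qle[of x k] K0K by (auto simp: c_def)
    then show ?thesis using nn(3) by (simp add: f_def)
  qed (simp add: f_def \<phi>0)
  have fi: "integrable lborel (f k)" for k
    unfolding f_def[abs_def] left_diff_distrib using \<phi>i Q\<phi>(1) by simp
  have fint: "integral\<^sup>L lborel (f k) = c * integral\<^sup>L lborel \<phi> + integral\<^sup>L lborel (I k)" for k
    unfolding f_def[abs_def] left_diff_distrib using \<phi>i Q\<phi>[of k] by simp
  have limm: "(\<lambda>k. integral\<^sup>L lborel (m k)) \<longlonglongrightarrow> (\<integral>x. (c + B) * \<phi> x \<partial>lborel)"
  proof (rule integral_dominated_convergence[where w="\<lambda>x. (c + B) * \<phi> x"])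
    show "m k \<in> borel_measurable lborel" for k
      unfolding m_def[abs_def] using borel_measurable_integrable[OF fi] borel_measurable_integrable[OF \<phi>i]
      by (intro borel_measurable_min borel_measurable_times) auto
    show "AE x in lborel. norm (m k x) \<le> (c + B) * \<phi> x" for k
      using fnn cB nn(3) by (intro AE_I2) (auto simp: m_def)
    show "AE x in lborel. (\<lambda>k. m k x) \<longlonglongrightarrow> (c + B) * \<phi> x"
    proof (rule AE_I2)
      fix x
      show "(\<lambda>k. m k x) \<longlonglongrightarrow> (c + B) * \<phi> x"
      proof (cases "\<phi> x = 0")
        case False
        then have xK0: "x \<in> K0" using \<phi>0 by blast
        then have x\<Omega>: "x \<in> \<Omega>" using K0(2) by blast
        have \<phi>p: "\<phi> x > 0" using False nn(3)[of x] by simp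
        show ?thesis
        proof (rule LIMSEQ_I)
          fix e :: real assume e: "e > 0"
          define \<eta> where "\<eta> = e / (2 * \<phi> x)"
          have \<eta>: "\<eta> > 0" "\<eta> * \<phi> x < e" using e \<phi>p by (auto simp: \<eta>_def)
          obtain \<rho> where \<rho>: "\<rho> > 0" "\<And>h. 0 < h \<Longrightarrow> h < \<rho> \<Longrightarrow> (\<Sum>b\<in>Basis. ?d (x + h *\<^sub>R b) + ?d (x - h *\<^sub>R b) - 2 * ?d x) / h\<^sup>2 \<le> - B + \<eta>"
            using lap[OF x\<Omega> \<eta>(1)] by blast
          obtain n0 where n0: "\<And>n. n \<ge> n0 \<Longrightarrow> h n < \<rho>"
            using order_tendstoD(2)[OF h(3) \<rho>(1)] unfolding eventually_sequentially by blast
          show "\<exists>n0. \<forall>n\<ge>n0. norm (m n x - (c + B) * \<phi> x) < e"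
          proof (intro exI allI impI)
            fix n assume "n \<ge> n0"
            then have "Q n x \<le> - B + \<eta>" unfolding Q_def using \<rho>(2) h(1) n0 by blast
            then have "(c + B - \<eta>) * \<phi> x \<le> (c - Q n x) * \<phi> x" using \<phi>p by (intro mult_right_mono) auto
            then have "f n x \<ge> (c + B) * \<phi> x - \<eta> * \<phi> x" by (simp add: f_def left_diff_distrib)
            moreover have "\<bar>min p q - q\<bar> < e" if "p \<ge> q - r" "r < e" for p q r :: real
              using that e by (cases "p \<le> q") (auto simp: min_def)
            ultimately show "norm (m n x - (c + B) * \<phi> x) < e"
              using \<eta>(2) unfolding m_def real_norm_def by blast
          qed
        qed
      qed (simp add: m_def f_def)
    qed
  qed (use \<phi>i in auto)
  have mi: "integrable lborel (m k)" for k
    unfolding m_def[abs_def] using fi \<phi>i by (intro integrable_min) auto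
  have Ai: "integrable lborel (A k)" "integrable lborel (Bk k)" for k
  proof -
    have "continuous_on K (A k)" "continuous_on K (Bk k)"
      unfolding A_def[abs_def] Bk_def[abs_def] by (intro continuous_intros dcs vc)+
    then show "integrable lborel (A k)" "integrable lborel (Bk k)"
      using A0 by (auto intro: integrable_lborel_compact_support[OF K])
  qed
  have mle: "integral\<^sup>L lborel (m k) \<le> c * integral\<^sup>L lborel \<phi> + (integral\<^sup>L lborel (A k) + integral\<^sup>L lborel (Bk k))" for k
  proof -
    have "integral\<^sup>L lborel (m k) \<le> integral\<^sup>L lborel (f k)"
      by (rule integral_mono[OF mi fi]) (simp add: m_def)
    moreover have "integral\<^sup>L lborel (I k) \<le> (\<integral>x. A k x + Bk k x \<partial>lborel)"
      by (rule integral_mono[OF Q\<phi>(2)]) (use Ai IAB in auto)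
    ultimately show ?thesis using Ai[of k] fint[of k] by simp
  qed
  have *: "(\<integral>x. (c + B) * \<phi> x \<partial>lborel) \<le> c * integral\<^sup>L lborel \<phi> + (integral\<^sup>L lborel Al + integral\<^sup>L lborel Bl)"
    by (rule LIMSEQ_le[OF limm tendsto_add[OF tendsto_const tendsto_add[OF limA limB]]]) (use mle in blast)
  have main: "B * integral\<^sup>L lborel \<phi> \<le> (\<integral>x. norm (gradient u x) * w x \<partial>lborel) + integral\<^sup>L lborel Bl"
  proof -
    have "(\<integral>x. (c + B) * \<phi> x \<partial>lborel) = c * integral\<^sup>L lborel \<phi> + B * integral\<^sup>L lborel \<phi>"
      by (subst integral_mult_right_zero) (rule distrib_right)
    then show ?thesis using Alint * by linarith
  qed
  have cl: "x \<in> \<Omega> \<and> ?d x \<ge> \<delta>" if "x \<in> K0" for x using that K0(2) \<delta> by force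
  have "weighted_L1 \<Omega> (s - 1) u = integral\<^sup>L lborel \<phi>"
    using cl u0(1) by (subst weighted_L1_clamped[where \<delta>=\<delta>]) (auto simp: \<phi>_def[abs_def] v_def w_def)
  moreover have "weighted_grad_L1 \<Omega> (s - 1) u = (\<integral>x. norm (gradient u x) * w x \<partial>lborel)"
    using cl u0(2) by (subst weighted_grad_L1_clamped[where \<delta>=\<delta>]) (auto simp: w_def)
  moreover have "(s - 1) * weighted_L1 \<Omega> s u = - integral\<^sup>L lborel Bl"
  proof -
    have "weighted_L1 \<Omega> s u = (\<integral>x. v x * clamped_powr \<Omega> \<delta> (- s) x \<partial>lborel)"
      using cl u0(1) by (subst weighted_L1_clamped[where \<delta>=\<delta>]) (auto simp: v_def)
    moreover have "integral\<^sup>L lborel Bl = (1 - s) * (\<integral>x. v x * clamped_powr \<Omega> \<delta> (- s) x \<partial>lborel)"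
      unfolding Bl_def[abs_def] by (rule integral_mult_right_zero)
    ultimately show ?thesis by (simp only: minus_mult_left minus_diff_eq)
  qed
  ultimately show ?thesis using main by simp
qed

section \<open>The discrete Laplacian of the distance and the first inequality\<close>

text \<open>Cauchy's mean value theorem compares the even function \<open>\<psi>\<close> with
  \<open>t\<^sup>2\<close>; an ordinary mean value theorem on the symmetric interval then produces
  the second derivative. Thus C2 suffices for an exact intermediate point.\<close>

lemma second_difference_mvt:
  fixes f :: "'a::euclidean_space \<Rightarrow> real"
  assumes f: "C_diff 2 f" and h: "h > 0"
  obtains \<xi> where "\<bar>\<xi>\<bar> < h"
    "f (y + h *\<^sub>R b) + f (y - h *\<^sub>R b) - 2 * f y = h\<^sup>2 * (frechet_derivative (gradient f) (at (y + \<xi> *\<^sub>R b)) b \<bullet> b)"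
proof -
  have f': "C_diff (Suc (Suc 0)) f" using f by (simp only: numeral_2_eq_2)
  define g where "g x = gradient f x \<bullet> b" for x
  let ?H = "\<lambda>x. frechet_derivative (gradient f) (at x) b"
  have fd: "((\<lambda>t. f (y + t *\<^sub>R b)) has_real_derivative g (y + t *\<^sub>R b)) (at t)" for t
  proof -
    have "((\<lambda>t. f (y + t *\<^sub>R b)) has_derivative (\<lambda>r. gradient f (y + t *\<^sub>R b) \<bullet> (r *\<^sub>R b))) (at t)"
      by (rule has_derivative_compose[OF _ has_derivative_gradient[OF f']]) (auto intro!: derivative_eq_intros)
    then show ?thesis by (simp add: has_field_derivative_def mult_commute_abs g_def)
  qed
  have gd: "((\<lambda>t. g (y + t *\<^sub>R b)) has_real_derivative ?H (y + t *\<^sub>R b) \<bullet> b) (at t)" for t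
  proof -
    have 1: "(gradient f has_derivative frechet_derivative (gradient f) (at x)) (at x)" for x
      by (rule has_derivative_gradient_Suc(1)[OF f'])
    have "((\<lambda>t. gradient f (y + t *\<^sub>R b)) has_derivative (\<lambda>r. frechet_derivative (gradient f) (at (y + t *\<^sub>R b)) (r *\<^sub>R b))) (at t)"
      by (rule has_derivative_compose[OF _ 1]) (auto intro!: derivative_eq_intros)
    then have "((\<lambda>t. g (y + t *\<^sub>R b)) has_derivative (\<lambda>r. frechet_derivative (gradient f) (at (y + t *\<^sub>R b)) (r *\<^sub>R b) \<bullet> b)) (at t)"
      unfolding g_def by (rule has_derivative_inner_left)
    then show ?thesis
      using has_derivative_linear[OF 1] by (simp add: has_field_derivative_def linear_scale mult_commute_abs)
  qed
  define \<psi> where "\<psi> t = f (y + t *\<^sub>R b) + f (y + (- t) *\<^sub>R b)" for t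
  have \<psi>d: "(\<psi> has_real_derivative (g (y + t *\<^sub>R b) - g (y + (- t) *\<^sub>R b))) (at t)" for t
  proof -
    have "((\<lambda>t. f (y + (- t) *\<^sub>R b)) has_real_derivative g (y + (- t) *\<^sub>R b) * (- 1)) (at t)"
      by (rule DERIV_chain2[of "\<lambda>t. f (y + t *\<^sub>R b)"]) (rule fd, auto intro!: derivative_eq_intros)
    from DERIV_add[OF fd[of t] this] show ?thesis unfolding \<psi>_def[abs_def] by simp
  qed
  have sq: "((\<lambda>t::real. t\<^sup>2) has_real_derivative 2 * t) (at t)" for t
    by (auto intro!: derivative_eq_intros)
  have "\<exists>c. 0 < c \<and> c < h \<and>
    (\<psi> h - \<psi> 0) * (2 * c) = (h\<^sup>2 - 0\<^sup>2) * (g (y + c *\<^sub>R b) - g (y + (- c) *\<^sub>R b))"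
    by (rule GMVT'[OF h]) (rule DERIV_isCont[OF \<psi>d], rule DERIV_isCont[OF sq], rule sq, rule \<psi>d)
  then obtain c where c: "0 < c" "c < h"
    "(\<psi> h - \<psi> 0) * (2 * c) = (h\<^sup>2 - 0\<^sup>2) * (g (y + c *\<^sub>R b) - g (y + (- c) *\<^sub>R b))" by blast
  have "- c < c" using c by simp
  then obtain \<xi> where \<xi>: "- c < \<xi>" "\<xi> < c"
    "g (y + c *\<^sub>R b) - g (y + (- c) *\<^sub>R b) = (c - (- c)) * (?H (y + \<xi> *\<^sub>R b) \<bullet> b)"
    using MVT2[of "- c" c "\<lambda>t. g (y + t *\<^sub>R b)" "\<lambda>t. ?H (y + t *\<^sub>R b) \<bullet> b"] gd by blast
  have "(\<psi> h - \<psi> 0) * (2 * c) = (h\<^sup>2 * (?H (y + \<xi> *\<^sub>R b) \<bullet> b)) * (2 * c)"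
    using c(3) unfolding \<xi>(3) by (simp add: mult_ac)
  then have "\<psi> h - \<psi> 0 = h\<^sup>2 * (?H (y + \<xi> *\<^sub>R b) \<bullet> b)" using c(1) by simp
  moreover have "\<psi> h - \<psi> 0 = f (y + h *\<^sub>R b) + f (y - h *\<^sub>R b) - 2 * f y" by (simp add: \<psi>_def)
  ultimately show ?thesis using that[of \<xi>] \<xi>(1,2) c by auto
qed

lemma ball_infdist_subset: "ball x (bdist \<Omega> x) \<subseteq> \<Omega>"
proof
  fix z assume z: "z \<in> ball x (bdist \<Omega> x)"
  show "z \<in> \<Omega>"
  proof (rule ccontr)
    assume "z \<notin> \<Omega>"
    then have "bdist \<Omega> x \<le> dist x z" by (intro infdist_le) simp
    then show False using z by simp
  qed
qed

lemma nearest_point_frontier: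
  assumes "open \<Omega>" "x \<in> \<Omega>" "y \<notin> \<Omega>" "bdist \<Omega> x = dist x y"
  shows "y \<in> frontier \<Omega>"
proof -
  have "x \<noteq> y" using assms by auto
  then have "y \<in> closure (ball x (dist x y))" by (simp add: closure_ball dist_commute)
  then have "y \<in> closure \<Omega>" using closure_mono[OF ball_infdist_subset[of x \<Omega>]] assms(4) by auto
  then show ?thesis using assms by (simp add: frontier_def interior_open)
qed

text \<open>The vertical distance \<open>z \<bullet> \<nu> - \<gamma> z\<close> to the boundary in a tangent chart touches \<open>d\<close> from above
  at \<open>x\<close>.\<close>

lemma (in chart) laplacian_le:
  assumes g0: "gradient \<gamma> y = 0" and yf: "y \<notin> \<Omega>" and x: "x \<in> \<Omega>" "bdist \<Omega> x = dist x y" and \<eta>: "\<eta> > 0"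
  shows "\<exists>\<rho>>0. \<forall>h. 0 < h \<and> h < \<rho> \<longrightarrow>
      (\<Sum>b\<in>Basis. bdist \<Omega> (x + h *\<^sub>R b) + bdist \<Omega> (x - h *\<^sub>R b) - 2 * bdist \<Omega> x) / h\<^sup>2 \<le> chart_div \<nu> \<gamma> y + \<eta>"
proof -
  let ?d = "bdist \<Omega>"
  have xy: "x \<noteq> y" using x yf by auto
  have yb: "y \<in> ball y r" using r_pos by simp
  have "N y = (x - y) /\<^sub>R norm (x - y)"
    by (rule nearest_normal(2)[OF yb yf xy]) (use ball_infdist_subset[of x \<Omega>] x(2) in simp)
  moreover have "N y = \<nu>" using g0 by (simp add: chart_normal_def chart_grad_def)
  ultimately have x_eq: "x = y + dist x y *\<^sub>R \<nu>" using xy by (simp add: dist_norm)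
  define D where "D = dist x y"
  have D: "D > 0" "?d x = D" "x = y + D *\<^sub>R \<nu>" using xy x(2) x_eq by (auto simp: D_def)
  have yfr: "y \<in> frontier \<Omega>" by (rule nearest_point_frontier[OF open_\<Omega> x(1) yf x(2)])
  have Gy: "G y = 0" using frontier_iff[OF yb] yfr by simp
  have Gx: "G x = D" using Gy by (simp add: D(3))
  have Px: "P x = y" unfolding P_eq Gx using D(3) by simp
  have "isCont P x" "isCont G x"
    using continuous_on_P[of UNIV] continuous_on_G[of UNIV] by (simp_all add: continuous_on_eq_continuous_at)
  then have "(P \<longlongrightarrow> y) (at x)" "(G \<longlongrightarrow> D) (at x)" using Px Gx by (simp_all add: isCont_def)
  then have "eventually (\<lambda>z. P z \<in> ball y r) (at x)" "eventually (\<lambda>z. G z > 0) (at x)"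
    using topological_tendstoD[OF _ open_ball yb] order_tendstoD(1)[OF _ D(1)] by blast+
  then have "eventually (\<lambda>z. P z \<in> ball y r \<and> G z > 0) (at x)" by (rule eventually_conj)
  then obtain \<rho>1 where \<rho>1: "\<rho>1 > 0" "\<And>z. z \<noteq> x \<Longrightarrow> dist z x < \<rho>1 \<Longrightarrow> P z \<in> ball y r \<and> G z > 0"
    unfolding eventually_at by auto
  \<comment> \<open>The point \<open>P z\<close> lies on the graph inside the chart ball, so it is
    outside \<open>\<Omega>\<close>, and its distance from \<open>z\<close> is the height
    \<open>G z\<close>. At \<open>x\<close> the height equals the distance, since
    \<open>P x = y\<close>.\<close>
  have dG: "?d z \<le> G z" if "z \<noteq> x" "dist z x < \<rho>1" for z
  proof -
    have "P z \<notin> \<Omega>" using mem_iff[of "P z"] \<rho>1(2)[OF that] by simp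
    then have "?d z \<le> dist z (P z)" by (intro infdist_le) simp
    also have "\<dots> = G z" using \<rho>1(2)[OF that] by (simp add: P_eq dist_norm)
    finally show ?thesis .
  qed
  define \<eta>' where "\<eta>' = \<eta> / DIM('a)"
  have \<eta>': "\<eta>' > 0" using \<eta> by (simp add: \<eta>'_def)
  have "\<exists>\<rho>>0. \<forall>b\<in>Basis. \<forall>\<xi>. \<bar>\<xi>\<bar> < \<rho> \<longrightarrow> Hs (y + \<xi> *\<^sub>R b) b \<bullet> b \<ge> Hs y b \<bullet> b - \<eta>'"
  proof -
    have "\<exists>\<rho>>0. \<forall>\<xi>. \<bar>\<xi>\<bar> < \<rho> \<longrightarrow> Hs (y + \<xi> *\<^sub>R b) b \<bullet> b \<ge> Hs y b \<bullet> b - \<eta>'" if b: "b \<in> Basis" for b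
    proof -
      have "continuous_on UNIV (\<lambda>x. Hs x b \<bullet> b)"
        by (intro continuous_intros has_derivative_gradient_Suc(3)[OF C2'])
      then have "isCont (\<lambda>x. Hs x b \<bullet> b) y" by (simp add: continuous_on_eq_continuous_at)
      then obtain \<rho> where \<rho>: "\<rho> > 0" "\<And>z. dist z y < \<rho> \<Longrightarrow> dist (Hs z b \<bullet> b) (Hs y b \<bullet> b) < \<eta>'"
        unfolding continuous_at_eps_delta using \<eta>' by blast
      have "Hs (y + \<xi> *\<^sub>R b) b \<bullet> b \<ge> Hs y b \<bullet> b - \<eta>'" if "\<bar>\<xi>\<bar> < \<rho>" for \<xi>
      proof -
        have "dist (y + \<xi> *\<^sub>R b) y < \<rho>" using that b by (simp add: dist_norm)
        from \<rho>(2)[OF this] show ?thesis by (simp add: dist_real_def)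
      qed
      then show ?thesis using \<rho>(1) by blast
    qed
    then obtain R where R: "\<And>b. b \<in> Basis \<Longrightarrow> R b > 0"
      "\<And>b \<xi>. b \<in> Basis \<Longrightarrow> \<bar>\<xi>\<bar> < R b \<Longrightarrow> Hs (y + \<xi> *\<^sub>R b) b \<bullet> b \<ge> Hs y b \<bullet> b - \<eta>'" by metis
    show ?thesis
      by (rule exI[of _ "Min (R ` Basis)"]) (use R in auto)
  qed
  then obtain \<rho>2 where \<rho>2: "\<rho>2 > 0"
    "\<And>b \<xi>. b \<in> Basis \<Longrightarrow> \<bar>\<xi>\<bar> < \<rho>2 \<Longrightarrow> Hs (y + \<xi> *\<^sub>R b) b \<bullet> b \<ge> Hs y b \<bullet> b - \<eta>'" by blast
  show ?thesis
  proof (intro exI[of _ "min \<rho>1 \<rho>2"] conjI allI impI)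
    show "min \<rho>1 \<rho>2 > 0" using \<rho>1 \<rho>2 by simp
    fix h assume h: "0 < h \<and> h < min \<rho>1 \<rho>2"
    have "(\<Sum>b\<in>Basis. ?d (x + h *\<^sub>R b) + ?d (x - h *\<^sub>R b) - 2 * ?d x)
        \<le> (\<Sum>b\<in>Basis. h\<^sup>2 * (- (Hs y b \<bullet> b) + \<eta>'))"
    proof (rule sum_mono)
      fix b :: 'a assume b: "b \<in> Basis"
      have nb: "norm (h *\<^sub>R b) = h" "h *\<^sub>R b \<noteq> 0" using b h by auto
      have "?d (x + h *\<^sub>R b) \<le> G (x + h *\<^sub>R b)" "?d (x - h *\<^sub>R b) \<le> G (x - h *\<^sub>R b)"
        using nb h by (auto intro!: dG simp: dist_norm)
      moreover have "G (x + h *\<^sub>R b) + G (x - h *\<^sub>R b) - 2 * G x =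
          - (\<gamma> (x + h *\<^sub>R b) + \<gamma> (x - h *\<^sub>R b) - 2 * \<gamma> x)"
        by (simp add: chart_fun_def inner_add_left inner_diff_left)
      \<comment> \<open>\<open>x\<close> lies above \<open>y\<close> in direction
        \<open>\<nu>\<close>, along which \<open>\<gamma>\<close> is constant. The second difference
        at \<open>x\<close> is thereby moved to the boundary point \<open>y\<close>, where the
        Hessian encodes the curvature.\<close>
      moreover have "\<gamma> (x + h *\<^sub>R b) = \<gamma> (y + h *\<^sub>R b)" "\<gamma> (x - h *\<^sub>R b) = \<gamma> (y - h *\<^sub>R b)" "\<gamma> x = \<gamma> y"
        using \<gamma>_shift[of "y + h *\<^sub>R b" D] \<gamma>_shift[of "y - h *\<^sub>R b" D] \<gamma>_shift[of y D]
        by (simp_all add: D(3) algebra_simps)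
      moreover obtain \<xi> where \<xi>: "\<bar>\<xi>\<bar> < h"
        "\<gamma> (y + h *\<^sub>R b) + \<gamma> (y - h *\<^sub>R b) - 2 * \<gamma> y = h\<^sup>2 * (Hs (y + \<xi> *\<^sub>R b) b \<bullet> b)"
        using second_difference_mvt[OF C2, of h y b] h by metis
      moreover have "h\<^sup>2 * (Hs (y + \<xi> *\<^sub>R b) b \<bullet> b) \<ge> h\<^sup>2 * (Hs y b \<bullet> b - \<eta>')"
        using \<rho>2(2)[OF b, of \<xi>] \<xi>(1) h by (intro mult_left_mono) auto
      moreover have "h\<^sup>2 * (- (Hs y b \<bullet> b) + \<eta>') = - (h\<^sup>2 * (Hs y b \<bullet> b - \<eta>'))" by (simp add: algebra_simps)
      ultimately show "?d (x + h *\<^sub>R b) + ?d (x - h *\<^sub>R b) - 2 * ?d x \<le> h\<^sup>2 * (- (Hs y b \<bullet> b) + \<eta>')"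
        using D(2) Gx by linarith
    qed
    also have "\<dots> = h\<^sup>2 * (\<Sum>b\<in>Basis. - (Hs y b \<bullet> b) + \<eta>')" by (rule sum_distrib_left[symmetric])
    also have "(\<Sum>b\<in>Basis. - (Hs y b \<bullet> b) + \<eta>') = chart_div \<nu> \<gamma> y + \<eta>"
      by (simp add: div_tangent[OF g0] sum_subtractf \<eta>'_def)
    finally show "(\<Sum>b\<in>Basis. ?d (x + h *\<^sub>R b) + ?d (x - h *\<^sub>R b) - 2 * ?d x) / h\<^sup>2 \<le> chart_div \<nu> \<gamma> y + \<eta>"
      using h by (subst pos_divide_le_eq) (auto simp: mult.commute)
  qed
qed

lemma C2_boundary_chart:
  assumes "open \<Omega>" "C2_boundary \<Omega>" "y \<in> frontier \<Omega>"
  obtains r \<nu> \<gamma> where "chart \<Omega> y r \<nu> \<gamma>"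
  using assms unfolding C2_boundary_def chart_def by blast

text \<open>The chart supplied at a nearest boundary point \<open>y\<close> is exchanged for a
  tangent chart there, since the comparison needs \<open>\<nu>\<close> to point from
  \<open>y\<close> towards \<open>x\<close>.\<close>

lemma mean_curvature_laplacian:
  fixes \<Omega> :: "'a::euclidean_space set"
  assumes \<Omega>: "open \<Omega>" "\<Omega> \<noteq> UNIV" "C2_boundary \<Omega>" and n: "DIM('a) \<ge> 2"
    and H: "\<And>y. y \<in> frontier \<Omega> \<Longrightarrow> H \<le> mean_curvature \<Omega> y"
    and x: "x \<in> \<Omega>" and \<eta>: "\<eta> > 0"
  shows "\<exists>\<rho>>0. \<forall>h. 0 < h \<and> h < \<rho> \<longrightarrow>
      (\<Sum>b\<in>Basis. bdist \<Omega> (x + h *\<^sub>R b) + bdist \<Omega> (x - h *\<^sub>R b) - 2 * bdist \<Omega> x) / h\<^sup>2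
        \<le> - (real (DIM('a) - 1) * H) + \<eta>"
proof -
  have C: "closed (- \<Omega>)" "- \<Omega> \<noteq> {}" using \<Omega> by auto
  obtain y where y: "y \<in> - \<Omega>" "bdist \<Omega> x = dist x y" using nearest_point_exists[OF C] .
  have yf: "y \<in> frontier \<Omega>" using nearest_point_frontier[OF \<Omega>(1) x _ y(2)] y(1) by simp
  obtain r \<nu> \<gamma> where "chart \<Omega> y r \<nu> \<gamma>" by (rule C2_boundary_chart[OF \<Omega>(1,3) yf])
  then interpret c: chart \<Omega> y r \<nu> \<gamma> .
  have yb: "y \<in> ball y r" using c.r_pos by simp
  obtain r' \<gamma>' where t: "graph_chart \<Omega> y r' (c.N y) \<gamma>'" "gradient \<gamma>' y = 0"
    using c.tangent_chart[OF yf yb] .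
  interpret c': chart \<Omega> y r' "c.N y" \<gamma>' by unfold_locales (use t \<Omega> in auto)
  have yb': "y \<in> ball y r'" using c'.r_pos by simp
  have "chart_div (c.N y) \<gamma>' y = - (real (DIM('a) - 1) * mean_curvature \<Omega> y)"
    using c'.mean_curvature_eq[OF yf yb'] n by simp
  also have "\<dots> \<le> - (real (DIM('a) - 1) * H)" using H[OF yf] by (simp add: mult_left_mono)
  finally have le: "chart_div (c.N y) \<gamma>' y \<le> - (real (DIM('a) - 1) * H)" .
  obtain \<rho> where \<rho>: "\<rho> > 0" "\<And>h. 0 < h \<Longrightarrow> h < \<rho> \<Longrightarrow>
      (\<Sum>b\<in>Basis. bdist \<Omega> (x + h *\<^sub>R b) + bdist \<Omega> (x - h *\<^sub>R b) - 2 * bdist \<Omega> x) / h\<^sup>2 \<le> chart_div (c.N y) \<gamma>' y + \<eta>"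
    using c'.laplacian_le[OF t(2) _ x y(2) \<eta>] y(1) by blast
  show ?thesis
  proof (intro exI[of _ \<rho>] conjI allI impI)
    fix h assume "0 < h \<and> h < \<rho>"
    then show "(\<Sum>b\<in>Basis. bdist \<Omega> (x + h *\<^sub>R b) + bdist \<Omega> (x - h *\<^sub>R b) - 2 * bdist \<Omega> x) / h\<^sup>2
        \<le> - (real (DIM('a) - 1) * H) + \<eta>" using \<rho>(2)[of h] le by linarith
  qed (rule \<rho>(1))
qed

lemma integral_pos_continuous:
  fixes f :: "'a::euclidean_space \<Rightarrow> real"
  assumes i: "integrable lborel f" and c: "isCont f x0" and nn: "\<And>x. f x \<ge> 0" and p: "f x0 > 0"
  shows "integral\<^sup>L lborel f > 0"
proof -
  have "(f \<longlongrightarrow> f x0) (nhds x0)" using c by (simp add: isCont_def tendsto_at_iff_tendsto_nhds)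
  then have "eventually (\<lambda>x. f x > f x0 / 2) (nhds x0)" by (rule order_tendstoD(1)) (use p in simp)
  then obtain r where r: "r > 0" "\<And>x. dist x x0 < r \<Longrightarrow> f x > f x0 / 2" unfolding eventually_nhds_metric by blast
  have "0 < f x0 / 2 * measure lborel (ball x0 r)" using p content_ball_pos[OF r(1), of x0] by simp
  also have "\<dots> = (\<integral>x. f x0 / 2 * indicator (ball x0 r) x \<partial>lborel)" by simp
  also have "\<dots> \<le> integral\<^sup>L lborel f"
  proof (rule integral_mono[OF _ i])
    show "integrable lborel (\<lambda>x. f x0 / 2 * indicator (ball x0 r) x)"
      using emeasure_bounded_finite[of "ball x0 r"] by (intro integrable_mult_right integrable_real_indicator) auto
    show "f x0 / 2 * indicator (ball x0 r) x \<le> f x" for x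
      using r(2)[of x] nn[of x] by (auto simp: indicator_def dist_commute intro: less_imp_le)
  qed
  finally show ?thesis .
qed

lemma weighted_L1_pos:
  assumes \<Omega>: "open \<Omega>" "\<Omega> \<noteq> UNIV" and u: "u \<in> Cc_infinity \<Omega>" and ne: "u \<noteq> (\<lambda>_. 0)"
  shows "weighted_L1 \<Omega> p u > 0"
proof -
  let ?K = "closure {x. u x \<noteq> 0}"
  note K = Cc_infinityD(2,3)[OF u] and u0 = Cc_infinityD(4)[OF u]
  have C: "closed (- \<Omega>)" "- \<Omega> \<noteq> {}" "?K \<inter> - \<Omega> = {}" using \<Omega> K by auto
  obtain \<delta> where \<delta>: "\<delta> > 0" "\<And>x. x \<in> ?K \<Longrightarrow> bdist \<Omega> x \<ge> 2 * \<delta>"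
    using compact_positive_distance[OF K(1) C] by metis
  have cl: "x \<in> \<Omega> \<and> bdist \<Omega> x \<ge> \<delta>" if "u x \<noteq> 0" for x
    using \<delta>(1) \<delta>(2)[of x] K(2) u0[of x] that by force
  obtain x0 where x0: "u x0 \<noteq> 0" using ne by auto
  have uc: "continuous_on A u" for A by (rule C_diff_continuous_on[OF Cc_infinityD(1)[OF u, of 0]])
  have fc: "continuous_on A (\<lambda>x. \<bar>u x\<bar> * clamped_powr \<Omega> \<delta> (- p) x)" for A
    by (intro continuous_intros uc continuous_on_clamped_powr \<delta>(1))
  have "weighted_L1 \<Omega> p u = (\<integral>x. \<bar>u x\<bar> * clamped_powr \<Omega> \<delta> (- p) x \<partial>lborel)"
    by (rule weighted_L1_clamped[OF cl])
  moreover have "(\<integral>x. \<bar>u x\<bar> * clamped_powr \<Omega> \<delta> (- p) x \<partial>lborel) > 0"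
  proof (rule integral_pos_continuous[where ?x0.0=x0])
    show "integrable lborel (\<lambda>x. \<bar>u x\<bar> * clamped_powr \<Omega> \<delta> (- p) x)"
    proof (rule integrable_lborel_compact_support[OF K(1) fc])
      fix x assume "x \<notin> ?K"
      from u0[OF this] show "\<bar>u x\<bar> * clamped_powr \<Omega> \<delta> (- p) x = 0" by simp
    qed
    show "isCont (\<lambda>x. \<bar>u x\<bar> * clamped_powr \<Omega> \<delta> (- p) x) x0"
      using fc[of UNIV] by (simp add: continuous_on_eq_continuous_at)
  qed (use x0 \<delta>(1) in \<open>auto simp: clamped_powr_def\<close>)
  ultimately show ?thesis by (simp only:)
qed

lemma weighted_L1_nonneg: "weighted_L1 \<Omega> p u \<ge> 0"
  unfolding weighted_L1_def set_lebesgue_integral_def by (intro integral_nonneg_AE AE_I2) auto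

text \<open>The extended real infimum forces three cases. Plus infinity is excluded by a boundary
  point. For minus infinity the product with the weighted norm is minus infinity unless
  \<open>u = 0\<close>, where the norm vanishes and the product is 0.\<close>

theorem L1_hardy_inf_mean_curvature:
  fixes \<Omega> :: "'a::euclidean_space set"
  assumes \<Omega>: "open \<Omega>" "\<Omega> \<noteq> UNIV" "C2_boundary \<Omega>" "frontier \<Omega> \<noteq> {}" and n: "DIM('a) \<ge> 2"
    and u: "u \<in> Cc_infinity \<Omega>" and s: "s \<ge> 1"
  shows "L1_hardy \<Omega> s (ereal (real (DIM('a) - 1)) * inf_mean_curvature \<Omega>) u"
proof -
  have n1: "real (DIM('a) - 1) > 0" using n by simp
  have hardy: "weighted_grad_L1 \<Omega> (s - 1) u \<ge> (s - 1) * weighted_L1 \<Omega> s u + real (DIM('a) - 1) * H * weighted_L1 \<Omega> (s - 1) u"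
    if H: "\<And>y. y \<in> frontier \<Omega> \<Longrightarrow> H \<le> mean_curvature \<Omega> y" for H
    by (rule weak_hardy[OF \<Omega>(1,2) u s mean_curvature_laplacian[OF \<Omega>(1-3) n H]])
  show ?thesis
  proof (cases "inf_mean_curvature \<Omega>")
    case (real H)
    have "H \<le> mean_curvature \<Omega> y" if "y \<in> frontier \<Omega>" for y
      using INF_lower[OF that, of "\<lambda>y. ereal (mean_curvature \<Omega> y)"] real
      by (simp add: inf_mean_curvature_def)
    from hardy[OF this] show ?thesis unfolding L1_hardy_def real by simp
  next
    case PInf
    obtain y where "y \<in> frontier \<Omega>" using \<Omega>(4) by blast
    then have "inf_mean_curvature \<Omega> \<le> ereal (mean_curvature \<Omega> y)"
      unfolding inf_mean_curvature_def by (rule INF_lower)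
    then show ?thesis using PInf by simp
  next
    case MInf
    have B: "ereal (real (DIM('a) - 1)) * inf_mean_curvature \<Omega> = - \<infinity>" using MInf n1 by simp
    show ?thesis
    proof (cases "u = (\<lambda>_. 0)")
      case True
      have "gradient u x = 0" for x by (rule gradient_unique) (simp add: True)
      then show ?thesis unfolding L1_hardy_def
        by (simp add: True weighted_L1_def weighted_grad_L1_def flip: zero_ereal_def)
    next
      case False
      then have "weighted_L1 \<Omega> (s - 1) u > 0" by (rule weighted_L1_pos[OF \<Omega>(1,2) u])
      then show ?thesis unfolding L1_hardy_def B by simp
    qed
  qed
qed

section \<open>Smooth functions of the distance\<close>

definition mollify :: "('a::euclidean_space \<Rightarrow> real) \<Rightarrow> ('a \<Rightarrow> real) \<Rightarrow> 'a \<Rightarrow> real" where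
  "mollify \<eta> f x = (\<integral>z. \<eta> (x - z) * f z \<partial>lborel)"

lemma mollify_integrable:
  fixes \<eta> f :: "'a::euclidean_space \<Rightarrow> real"
  assumes "continuous_on UNIV \<eta>" "continuous_on UNIV f" "compact S" "\<And>x. x \<notin> S \<Longrightarrow> f x = 0"
  shows "integrable lborel (\<lambda>z. \<eta> (x - z) * f z)"
proof (rule integrable_lborel_compact_support[OF assms(3)])
  have "continuous_on UNIV (\<lambda>z. \<eta> (x - z))"
    by (rule continuous_on_compose2[OF assms(1)]) (auto intro!: continuous_intros)
  then show "continuous_on S (\<lambda>z. \<eta> (x - z) * f z)"
    using assms(2) by (intro continuous_on_mult) (auto intro: continuous_on_subset)
qed (simp add: assms(4))

lemma lborel_integral_abs_le:
  fixes f g :: "'a::euclidean_space \<Rightarrow> real"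
  assumes f: "integrable lborel f" and g: "integrable lborel g" and le: "\<And>x. norm (f x) \<le> g x"
  shows "norm (integral\<^sup>L lborel f) \<le> integral\<^sup>L lborel g"
proof -
  have "norm (integral\<^sup>L lborel f) \<le> (\<integral>x. norm (f x) \<partial>lborel)" by (rule integral_norm_bound)
  also have "\<dots> \<le> integral\<^sup>L lborel g" by (rule integral_mono[OF integrable_norm[OF f] g]) (rule le)
  finally show ?thesis .
qed

lemma onorm_inner_le:
  fixes g :: "'a::euclidean_space"
  assumes "norm g \<le> c" shows "onorm (\<lambda>h. g \<bullet> h) \<le> c"
proof (rule onorm_bound)
  show "0 \<le> c" using assms norm_ge_zero order_trans by blast
  fix h
  have "\<bar>g \<bullet> h\<bar> \<le> norm g * norm h" by (rule Cauchy_Schwarz_ineq2)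
  also have "\<dots> \<le> c * norm h" using assms by (rule mult_right_mono) simp
  finally show "norm (g \<bullet> h) \<le> c * norm h" by simp
qed

text \<open>The derivative falls on the kernel, and a directional derivative of the kernel is again
  a kernel, so the formula iterates to all orders. The remainder is uniformly small because the
  gradient of \<open>\<eta>\<close> is uniformly continuous on a ball containing all relevant
  differences \<open>x - z\<close>.\<close>

lemma mollify_has_derivative:
  fixes \<eta> f :: "'a::euclidean_space \<Rightarrow> real"
  assumes \<eta>: "C_diff (Suc 0) \<eta>" and f: "continuous_on UNIV f" "compact S" "\<And>x. x \<notin> S \<Longrightarrow> f x = 0"
  shows "(mollify \<eta> f has_derivative (\<lambda>v. mollify (\<lambda>p. frechet_derivative \<eta> (at p) v) f x)) (at x)"
proof -
  let ?D = "\<lambda>p v. frechet_derivative \<eta> (at p) v"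
  have \<eta>c: "continuous_on UNIV \<eta>" by (rule C_diff_continuous_on[OF \<eta>])
  have Dc: "continuous_on UNIV (\<lambda>p. ?D p v)" for v using \<eta> by simp
  have lin: "linear (?D p)" for p using \<eta> by (simp add: linear_frechet_derivative)
  note i\<eta> = mollify_integrable[OF \<eta>c f] and iD = mollify_integrable[OF Dc f]
  have L: "linear (\<lambda>v. mollify (\<lambda>p. ?D p v) f x)"
  proof
    show "mollify (\<lambda>p. ?D p (v + w)) f x = mollify (\<lambda>p. ?D p v) f x + mollify (\<lambda>p. ?D p w) f x" for v w
      unfolding mollify_def linear_add[OF lin] distrib_right
      by (rule Bochner_Integration.integral_add[OF iD iD])
    show "mollify (\<lambda>p. ?D p (r *\<^sub>R v)) f x = r *\<^sub>R mollify (\<lambda>p. ?D p v) f x" for r v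
      unfolding mollify_def linear_scale[OF lin] real_scaleR_def mult.assoc by (rule integral_mult_right_zero)
  qed
  have "bounded S" using f(2) by (rule compact_imp_bounded)
  then obtain M where M: "\<And>z. z \<in> S \<Longrightarrow> norm z \<le> M" unfolding bounded_iff by blast
  \<comment> \<open>All \<open>x - z\<close> with \<open>z \<in> S\<close> have norm at most
    \<open>R - 1\<close>, which leaves room for increments shorter than 1. The absolute value covers
    a negative \<open>M\<close> when \<open>S\<close> is empty.\<close>
  define R where "R = norm x + \<bar>M\<bar> + 1"
  have fi: "integrable lborel f" by (rule integrable_lborel_compact_support[OF f(2) continuous_on_subset[OF f(1)]]) (use f(3) in auto)
  define I where "I = (\<integral>z. \<bar>f z\<bar> \<partial>lborel)"
  have I: "I \<ge> 0" unfolding I_def by (intro integral_nonneg_AE AE_I2) simp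
  have "uniformly_continuous_on (cball 0 R) (gradient \<eta>)"
    by (rule compact_uniformly_continuous[OF continuous_on_gradient[OF \<eta>] compact_cball])
  have "\<exists>d>0. \<forall>y. norm (y - x) < d \<longrightarrow> norm (mollify \<eta> f y - mollify \<eta> f x - mollify (\<lambda>p. ?D p (y - x)) f x) \<le> e * norm (y - x)"
    if e: "e > 0" for e
  proof -
    \<comment> \<open>Adding 1 to the L1 norm of \<open>f\<close> avoids division by zero when that
      norm vanishes.\<close>
    define e' where "e' = e / (I + 1)"
    have e': "e' > 0" "e' * I \<le> e" using e I by (auto simp: e'_def field_simps)
    obtain d where d: "d > 0" "\<And>p q. p \<in> cball 0 R \<Longrightarrow> q \<in> cball 0 R \<Longrightarrow> dist q p < d \<Longrightarrow> dist (gradient \<eta> q) (gradient \<eta> p) < e'"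
      using \<open>uniformly_continuous_on _ _\<close> e'(1) unfolding uniformly_continuous_on_def by metis
    show ?thesis
    proof (intro exI[of _ "min d 1"] conjI allI impI)
      show "min d 1 > 0" using d by simp
      fix y assume y: "norm (y - x) < min d 1"
      let ?w = "y - x"
      have bound: "\<bar>\<eta> (p + ?w) - \<eta> p - ?D p ?w\<bar> \<le> e' * norm ?w" if p: "norm p \<le> R - 1" for p
      proof -
        define g where "g q = \<eta> q - gradient \<eta> p \<bullet> q" for q
        have gd: "(g has_derivative (\<lambda>h. (gradient \<eta> q - gradient \<eta> p) \<bullet> h)) (at q)" for q
          unfolding g_def[abs_def] inner_diff_left
          by (intro has_derivative_diff has_derivative_gradient[OF \<eta>] has_derivative_inner_right has_derivative_ident)
        have "norm (g (p + ?w) - g p) \<le> e' * norm (p + ?w - p)"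
        proof (rule differentiable_bound[where S="ball p (min d 1)" and f'="\<lambda>q h. (gradient \<eta> q - gradient \<eta> p) \<bullet> h"])
          show "(g has_derivative (\<lambda>h. (gradient \<eta> q - gradient \<eta> p) \<bullet> h)) (at q within ball p (min d 1))" for q
            using gd has_derivative_at_withinI by blast
          fix q assume q: "q \<in> ball p (min d 1)"
          have "norm q \<le> R" using norm_triangle_sub[of q p] q p by (simp add: dist_norm norm_minus_commute)
          moreover have "norm p \<le> R" using p by simp
          ultimately have "norm (gradient \<eta> q - gradient \<eta> p) \<le> e'"
            using d(2)[of p q] q by (simp add: dist_norm norm_minus_commute less_imp_le)
          then show "onorm (\<lambda>h. (gradient \<eta> q - gradient \<eta> p) \<bullet> h) \<le> e'"
            by (rule onorm_inner_le)
        qed (use y d in \<open>auto simp: dist_norm norm_minus_commute\<close>)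
        moreover have "g (p + ?w) - g p = \<eta> (p + ?w) - \<eta> p - ?D p ?w"
          using GDERIV_gradient(2)[of \<eta> p ?w] \<eta> by (simp add: g_def inner_add_right)
        ultimately show ?thesis by simp
      qed
      have eq: "mollify \<eta> f y - mollify \<eta> f x - mollify (\<lambda>p. ?D p ?w) f x =
          (\<integral>z. (\<eta> (x - z + ?w) - \<eta> (x - z) - ?D (x - z) ?w) * f z \<partial>lborel)"
      proof -
        have "(\<integral>z. (\<eta> (x - z + ?w) - \<eta> (x - z) - ?D (x - z) ?w) * f z \<partial>lborel) =
            (\<integral>z. \<eta> (y - z) * f z - \<eta> (x - z) * f z - ?D (x - z) ?w * f z \<partial>lborel)"
          by (rule Bochner_Integration.integral_cong[OF refl]) (simp add: left_diff_distrib)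
        then show ?thesis unfolding mollify_def using i\<eta> iD by simp
      qed
      have "norm (mollify \<eta> f y - mollify \<eta> f x - mollify (\<lambda>p. ?D p ?w) f x) \<le> (\<integral>z. e' * norm ?w * \<bar>f z\<bar> \<partial>lborel)"
        unfolding eq
      proof (rule lborel_integral_abs_le)
        show "integrable lborel (\<lambda>z. (\<eta> (x - z + ?w) - \<eta> (x - z) - ?D (x - z) ?w) * f z)"
        proof -
          have s: "x - z + ?w = y - z" for z by simp
          show ?thesis unfolding left_diff_distrib s by (intro Bochner_Integration.integrable_diff i\<eta> iD)
        qed
        fix z
        show "norm ((\<eta> (x - z + ?w) - \<eta> (x - z) - ?D (x - z) ?w) * f z) \<le> e' * norm ?w * \<bar>f z\<bar>"
        proof (cases "z \<in> S")
          case True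
          have "norm (x - z) \<le> R - 1" using M[OF True] norm_triangle_ineq4[of x z] by (simp add: R_def)
          from bound[OF this] show ?thesis unfolding real_norm_def abs_mult by (rule mult_right_mono) simp
        qed (simp add: f(3))
      qed (use fi in simp)
      also have "\<dots> = (e' * I) * norm ?w" by (simp add: I_def)
      also have "\<dots> \<le> e * norm ?w" using e'(2) by (rule mult_right_mono) simp
      finally show "norm (mollify \<eta> f y - mollify \<eta> f x - mollify (\<lambda>p. ?D p ?w) f x) \<le> e * norm ?w" .
    qed
  qed
  then show ?thesis unfolding has_derivative_at_alt using L linear_conv_bounded_linear by blast
qed

lemma C_diff_mollify:
  fixes \<eta> f :: "'a::euclidean_space \<Rightarrow> real"
  assumes "\<And>j. C_diff j \<eta>" and f: "continuous_on UNIV f" "compact S" "\<And>x. x \<notin> S \<Longrightarrow> f x = 0"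
  shows "C_diff k (mollify \<eta> f)"
  using assms(1)
proof (induction k arbitrary: \<eta>)
  case 0
  have "continuous_on UNIV (mollify \<eta> f)"
    by (intro continuous_at_imp_continuous_on ballI has_derivative_continuous[OF mollify_has_derivative[OF 0 f]])
  then show ?case by simp
next
  case (Suc k)
  show ?case
  proof (rule C_diff_SucI[OF mollify_has_derivative[OF Suc.prems f]])
    fix v
    have "C_diff j (\<lambda>p. frechet_derivative \<eta> (at p) v)" for j using Suc.prems[of "Suc j"] by simp
    then show "C_diff k (mollify (\<lambda>p. frechet_derivative \<eta> (at p) v) f)" by (rule Suc.IH)
  qed
qed

text \<open>The flat function is composed with the squared norm, which is smooth at the origin,
  unlike the norm. Evenness and translation invariance give the normalisation in the reflected form
  used by \<open>mollify\<close>.\<close>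

lemma mollifier_exists:
  fixes \<delta> :: real
  assumes \<delta>: "\<delta> > 0"
  obtains \<eta> :: "'a::euclidean_space \<Rightarrow> real" where "\<And>k. C_diff k \<eta>" "\<And>x. \<eta> x \<ge> 0" "\<And>x. norm x \<ge> \<delta> \<Longrightarrow> \<eta> x = 0"
    "\<And>x. integrable lborel (\<lambda>z. \<eta> (x - z))" "\<And>x. (\<integral>z. \<eta> (x - z) \<partial>lborel) = 1"
proof -
  define \<eta>0 where "\<eta>0 x = flat 0 (\<delta>\<^sup>2 - (norm x)\<^sup>2)" for x :: 'a
  have C0: "C_diff k \<eta>0" for k
    unfolding \<eta>0_def[abs_def] using C_diff_norm_power2[of k "0::'a"]
    by (intro C_diff_compose[OF C_diff_flat] C_diff_diff C_diff_const) simp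
  have supp: "\<eta>0 x = 0" if "norm x \<ge> \<delta>" for x
  proof -
    have "\<delta>\<^sup>2 \<le> (norm x)\<^sup>2" by (rule power_mono[OF that]) (use \<delta> in simp)
    then have "\<not> \<delta>\<^sup>2 - (norm x)\<^sup>2 > 0" by linarith
    then show ?thesis unfolding \<eta>0_def flat_def by (simp only: if_False)
  qed
  have c0: "continuous_on A \<eta>0" for A by (rule C_diff_continuous_on[OF C0[of 0]])
  have i0: "integrable lborel \<eta>0"
    by (rule integrable_lborel_compact_support[OF compact_cball[of 0 \<delta>] c0]) (auto intro!: supp)
  define c where "c = integral\<^sup>L lborel \<eta>0"
  have c: "c > 0" unfolding c_def
  proof (rule integral_pos_continuous[OF i0, of 0])
    show "isCont \<eta>0 0" using c0[of UNIV] by (simp add: continuous_on_eq_continuous_at)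
  qed (use \<delta> in \<open>auto simp: \<eta>0_def flat_def\<close>)
  have even: "\<eta>0 (x - z) = \<eta>0 (z + (- x))" for x z by (simp add: \<eta>0_def norm_minus_commute)
  show ?thesis
  proof (rule that[of "\<lambda>x. \<eta>0 x / c"])
    show "C_diff k (\<lambda>x. \<eta>0 x / c)" for k
      unfolding divide_inverse by (intro C_diff_mult C0 C_diff_const)
    show "integrable lborel (\<lambda>z. \<eta>0 (x - z) / c)" for x
      unfolding even using i0 lborel_shift(2)[of \<eta>0 "- x"] by simp
    show "(\<integral>z. \<eta>0 (x - z) / c \<partial>lborel) = 1" for x
      unfolding even using c lborel_shift(1)[of \<eta>0 "- x"] by (simp add: c_def)
  qed (use c supp in \<open>auto simp: \<eta>0_def flat_nonneg\<close>)
qed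

text \<open>Increments along the gradient itself realise its norm.\<close>

lemma norm_gradient_le:
  fixes u :: "'a::euclidean_space \<Rightarrow> real"
  assumes u: "C_diff (Suc 0) u" and \<delta>: "\<delta> > 0" and L: "\<And>w. norm w < \<delta> \<Longrightarrow> \<bar>u (x + w) - u x\<bar> \<le> L * norm w"
  shows "norm (gradient u x) \<le> L"
proof (cases "gradient u x = 0")
  case True
  \<comment> \<open>With zero gradient it remains to see that \<open>L\<close> is nonnegative, which
    any nonzero increment shows.\<close>
  obtain b :: 'a where b: "b \<in> Basis" using nonempty_Basis by blast
  have "0 \<le> \<bar>u (x + (\<delta>/2) *\<^sub>R b) - u x\<bar>" by simp
  also have "\<dots> \<le> L * (\<delta> / 2)" using L[of "(\<delta>/2) *\<^sub>R b"] b \<delta> by simp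
  finally show ?thesis using True \<delta> by (simp add: zero_le_mult_iff)
next
  case False
  let ?g = "gradient u x"
  define h where "h k = 1 / real (Suc k)" for k
  have h: "h k > 0" for k by (simp add: h_def)
  have h0: "h \<longlonglongrightarrow> 0" unfolding h_def by (rule LIMSEQ_Suc[OF lim_1_over_n])
  have lim: "(\<lambda>k. (u (x + h k *\<^sub>R ?g) - u x) / h k) \<longlonglongrightarrow> ?g \<bullet> ?g"
    by (rule gradient_difference_quotient[OF u h0]) (use h in \<open>simp add: less_imp_neq[symmetric]\<close>)
  have "eventually (\<lambda>k. h k < \<delta> / norm ?g) sequentially"
    using False \<delta> by (intro order_tendstoD(2)[OF h0]) simp
  then have "eventually (\<lambda>k. (u (x + h k *\<^sub>R ?g) - u x) / h k \<le> L * norm ?g) sequentially"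
  proof eventually_elim
    case (elim k)
    then have "norm (h k *\<^sub>R ?g) < \<delta>" using False h[of k] by (simp add: pos_less_divide_eq)
    then have "u (x + h k *\<^sub>R ?g) - u x \<le> L * norm ?g * h k" using L[of "h k *\<^sub>R ?g"] h[of k] by (simp add: mult_ac)
    then show ?case using h[of k] by (simp add: pos_divide_le_eq)
  qed
  then have "?g \<bullet> ?g \<le> L * norm ?g" using tendsto_upperbound[OF lim] by simp
  then show ?thesis using False by (simp add: dot_square_norm power2_eq_square)
qed

lemma compact_superlevel_bdist:
  fixes \<Omega> :: "'a::euclidean_space set"
  assumes "bounded \<Omega>" "\<Omega> \<noteq> UNIV" "\<epsilon> > 0"
  shows "compact {x. bdist \<Omega> x \<ge> \<epsilon>}" "{x. bdist \<Omega> x \<ge> \<epsilon>} \<subseteq> \<Omega>"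
proof -
  show sub: "{x. bdist \<Omega> x \<ge> \<epsilon>} \<subseteq> \<Omega>"
  proof
    fix x assume x: "x \<in> {x. bdist \<Omega> x \<ge> \<epsilon>}"
    show "x \<in> \<Omega>"
    proof (rule ccontr)
      assume "x \<notin> \<Omega>"
      then have "bdist \<Omega> x = 0" by simp
      then show False using x assms(3) by simp
    qed
  qed
  have "closed {x. bdist \<Omega> x \<ge> \<epsilon>}" by (intro closed_Collect_le continuous_intros)
  then show "compact {x. bdist \<Omega> x \<ge> \<epsilon>}"
    using bounded_subset[OF assms(1) sub] by (simp add: compact_eq_bounded_closed)
qed

lemma bdist_bounded:
  fixes \<Omega> :: "'a::euclidean_space set"
  assumes "bounded \<Omega>" "\<Omega> \<noteq> UNIV"
  obtains D where "D > 0" "\<And>x. bdist \<Omega> x \<le> D"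
proof -
  have K: "compact {x. bdist \<Omega> x \<ge> 1}" by (rule compact_superlevel_bdist(1)[OF assms]) simp
  have "compact (bdist \<Omega> ` {x. bdist \<Omega> x \<ge> 1})"
    by (rule compact_continuous_image[OF _ K]) (intro continuous_intros)
  then have "bounded (bdist \<Omega> ` {x. bdist \<Omega> x \<ge> 1})" by (rule compact_imp_bounded)
  then obtain D where D: "\<And>x. bdist \<Omega> x \<ge> 1 \<Longrightarrow> bdist \<Omega> x \<le> D" unfolding bounded_iff by fastforce
  have "bdist \<Omega> x \<le> max D 1" for x using D[of x] by (cases "bdist \<Omega> x \<ge> 1") auto
  then show ?thesis using that[of "max D 1"] by simp
qed

text \<open>An increment of the mollified function averages increments of \<open>F\<close> along the
  distance at nearby points. As the distance is 1-Lipschitz, these are bounded by nearby values of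
  \<open>F'\<close> times the length of the increment, so the gradient bound survives without
  differentiating the distance.\<close>

lemma smooth_approximation:
  fixes \<Omega> :: "'a::euclidean_space set" and F F' :: "real \<Rightarrow> real"
  assumes \<Omega>: "bounded \<Omega>" "\<Omega> \<noteq> UNIV" and \<epsilon>: "\<epsilon> > 0" and e: "e > 0"
    and F: "\<And>t. (F has_real_derivative F' t) (at t)" "continuous_on UNIV F'" "\<And>t. F' t \<ge> 0"
      "\<And>t. t \<le> \<epsilon> \<Longrightarrow> F t = 0"
  obtains u where "u \<in> Cc_infinity \<Omega>" "\<And>x. \<bar>u x - F (bdist \<Omega> x)\<bar> \<le> e"
    "\<And>x. bdist \<Omega> x < \<epsilon> / 2 \<Longrightarrow> u x = 0" "\<And>x. norm (gradient u x) \<le> F' (bdist \<Omega> x) + e"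
proof -
  let ?d = "bdist \<Omega>"
  obtain D where D: "D > 0" "\<And>x. ?d x \<le> D" using bdist_bounded[OF \<Omega>] by metis
  have dr: "?d x \<in> {0..D}" for x using D(2)[of x] infdist_nonneg[of x "- \<Omega>"] by simp
  have "compact (F' ` {0..D})" by (intro compact_continuous_image continuous_on_subset[OF F(2)]) auto
  then have "bounded (F' ` {0..D})" by (rule compact_imp_bounded)
  then obtain M where M0: "M > 0" and M1: "\<forall>y\<in>F' ` {0..D}. norm y \<le> M" unfolding bounded_pos by blast
  have "F' t \<le> M" if "t \<in> {0..D}" for t
  proof -
    have "norm (F' t) \<le> M" using M1 that by blast
    then show ?thesis by simp
  qed
  note M = M0 this
  have "uniformly_continuous_on {0..D} F'"
    by (rule compact_uniformly_continuous) (use continuous_on_subset[OF F(2)] in auto)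
  then obtain \<delta>0 where \<delta>0: "\<delta>0 > 0" "\<And>t t'. t \<in> {0..D} \<Longrightarrow> t' \<in> {0..D} \<Longrightarrow> \<bar>t' - t\<bar> < \<delta>0 \<Longrightarrow> \<bar>F' t' - F' t\<bar> < e"
    using e unfolding uniformly_continuous_on_def dist_real_def by metis
  \<comment> \<open>Each term has a purpose: \<open>\<delta>0 / 2\<close> covers one averaging shift
    plus one increment in the continuity of \<open>F'\<close>, \<open>\<epsilon> / 2\<close> keeps
    the support away from the boundary, and \<open>e / M\<close> gives uniform closeness.\<close>
  define \<delta> where "\<delta> = min (\<delta>0 / 2) (min (\<epsilon> / 2) (e / M))"
  have \<delta>: "\<delta> > 0" "\<delta> \<le> \<delta>0 / 2" "\<delta> \<le> \<epsilon> / 2" "\<delta> \<le> e / M"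
  proof -
    show "\<delta> > 0" using \<delta>0(1) \<epsilon> e M(1) by (simp add: \<delta>_def)
    show "\<delta> \<le> \<delta>0 / 2" "\<delta> \<le> \<epsilon> / 2" "\<delta> \<le> e / M" unfolding \<delta>_def by linarith+
  qed
  obtain \<eta> :: "'a \<Rightarrow> real" where \<eta>: "\<And>k. C_diff k \<eta>" "\<And>x. \<eta> x \<ge> 0" "\<And>x. norm x \<ge> \<delta> \<Longrightarrow> \<eta> x = 0"
    "\<And>x. integrable lborel (\<lambda>z. \<eta> (x - z))" "\<And>x. (\<integral>z. \<eta> (x - z) \<partial>lborel) = 1"
    by (rule mollifier_exists[OF \<delta>(1)], rule that)
  define U where "U x = F (?d x)" for x
  have Fc: "continuous_on UNIV F"
    by (intro continuous_at_imp_continuous_on ballI DERIV_isCont[OF F(1)])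
  have Uc: "continuous_on UNIV U"
    unfolding U_def[abs_def] by (rule continuous_on_compose2[OF Fc]) (auto intro!: continuous_intros)
  define K where "K = {x. ?d x \<ge> \<epsilon> / 2}"
  have K: "compact K" "K \<subseteq> \<Omega>" unfolding K_def using compact_superlevel_bdist[OF \<Omega>, of "\<epsilon>/2"] \<epsilon> by auto
  have U0: "U x = 0" if "?d x \<le> \<epsilon>" for x using F(4)[OF that] by (simp add: U_def)
  have U0K: "U x = 0" if "x \<notin> K" for x using that \<epsilon> by (intro U0) (auto simp: K_def)
  define u where "u = mollify \<eta> U"
  have uC: "C_diff k u" for k unfolding u_def by (rule C_diff_mollify[OF \<eta>(1) Uc K(1) U0K])
  have u0: "u x = 0" if x: "?d x < \<epsilon> / 2" for x
  proof -
    have "\<eta> (x - z) * U z = 0" for z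
    proof (cases "norm (x - z) < \<delta>")
      case True
      have "\<bar>?d x - ?d z\<bar> \<le> dist x z" by (rule infdist_triangle_abs)
      then have "U z = 0" using True x \<delta>(3) by (intro U0) (simp add: dist_norm)
      then show ?thesis by simp
    qed (simp add: \<eta>(3))
    then show ?thesis unfolding u_def mollify_def by (simp only:) simp
  qed
  have iU: "integrable lborel (\<lambda>z. \<eta> (x - z) * U z)" for x
    by (rule mollify_integrable[OF _ Uc K(1) U0K]) (rule C_diff_continuous_on[OF \<eta>(1)[of 0]])
  have avg: "\<bar>\<integral>z. \<eta> (x - z) * f z \<partial>lborel\<bar> \<le> c"
    if i: "integrable lborel (\<lambda>z. \<eta> (x - z) * f z)" and le: "\<And>z. norm (x - z) < \<delta> \<Longrightarrow> \<bar>f z\<bar> \<le> c" for x f c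
  proof -
    have "norm (\<integral>z. \<eta> (x - z) * f z \<partial>lborel) \<le> (\<integral>z. c * \<eta> (x - z) \<partial>lborel)"
    proof (rule lborel_integral_abs_le[OF i])
      show "integrable lborel (\<lambda>z. c * \<eta> (x - z))" using \<eta>(4) by simp
      show "norm (\<eta> (x - z) * f z) \<le> c * \<eta> (x - z)" for z
      proof (cases "norm (x - z) < \<delta>")
        case True
        then show ?thesis using le[OF True] \<eta>(2)[of "x - z"] mult_right_mono[of "\<bar>f z\<bar>" c "\<eta> (x - z)"]
          by (simp add: abs_mult mult.commute)
      qed (simp add: \<eta>(3))
    qed
    also have "\<dots> = c" using \<eta>(5)[of x] by simp
    finally show ?thesis by simp
  qed
  have Fdiff: "\<bar>F a - F b\<bar> \<le> c * \<bar>a - b\<bar>" if "\<And>t. min a b \<le> t \<Longrightarrow> t \<le> max a b \<Longrightarrow> F' t \<le> c" for a b c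
  proof -
    have *: "\<bar>F a - F b\<bar> \<le> c * \<bar>a - b\<bar>" if ab: "a < b" and le: "\<And>t. a \<le> t \<Longrightarrow> t \<le> b \<Longrightarrow> F' t \<le> c" for a b
    proof -
      obtain t where t: "a < t" "t < b" "F b - F a = (b - a) * F' t" using MVT2[OF ab, of F F'] F(1) by blast
      have "(b - a) * F' t \<le> (b - a) * c" "0 \<le> (b - a) * F' t" using ab le[of t] t F(3)[of t] by (auto intro: mult_left_mono)
      then have 1: "0 \<le> F b - F a" and 2: "F b - F a \<le> c * (b - a)"
        by (simp_all only: t(3) mult.commute[of c])
      have 3: "\<bar>F a - F b\<bar> = F b - F a" "\<bar>a - b\<bar> = b - a" using 1 ab by simp_all
      show ?thesis unfolding 3 by (rule 2)
    qed
    consider "a < b" | "a = b" | "b < a" by linarith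
    then show ?thesis
      using *[of a b] *[of b a] that by cases (auto simp: abs_minus_commute min_def max_def)
  qed
  have close: "\<bar>u x - U x\<bar> \<le> e" for x
  proof -
    have "u x - U x = (\<integral>z. \<eta> (x - z) * (U z - U x) \<partial>lborel)"
      unfolding right_diff_distrib using iU[of x] \<eta>(4)[of x] \<eta>(5)[of x] by (simp add: u_def mollify_def)
    also have "\<bar>\<dots>\<bar> \<le> e"
    proof (rule avg)
      show "integrable lborel (\<lambda>z. \<eta> (x - z) * (U z - U x))"
        unfolding right_diff_distrib using iU[of x] \<eta>(4)[of x] by simp
      fix z assume z: "norm (x - z) < \<delta>"
      have "\<bar>?d z - ?d x\<bar> \<le> \<delta>"
        using infdist_triangle_abs[of z "- \<Omega>" x] z by (simp add: dist_norm norm_minus_commute)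
      moreover have "\<bar>U z - U x\<bar> \<le> M * \<bar>?d z - ?d x\<bar>"
        unfolding U_def using dr[of x] dr[of z] by (intro Fdiff M(2)) (auto simp: min_def max_def split: if_splits)
      ultimately have "\<bar>U z - U x\<bar> \<le> M * \<delta>" using M(1) mult_left_mono[of "\<bar>?d z - ?d x\<bar>" \<delta> M] by linarith
      also have "\<dots> \<le> e" using \<delta>(4) M(1) by (simp add: field_simps)
      finally show "\<bar>U z - U x\<bar> \<le> e" .
    qed
    finally show ?thesis .
  qed
  have grad: "norm (gradient u x) \<le> F' (?d x) + e" for x
  proof (rule norm_gradient_le[OF uC \<delta>(1)])
    fix w :: 'a assume w: "norm w < \<delta>"
    \<comment> \<open>Translation invariance moves the increment from the kernel to
      \<open>U\<close>, so both values of \<open>u\<close> are averages with the same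
      kernel.\<close>
    have sh: "(\<lambda>z. \<eta> (x - z) * U (z + w)) = (\<lambda>z. (\<lambda>z. \<eta> (x + w - z) * U z) (z + w))"
      by (simp add: algebra_simps)
    have i2: "integrable lborel (\<lambda>z. \<eta> (x - z) * U (z + w))"
      unfolding sh by (subst lborel_shift(2)) (rule iU)
    have "u (x + w) = (\<integral>z. \<eta> (x - z) * U (z + w) \<partial>lborel)"
      unfolding sh by (subst lborel_shift(1)) (simp add: u_def mollify_def)
    then have "u (x + w) - u x = (\<integral>z. \<eta> (x - z) * (U (z + w) - U z) \<partial>lborel)"
      unfolding right_diff_distrib using i2 iU[of x] by (simp add: u_def mollify_def)
    also have "\<bar>\<dots>\<bar> \<le> (F' (?d x) + e) * norm w"
    proof (rule avg)
      show "integrable lborel (\<lambda>z. \<eta> (x - z) * (U (z + w) - U z))"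
        unfolding right_diff_distrib using i2 iU[of x] by simp
      fix z assume z: "norm (x - z) < \<delta>"
      have zx: "\<bar>?d z - ?d x\<bar> < \<delta>"
        using infdist_triangle_abs[of z "- \<Omega>" x] z by (simp add: dist_norm norm_minus_commute)
      have zw: "\<bar>?d (z + w) - ?d z\<bar> \<le> norm w"
        using infdist_triangle_abs[of "z + w" "- \<Omega>" z] by (simp add: dist_norm)
      have "\<bar>U (z + w) - U z\<bar> \<le> (F' (?d x) + e) * \<bar>?d (z + w) - ?d z\<bar>"
        unfolding U_def
      proof (rule Fdiff)
        fix t assume t: "min (?d (z + w)) (?d z) \<le> t" "t \<le> max (?d (z + w)) (?d z)"
        have "t \<in> {0..D}" using t dr[of z] dr[of "z + w"] by (auto simp: min_def max_def split: if_splits)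
        moreover have "\<bar>t - ?d x\<bar> < \<delta>0" using t zx zw w \<delta>(2) by (auto simp: min_def max_def abs_if split: if_splits)
        ultimately show "F' t \<le> F' (?d x) + e" using \<delta>0(2)[OF dr[of x], of t] by linarith
      qed
      also have "\<dots> \<le> (F' (?d x) + e) * norm w" using zw F(3)[of "?d x"] e by (intro mult_left_mono) auto
      finally show "\<bar>U (z + w) - U z\<bar> \<le> (F' (?d x) + e) * norm w" .
    qed
    finally show "\<bar>u (x + w) - u x\<bar> \<le> (F' (?d x) + e) * norm w" .
  qed
  have "{x. u x \<noteq> 0} \<subseteq> K" using u0 by (force simp: K_def)
  then have cl: "closure {x. u x \<noteq> 0} \<subseteq> K" using K(1) by (simp add: closure_minimal compact_imp_closed)
  then have "compact (closure {x. u x \<noteq> 0})"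
    using K(1) by (meson bounded_subset closed_closure compact_eq_bounded_closed)
  then have "u \<in> Cc_infinity \<Omega>" unfolding Cc_infinity_def using uC cl K(2) by auto
  then show ?thesis using that[of u] close u0 grad by (simp add: U_def)
qed

section \<open>Surface measure and boundary layers\<close>

definition slab :: "'a::euclidean_space \<Rightarrow> 'a set" where
  "slab \<nu> = {x. 0 \<le> x \<bullet> \<nu> \<and> x \<bullet> \<nu> \<le> 1}"

lemma closed_slab: "closed (slab \<nu>)"
proof -
  have "slab \<nu> = {x. 0 \<le> x \<bullet> \<nu>} \<inter> {x. x \<bullet> \<nu> \<le> 1}" by (auto simp: slab_def)
  then show ?thesis by (auto intro!: closed_Int closed_Collect_le continuous_intros)
qed

lemma slab_measurable [measurable]: "slab \<nu> \<in> sets borel"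
  by (rule borel_closed[OF closed_slab])

lemma nn_integral_lborel_shift:
  fixes f :: "'a::euclidean_space \<Rightarrow> ennreal"
  assumes [measurable]: "f \<in> borel_measurable borel"
  shows "(\<integral>\<^sup>+x. f (x + b) \<partial>lborel) = (\<integral>\<^sup>+x. f x \<partial>lborel)"
proof -
  have "(\<integral>\<^sup>+x. f x \<partial>lborel) = (\<integral>\<^sup>+x. f x \<partial>distr lborel borel ((+) b))" by (simp add: lborel_distr_plus)
  also have "\<dots> = (\<integral>\<^sup>+x. f (b + x) \<partial>lborel)" by (subst nn_integral_distr) auto
  finally show ?thesis by (simp add: add.commute)
qed

text \<open>Fubini along the direction \<open>\<nu>\<close> without choosing coordinates: only Tonelli and translation
  invariance are used.\<close>

lemma nn_integral_slab:
  fixes \<Theta> :: "'a::euclidean_space \<Rightarrow> ennreal"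
  assumes \<nu>: "norm \<nu> = 1" and [measurable]: "\<Theta> \<in> borel_measurable borel"
  shows "(\<integral>\<^sup>+x. \<Theta> x \<partial>lborel) = (\<integral>\<^sup>+x. indicator (slab \<nu>) x * (\<integral>\<^sup>+\<tau>. \<Theta> (x + \<tau> *\<^sub>R \<nu>) \<partial>lborel) \<partial>lborel)"
proof -
  have nn: "\<nu> \<bullet> \<nu> = 1" using \<nu> by (simp add: dot_square_norm)
  have "(\<integral>\<^sup>+x. indicator (slab \<nu>) x * (\<integral>\<^sup>+\<tau>. \<Theta> (x + \<tau> *\<^sub>R \<nu>) \<partial>(lborel :: real measure)) \<partial>lborel) =
      (\<integral>\<^sup>+x. (\<integral>\<^sup>+\<tau>. indicator (slab \<nu>) x * \<Theta> (x + \<tau> *\<^sub>R \<nu>) \<partial>(lborel :: real measure)) \<partial>lborel)"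
    by (intro nn_integral_cong nn_integral_cmult[symmetric]) simp
  also have "\<dots> = (\<integral>\<^sup>+\<tau>. (\<integral>\<^sup>+x. indicator (slab \<nu>) x * \<Theta> (x + \<tau> *\<^sub>R \<nu>) \<partial>lborel) \<partial>(lborel :: real measure))"
    by (rule lborel_pair.Fubini') simp
  also have "\<dots> = (\<integral>\<^sup>+\<tau>. (\<integral>\<^sup>+x. indicator (slab \<nu>) (x - \<tau> *\<^sub>R \<nu>) * \<Theta> x \<partial>lborel) \<partial>(lborel :: real measure))"
  proof (rule nn_integral_cong)
    fix \<tau> :: real
    have "(\<integral>\<^sup>+x. (\<lambda>x. indicator (slab \<nu>) (x - \<tau> *\<^sub>R \<nu>) * \<Theta> x) (x + \<tau> *\<^sub>R \<nu>) \<partial>lborel) =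
        (\<integral>\<^sup>+x. indicator (slab \<nu>) (x - \<tau> *\<^sub>R \<nu>) * \<Theta> x \<partial>lborel)"
      by (rule nn_integral_lborel_shift) measurable
    then show "(\<integral>\<^sup>+x. indicator (slab \<nu>) x * \<Theta> (x + \<tau> *\<^sub>R \<nu>) \<partial>lborel) =
        (\<integral>\<^sup>+x. indicator (slab \<nu>) (x - \<tau> *\<^sub>R \<nu>) * \<Theta> x \<partial>lborel)" by simp
  qed
  also have "\<dots> = (\<integral>\<^sup>+x. (\<integral>\<^sup>+\<tau>. indicator (slab \<nu>) (x - \<tau> *\<^sub>R \<nu>) * \<Theta> x \<partial>(lborel :: real measure)) \<partial>lborel)"
    by (rule lborel_pair.Fubini'[symmetric]) measurable
  also have "\<dots> = (\<integral>\<^sup>+x. \<Theta> x \<partial>lborel)"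
  proof (rule nn_integral_cong)
    fix x
    \<comment> \<open>Along every line in direction \<open>\<nu>\<close> the admissible parameters
      form an interval of length 1.\<close>
    have "(\<integral>\<^sup>+\<tau>. indicator (slab \<nu>) (x - \<tau> *\<^sub>R \<nu>) * \<Theta> x \<partial>(lborel :: real measure)) =
        (\<integral>\<^sup>+\<tau>. \<Theta> x * indicator {x \<bullet> \<nu> - 1 .. x \<bullet> \<nu>} \<tau> \<partial>(lborel :: real measure))"
      by (intro nn_integral_cong) (auto simp: slab_def indicator_def inner_diff_left nn)
    also have "\<dots> = \<Theta> x" by (subst nn_integral_cmult_indicator) auto
    finally show "(\<integral>\<^sup>+\<tau>. indicator (slab \<nu>) (x - \<tau> *\<^sub>R \<nu>) * \<Theta> x \<partial>(lborel :: real measure)) = \<Theta> x" .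
  qed
  finally show ?thesis by simp
qed

text \<open>The area formula of a chart as the image of a weighted volume on the slab under
  projection to the graph. Countable additivity is then automatic, and on boundary sets in the chart
  ball it is what \<open>is_surface_measure\<close> prescribes.\<close>

definition chart_measure :: "'a::euclidean_space \<Rightarrow> ('a \<Rightarrow> real) \<Rightarrow> 'a measure" where
  "chart_measure \<nu> \<gamma> =
    distr (density lborel (\<lambda>x. indicator (slab \<nu>) x * ennreal (norm (chart_grad \<nu> \<gamma> x)))) borel (chart_proj \<nu> \<gamma>)"

lemma sets_chart_measure [simp, measurable_cong]: "sets (chart_measure \<nu> \<gamma>) = sets borel"
  by (simp add: chart_measure_def)

context chart begin

lemma chart_measurable [measurable]: "P \<in> borel_measurable borel" "G \<in> borel_measurable borel" "a \<in> borel_measurable borel"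
  using continuous_on_P continuous_on_G continuous_on_a by (auto intro: borel_measurable_continuous_onI)

lemma nn_integral_chart_measure:
  assumes [measurable]: "f \<in> borel_measurable borel"
  shows "(\<integral>\<^sup>+x. f x \<partial>chart_measure \<nu> \<gamma>) = (\<integral>\<^sup>+x. indicator (slab \<nu>) x * (ennreal (norm (a x)) * f (P x)) \<partial>lborel)"
  unfolding chart_measure_def
  by (subst nn_integral_distr) (auto simp: nn_integral_density mult.assoc)

text \<open>Heights over the graph are measured in units of \<open>t\<close>. A layer of thickness
  of order \<open>t\<close> then occupies a range of \<open>\<theta>\<close> of order 1, which is
  the setting for a limit under the integral.\<close>

lemma nn_integral_chart_lines:
  fixes \<Theta> :: "'a \<Rightarrow> ennreal"
  assumes t: "t > 0" and [measurable]: "\<Theta> \<in> borel_measurable borel"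
  shows "(\<integral>\<^sup>+x. \<Theta> x \<partial>lborel) =
    ennreal t * (\<integral>\<^sup>+x. indicator (slab \<nu>) x * (\<integral>\<^sup>+\<theta>. \<Theta> (P x + (t * \<theta>) *\<^sub>R \<nu>) \<partial>lborel) \<partial>lborel)"
proof -
  have inner: "(\<integral>\<^sup>+\<tau>. \<Theta> (x + \<tau> *\<^sub>R \<nu>) \<partial>lborel) = ennreal t * (\<integral>\<^sup>+\<theta>. \<Theta> (P x + (t * \<theta>) *\<^sub>R \<nu>) \<partial>lborel)" for x
  proof -
    have "(\<integral>\<^sup>+\<tau>. \<Theta> (x + \<tau> *\<^sub>R \<nu>) \<partial>lborel) = \<bar>t\<bar> * (\<integral>\<^sup>+\<theta>. \<Theta> (x + (- G x + t * \<theta>) *\<^sub>R \<nu>) \<partial>lborel)"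
      by (rule nn_integral_real_affine) (use t in auto)
    then show ?thesis using t by (simp add: P_eq algebra_simps)
  qed
  have m: "(\<lambda>x. \<integral>\<^sup>+\<theta>. \<Theta> (P x + (t * \<theta>) *\<^sub>R \<nu>) \<partial>(lborel :: real measure)) \<in> borel_measurable lborel"
    by (rule lborel.borel_measurable_nn_integral) measurable
  have "(\<integral>\<^sup>+x. \<Theta> x \<partial>lborel) = (\<integral>\<^sup>+x. ennreal t * (indicator (slab \<nu>) x * (\<integral>\<^sup>+\<theta>. \<Theta> (P x + (t * \<theta>) *\<^sub>R \<nu>) \<partial>lborel)) \<partial>lborel)"
    unfolding nn_integral_slab[OF norm_\<nu> assms(2)] inner by (simp add: mult.left_commute)
  also have "\<dots> = ennreal t * (\<integral>\<^sup>+x. indicator (slab \<nu>) x * (\<integral>\<^sup>+\<theta>. \<Theta> (P x + (t * \<theta>) *\<^sub>R \<nu>) \<partial>lborel) \<partial>lborel)"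
    using m by (intro nn_integral_cmult) measurable
  finally show ?thesis .
qed

text \<open>Moving along \<open>\<nu>\<close> preserves the component orthogonal to
  \<open>\<nu>\<close>, and in the slab the other component is at most 1. Hence slab points that
  project into a bounded set are themselves bounded.\<close>

lemma slab_norm_le:
  assumes "x \<in> slab \<nu>"
  shows "norm x \<le> 2 * norm (x + t *\<^sub>R \<nu>) + 1"
proof -
  let ?z = "x + t *\<^sub>R \<nu>"
  have x: "x = ?z - (?z \<bullet> \<nu>) *\<^sub>R \<nu> + (x \<bullet> \<nu>) *\<^sub>R \<nu>" by (simp add: inner_add_left algebra_simps)
  have "norm (z - \<alpha> *\<^sub>R \<nu> + \<beta> *\<^sub>R \<nu>) \<le> norm z + \<bar>\<alpha>\<bar> + \<bar>\<beta>\<bar>" for z and \<alpha> \<beta> :: real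
    using norm_triangle_ineq[of "z - \<alpha> *\<^sub>R \<nu>" "\<beta> *\<^sub>R \<nu>"] norm_triangle_ineq4[of z "\<alpha> *\<^sub>R \<nu>"] by simp
  from this[of ?z "?z \<bullet> \<nu>" "x \<bullet> \<nu>"] have "norm x \<le> norm ?z + \<bar>?z \<bullet> \<nu>\<bar> + \<bar>x \<bullet> \<nu>\<bar>"
    unfolding x[symmetric] .
  moreover have "\<bar>?z \<bullet> \<nu>\<bar> \<le> norm ?z" using Cauchy_Schwarz_ineq2[of ?z \<nu>] by simp
  moreover have "\<bar>x \<bullet> \<nu>\<bar> \<le> 1" using assms by (simp add: slab_def)
  ultimately show ?thesis by simp
qed

lemma chart_measure_ball_finite: "emeasure (chart_measure \<nu> \<gamma>) (ball y r) < \<infinity>"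
proof -
  define R where "R = 2 * (norm y + r) + 1"
  have "compact ((\<lambda>x. norm (a x)) ` cball (0::'a) R)"
    by (intro compact_continuous_image continuous_intros continuous_on_a) simp
  then have "bounded ((\<lambda>x. norm (a x)) ` cball (0::'a) R)" by (rule compact_imp_bounded)
  then obtain M where M0: "M > 0" and "\<forall>v\<in>(\<lambda>x. norm (a x)) ` cball (0::'a) R. norm v \<le> M" unfolding bounded_pos by blast
  then have M: "norm (a x) \<le> M" if "x \<in> cball (0::'a) R" for x using that by force
  have "emeasure (chart_measure \<nu> \<gamma>) (ball y r) = (\<integral>\<^sup>+x. indicator (ball y r) x \<partial>chart_measure \<nu> \<gamma>)"
    by (subst nn_integral_indicator) auto
  also have "\<dots> = (\<integral>\<^sup>+x. indicator (slab \<nu>) x * (ennreal (norm (a x)) * indicator (ball y r) (P x)) \<partial>lborel)"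
    by (rule nn_integral_chart_measure, rule borel_measurable_indicator) simp
  also have "\<dots> \<le> (\<integral>\<^sup>+x. ennreal M * indicator (cball (0::'a) R) x \<partial>lborel)"
  proof (rule nn_integral_mono)
    fix x
    show "indicator (slab \<nu>) x * (ennreal (norm (a x)) * indicator (ball y r) (P x)) \<le> ennreal M * indicator (cball (0::'a) R) x"
    proof (cases "x \<in> slab \<nu> \<and> P x \<in> ball y r")
      case True
      then have "norm (P x) \<le> norm y + r" using norm_triangle_sub[of "P x" y] by (simp add: dist_norm norm_minus_commute)
      then have "x \<in> cball (0::'a) R" using slab_norm_le[of x "- G x"] True by (simp add: R_def P_eq)
      then show ?thesis using True M by (simp add: ennreal_leI)
    qed auto
  qed
  also have "\<dots> = ennreal M * emeasure lborel (cball (0::'a) R)" by (rule nn_integral_cmult_indicator) simp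
  also have "\<dots> < \<infinity>" using emeasure_bounded_finite[of "cball (0::'a) R"] by (simp add: ennreal_mult_less_top)
  finally show ?thesis .
qed

lemma G_lipschitz_ball:
  obtains L where "L \<ge> 1" "\<And>z w. z \<in> ball y r \<Longrightarrow> w \<in> ball y r \<Longrightarrow> \<bar>G z - G w\<bar> \<le> L * dist z w"
    "\<And>z. z \<in> ball y r \<Longrightarrow> norm (a z) \<le> L"
proof -
  have "compact ((\<lambda>x. norm (a x)) ` cball y r)"
    by (intro compact_continuous_image continuous_intros continuous_on_a) simp
  then have "bounded ((\<lambda>x. norm (a x)) ` cball y r)" by (rule compact_imp_bounded)
  then obtain M where "\<forall>v\<in>(\<lambda>x. norm (a x)) ` cball y r. norm v \<le> M" unfolding bounded_pos by blast
  then have M: "norm (a x) \<le> M" if "x \<in> ball y r" for x using that by force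
  have M1: "M \<ge> 1" using M[of y] norm_a_ge_1[of y] r_pos by simp
  have "norm (G z - G w) \<le> M * norm (z - w)" if "z \<in> ball y r" "w \<in> ball y r" for z w
  proof (rule differentiable_bound[where S="ball y r" and f'="\<lambda>x h. a x \<bullet> h"])
    show "(G has_derivative (\<lambda>h. a x \<bullet> h)) (at x within ball y r)" for x
      using G_deriv has_derivative_at_withinI by blast
    show "onorm (\<lambda>h. a x \<bullet> h) \<le> M" if "x \<in> ball y r" for x by (rule onorm_inner_le[OF M[OF that]])
  qed (use that in auto)
  then show ?thesis using that[OF M1] M by (simp add: dist_norm)
qed

text \<open>To first order a vertical height \<open>t * \<theta>\<close> corresponds to distance
  \<open>t * \<theta> / norm (a p)\<close>. If the ratio is below 1, a step of length
  \<open>t * s\<close> against the normal with \<open>s < 1\<close> leaves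
  \<open>\<Omega>\<close>.\<close>

lemma bdist_vertical_less:
  assumes p: "p \<in> ball y r" "G p = 0" and \<theta>: "\<theta> < norm (a p)"
  shows "eventually (\<lambda>t. bdist \<Omega> (p + (t * \<theta>) *\<^sub>R \<nu>) < t) (at_right 0)"
proof -
  let ?J = "norm (a p)"
  have J: "?J > 0" using norm_a_ge_1[of p] by linarith
  define q where "q = \<theta> / ?J"
  \<comment> \<open>A number strictly between \<open>q\<close> and 1; the lower limit 1/2 keeps it
    positive when \<open>\<theta>\<close> is negative.\<close>
  define s where "s = max (1/2) ((q + 1) / 2)"
  have "q < 1" using \<theta> J by (simp add: q_def)
  then have "s < 1" "s > q" "s > 0" by (auto simp: s_def max_def)
  then have s: "s < 1" "s > \<theta> / ?J" "s > 0" by (simp_all add: q_def)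
  have sJ: "\<theta> - s * ?J < 0" using s(2) J by (simp add: pos_divide_less_eq)
  define v where "v = \<theta> *\<^sub>R \<nu> - s *\<^sub>R N p"
  have "a p \<bullet> N p = ?J" by (subst a_eq) (simp add: dot_square_norm)
  then have av: "a p \<bullet> v < 0" using sJ by (simp add: v_def inner_diff_right)
  obtain e where e: "e > 0" "\<And>h. 0 < h \<Longrightarrow> h < e \<Longrightarrow> G (p + h *\<^sub>R v) < G p"
    using has_real_derivative_neg_dec_right[OF G_dir_deriv av] by auto
  have "eventually (\<lambda>t. G (p + t *\<^sub>R v) < 0) (at_right 0)"
    unfolding eventually_at_right_field using e p(2) by auto
  moreover have "((\<lambda>t. p + t *\<^sub>R v) \<longlongrightarrow> p + 0 *\<^sub>R v) (at_right 0)" by (intro tendsto_intros)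
  then have "eventually (\<lambda>t. p + t *\<^sub>R v \<in> ball y r) (at_right 0)"
    using p by (intro topological_tendstoD) auto
  moreover have "eventually (\<lambda>t. t > (0::real)) (at_right 0)" by (simp add: eventually_at_right_less)
  ultimately show ?thesis
  proof eventually_elim
    case (elim t)
    then have "p + t *\<^sub>R v \<notin> \<Omega>" using mem_iff by force
    then have "bdist \<Omega> (p + (t * \<theta>) *\<^sub>R \<nu>) \<le> dist (p + (t * \<theta>) *\<^sub>R \<nu>) (p + t *\<^sub>R v)" by (intro infdist_le) simp
    also have "\<dots> = norm ((t * s) *\<^sub>R N p)" by (simp add: dist_norm v_def algebra_simps)
    also have "\<dots> < t" using elim s by simp
    finally show ?case .
  qed
qed

text \<open>An exterior point \<open>w\<close> within distance \<open>t\<close> would have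
  first-order height at least \<open>t * (\<theta> - norm (a p))\<close>. The error of
  differentiability cannot make this nonpositive, contrary to \<open>G w \<le> 0\<close>.\<close>

lemma bdist_vertical_ge:
  assumes \<Omega>: "\<Omega> \<noteq> UNIV" and p: "p \<in> ball y r" "G p = 0" and \<theta>: "\<theta> > norm (a p)"
  shows "eventually (\<lambda>t. bdist \<Omega> (p + (t * \<theta>) *\<^sub>R \<nu>) \<ge> t) (at_right 0)"
proof -
  let ?J = "norm (a p)"
  have \<theta>0: "\<theta> > 0" using \<theta> norm_ge_zero[of "a p"] by linarith
  have C: "closed (- \<Omega>)" "- \<Omega> \<noteq> {}" using open_\<Omega> \<Omega> by auto
  \<comment> \<open>Points in question lie within \<open>t * (\<theta> + 1)\<close> of
    \<open>p\<close>, so this tolerance spends half of the margin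
    \<open>\<theta> - norm (a p)\<close>.\<close>
  define \<eta> where "\<eta> = (\<theta> - ?J) / (2 * (\<theta> + 1))"
  have "\<eta> * (\<theta> + 1) = (\<theta> - ?J) / 2" using \<theta>0 by (simp add: \<eta>_def field_simps)
  moreover have "(\<theta> - ?J) / 2 < \<theta> - ?J" using \<theta> by simp
  ultimately have "\<eta> * (\<theta> + 1) < \<theta> - ?J" by (simp only:)
  moreover have "\<eta> > 0" using \<theta> \<theta>0 by (simp add: \<eta>_def)
  ultimately have \<eta>: "\<eta> > 0" "\<eta> * (\<theta> + 1) < \<theta> - ?J" by blast+
  obtain e where e: "e > 0" "\<And>z. norm (z - p) < e \<Longrightarrow> norm (G z - G p - a p \<bullet> (z - p)) \<le> \<eta> * norm (z - p)"
    using G_deriv[of p, unfolded has_derivative_at_alt] \<eta>(1) by blast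
  define d where "d = min e (r - dist y p) / (\<theta> + 1)"
  have d: "d > 0" using e(1) p(1) \<theta>0 by (simp add: d_def)
  have "bdist \<Omega> (p + (t * \<theta>) *\<^sub>R \<nu>) \<ge> t" if t: "0 < t" "t < d" for t
  proof (rule ccontr)
    assume "\<not> bdist \<Omega> (p + (t * \<theta>) *\<^sub>R \<nu>) \<ge> t"
    moreover obtain w where w: "w \<in> - \<Omega>" "bdist \<Omega> (p + (t * \<theta>) *\<^sub>R \<nu>) = dist (p + (t * \<theta>) *\<^sub>R \<nu>) w"
      using nearest_point_exists[OF C] .
    ultimately have lt: "norm (p + (t * \<theta>) *\<^sub>R \<nu> - w) < t" by (simp add: dist_norm)
    define f where "f = p + (t * \<theta>) *\<^sub>R \<nu> - w"
    have wp: "w - p = (t * \<theta>) *\<^sub>R \<nu> - f" by (simp add: f_def)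
    have f: "norm f < t" using lt by (simp add: f_def)
    have "norm (w - p) \<le> t * \<theta> + norm f" unfolding wp
      using norm_triangle_ineq4[of "(t * \<theta>) *\<^sub>R \<nu>" f] t \<theta>0 by simp
    then have n: "norm (w - p) \<le> t * (\<theta> + 1)" using f by (simp add: distrib_left)
    also have "\<dots> < min e (r - dist y p)" using t \<theta>0 by (simp add: d_def pos_less_divide_eq)
    finally have n2: "norm (w - p) < e" "norm (w - p) < r - dist y p" by auto
    have "dist y w < r" using n2(2) dist_triangle[of y w p] by (simp add: dist_norm norm_minus_commute)
    then have "G w \<le> 0" using w(1) mem_iff[of w] by auto
    moreover have "G w \<ge> a p \<bullet> (w - p) - \<eta> * (t * (\<theta> + 1))"
    proof -
      have "\<eta> * norm (w - p) \<le> \<eta> * (t * (\<theta> + 1))" using n \<eta>(1) by simp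
      then show ?thesis using e(2)[OF n2(1)] p(2) by (simp add: abs_le_iff)
    qed
    moreover have "a p \<bullet> (w - p) \<ge> t * \<theta> - t * ?J"
    proof -
      have "\<bar>a p \<bullet> f\<bar> \<le> ?J * norm f" by (rule Cauchy_Schwarz_ineq2)
      also have "\<dots> \<le> ?J * t" using f by (intro mult_left_mono) auto
      finally show ?thesis unfolding wp by (simp add: inner_diff_right abs_le_iff mult.commute)
    qed
    moreover have "t * (\<eta> * (\<theta> + 1)) < t * (\<theta> - ?J)" using \<eta>(2) t by simp
    ultimately show False by (simp add: algebra_simps)
  qed
  then show ?thesis unfolding eventually_at_right_field using d by blast
qed

text \<open>Above a graph point \<open>p\<close> the layer of thickness \<open>t\<close> occupies,
  after rescaling, heights \<open>\<theta>\<close> tending to the interval from 0 to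
  \<open>norm (a p)\<close>. The length of this interval is the area density. Dominated convergence
  is used along each line and then across the slab.\<close>

lemma tube_limit:
  assumes \<Omega>: "\<Omega> \<noteq> UNIV" and k: "continuous_on UNIV k" "\<And>z. k z \<ge> 0"
    and S: "compact S" "S \<subseteq> ball y r" "\<And>z. z \<notin> S \<Longrightarrow> k z = 0"
    and t: "\<And>n. t n > 0" "t \<longlonglongrightarrow> (0::real)"
  shows "(\<lambda>n. ennreal (1 / t n) * (\<integral>\<^sup>+z. indicator (\<Omega> \<inter> {z. bdist \<Omega> z < t n}) z * ennreal (k z) \<partial>lborel))
    \<longlonglongrightarrow> (\<integral>\<^sup>+z. ennreal (k z) \<partial>chart_measure \<nu> \<gamma>)"
proof -
  let ?d = "bdist \<Omega>"
  have C: "closed (- \<Omega>)" "- \<Omega> \<noteq> {}" using open_\<Omega> \<Omega> by auto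
  have km [measurable]: "k \<in> borel_measurable borel" using k(1) by (rule borel_measurable_continuous_onI)
  have dm [measurable]: "?d \<in> borel_measurable borel"
    by (intro borel_measurable_continuous_onI continuous_intros)
  have Om [measurable]: "\<Omega> \<in> sets borel" using open_\<Omega> by simp
  define \<Theta> where "\<Theta> n z = indicator (\<Omega> \<inter> {z. ?d z < t n}) z * ennreal (k z)" for n z
  have \<Theta>m [measurable]: "\<Theta> n \<in> borel_measurable borel" for n
    unfolding \<Theta>_def[abs_def] by measurable
  obtain L where L: "L \<ge> 1" "\<And>z w. z \<in> ball y r \<Longrightarrow> w \<in> ball y r \<Longrightarrow> \<bar>G z - G w\<bar> \<le> L * dist z w"
    "\<And>z. z \<in> ball y r \<Longrightarrow> norm (a z) \<le> L" by (rule G_lipschitz_ball, rule that)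
  have "- ball y r \<noteq> {}"
  proof -
    have "y + (r + r) *\<^sub>R \<nu> \<in> - ball y r" using r_pos by (simp add: dist_norm)
    then show ?thesis by blast
  qed
  moreover have "S \<inter> - ball y r = {}" using S(2) by blast
  ultimately obtain \<rho> where \<rho>: "\<rho> > 0" "\<And>z. z \<in> S \<Longrightarrow> infdist z (- ball y r) \<ge> 2 * \<rho>"
    using compact_positive_distance[OF S(1), of "- ball y r"] by (metis closed_Compl open_ball)
  have "bounded (k ` S)"
    by (intro compact_imp_bounded compact_continuous_image S continuous_on_subset[OF k(1)]) auto
  then obtain M where M0: "M > 0" and "\<forall>v\<in>k ` S. norm v \<le> M" unfolding bounded_pos by blast
  then have M: "k z \<le> M" for z using S(3)[of z] k(2)[of z] by (cases "z \<in> S") force+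
  \<comment> \<open>Within a layer thinner than \<open>2 * \<rho>\<close> the nearest exterior point
    is still in the chart ball, so the Lipschitz bound for \<open>G\<close> limits the rescaled
    height by \<open>L\<close>. This supplies both dominating functions.\<close>
  have \<Theta>_supp: "z \<in> S \<and> 0 < \<theta> \<and> \<theta> \<le> L"
    if nz: "\<Theta> n z \<noteq> 0" and z: "z = P x + (t n * \<theta>) *\<^sub>R \<nu>" and tn: "t n < 2 * \<rho>" for n z x \<theta>
  proof -
    have zS: "z \<in> S" by (rule ccontr) (use nz S(3)[of z] in \<open>auto simp: \<Theta>_def\<close>)
    have zO: "z \<in> \<Omega>" "?d z < t n" using nz by (auto simp: \<Theta>_def indicator_def split: if_splits)
    have zb: "z \<in> ball y r" using zS S(2) by blast
    have Gz: "G z = t n * \<theta>" unfolding z by simp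
    then have \<theta>: "\<theta> > 0" using mem_iff[OF zb] zO t(1)[of n] by (simp add: zero_less_mult_iff)
    obtain w where w: "w \<in> - \<Omega>" "?d z = dist z w" using nearest_point_exists[OF C] .
    have wb: "w \<in> ball y r"
    proof (rule ccontr)
      assume "w \<notin> ball y r"
      then have "infdist z (- ball y r) \<le> dist z w" by (intro infdist_le) simp
      then show False using \<rho>(2)[OF zS] w(2) zO(2) tn by linarith
    qed
    have "G w \<le> 0" using mem_iff[OF wb] w(1) by auto
    then have "t n * \<theta> \<le> L * dist z w" using L(2)[OF zb wb] Gz by simp
    also have "\<dots> \<le> L * t n" using w(2) zO(2) L(1) by (intro mult_left_mono) auto
    finally have "\<theta> \<le> L" using t(1)[of n] by (simp add: mult.commute)
    then show ?thesis using zS \<theta> by blast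
  qed
  define R where "R = 2 * (norm y + r) + 1"
  have inner_lim: "(\<lambda>n. \<integral>\<^sup>+\<theta>. \<Theta> n (P x + (t n * \<theta>) *\<^sub>R \<nu>) \<partial>lborel) \<longlonglongrightarrow> ennreal (norm (a x)) * ennreal (k (P x))" for x
  proof -
    let ?p = "P x" let ?J = "norm (a x)"
    \<comment> \<open>The gradient of a function constant along \<open>\<nu>\<close> is constant
      along \<open>\<nu>\<close> too, so the density at the slab point is the one at its
      projection.\<close>
    have grad_P: "a (P x) = a x"
    proof -
      have "gradient \<gamma> (x + s *\<^sub>R \<nu>) = gradient \<gamma> x" for s
      proof (rule gradient_unique[symmetric])
        have "((\<lambda>z. \<gamma> (z + s *\<^sub>R \<nu>)) has_derivative (\<lambda>h. gradient \<gamma> (x + s *\<^sub>R \<nu>) \<bullet> h)) (at x)"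
          by (rule has_derivative_compose[OF _ \<gamma>_deriv]) (auto intro!: derivative_eq_intros)
        then show "(\<gamma> has_derivative (\<lambda>h. h \<bullet> gradient \<gamma> (x + s *\<^sub>R \<nu>))) (at x)"
          by (simp add: inner_commute)
      qed
      then show ?thesis unfolding P_eq chart_grad_def by metis
    qed
    have ev: "eventually (\<lambda>n. t n < 2 * \<rho>) sequentially" using order_tendstoD(2)[OF t(2)] \<rho>(1) by simp
    then obtain n0 where n0: "\<And>n. n \<ge> n0 \<Longrightarrow> t n < 2 * \<rho>" unfolding eventually_sequentially by blast
    have tr: "filterlim t (at_right 0) sequentially"
      unfolding filterlim_at using t by (auto simp: less_imp_neq[OF t(1), symmetric])
    have "(\<lambda>n. \<integral>\<^sup>+\<theta>. \<Theta> (n + n0) (?p + (t (n + n0) * \<theta>) *\<^sub>R \<nu>) \<partial>lborel) \<longlonglongrightarrow>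
        (\<integral>\<^sup>+\<theta>. ennreal (k ?p) * indicator {0<..<?J} \<theta> \<partial>(lborel :: real measure))"
    proof (rule nn_integral_dominated_convergence[where w="\<lambda>\<theta>. ennreal M * indicator {0..L} \<theta>"])
      show "(\<integral>\<^sup>+\<theta>. ennreal M * indicator {0..L} \<theta> \<partial>lborel) < \<infinity>"
        using L(1) by (subst nn_integral_cmult_indicator) (auto simp: ennreal_mult_less_top)
      show "AE \<theta> in lborel. \<Theta> (n + n0) (?p + (t (n + n0) * \<theta>) *\<^sub>R \<nu>) \<le> ennreal M * indicator {0..L} \<theta>" for n
      proof (rule AE_I2)
        fix \<theta>
        show "\<Theta> (n + n0) (?p + (t (n + n0) * \<theta>) *\<^sub>R \<nu>) \<le> ennreal M * indicator {0..L} \<theta>"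
        proof (cases "\<Theta> (n + n0) (?p + (t (n + n0) * \<theta>) *\<^sub>R \<nu>) = 0")
          case False
          from \<Theta>_supp[OF this refl n0] have "\<theta> \<in> {0..L}" by simp
          then show ?thesis using M by (auto simp: \<Theta>_def indicator_def intro: ennreal_leI)
        qed simp
      qed
      have "AE \<theta> in lborel. \<theta> \<noteq> ?J" by (rule AE_lborel_singleton)
      then show "AE \<theta> in lborel. (\<lambda>n. \<Theta> (n + n0) (?p + (t (n + n0) * \<theta>) *\<^sub>R \<nu>)) \<longlonglongrightarrow> ennreal (k ?p) * indicator {0<..<?J} \<theta>"
      proof eventually_elim
        case (elim \<theta>)
        have pl: "(\<lambda>n. ?p + (t n * \<theta>) *\<^sub>R \<nu>) \<longlonglongrightarrow> ?p + (0 * \<theta>) *\<^sub>R \<nu>" by (intro tendsto_intros t(2))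
        then have pl': "(\<lambda>n. ?p + (t n * \<theta>) *\<^sub>R \<nu>) \<longlonglongrightarrow> ?p" by simp
        have "isCont k ?p" using k(1) by (simp add: continuous_on_eq_continuous_at)
        then have kl: "(\<lambda>n. k (?p + (t n * \<theta>) *\<^sub>R \<nu>)) \<longlonglongrightarrow> k ?p" using pl' isCont_tendsto_compose by blast
        have "(\<lambda>n. \<Theta> n (?p + (t n * \<theta>) *\<^sub>R \<nu>)) \<longlonglongrightarrow> ennreal (k ?p) * indicator {0<..<?J} \<theta>"
        proof (cases "?p \<in> ball y r \<and> \<theta> > 0")
          case True
          then have p: "?p \<in> ball y r" and \<theta>: "\<theta> > 0" by auto
          have evb: "eventually (\<lambda>n. ?p + (t n * \<theta>) *\<^sub>R \<nu> \<in> ball y r) sequentially"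
            using p by (intro topological_tendstoD[OF pl']) auto
          consider "\<theta> < ?J" | "\<theta> > ?J" using elim by linarith
          then show ?thesis
          proof cases
            case 1
            have "eventually (\<lambda>s. ?d (?p + (s * \<theta>) *\<^sub>R \<nu>) < s) (at_right 0)"
              by (rule bdist_vertical_less[OF p]) (use 1 grad_P in auto)
            then have "eventually (\<lambda>n. ?d (?p + (t n * \<theta>) *\<^sub>R \<nu>) < t n) sequentially"
              using eventually_compose_filterlim[OF _ tr] by blast
            then have "eventually (\<lambda>n. ennreal (k (?p + (t n * \<theta>) *\<^sub>R \<nu>)) = \<Theta> n (?p + (t n * \<theta>) *\<^sub>R \<nu>)) sequentially"
              using evb
            proof eventually_elim
              case (elim n)
              then have "?p + (t n * \<theta>) *\<^sub>R \<nu> \<in> \<Omega>" using mem_iff t(1)[of n] \<theta> by simp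
              then show ?case using elim by (simp add: \<Theta>_def)
            qed
            moreover have "(\<lambda>n. ennreal (k (?p + (t n * \<theta>) *\<^sub>R \<nu>))) \<longlonglongrightarrow> ennreal (k ?p)"
              by (intro tendsto_ennrealI kl)
            ultimately have "(\<lambda>n. \<Theta> n (?p + (t n * \<theta>) *\<^sub>R \<nu>)) \<longlonglongrightarrow> ennreal (k ?p)"
              by (rule Lim_transform_eventually[rotated])
            then show ?thesis using 1 \<theta> by simp
          next
            case 2
            have "eventually (\<lambda>s. ?d (?p + (s * \<theta>) *\<^sub>R \<nu>) \<ge> s) (at_right 0)"
              by (rule bdist_vertical_ge[OF \<Omega> p]) (use 2 grad_P in auto)
            then have "eventually (\<lambda>n. ?d (?p + (t n * \<theta>) *\<^sub>R \<nu>) \<ge> t n) sequentially"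
              using eventually_compose_filterlim[OF _ tr] by blast
            then have "eventually (\<lambda>n. 0 = \<Theta> n (?p + (t n * \<theta>) *\<^sub>R \<nu>)) sequentially"
              by eventually_elim (simp add: \<Theta>_def)
            then have "(\<lambda>n. \<Theta> n (?p + (t n * \<theta>) *\<^sub>R \<nu>)) \<longlonglongrightarrow> 0"
              by (rule Lim_transform_eventually[OF tendsto_const])
            then show ?thesis using 2 by simp
          qed
        next
          case False
          \<comment> \<open>Outside the chart ball nothing is known about the layer. There
            \<open>k\<close> vanishes at the projected point, and continuity alone sends the
            integrand to 0.\<close>
          have zero: "ennreal (k ?p) * indicator {0<..<?J} \<theta> = 0"
          proof (cases "\<theta> > 0")
            case True
            then have "?p \<notin> S" using False S(2) by blast
            then show ?thesis using S(3) by simp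
          qed simp
          show ?thesis
          proof (cases "\<theta> > 0")
            case True
            then have "?p \<notin> S" using False S(2) by blast
            then have "k ?p = 0" by (rule S(3))
            then have kz: "(\<lambda>n. ennreal (k (?p + (t n * \<theta>) *\<^sub>R \<nu>))) \<longlonglongrightarrow> 0"
              using tendsto_ennrealI[OF kl] by simp
            have "(\<lambda>n. \<Theta> n (?p + (t n * \<theta>) *\<^sub>R \<nu>)) \<longlonglongrightarrow> 0"
              by (rule tendsto_sandwich[OF _ _ tendsto_const kz]) (auto simp: \<Theta>_def indicator_def)
            then show ?thesis unfolding zero .
          next
            case False
            have "eventually (\<lambda>n. 0 = \<Theta> n (?p + (t n * \<theta>) *\<^sub>R \<nu>)) sequentially"
              using ev by eventually_elim (use \<Theta>_supp[OF _ refl] False in force)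
            then have "(\<lambda>n. \<Theta> n (?p + (t n * \<theta>) *\<^sub>R \<nu>)) \<longlonglongrightarrow> 0"
              by (rule Lim_transform_eventually[OF tendsto_const])
            then show ?thesis unfolding zero .
          qed
        qed
        from LIMSEQ_ignore_initial_segment[OF this, of n0]
        show ?case .
      qed
    qed measurable
    moreover have "(\<integral>\<^sup>+\<theta>. ennreal (k ?p) * indicator {0<..<?J} \<theta> \<partial>(lborel :: real measure)) = ennreal ?J * ennreal (k ?p)"
      by (subst nn_integral_cmult_indicator) (auto simp: mult.commute)
    ultimately have "(\<lambda>n. \<integral>\<^sup>+\<theta>. \<Theta> (n + n0) (?p + (t (n + n0) * \<theta>) *\<^sub>R \<nu>) \<partial>lborel) \<longlonglongrightarrow> ennreal ?J * ennreal (k ?p)" by simp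
    then show ?thesis by (rule LIMSEQ_offset)
  qed
  obtain n0 where n0: "\<And>n. n \<ge> n0 \<Longrightarrow> t n < 2 * \<rho>"
    using order_tendstoD(2)[OF t(2), of "2 * \<rho>"] \<rho>(1) unfolding eventually_sequentially by auto
  define F where "F n x = indicator (slab \<nu>) x * (\<integral>\<^sup>+\<theta>. \<Theta> n (P x + (t n * \<theta>) *\<^sub>R \<nu>) \<partial>(lborel :: real measure))" for n x
  have [measurable]: "cball (0::'a) R \<in> sets borel" by simp
  have Fm [measurable]: "F n \<in> borel_measurable lborel" for n
  proof -
    have [measurable]: "(\<lambda>x. \<integral>\<^sup>+\<theta>. \<Theta> n (P x + (t n * \<theta>) *\<^sub>R \<nu>) \<partial>(lborel :: real measure)) \<in> borel_measurable lborel"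
      by (rule lborel.borel_measurable_nn_integral) measurable
    show ?thesis unfolding F_def[abs_def] by measurable
  qed
  have "(\<lambda>n. \<integral>\<^sup>+x. F (n + n0) x \<partial>lborel) \<longlonglongrightarrow>
      (\<integral>\<^sup>+x. indicator (slab \<nu>) x * (ennreal (norm (a x)) * ennreal (k (P x))) \<partial>lborel)"
  proof (rule nn_integral_dominated_convergence[where w="\<lambda>x. ennreal (M * L) * indicator (cball (0::'a) R) x"])
    show "(\<integral>\<^sup>+x. ennreal (M * L) * indicator (cball (0::'a) R) x \<partial>lborel) < \<infinity>"
      using emeasure_bounded_finite[of "cball (0::'a) R"]
      by (subst nn_integral_cmult_indicator) (auto simp: ennreal_mult_less_top)
    show "AE x in lborel. F (n + n0) x \<le> ennreal (M * L) * indicator (cball (0::'a) R) x" for n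
    proof (rule AE_I2)
      fix x
      let ?n = "n + n0"
      show "F ?n x \<le> ennreal (M * L) * indicator (cball (0::'a) R) x"
      proof (cases "x \<in> slab \<nu>")
        case True
        have "\<Theta> ?n (P x + (t ?n * \<theta>) *\<^sub>R \<nu>) \<le> ennreal M * indicator (cball (0::'a) R) x * indicator {0..L} \<theta>" for \<theta>
        proof (cases "\<Theta> ?n (P x + (t ?n * \<theta>) *\<^sub>R \<nu>) = 0")
          case False
          let ?z = "P x + (t ?n * \<theta>) *\<^sub>R \<nu>"
          from \<Theta>_supp[OF False refl n0] have z: "?z \<in> S" "\<theta> \<in> {0..L}" by auto
          have "norm ?z \<le> norm y + r" using S(2) z(1) norm_triangle_sub[of ?z y] by (force simp: dist_norm norm_minus_commute)
          moreover have "?z = x + (- G x + t ?n * \<theta>) *\<^sub>R \<nu>" by (simp add: P_eq algebra_simps)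
          ultimately have "x \<in> cball (0::'a) R" using slab_norm_le[OF True, of "- G x + t ?n * \<theta>"] by (simp add: R_def)
          then show ?thesis using z(2) M by (auto simp: \<Theta>_def indicator_def intro: ennreal_leI)
        qed simp
        then have "(\<integral>\<^sup>+\<theta>. \<Theta> ?n (P x + (t ?n * \<theta>) *\<^sub>R \<nu>) \<partial>lborel) \<le>
            (\<integral>\<^sup>+\<theta>. ennreal M * indicator (cball (0::'a) R) x * indicator {0..L} \<theta> \<partial>lborel)"
          by (intro nn_integral_mono)
        also have "\<dots> = ennreal M * indicator (cball (0::'a) R) x * ennreal L"
          using L(1) by (subst nn_integral_cmult_indicator) auto
        also have "\<dots> = ennreal (M * L) * indicator (cball (0::'a) R) x"
          using M0 L(1) by (simp add: ennreal_mult mult_ac)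
        finally show ?thesis using True by (simp add: F_def)
      qed (simp add: F_def)
    qed
    show "AE x in lborel. (\<lambda>n. F (n + n0) x) \<longlonglongrightarrow> indicator (slab \<nu>) x * (ennreal (norm (a x)) * ennreal (k (P x)))"
    proof (rule AE_I2)
      fix x
      show "(\<lambda>n. F (n + n0) x) \<longlonglongrightarrow> indicator (slab \<nu>) x * (ennreal (norm (a x)) * ennreal (k (P x)))"
        using LIMSEQ_ignore_initial_segment[OF inner_lim[of x], of n0]
        by (cases "x \<in> slab \<nu>") (simp_all add: F_def)
    qed
  qed measurable
  then have "(\<lambda>n. \<integral>\<^sup>+x. F n x \<partial>lborel) \<longlonglongrightarrow> (\<integral>\<^sup>+z. ennreal (k z) \<partial>chart_measure \<nu> \<gamma>)"
    by (subst nn_integral_chart_measure) (auto intro: LIMSEQ_offset)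
  moreover have "ennreal (1 / t n) * (\<integral>\<^sup>+z. \<Theta> n z \<partial>lborel) = (\<integral>\<^sup>+x. F n x \<partial>lborel)" for n
  proof -
    have "ennreal (1 / t n) * (\<integral>\<^sup>+z. \<Theta> n z \<partial>lborel) = ennreal (1 / t n) * ennreal (t n) * (\<integral>\<^sup>+x. F n x \<partial>lborel)"
      by (subst nn_integral_chart_lines[OF t(1)[of n]]) (auto simp: F_def[abs_def] mult.assoc)
    also have "ennreal (1 / t n) * ennreal (t n) = 1" using t(1)[of n] by (subst ennreal_mult[symmetric]) auto
    finally show ?thesis by simp
  qed
  ultimately show ?thesis by (simp add: \<Theta>_def)
qed

end

lemma (in chart) emeasure_chart_measure:
  assumes [measurable]: "A \<in> sets borel"
  shows "emeasure (chart_measure \<nu> \<gamma>) A =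
    (\<integral>\<^sup>+x\<in>{x. 0 \<le> x \<bullet> \<nu> \<and> x \<bullet> \<nu> \<le> 1}.
       ennreal (sqrt (1 + (norm (gradient \<gamma> x))\<^sup>2)) * indicator A (x + (\<gamma> x - x \<bullet> \<nu>) *\<^sub>R \<nu>) \<partial>lborel)"
proof -
  have "emeasure (chart_measure \<nu> \<gamma>) A = (\<integral>\<^sup>+x. indicator A x \<partial>chart_measure \<nu> \<gamma>)"
    by (subst nn_integral_indicator) auto
  also have "\<dots> = (\<integral>\<^sup>+x. indicator (slab \<nu>) x * (ennreal (norm (a x)) * indicator A (P x)) \<partial>lborel)"
    by (rule nn_integral_chart_measure) simp
  finally show ?thesis by (simp add: norm_a slab_def chart_proj_def mult_ac)
qed

lemma (in chart) emeasure_chart_measure_frontier: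
  assumes A: "A \<in> sets borel" "A \<subseteq> ball y r"
  shows "emeasure (chart_measure \<nu> \<gamma>) (A \<inter> frontier \<Omega>) = emeasure (chart_measure \<nu> \<gamma>) A"
proof -
  have F: "frontier \<Omega> \<in> sets borel" by (rule borel_closed[OF frontier_closed])
  have "indicator (A \<inter> frontier \<Omega>) (P x) = (indicator A (P x) :: ennreal)" for x
    using frontier_iff[of "P x"] A(2) by (auto simp: indicator_def)
  then show ?thesis
    using A(1) F by (subst (1 2) emeasure_chart_measure) (auto simp: chart_proj_def)
qed

text \<open>Restricting by the density \<open>indicator W\<close> makes the measures finite, after
  which the open sets form a generator closed under intersection.\<close>

lemma emeasure_eq_on_open_subset:
  fixes M N :: "'a::euclidean_space measure"
  assumes sets: "sets M = sets borel" "sets N = sets borel" and W: "open W"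
    and fin: "emeasure M W < \<infinity>"
    and eq: "\<And>U. open U \<Longrightarrow> U \<subseteq> W \<Longrightarrow> emeasure M U = emeasure N U"
    and A: "A \<in> sets borel" "A \<subseteq> W"
  shows "emeasure M A = emeasure N A"
proof -
  note [measurable_cong] = sets
  have Wm: "W \<in> sets M" "W \<in> sets N" using W sets by auto
  let ?M = "density M (indicator W)" and ?N = "density N (indicator W)"
  have em: "emeasure ?M X = emeasure M (W \<inter> X)" "emeasure ?N X = emeasure N (W \<inter> X)" if "X \<in> sets borel" for X
    using that Wm sets by (simp_all add: emeasure_restricted)
  have "?M = ?N"
  proof (rule measure_eqI_generator_eq[where E="{S. open S}" and \<Omega>=UNIV and A="\<lambda>_. UNIV"])
    show "Int_stable {S::'a set. open S}" by (auto simp: Int_stable_def)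
    show "emeasure ?M X = emeasure ?N X" if "X \<in> {S. open S}" for X
    proof -
      have "open (W \<inter> X)" using that W by auto
      then have "emeasure M (W \<inter> X) = emeasure N (W \<inter> X)" by (rule eq) simp
      then show ?thesis using that by (simp add: em)
    qed
    show "sets ?M = sigma_sets UNIV {S. open S}" "sets ?N = sigma_sets UNIV {S. open S}"
      by (simp_all add: sets borel_def)
    show "emeasure ?M ((\<lambda>_. UNIV) i) \<noteq> \<infinity>" for i :: nat using fin by (simp add: em)
  qed auto
  then have "emeasure ?M A = emeasure ?N A" by simp
  then show ?thesis using A by (simp add: em Int_absorb1)
qed

text \<open>Both chart measures are the limit of the same normalised volumes of thin layers, so no change
  of variables between charts is needed.\<close>

lemma chart_measures_agree:
  fixes \<Omega> :: "'a::euclidean_space set"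
  assumes "chart \<Omega> y1 r1 \<nu>1 \<gamma>1" "chart \<Omega> y2 r2 \<nu>2 \<gamma>2" and \<Omega>: "\<Omega> \<noteq> UNIV"
    and A: "A \<in> sets borel" "A \<subseteq> ball y1 r1" "A \<subseteq> ball y2 r2"
  shows "emeasure (chart_measure \<nu>1 \<gamma>1) A = emeasure (chart_measure \<nu>2 \<gamma>2) A"
proof -
  interpret c1: chart \<Omega> y1 r1 \<nu>1 \<gamma>1 by fact
  interpret c2: chart \<Omega> y2 r2 \<nu>2 \<gamma>2 by fact
  let ?W = "ball y1 r1 \<inter> ball y2 r2"
  have "emeasure (chart_measure \<nu>1 \<gamma>1) ?W \<le> emeasure (chart_measure \<nu>1 \<gamma>1) (ball y1 r1)"
    by (rule emeasure_mono) auto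
  then have fin: "emeasure (chart_measure \<nu>1 \<gamma>1) ?W < \<infinity>"
    using c1.chart_measure_ball_finite by (rule le_less_trans)
  show ?thesis
  proof (rule emeasure_eq_on_open_subset[OF _ _ _ fin])
    fix U assume U: "open U" "U \<subseteq> ?W"
    have bU: "bounded U" using U(2) bounded_subset[OF bounded_ball] by blast
    have nU: "U \<noteq> UNIV" using bU not_bounded_UNIV by auto
    have C: "closed (- U)" "- U \<noteq> {}" using U nU by auto
    \<comment> \<open>Continuous functions with compact support in \<open>U\<close> that increase to
      its indicator. They are the bridge from the layer limits, available for continuous integrands,
      to measures of open sets.\<close>
    define k where "k n x = min 1 (max 0 (real n * bdist U x - 1))" for n x
    have kc: "continuous_on UNIV (k n)" for n
      unfolding k_def[abs_def] by (intro continuous_intros)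
    have kint: "(\<integral>\<^sup>+z. ennreal (k (Suc n) z) \<partial>chart_measure \<nu>1 \<gamma>1) = (\<integral>\<^sup>+z. ennreal (k (Suc n) z) \<partial>chart_measure \<nu>2 \<gamma>2)" for n
    proof -
      let ?S = "{x. bdist U x \<ge> 1 / real (Suc n)}"
      have S: "compact ?S" "?S \<subseteq> U" using compact_superlevel_bdist[OF bU nU, of "1 / real (Suc n)"] by auto
      have S0: "k (Suc n) z = 0" if "z \<notin> ?S" for z
        using that by (simp add: k_def field_simps)
      have knn: "k (Suc n) z \<ge> 0" for z by (simp add: k_def)
      define t where "t m = 1 / real (Suc m)" for m
      have t: "t m > 0" "t \<longlonglongrightarrow> 0" for m unfolding t_def by (simp, rule LIMSEQ_Suc[OF lim_1_over_n])
      have Sb: "?S \<subseteq> ball y1 r1" "?S \<subseteq> ball y2 r2" using S(2) U(2) by auto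
      show ?thesis
        by (rule LIMSEQ_unique[OF c1.tube_limit[OF \<Omega> kc knn S(1) Sb(1) S0 t(1,2)] c2.tube_limit[OF \<Omega> kc knn S(1) Sb(2) S0 t(1,2)]])
    qed
    have lim: "(\<lambda>n. \<integral>\<^sup>+z. ennreal (k (Suc n) z) \<partial>M) \<longlonglongrightarrow> emeasure M U" if M: "sets M = sets borel" for M :: "'a measure"
    proof -
      have "(\<lambda>n. \<integral>\<^sup>+z. ennreal (k (Suc n) z) \<partial>M) \<longlonglongrightarrow> (\<integral>\<^sup>+z. indicator U z \<partial>M)"
      proof (rule nn_integral_LIMSEQ)
        show "incseq (\<lambda>n z. ennreal (k (Suc n) z))"
        proof (intro incseq_SucI le_funI ennreal_leI)
          fix n z
          have "real (Suc n) * bdist U z \<le> real (Suc (Suc n)) * bdist U z"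
            by (intro mult_right_mono infdist_nonneg) simp
          then show "k (Suc n) z \<le> k (Suc (Suc n)) z" unfolding k_def by linarith
        qed
        show "(\<lambda>z. ennreal (k (Suc n) z)) \<in> borel_measurable M" for n
        proof -
          have [measurable]: "k (Suc n) \<in> borel_measurable borel" using kc by (rule borel_measurable_continuous_onI)
          have [measurable_cong]: "sets M = sets borel" by (rule M)
          show ?thesis by measurable
        qed
        fix z
        show "(\<lambda>n. ennreal (k (Suc n) z)) \<longlonglongrightarrow> indicator U z"
        proof (cases "z \<in> U")
          case True
          then have dz: "bdist U z > 0" using infdist_pos_iff[OF C] by blast
          obtain m where m: "real m > 2 / bdist U z" using reals_Archimedean2 by blast
          have "k (Suc n) z = 1" if "n \<ge> m" for n
          proof -
            have "2 / bdist U z < real (Suc n)" using m that by simp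
            then have "2 < real (Suc n) * bdist U z" using dz by (simp only: pos_divide_less_eq)
            then show ?thesis unfolding k_def by linarith
          qed
          then have "eventually (\<lambda>n. 1 = ennreal (k (Suc n) z)) sequentially"
            unfolding eventually_sequentially by (intro exI[of _ m]) simp
          then have "(\<lambda>n. ennreal (k (Suc n) z)) \<longlonglongrightarrow> 1" by (rule Lim_transform_eventually[OF tendsto_const])
          then show ?thesis using True by simp
        next
          case False
          then have "k n z = 0" for n by (simp add: k_def)
          then show ?thesis using False by simp
        qed
      qed
      then show ?thesis using U(1) M by simp
    qed
    show "emeasure (chart_measure \<nu>1 \<gamma>1) U = emeasure (chart_measure \<nu>2 \<gamma>2) U"
      by (rule LIMSEQ_unique[OF lim]) (simp, use lim[of "chart_measure \<nu>2 \<gamma>2"] kint in simp)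
  qed (use A in auto)
qed

section \<open>The surface measure of a bounded domain\<close>

locale C2_domain =
  fixes \<Omega> :: "'a::euclidean_space set"
  assumes open_\<Omega>: "open \<Omega>" and ne_\<Omega>: "\<Omega> \<noteq> {}" and bounded_\<Omega>: "bounded \<Omega>" and C2: "C2_boundary \<Omega>"
begin

lemma not_UNIV: "\<Omega> \<noteq> UNIV"
  using bounded_\<Omega> not_bounded_UNIV by auto

lemma closed_Compl: "closed (- \<Omega>)" "- \<Omega> \<noteq> {}"
  using open_\<Omega> not_UNIV by auto

lemma compact_frontier: "compact (frontier \<Omega>)"
  using bounded_\<Omega> by (simp add: compact_frontier_bounded)

lemma frontier_ne: "frontier \<Omega> \<noteq> {}"
  using frontier_not_empty[OF ne_\<Omega> not_UNIV] .

text \<open>The boundary is covered by balls of a quarter of the chart radius, so that cut-offs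
  equal to 1 there can still be supported in half the chart ball.\<close>

lemma finite_atlas:
  obtains m :: nat and y r \<nu> \<gamma> where "\<And>j. j < m \<Longrightarrow> chart \<Omega> (y j) (r j) (\<nu> j) (\<gamma> j)" "\<And>j. j < m \<Longrightarrow> y j \<in> frontier \<Omega>"
    "frontier \<Omega> \<subseteq> (\<Union>j<m. ball (y j) (r j / 4))"
proof -
  have "\<forall>y\<in>frontier \<Omega>. \<exists>r \<nu> \<gamma>. chart \<Omega> y r \<nu> \<gamma>"
    using C2_boundary_chart[OF open_\<Omega> C2] by metis
  then obtain R V \<Gamma> where c: "\<And>y. y \<in> frontier \<Omega> \<Longrightarrow> chart \<Omega> y (R y) (V y) (\<Gamma> y)" by metis
  have "frontier \<Omega> \<subseteq> (\<Union>y\<in>frontier \<Omega>. ball y (R y / 4))"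
  proof
    fix y assume y: "y \<in> frontier \<Omega>"
    have "R y > 0" using chart.r_pos[OF c[OF y]] .
    then show "y \<in> (\<Union>y\<in>frontier \<Omega>. ball y (R y / 4))" using y by force
  qed
  then obtain F where F: "F \<subseteq> frontier \<Omega>" "finite F" "frontier \<Omega> \<subseteq> (\<Union>y\<in>F. ball y (R y / 4))"
    using compactE_image[OF compact_frontier, of "frontier \<Omega>" "\<lambda>y. ball y (R y / 4)"] by auto
  obtain f where f: "bij_betw f {0..<card F} F" using ex_bij_betw_nat_finite[OF F(2)] by blast
  have fF: "f j \<in> F" if "j < card F" for j using f that by (auto simp: bij_betw_def)
  show ?thesis
  proof (rule that[of "card F" f "R \<circ> f" "V \<circ> f" "\<Gamma> \<circ> f"])
    show "chart \<Omega> (f j) ((R \<circ> f) j) ((V \<circ> f) j) ((\<Gamma> \<circ> f) j)" "f j \<in> frontier \<Omega>" if "j < card F" for j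
      using c fF[OF that] F(1) by auto
    have "(\<Union>j<card F. ball (f j) ((R \<circ> f) j / 4)) = (\<Union>y\<in>f ` {..<card F}. ball y (R y / 4))" by auto
    also have "f ` {..<card F} = F" using f by (simp add: bij_betw_def lessThan_atLeast0)
    finally show "frontier \<Omega> \<subseteq> (\<Union>j<card F. ball (f j) ((R \<circ> f) j / 4))" using F(3) by simp
  qed
qed

text \<open>The boundary is cut into disjoint Borel pieces, each inside one chart ball, and the
  chart measures are added. Agreement of chart measures on overlaps gives the formula in every other
  chart. Since these formulas determine the measure on each piece, it is unique.\<close>

lemma surface_measure_exists:
  obtains \<sigma> where "is_surface_measure \<Omega> \<sigma>" "emeasure \<sigma> UNIV < \<infinity>"
    "\<And>\<sigma>'. is_surface_measure \<Omega> \<sigma>' \<Longrightarrow> \<sigma>' = \<sigma>"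
proof -
  obtain m :: nat and y r \<nu> \<gamma> where ch: "\<And>j. j < m \<Longrightarrow> chart \<Omega> (y j) (r j) (\<nu> j) (\<gamma> j)"
    and yf: "\<And>j. j < m \<Longrightarrow> y j \<in> frontier \<Omega>" and cov: "frontier \<Omega> \<subseteq> (\<Union>j<m. ball (y j) (r j / 4))"
    by (rule finite_atlas, rule that)
  have rp: "r j > 0" if "j < m" for j using chart.r_pos[OF ch[OF that]] .
  let ?B = "\<lambda>j. ball (y j) (r j)"
  \<comment> \<open>Each boundary point is assigned to the first chart ball that contains
    it.\<close>
  define D where "D j = (frontier \<Omega> \<inter> ?B j) - (\<Union>i<j. ?B i)" for j
  have Fm [measurable]: "frontier \<Omega> \<in> sets borel" by (rule borel_closed[OF frontier_closed])
  have Dm [measurable]: "D j \<in> sets borel" for j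
    unfolding D_def using Fm by (intro sets.Diff sets.Int sets.finite_UN) auto
  have Dsub: "D j \<subseteq> frontier \<Omega>" "D j \<subseteq> ?B j" for j by (auto simp: D_def)
  have disj: "disjoint_family_on D {..<m}"
  proof -
    have "D i \<inter> D j = {}" if "i < j" for i j using that by (auto simp: D_def)
    then show ?thesis unfolding disjoint_family_on_def by (metis Int_commute linorder_neqE_nat)
  qed
  have DU: "(\<Union>j<m. D j) = frontier \<Omega>"
  proof
    show "frontier \<Omega> \<subseteq> (\<Union>j<m. D j)"
    proof
      fix p assume p: "p \<in> frontier \<Omega>"
      then obtain j where "j < m" "p \<in> ball (y j) (r j / 4)" using cov by auto
      then have ex: "j < m \<and> p \<in> ?B j" using rp[of j] by auto
      define l where "l = (LEAST j. j < m \<and> p \<in> ?B j)"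
      have l: "l < m \<and> p \<in> ?B l" unfolding l_def by (rule LeastI[of _ j]) (rule ex)
      have "p \<notin> ?B i" if "i < l" for i using not_less_Least[of i "\<lambda>j. j < m \<and> p \<in> ?B j"] that l by (auto simp: l_def)
      then show "p \<in> (\<Union>j<m. D j)" using l p by (auto simp: D_def)
    qed
  qed (use Dsub in auto)
  let ?s = "\<lambda>j. chart_measure (\<nu> j) (\<gamma> j)"
  define \<mu> where "\<mu> A = (\<Sum>j<m. emeasure (?s j) (A \<inter> D j))" for A
  define \<sigma> where "\<sigma> = measure_of UNIV (sets borel) \<mu>"
  have sets_\<sigma>: "sets \<sigma> = sets borel" unfolding \<sigma>_def using sets.sets_measure_of_eq[of borel] by simp
  have em: "emeasure \<sigma> A = \<mu> A" if A: "A \<in> sets borel" for A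
  proof (rule emeasure_measure_of[OF \<sigma>_def])
    show "positive (sets \<sigma>) \<mu>" by (simp add: positive_def \<mu>_def)
    show "countably_additive (sets \<sigma>) \<mu>"
    proof (rule countably_additiveI)
      fix X :: "nat \<Rightarrow> 'a set" assume X: "range X \<subseteq> sets \<sigma>" "disjoint_family X"
      have Xm: "X n \<in> sets borel" for n using X(1) sets_\<sigma> by auto
      have "(\<Sum>n. \<mu> (X n)) = (\<Sum>j<m. \<Sum>n. emeasure (?s j) (X n \<inter> D j))"
        unfolding \<mu>_def by (rule suminf_sum) simp
      also have "\<dots> = (\<Sum>j<m. emeasure (?s j) (\<Union>n. X n \<inter> D j))"
      proof (intro sum.cong refl suminf_emeasure)
        fix j
        show "range (\<lambda>n. X n \<inter> D j) \<subseteq> sets (?s j)" using Xm Dm by auto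
        show "disjoint_family (\<lambda>n. X n \<inter> D j)" using X(2) by (auto simp: disjoint_family_on_def)
      qed
      also have "\<dots> = \<mu> (\<Union>n. X n)" by (simp add: \<mu>_def)
      finally show "(\<Sum>n. \<mu> (X n)) = \<mu> (\<Union>n. X n)" .
    qed
  qed (use A sets_\<sigma> in auto)
  have loc: "emeasure \<sigma> A = emeasure (chart_measure \<nu>' \<gamma>') A"
    if c: "chart \<Omega> y' r' \<nu>' \<gamma>'" and A: "A \<in> sets borel" "A \<subseteq> frontier \<Omega> \<inter> ball y' r'" for y' r' \<nu>' \<gamma>' A
  proof -
    have "emeasure \<sigma> A = (\<Sum>j<m. emeasure (chart_measure \<nu>' \<gamma>') (A \<inter> D j))"
      unfolding em[OF A(1)] \<mu>_def
    proof (rule sum.cong[OF refl])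
      fix j assume "j \<in> {..<m}"
      then have cj: "chart \<Omega> (y j) (r j) (\<nu> j) (\<gamma> j)" using ch by simp
      show "emeasure (?s j) (A \<inter> D j) = emeasure (chart_measure \<nu>' \<gamma>') (A \<inter> D j)"
        by (rule chart_measures_agree[OF cj c not_UNIV]) (use A Dsub(2)[of j] in auto)
    qed
    also have "\<dots> = emeasure (chart_measure \<nu>' \<gamma>') (\<Union>j<m. A \<inter> D j)"
    proof (rule sum_emeasure)
      show "disjoint_family_on (\<lambda>j. A \<inter> D j) {..<m}" using disj by (auto simp: disjoint_family_on_def)
    qed (use A in auto)
    also have "(\<Union>j<m. A \<inter> D j) = A" using A(2) DU by auto
    finally show ?thesis .
  qed
  have chI: "chart \<Omega> y' r' \<nu>' \<gamma>'" if "graph_chart \<Omega> y' r' \<nu>' \<gamma>'" for y' r' \<nu>' \<gamma>'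
    using that open_\<Omega> by unfold_locales
  show ?thesis
  proof (rule that[of \<sigma>])
    show "is_surface_measure \<Omega> \<sigma>"
      unfolding is_surface_measure_def
    proof (intro conjI ballI allI impI)
      show "sets \<sigma> = sets borel" by (rule sets_\<sigma>)
      have "(- frontier \<Omega>) \<inter> D j = {}" for j using Dsub(1) by auto
      then show "emeasure \<sigma> (- frontier \<Omega>) = 0" using Fm by (subst em) (auto simp: \<mu>_def)
      fix y' r' \<nu>' \<gamma>' A
      assume g: "graph_chart \<Omega> y' r' \<nu>' \<gamma>'" and A: "A \<in> sets borel" "A \<subseteq> frontier \<Omega> \<inter> ball y' r'"
      show "emeasure \<sigma> A = (\<integral>\<^sup>+x\<in>{x. 0 \<le> x \<bullet> \<nu>' \<and> x \<bullet> \<nu>' \<le> 1}.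
           ennreal (sqrt (1 + (norm (gradient \<gamma>' x))\<^sup>2)) * indicator A (x + (\<gamma>' x - x \<bullet> \<nu>') *\<^sub>R \<nu>') \<partial>lborel)"
        using loc[OF chI[OF g] A] chart.emeasure_chart_measure[OF chI[OF g] A(1)] by simp
    qed
    have "emeasure (?s j) (UNIV \<inter> D j) < \<infinity>" if "j < m" for j
    proof -
      have "emeasure (?s j) (UNIV \<inter> D j) \<le> emeasure (?s j) (?B j)"
        by (rule emeasure_mono) (use Dsub(2) in auto)
      also have "\<dots> < \<infinity>" by (rule chart.chart_measure_ball_finite[OF ch[OF that]])
      finally show ?thesis .
    qed
    then show "emeasure \<sigma> UNIV < \<infinity>" by (subst em) (auto simp: \<mu>_def)
    fix \<sigma>' assume s': "is_surface_measure \<Omega> \<sigma>'"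
    have sets': "sets \<sigma>' = sets borel" using s' by (simp add: is_surface_measure_def)
    show "\<sigma>' = \<sigma>"
    proof (rule measure_eqI)
      show "sets \<sigma>' = sets \<sigma>" by (simp add: sets' sets_\<sigma>)
      fix A assume "A \<in> sets \<sigma>'"
      then have A: "A \<in> sets borel" by (simp add: sets')
      have n: "emeasure \<sigma>' (A - frontier \<Omega>) = 0"
      proof -
        have "emeasure \<sigma>' (A - frontier \<Omega>) \<le> emeasure \<sigma>' (- frontier \<Omega>)"
          by (rule emeasure_mono) (use Fm sets' in auto)
        then show ?thesis using s' by (simp add: is_surface_measure_def)
      qed
      have "emeasure \<sigma>' A = emeasure \<sigma>' (A \<inter> frontier \<Omega>) + emeasure \<sigma>' (A - frontier \<Omega>)"
        by (subst plus_emeasure) (use A Fm sets' in \<open>auto simp: Int_Diff_Un\<close>)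
      also have "\<dots> = emeasure \<sigma>' (\<Union>j<m. A \<inter> D j)"
        unfolding n using DU by (simp add: UN_extend_simps)
      also have "\<dots> = (\<Sum>j<m. emeasure \<sigma>' (A \<inter> D j))"
      proof (rule sum_emeasure[symmetric])
        show "disjoint_family_on (\<lambda>j. A \<inter> D j) {..<m}" using disj by (auto simp: disjoint_family_on_def)
        show "(\<lambda>j. A \<inter> D j) ` {..<m} \<subseteq> sets \<sigma>'" unfolding sets' using A by auto
      qed simp
      also have "\<dots> = (\<Sum>j<m. emeasure (?s j) (A \<inter> D j))"
      proof (rule sum.cong[OF refl])
        fix j assume "j \<in> {..<m}"
        then have j: "j < m" by simp
        have "graph_chart \<Omega> (y j) (r j) (\<nu> j) (\<gamma> j)" using ch[OF j] by (simp add: chart_def)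
        moreover have "A \<inter> D j \<in> sets borel" "A \<inter> D j \<subseteq> frontier \<Omega> \<inter> ball (y j) (r j)"
          using A Dsub[of j] by auto
        ultimately have "emeasure \<sigma>' (A \<inter> D j) = (\<integral>\<^sup>+x\<in>{x. 0 \<le> x \<bullet> \<nu> j \<and> x \<bullet> \<nu> j \<le> 1}.
           ennreal (sqrt (1 + (norm (gradient (\<gamma> j) x))\<^sup>2)) * indicator (A \<inter> D j) (x + (\<gamma> j x - x \<bullet> \<nu> j) *\<^sub>R \<nu> j) \<partial>lborel)"
          using s' yf[OF j] unfolding is_surface_measure_def by blast
        then show "emeasure \<sigma>' (A \<inter> D j) = emeasure (?s j) (A \<inter> D j)"
          using chart.emeasure_chart_measure[OF ch[OF j], of "A \<inter> D j"] A by simp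
      qed
      also have "\<dots> = emeasure \<sigma> A" by (simp add: em[OF A] \<mu>_def)
      finally show "emeasure \<sigma>' A = emeasure \<sigma> A" .
    qed
  qed
qed

abbreviation "\<sigma> \<equiv> surface_measure \<Omega>"

lemma surface_measure: "is_surface_measure \<Omega> \<sigma>" and surface_measure_finite: "emeasure \<sigma> UNIV < \<infinity>"
proof -
  obtain \<sigma>' where s: "is_surface_measure \<Omega> \<sigma>'" "emeasure \<sigma>' UNIV < \<infinity>"
    "\<And>\<sigma>''. is_surface_measure \<Omega> \<sigma>'' \<Longrightarrow> \<sigma>'' = \<sigma>'"
    by (rule surface_measure_exists, rule that)
  have "\<sigma> = \<sigma>'" unfolding surface_measure_def using s(1,3) by (rule the_equality)
  then show "is_surface_measure \<Omega> \<sigma>" "emeasure \<sigma> UNIV < \<infinity>" using s(1,2) by simp_all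
qed

lemma sets_surface_measure [simp, measurable_cong]: "sets \<sigma> = sets borel"
  and surface_measure_null: "emeasure \<sigma> (- frontier \<Omega>) = 0"
  using surface_measure by (auto simp: is_surface_measure_def)

lemma frontier_borel [measurable]: "frontier \<Omega> \<in> sets borel"
  by (rule borel_closed[OF frontier_closed])

lemma AE_frontier: "AE x in \<sigma>. x \<in> frontier \<Omega>"
  by (rule AE_I[where N="- frontier \<Omega>"]) (auto simp: surface_measure_null)

lemma emeasure_surface_measure_chart:
  assumes c: "chart \<Omega> y r \<nu> \<gamma>" "y \<in> frontier \<Omega>" and A: "A \<in> sets borel" "A \<subseteq> frontier \<Omega> \<inter> ball y r"
  shows "emeasure \<sigma> A = emeasure (chart_measure \<nu> \<gamma>) A"
proof -
  interpret c: chart \<Omega> y r \<nu> \<gamma> by fact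
  show ?thesis
    unfolding c.emeasure_chart_measure[OF A(1)]
    using surface_measure c(2) c.graph_chart A unfolding is_surface_measure_def by blast
qed

text \<open>The chart measure is global and may charge sets outside the chart ball, where it has no
  relation to \<open>\<sigma>\<close>. Requiring \<open>k\<close> to vanish there allows both
  measures to be restricted to the ball.\<close>

lemma nn_integral_surface_measure:
  assumes c: "chart \<Omega> y r \<nu> \<gamma>" "y \<in> frontier \<Omega>" and k: "k \<in> borel_measurable borel" "\<And>z. z \<notin> ball y r \<Longrightarrow> k z = (0::ennreal)"
  shows "(\<integral>\<^sup>+z. k z \<partial>\<sigma>) = (\<integral>\<^sup>+z. k z \<partial>chart_measure \<nu> \<gamma>)"
proof -
  interpret c: chart \<Omega> y r \<nu> \<gamma> by fact
  note [measurable] = k(1)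
  have sp: "space \<sigma> = UNIV" using sets_eq_imp_space_eq[OF sets_surface_measure] by simp
  have eq: "density \<sigma> (indicator (ball y r)) = density (chart_measure \<nu> \<gamma>) (indicator (ball y r))"
  proof (rule measure_eqI)
    fix X assume "X \<in> sets (density \<sigma> (indicator (ball y r)))"
    then have X: "X \<in> sets borel" by simp
    let ?A = "ball y r \<inter> X"
    have A: "?A \<in> sets borel" using X by simp
    have "emeasure \<sigma> ?A = emeasure \<sigma> (?A \<inter> frontier \<Omega>) + emeasure \<sigma> (?A - frontier \<Omega>)"
      by (subst plus_emeasure) (use A in \<open>auto simp: Int_Diff_Un\<close>)
    also have "emeasure \<sigma> (?A - frontier \<Omega>) = 0"
    proof -
      have "emeasure \<sigma> (?A - frontier \<Omega>) \<le> emeasure \<sigma> (- frontier \<Omega>)" by (rule emeasure_mono) auto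
      then show ?thesis by (simp add: surface_measure_null)
    qed
    also have "emeasure \<sigma> (?A \<inter> frontier \<Omega>) = emeasure (chart_measure \<nu> \<gamma>) (?A \<inter> frontier \<Omega>)"
    proof -
      have "?A \<inter> frontier \<Omega> \<in> sets borel" "?A \<inter> frontier \<Omega> \<subseteq> frontier \<Omega> \<inter> ball y r" using A by auto
      then show ?thesis by (rule emeasure_surface_measure_chart[OF c])
    qed
    also have "\<dots> = emeasure (chart_measure \<nu> \<gamma>) ?A" by (rule c.emeasure_chart_measure_frontier) (use A in auto)
    finally show "emeasure (density \<sigma> (indicator (ball y r))) X = emeasure (density (chart_measure \<nu> \<gamma>) (indicator (ball y r))) X"
      using X by (simp add: emeasure_restricted)
  qed simp
  have ki: "k z = indicator (ball y r) z * k z" for z using k(2)[of z] by (cases "z \<in> ball y r") auto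
  have m: "indicator (ball y r) \<in> borel_measurable M" if "sets M = sets borel" for M :: "'a measure"
    by (rule borel_measurable_indicator) (simp add: that)
  have "(\<integral>\<^sup>+z. k z \<partial>\<sigma>) = (\<integral>\<^sup>+z. k z \<partial>density \<sigma> (indicator (ball y r)))"
    by (subst nn_integral_density) (auto simp: m simp flip: ki)
  also have "\<dots> = (\<integral>\<^sup>+z. k z \<partial>chart_measure \<nu> \<gamma>)"
    unfolding eq by (subst nn_integral_density) (auto simp: m simp flip: ki)
  finally show ?thesis .
qed

end

section \<open>Partition of unity and limits of layer integrals\<close>

definition plateau :: "'a::euclidean_space \<Rightarrow> real \<Rightarrow> 'a \<Rightarrow> real" where
  "plateau y r x = 1 - step (2 / (r / 2)\<^sup>2 * (norm (x - y))\<^sup>2 - 1)"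

lemma plateau_props:
  assumes r: "r > 0"
  shows "C_diff 2 (plateau y r)" "0 \<le> plateau y r x" "plateau y r x \<le> 1"
    "x \<in> ball y (r / 4) \<Longrightarrow> plateau y r x = 1" "x \<notin> cball y (r / 2) \<Longrightarrow> plateau y r x = 0"
proof -
  show "C_diff 2 (plateau y r)"
    unfolding plateau_def[abs_def]
    by (intro C_diff_diff C_diff_const C_diff_compose[OF C_diff_step] C_diff_mult C_diff_norm_power2)
  show "0 \<le> plateau y r x" "plateau y r x \<le> 1" using step_props by (auto simp: plateau_def)
  let ?q = "(norm (x - y))\<^sup>2 / (r / 2)\<^sup>2"
  have eq: "2 / (r / 2)\<^sup>2 * (norm (x - y))\<^sup>2 - 1 = 2 * ?q - 1" by simp
  show "plateau y r x = 1" if "x \<in> ball y (r / 4)"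
  proof -
    have "(norm (x - y))\<^sup>2 \<le> (r / 4)\<^sup>2" using that by (intro power_mono) (auto simp: dist_norm norm_minus_commute)
    also have "\<dots> = 1 / 4 * (r / 2)\<^sup>2" by (simp add: power_divide)
    finally have "?q \<le> 1 / 4" using r by (subst pos_divide_le_eq) auto
    then have "2 * ?q - 1 \<le> 0" by linarith
    then show ?thesis unfolding plateau_def eq using step_props(1) by simp
  qed
  show "plateau y r x = 0" if "x \<notin> cball y (r / 2)"
  proof -
    have "(r / 2)\<^sup>2 \<le> (norm (x - y))\<^sup>2" using that r by (intro power_mono) (auto simp: dist_norm norm_minus_commute)
    then have "1 \<le> ?q" using r by (subst pos_le_divide_eq) auto
    then have "2 * ?q - 1 \<ge> 1" by linarith
    then show ?thesis unfolding plateau_def eq using step_props(2) by simp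
  qed
qed

text \<open>The ordered products turn cut-offs into functions whose sum misses 1 only by the product
  of all \<open>1 - \<theta> i\<close>. That product vanishes wherever one cut-off equals 1.\<close>

lemma sum_prod_telescope:
  fixes \<theta> :: "nat \<Rightarrow> real"
  shows "(\<Sum>j<m. \<theta> j * (\<Prod>i<j. 1 - \<theta> i)) = 1 - (\<Prod>i<m. 1 - \<theta> i)"
  by (induction m) (auto simp: algebra_simps)

context C2_domain begin

lemma frontier_neighbourhood:
  assumes "open V" "frontier \<Omega> \<subseteq> V"
  obtains \<delta> where "\<delta> > 0" "\<And>x. x \<in> \<Omega> \<Longrightarrow> bdist \<Omega> x < \<delta> \<Longrightarrow> x \<in> V"
proof (cases "V = UNIV")
  case True
  then show ?thesis using that[of 1] by simp
next
  case False
  then have V: "closed (- V)" "- V \<noteq> {}" "frontier \<Omega> \<inter> - V = {}" using assms by auto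
  obtain \<delta> where \<delta>: "\<delta> > 0" "\<And>p. p \<in> frontier \<Omega> \<Longrightarrow> infdist p (- V) \<ge> 2 * \<delta>"
    using compact_positive_distance[OF compact_frontier V] by metis
  show ?thesis
  proof (rule that[OF \<delta>(1)])
    fix x assume x: "x \<in> \<Omega>" "bdist \<Omega> x < \<delta>"
    obtain p where p: "p \<in> - \<Omega>" "bdist \<Omega> x = dist x p" using nearest_point_exists[OF closed_Compl] .
    have "p \<in> frontier \<Omega>" using nearest_point_frontier[OF open_\<Omega> x(1) _ p(2)] p(1) by simp
    then have "infdist p (- V) \<ge> 2 * \<delta>" by (rule \<delta>(2))
    moreover have "infdist p (- V) \<le> dist p x" if "x \<notin> V" using that by (intro infdist_le) simp
    ultimately show "x \<in> V" using p(2) x(2) \<delta>(1) by (cases "x \<in> V") (auto simp: dist_commute)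
  qed
qed

text \<open>The sum is 1 on an open neighbourhood of the boundary and not merely on it; therefore
  the gradients of the summands cancel at boundary points.\<close>

lemma partition_atlas:
  obtains m :: nat and y r \<nu> \<gamma> \<psi> V where "\<And>j. j < m \<Longrightarrow> chart \<Omega> (y j) (r j) (\<nu> j) (\<gamma> j)" "\<And>j. j < m \<Longrightarrow> y j \<in> frontier \<Omega>"
    "\<And>j. j < m \<Longrightarrow> C_diff 2 (\<psi> j)" "\<And>j x. j < m \<Longrightarrow> \<psi> j x \<ge> 0" "\<And>j x. j < m \<Longrightarrow> \<psi> j x \<le> 1"
    "\<And>j x. j < m \<Longrightarrow> x \<notin> cball (y j) (r j / 2) \<Longrightarrow> \<psi> j x = 0"
    "open V" "frontier \<Omega> \<subseteq> V" "\<And>x. x \<in> V \<Longrightarrow> (\<Sum>j<m. \<psi> j x) = (1::real)"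
    "\<And>x. (\<Sum>j<m. \<psi> j x) \<ge> 0" "\<And>x. (\<Sum>j<m. \<psi> j x) \<le> 1"
proof -
  obtain m :: nat and y r \<nu> \<gamma> where ch: "\<And>j. j < m \<Longrightarrow> chart \<Omega> (y j) (r j) (\<nu> j) (\<gamma> j)"
    and yf: "\<And>j. j < m \<Longrightarrow> y j \<in> frontier \<Omega>" and cov: "frontier \<Omega> \<subseteq> (\<Union>j<m. ball (y j) (r j / 4))"
    by (rule finite_atlas, rule that)
  have rp: "r j > 0" if "j < m" for j using chart.r_pos[OF ch[OF that]] .
  define \<theta> where "\<theta> j = plateau (y j) (r j)" for j
  have \<theta>: "0 \<le> \<theta> j x" "\<theta> j x \<le> 1" "C_diff 2 (\<theta> j)" if "j < m" for j x
    unfolding \<theta>_def using plateau_props[OF rp[OF that]] by auto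
  define \<psi> where "\<psi> j x = \<theta> j x * (\<Prod>i<j. 1 - \<theta> i x)" for j x
  have prod01: "0 \<le> (\<Prod>i<j. 1 - \<theta> i x)" "(\<Prod>i<j. 1 - \<theta> i x) \<le> 1" if "j \<le> m" for j x
    using that \<theta> by (auto intro!: prod_nonneg prod_le_1)
  have sum: "(\<Sum>j<m. \<psi> j x) = 1 - (\<Prod>i<m. 1 - \<theta> i x)" for x
    unfolding \<psi>_def by (rule sum_prod_telescope)
  show ?thesis
  proof (rule that[of m y r \<nu> \<gamma> \<psi> "\<Union>j<m. ball (y j) (r j / 4)"])
    fix j x assume j: "j < m"
    show "chart \<Omega> (y j) (r j) (\<nu> j) (\<gamma> j)" "y j \<in> frontier \<Omega>" by (rule ch[OF j], rule yf[OF j])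
    show "C_diff 2 (\<psi> j)" unfolding \<psi>_def[abs_def]
      using j by (intro C_diff_mult C_diff_prod C_diff_diff C_diff_const \<theta>) auto
    show "\<psi> j x \<ge> 0" unfolding \<psi>_def using \<theta>[OF j] prod01[of j x] j by simp
    show "\<psi> j x \<le> 1" unfolding \<psi>_def using \<theta>[OF j] prod01[of j x] j by (intro mult_le_one) auto
    show "\<psi> j x = 0" if "x \<notin> cball (y j) (r j / 2)"
      using plateau_props(5)[OF rp[OF j] that] by (simp add: \<psi>_def \<theta>_def)
  next
    fix x assume "x \<in> (\<Union>j<m. ball (y j) (r j / 4))"
    then obtain j where j: "j < m" "x \<in> ball (y j) (r j / 4)" by blast
    then have "\<theta> j x = 1" unfolding \<theta>_def using plateau_props(4)[OF rp[OF j(1)]] by blast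
    then have "(\<Prod>i<m. 1 - \<theta> i x) = 0" using j(1) by (intro prod_zero) auto
    then show "(\<Sum>j<m. \<psi> j x) = 1" by (simp add: sum)
  next
    fix x
    show "(\<Sum>j<m. \<psi> j x) \<ge> 0" "(\<Sum>j<m. \<psi> j x) \<le> 1" using prod01[of m x] by (auto simp: sum)
  qed (use cov in auto)
qed

lemma compact_closure_\<Omega>: "compact (closure \<Omega>)"
  using bounded_\<Omega> by simp

lemma bdist_measurable [measurable]: "bdist \<Omega> \<in> borel_measurable borel"
  by (intro borel_measurable_continuous_onI continuous_intros)

lemma \<Omega>_measurable [measurable]: "\<Omega> \<in> sets borel"
  using open_\<Omega> by simp

definition layer :: "('a \<Rightarrow> real) \<Rightarrow> real \<Rightarrow> real" where
  "layer p t = (\<integral>x. indicator (\<Omega> \<inter> {z. bdist \<Omega> z < t}) x * p x \<partial>lborel)"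

lemma layer_integrable:
  fixes p :: "'a \<Rightarrow> real"
  assumes p: "continuous_on UNIV p"
  shows "integrable lborel (\<lambda>x. indicator (\<Omega> \<inter> {z. bdist \<Omega> z < t}) x * p x)"
proof -
  have [measurable]: "p \<in> borel_measurable borel" using p by (rule borel_measurable_continuous_onI)
  have i: "integrable lborel (\<lambda>x. indicator (closure \<Omega>) x *\<^sub>R p x)"
    by (rule borel_integrable_compact[OF compact_closure_\<Omega>]) (rule continuous_on_subset[OF p], simp)
  show ?thesis
    by (rule Bochner_Integration.integrable_bound[OF i])
      (use closure_subset in \<open>auto simp: indicator_def intro!: AE_I2\<close>)
qed

text \<open>Multiplication by the partition reduces the claim to integrands supported in one chart,
  for which \<open>tube_limit\<close> gives the chart measure and hence the surface measure.\<close>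

lemma nn_layer_limit:
  assumes p: "continuous_on UNIV p" "\<And>x. p x \<ge> 0" and t: "\<And>n. t n > 0" "t \<longlonglongrightarrow> (0::real)"
  shows "(\<lambda>n. ennreal (1 / t n) * (\<integral>\<^sup>+z. indicator (\<Omega> \<inter> {z. bdist \<Omega> z < t n}) z * ennreal (p z) \<partial>lborel))
    \<longlonglongrightarrow> (\<integral>\<^sup>+z. ennreal (p z) \<partial>\<sigma>)"
proof -
  have pm [measurable]: "p \<in> borel_measurable borel" using p(1) by (rule borel_measurable_continuous_onI)
  obtain m :: nat and y r \<nu> \<gamma> \<psi> V where ch: "\<And>j. j < m \<Longrightarrow> chart \<Omega> (y j) (r j) (\<nu> j) (\<gamma> j)" "\<And>j. j < m \<Longrightarrow> y j \<in> frontier \<Omega>"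
    and \<psi>: "\<And>j. j < m \<Longrightarrow> C_diff 2 (\<psi> j)" "\<And>j x. j < m \<Longrightarrow> \<psi> j x \<ge> 0" "\<And>j x. j < m \<Longrightarrow> \<psi> j x \<le> 1"
    "\<And>j x. j < m \<Longrightarrow> x \<notin> cball (y j) (r j / 2) \<Longrightarrow> \<psi> j x = 0"
    and V: "open V" "frontier \<Omega> \<subseteq> V" "\<And>x. x \<in> V \<Longrightarrow> (\<Sum>j<m. \<psi> j x) = (1::real)"
    by (rule partition_atlas, rule that)
  obtain \<delta> where \<delta>: "\<delta> > 0" "\<And>x. x \<in> \<Omega> \<Longrightarrow> bdist \<Omega> x < \<delta> \<Longrightarrow> x \<in> V"
    by (rule frontier_neighbourhood[OF V(1,2)], rule that)
  have \<psi>c: "continuous_on A (\<psi> j)" if "j < m" for A j using C_diff_continuous_on[OF \<psi>(1)[OF that]] .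
  have \<psi>m: "\<psi> j \<in> borel_measurable borel" if "j < m" for j
    using \<psi>c[OF that] by (rule borel_measurable_continuous_onI)
  define I where "I k n = ennreal (1 / t n) * (\<integral>\<^sup>+z. indicator (\<Omega> \<inter> {z. bdist \<Omega> z < t n}) z * ennreal (k z) \<partial>lborel)" for k n
  have loc: "I (\<lambda>z. p z * \<psi> j z) \<longlonglongrightarrow> (\<integral>\<^sup>+z. ennreal (p z * \<psi> j z) \<partial>\<sigma>)" if j: "j < m" for j
  proof -
    have rp: "r j > 0" using chart.r_pos[OF ch(1)[OF j]] .
    have sub: "cball (y j) (r j / 2) \<subseteq> ball (y j) (r j)" using rp by auto
    have z: "p z * \<psi> j z = 0" if "z \<notin> cball (y j) (r j / 2)" for z using \<psi>(4)[OF j that] by simp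
    have "I (\<lambda>z. p z * \<psi> j z) \<longlonglongrightarrow> (\<integral>\<^sup>+z. ennreal (p z * \<psi> j z) \<partial>chart_measure (\<nu> j) (\<gamma> j))"
      unfolding I_def
    proof (rule chart.tube_limit[OF ch(1)[OF j] not_UNIV _ _ compact_cball sub z t])
      show "continuous_on UNIV (\<lambda>z. p z * \<psi> j z)" by (intro continuous_intros p \<psi>c j)
      show "p z * \<psi> j z \<ge> 0" for z using p(2) \<psi>(2)[OF j] by simp
    qed
    also have "(\<integral>\<^sup>+z. ennreal (p z * \<psi> j z) \<partial>chart_measure (\<nu> j) (\<gamma> j)) = (\<integral>\<^sup>+z. ennreal (p z * \<psi> j z) \<partial>\<sigma>)"
    proof (rule nn_integral_surface_measure[OF ch(1)[OF j] ch(2)[OF j], symmetric])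
      show "(\<lambda>z. ennreal (p z * \<psi> j z)) \<in> borel_measurable borel" using \<psi>m[OF j] by measurable
      show "ennreal (p z * \<psi> j z) = 0" if "z \<notin> ball (y j) (r j)" for z
      proof -
        have "z \<notin> cball (y j) (r j / 2)" using that sub by blast
        from z[OF this] show ?thesis by (simp only: ennreal_0)
      qed
    qed
    finally show ?thesis .
  qed
  have l1: "(\<lambda>n. \<Sum>j<m. I (\<lambda>z. p z * \<psi> j z) n) \<longlonglongrightarrow> (\<Sum>j<m. \<integral>\<^sup>+z. ennreal (p z * \<psi> j z) \<partial>\<sigma>)"
    by (intro tendsto_sum loc) simp
  have l2: "(\<Sum>j<m. \<integral>\<^sup>+z. ennreal (p z * \<psi> j z) \<partial>\<sigma>) = (\<integral>\<^sup>+z. ennreal (p z) \<partial>\<sigma>)"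
  proof -
    have "(\<Sum>j<m. \<integral>\<^sup>+z. ennreal (p z * \<psi> j z) \<partial>\<sigma>) = (\<integral>\<^sup>+z. (\<Sum>j<m. ennreal (p z * \<psi> j z)) \<partial>\<sigma>)"
      by (rule nn_integral_sum[symmetric]) (use \<psi>m in measurable)
    also have "\<dots> = (\<integral>\<^sup>+z. ennreal (p z) \<partial>\<sigma>)"
    proof (rule nn_integral_cong_AE)
      show "AE z in \<sigma>. (\<Sum>j<m. ennreal (p z * \<psi> j z)) = ennreal (p z)"
        using AE_frontier
      proof eventually_elim
        case (elim z)
        have "(\<Sum>j<m. ennreal (p z * \<psi> j z)) = ennreal (\<Sum>j<m. p z * \<psi> j z)"
          by (rule sum_ennreal) (use p(2) \<psi>(2) in auto)
        also have "(\<Sum>j<m. p z * \<psi> j z) = p z" using V(2,3) elim by (simp add: sum_distrib_left[symmetric] subset_iff)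
        finally show ?case .
      qed
    qed
    finally show ?thesis .
  qed
  \<comment> \<open>Once \<open>t n\<close> is below \<open>\<delta>\<close> the whole layer lies in
    \<open>V\<close>, where the partition sums to 1.\<close>
  have l3: "eventually (\<lambda>n. (\<Sum>j<m. I (\<lambda>z. p z * \<psi> j z) n) = I p n) sequentially"
    using order_tendstoD(2)[OF t(2) \<delta>(1)]
  proof eventually_elim
    case (elim n)
    let ?T = "\<Omega> \<inter> {z. bdist \<Omega> z < t n}"
    have "(\<Sum>j<m. I (\<lambda>z. p z * \<psi> j z) n) = ennreal (1 / t n) * (\<Sum>j<m. \<integral>\<^sup>+z. indicator ?T z * ennreal (p z * \<psi> j z) \<partial>lborel)"
      by (simp add: I_def sum_distrib_left)
    also have "(\<Sum>j<m. \<integral>\<^sup>+z. indicator ?T z * ennreal (p z * \<psi> j z) \<partial>lborel) =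
        (\<integral>\<^sup>+z. (\<Sum>j<m. indicator ?T z * ennreal (p z * \<psi> j z)) \<partial>lborel)"
      by (rule nn_integral_sum[symmetric]) (use \<psi>m in measurable)
    also have "\<dots> = (\<integral>\<^sup>+z. indicator ?T z * ennreal (p z) \<partial>lborel)"
    proof (rule nn_integral_cong)
      fix z
      show "(\<Sum>j<m. indicator ?T z * ennreal (p z * \<psi> j z)) = indicator ?T z * ennreal (p z)"
      proof (cases "z \<in> ?T")
        case True
        then have zV: "z \<in> V" using \<delta>(2) elim by auto
        have "(\<Sum>j<m. ennreal (p z * \<psi> j z)) = ennreal (\<Sum>j<m. p z * \<psi> j z)"
          by (rule sum_ennreal) (use p(2) \<psi>(2) in auto)
        also have "(\<Sum>j<m. p z * \<psi> j z) = p z" using V(3)[OF zV] by (simp add: sum_distrib_left[symmetric])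
        finally show ?thesis using True by simp
      qed simp
    qed
    finally show ?case by (simp add: I_def)
  qed
  have "I p \<longlonglongrightarrow> (\<integral>\<^sup>+z. ennreal (p z) \<partial>\<sigma>)"
    using Lim_transform_eventually[OF l1 l3] unfolding l2 .
  then show ?thesis by (simp only: I_def[abs_def])
qed

lemma finite_surface_measure: "finite_measure \<sigma>"
proof
  have "space \<sigma> = UNIV" using sets_eq_imp_space_eq[OF sets_surface_measure] by simp
  then show "emeasure \<sigma> (space \<sigma>) \<noteq> \<infinity>" using surface_measure_finite by simp
qed

lemma integrable_surface_measure:
  assumes p: "continuous_on UNIV p"
  shows "integrable \<sigma> (p :: 'a \<Rightarrow> real)"
proof -
  interpret finite_measure \<sigma> by (rule finite_surface_measure)
  have [measurable]: "p \<in> borel_measurable borel" using p by (rule borel_measurable_continuous_onI)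
  have "bounded (p ` frontier \<Omega>)"
    by (intro compact_imp_bounded compact_continuous_image compact_frontier continuous_on_subset[OF p]) auto
  then obtain B where "\<forall>v\<in>p ` frontier \<Omega>. norm v \<le> B" unfolding bounded_pos by blast
  then have B: "norm (p x) \<le> B" if "x \<in> frontier \<Omega>" for x using that by blast
  show ?thesis
    by (rule integrable_const_bound[where B=B]) (use AE_frontier B in \<open>auto elim: eventually_mono\<close>)
qed

lemma layer_limit_seq:
  assumes p: "continuous_on UNIV p" and t: "\<And>n. t n > 0" "t \<longlonglongrightarrow> (0::real)"
  shows "(\<lambda>n. layer p (t n) / t n) \<longlonglongrightarrow> integral\<^sup>L \<sigma> p"
proof -
  have pos: "(\<lambda>n. layer p (t n) / t n) \<longlonglongrightarrow> integral\<^sup>L \<sigma> p" if p: "continuous_on UNIV p" "\<And>x. p x \<ge> 0" for p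
  proof -
    have [measurable]: "p \<in> borel_measurable borel" using p(1) by (rule borel_measurable_continuous_onI)
    have \<sigma>p: "(\<integral>\<^sup>+z. ennreal (p z) \<partial>\<sigma>) = ennreal (integral\<^sup>L \<sigma> p)"
      by (rule nn_integral_eq_integral[OF integrable_surface_measure[OF p(1)]]) (use p(2) in auto)
    have "ennreal (1 / t n) * (\<integral>\<^sup>+z. indicator (\<Omega> \<inter> {z. bdist \<Omega> z < t n}) z * ennreal (p z) \<partial>lborel) = ennreal (layer p (t n) / t n)" for n
    proof -
      have "(\<integral>\<^sup>+z. indicator (\<Omega> \<inter> {z. bdist \<Omega> z < t n}) z * ennreal (p z) \<partial>lborel) =
          (\<integral>\<^sup>+z. ennreal (indicator (\<Omega> \<inter> {z. bdist \<Omega> z < t n}) z * p z) \<partial>lborel)"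
        by (intro nn_integral_cong) (auto simp: indicator_def)
      also have "\<dots> = ennreal (layer p (t n))"
        unfolding layer_def by (rule nn_integral_eq_integral[OF layer_integrable[OF p(1)]]) (use p(2) in auto)
      finally show ?thesis using t(1)[of n] by (simp add: ennreal_mult'[symmetric])
    qed
    then have lim: "(\<lambda>n. ennreal (layer p (t n) / t n)) \<longlonglongrightarrow> ennreal (integral\<^sup>L \<sigma> p)"
      using nn_layer_limit[OF p t] \<sigma>p by simp
    have "layer p (t n) / t n \<ge> 0" for n
      unfolding layer_def using t(1)[of n] p(2) by (intro divide_nonneg_pos integral_nonneg_AE AE_I2) auto
    moreover have "integral\<^sup>L \<sigma> p \<ge> 0" using p(2) by (intro integral_nonneg_AE AE_I2) auto
    ultimately show ?thesis using lim by (subst (asm) tendsto_ennreal_iff) auto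
  qed
  let ?p = "\<lambda>x. max 0 (p x)" and ?q = "\<lambda>x. max 0 (- p x)"
  have c: "continuous_on UNIV ?p" "continuous_on UNIV ?q" by (intro continuous_intros p)+
  have "(\<lambda>n. layer ?p (t n) / t n - layer ?q (t n) / t n) \<longlonglongrightarrow> integral\<^sup>L \<sigma> ?p - integral\<^sup>L \<sigma> ?q"
    by (intro tendsto_diff pos c) auto
  moreover have pq: "p x = ?p x - ?q x" for x by simp
  have "layer ?p (t n) / t n - layer ?q (t n) / t n = layer p (t n) / t n" for n
  proof -
    have "layer p (t n) = layer ?p (t n) - layer ?q (t n)"
      unfolding layer_def
      by (subst Bochner_Integration.integral_diff[symmetric, OF layer_integrable[OF c(1)] layer_integrable[OF c(2)]])
        (intro Bochner_Integration.integral_cong refl, auto simp: max_def)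
    then show ?thesis by (simp add: diff_divide_distrib)
  qed
  moreover have "integral\<^sup>L \<sigma> ?p - integral\<^sup>L \<sigma> ?q = integral\<^sup>L \<sigma> p"
    by (subst Bochner_Integration.integral_diff[symmetric, OF integrable_surface_measure[OF c(1)] integrable_surface_measure[OF c(2)]])
      (intro Bochner_Integration.integral_cong refl, auto simp: max_def)
  ultimately show ?thesis by simp
qed

lemma layer_limit:
  assumes p: "continuous_on UNIV p"
  shows "((\<lambda>t. layer p t / t) \<longlongrightarrow> integral\<^sup>L \<sigma> p) (at_right 0)"
  by (rule tendsto_at_right_sequentially[of 0 1]) (use layer_limit_seq[OF p] in auto)

end

section \<open>The divergence of the normal field\<close>

lemma gradient_zero_outside:
  fixes f :: "'a::euclidean_space \<Rightarrow> real"
  assumes "closed S" "\<And>x. x \<notin> S \<Longrightarrow> f x = 0" "x \<notin> S"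
  shows "gradient f x = 0"
proof (rule gradient_unique)
  show "(f has_derivative (\<lambda>h. h \<bullet> 0)) (at x)"
  proof (rule has_derivative_transform_within_open[OF _ open_Compl[OF assms(1)]])
    show "((\<lambda>x. 0) has_derivative (\<lambda>h. h \<bullet> 0)) (at x)" by simp
  qed (use assms in auto)
qed

lemma bounded_image_compact_le:
  fixes f :: "'a::topological_space \<Rightarrow> 'b::real_normed_vector"
  assumes "compact S" "continuous_on S f"
  obtains M where "M > 0" "\<And>x. x \<in> S \<Longrightarrow> norm (f x) \<le> M"
proof -
  have "bounded (f ` S)" by (intro compact_imp_bounded compact_continuous_image assms)
  then obtain M where "M > 0" "\<forall>v\<in>f ` S. norm v \<le> M" unfolding bounded_pos by blast
  then show ?thesis using that by blast
qed

context C2_domain begin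

lemma bdist_outside: "x \<notin> \<Omega> \<Longrightarrow> bdist \<Omega> x = 0"
  by simp

text \<open>Integration by parts for \<open>H(d)\<close>, obtained from difference quotients because \<open>d\<close> is only
  known to be differentiable almost everywhere.\<close>

lemma weak_chain_rule:
  fixes H H' :: "real \<Rightarrow> real"
  assumes \<epsilon>: "\<epsilon> > 0" and H: "\<And>t. (H has_real_derivative H' t) (at t)" "continuous_on UNIV H'" "\<And>t. t \<le> \<epsilon> \<Longrightarrow> H t = 0" "\<And>t. t \<le> \<epsilon> \<Longrightarrow> H' t = 0"
  obtains E where "E \<in> borel_measurable lborel"
    "AE x in lborel. bdist \<Omega> x \<ge> \<epsilon> / 2 \<longrightarrow> norm (E x) = 1 \<and> (\<forall>y\<in>- \<Omega>. bdist \<Omega> x = dist x y \<longrightarrow> E x = (x - y) /\<^sub>R bdist \<Omega> x)"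
    "\<And>f S b. C_diff (Suc 0) f \<Longrightarrow> compact S \<Longrightarrow> (\<And>x. x \<notin> S \<Longrightarrow> f x = 0) \<Longrightarrow> b \<in> Basis \<Longrightarrow>
       integrable lborel (\<lambda>x. H' (bdist \<Omega> x) * (E x \<bullet> b) * f x) \<and>
       (\<integral>x. H' (bdist \<Omega> x) * (E x \<bullet> b) * f x \<partial>lborel) = - (\<integral>x. H (bdist \<Omega> x) * (gradient f x \<bullet> b) \<partial>lborel)"
proof -
  let ?d = "bdist \<Omega>"
  \<comment> \<open>Half of the margin \<open>\<epsilon>\<close> is reserved for shifts: as
    \<open>h k\<close> is below \<open>\<epsilon> / 2\<close>, outside \<open>K\<close> both points
    of a difference quotient have distance at most \<open>\<epsilon>\<close>, where \<open>H\<close>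
    vanishes.\<close>
  define K where "K = {x. ?d x \<ge> \<epsilon> / 2}"
  have K: "compact K" "K \<inter> - \<Omega> = {}"
    unfolding K_def using compact_superlevel_bdist[OF bounded_\<Omega> not_UNIV, of "\<epsilon>/2"] \<epsilon> by auto
  have e2: "\<epsilon> / 2 > 0" using \<epsilon> by simp
  obtain h :: "nat \<Rightarrow> real" and E :: "'a \<Rightarrow> 'a" where h: "\<And>k. 0 < h k" "\<And>k. h k < \<epsilon> / 2" "h \<longlonglongrightarrow> 0"
    and Em: "E \<in> borel_measurable lborel" and E:
    "AE x in lborel. x \<in> K \<longrightarrow> norm (E x) = 1 \<and> (\<forall>y\<in>- \<Omega>. ?d x = dist x y \<longrightarrow> E x = (x - y) /\<^sub>R ?d x) \<and>
       (\<forall>b\<in>Basis. (\<lambda>k. (?d (x + h k *\<^sub>R b) - ?d x) / h k) \<longlonglongrightarrow> E x \<bullet> b)"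
    by (rule infdist_gradient_field[OF closed_Compl K e2], rule that)
  have hne: "h k \<noteq> 0" for k using h(1)[of k] by simp
  obtain D where D: "D > 0" "\<And>x. ?d x \<le> D" using bdist_bounded[OF bounded_\<Omega> not_UNIV] by metis
  have dr: "?d x \<in> {0..D}" for x using D(2)[of x] infdist_nonneg[of x "- \<Omega>"] by simp
  obtain M where M: "M > 0" "\<And>t. t \<in> {0..D} \<Longrightarrow> norm (H' t) \<le> M"
    by (rule bounded_image_compact_le[of "{0..D}" H'], simp, rule continuous_on_subset[OF H(2)], simp, rule that)
  have HL: "\<bar>H (?d x) - H (?d z)\<bar> \<le> M * dist x z" for x z
  proof -
    have "norm (H (?d x) - H (?d z)) \<le> M * norm (?d x - ?d z)"
      by (rule field_differentiable_bound[where S="{0..D}" and f'=H'])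
        (use dr M(2) H(1) has_field_derivative_at_within in blast)+
    also have "\<dots> \<le> M * dist x z" using infdist_triangle_abs[of x "- \<Omega>" z] M(1) by (intro mult_left_mono) auto
    finally show ?thesis by simp
  qed
  have Hc: "continuous_on UNIV H"
    by (intro continuous_at_imp_continuous_on ballI DERIV_isCont[OF H(1)])
  define F where "F x = H (?d x)" for x
  have Fc: "continuous_on UNIV F"
    unfolding F_def[abs_def] by (rule continuous_on_compose2[OF Hc]) (auto intro!: continuous_intros)
  have F0: "F x = 0" if "?d x \<le> \<epsilon>" for x using H(3)[OF that] by (simp add: F_def)
  have F0K: "F x = 0" if "x \<notin> K" for x using that \<epsilon> by (intro F0) (auto simp: K_def)
  have H'c: "continuous_on UNIV (\<lambda>x. H' (?d x))"
    by (rule continuous_on_compose2[OF H(2)]) (auto intro!: continuous_intros)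
  have H'm: "(\<lambda>x. H' (?d x)) \<in> borel_measurable borel" using H'c by (rule borel_measurable_continuous_onI)
  have Em': "E \<in> borel_measurable borel" using Em by simp
  have indK: "integrable lborel (indicator K :: _ \<Rightarrow> real)" by (rule integrable_indicator_compact[OF K(1)])
  show ?thesis
  proof (rule that[OF Em])
    show "AE x in lborel. ?d x \<ge> \<epsilon> / 2 \<longrightarrow> norm (E x) = 1 \<and> (\<forall>y\<in>- \<Omega>. ?d x = dist x y \<longrightarrow> E x = (x - y) /\<^sub>R ?d x)"
      using E by eventually_elim (simp add: K_def)
    fix f :: "'a \<Rightarrow> real" and S and b :: 'a
    assume f: "C_diff (Suc 0) f" and S: "compact S" and f0: "\<And>x. x \<notin> S \<Longrightarrow> f x = 0" and b: "b \<in> Basis"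
    have g0: "gradient f x = 0" if "x \<notin> S" for x
      by (rule gradient_zero_outside[OF compact_imp_closed[OF S] f0 that])
    obtain L where L: "L \<ge> 0" "\<And>x z. \<bar>f x - f z\<bar> \<le> L * dist x z" "\<And>x. norm (gradient f x) \<le> L"
      by (rule C1_compact_support_lipschitz[OF f S g0], assumption, rule that)
    have fc: "continuous_on UNIV f" by (rule C_diff_continuous_on[OF f])
    have fm [measurable]: "f \<in> borel_measurable borel" using fc by (rule borel_measurable_continuous_onI)
    have Fm [measurable]: "F \<in> borel_measurable borel" using Fc by (rule borel_measurable_continuous_onI)
    obtain B where B: "B > 0" "\<And>x. x \<in> S \<Longrightarrow> norm (f x) \<le> B"
      by (rule bounded_image_compact_le[OF S, of f], rule continuous_on_subset[OF fc], simp, rule that)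
    have fB: "norm (f x) \<le> B" for x using B f0[of x] by (cases "x \<in> S") auto
    obtain B' where B': "B' > 0" "\<And>x. x \<in> K \<Longrightarrow> norm (F x) \<le> B'"
      by (rule bounded_image_compact_le[OF K(1), of F], rule continuous_on_subset[OF Fc], simp, rule that)
    define u where "u k x = (F (x + h k *\<^sub>R b) - F x) / h k * f x" for k x
    define v where "v k x = F x * ((f (x - h k *\<^sub>R b) - f x) / h k)" for k x
    have shc: "continuous_on A (\<lambda>x. g (x + c))" if "continuous_on UNIV g" for A c and g :: "'a \<Rightarrow> real"
      by (rule continuous_on_compose2[OF that]) (auto intro!: continuous_intros)
    have int1: "integrable lborel (\<lambda>x. F (x + h k *\<^sub>R b) * f x)" "integrable lborel (\<lambda>x. F x * f x)" for k
      using f0 by (auto intro!: integrable_lborel_compact_support[OF S] continuous_on_mult shc continuous_on_subset[OF Fc] continuous_on_subset[OF fc] Fc)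
    have sh: "(\<lambda>x. F (x + h k *\<^sub>R b) * f x) = (\<lambda>x. (\<lambda>x. F x * f (x - h k *\<^sub>R b)) (x + h k *\<^sub>R b))" for k by simp
    have int2: "integrable lborel (\<lambda>x. F x * f (x - h k *\<^sub>R b))" for k
      using int1(1)[of k] unfolding sh by (subst (asm) lborel_shift(2))
    \<comment> \<open>Translation moves the difference quotient from \<open>F\<close> to
      \<open>f\<close>. The two forms have separate limits: one contains \<open>E\<close>, the other
      the classical gradient of \<open>f\<close>.\<close>
    have uv: "integral\<^sup>L lborel (u k) = integral\<^sup>L lborel (v k)" for k
    proof -
      have "integral\<^sup>L lborel (u k) = (\<integral>x. (F (x + h k *\<^sub>R b) * f x - F x * f x) / h k \<partial>lborel)"
        by (simp add: u_def[abs_def] left_diff_distrib diff_divide_distrib)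
      also have "\<dots> = ((\<integral>x. F (x + h k *\<^sub>R b) * f x \<partial>lborel) - (\<integral>x. F x * f x \<partial>lborel)) / h k"
        using int1(1)[of k] int1(2) by simp
      also have "(\<integral>x. F (x + h k *\<^sub>R b) * f x \<partial>lborel) = (\<integral>x. F x * f (x - h k *\<^sub>R b) \<partial>lborel)"
        unfolding sh by (rule lborel_shift(1))
      also have "((\<integral>x. F x * f (x - h k *\<^sub>R b) \<partial>lborel) - (\<integral>x. F x * f x \<partial>lborel)) / h k =
          (\<integral>x. (F x * f (x - h k *\<^sub>R b) - F x * f x) / h k \<partial>lborel)"
        using int2[of k] int1(2) by simp
      also have "\<dots> = integral\<^sup>L lborel (v k)"
        by (simp add: v_def[abs_def] right_diff_distrib diff_divide_distrib)
      finally show ?thesis .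
    qed
    have dist_h: "dist (x + h k *\<^sub>R b) x = h k" "dist (x - h k *\<^sub>R b) x = h k" for x k
      using b h(1)[of k] by (simp_all add: dist_norm)
    have limu: "(\<lambda>k. integral\<^sup>L lborel (u k)) \<longlonglongrightarrow> (\<integral>x. H' (?d x) * (E x \<bullet> b) * f x \<partial>lborel)"
      and intu: "integrable lborel (\<lambda>x. H' (?d x) * (E x \<bullet> b) * f x)"
    proof -
      have Du: "integrable lborel (\<lambda>x. M * B * indicator K x)" using indK by simp
      have mu: "(\<lambda>x. H' (?d x) * (E x \<bullet> b) * f x) \<in> borel_measurable lborel"
        using H'm Em' fm by measurable
      have mk: "u k \<in> borel_measurable lborel" for k
        unfolding u_def[abs_def] by measurable
      have Au: "AE x in lborel. (\<lambda>k. u k x) \<longlonglongrightarrow> H' (?d x) * (E x \<bullet> b) * f x"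
        using E
      proof eventually_elim
        case (elim x)
        show ?case
        proof (cases "x \<in> K")
          case True
          have "(\<lambda>k. x + h k *\<^sub>R b) \<longlonglongrightarrow> x + 0 *\<^sub>R b" by (intro tendsto_intros h(3))
          then have "(\<lambda>k. ?d (x + h k *\<^sub>R b)) \<longlonglongrightarrow> ?d x"
            using tendsto_infdist[of "\<lambda>k. x + h k *\<^sub>R b" x] by simp
          moreover have "(\<lambda>k. (?d (x + h k *\<^sub>R b) - ?d x) / h k) \<longlonglongrightarrow> E x \<bullet> b" using elim True b by blast
          ultimately have "(\<lambda>k. (H (?d (x + h k *\<^sub>R b)) - H (?d x)) / h k) \<longlonglongrightarrow> H' (?d x) * (E x \<bullet> b)"
            by (rule sequential_chain[OF H(1)])
          then show ?thesis unfolding u_def F_def by (intro tendsto_mult tendsto_const)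
        next
          case False
          have "u k x = 0" for k
          proof -
            have "\<bar>?d (x + h k *\<^sub>R b) - ?d x\<bar> \<le> h k" using infdist_triangle_abs[of "x + h k *\<^sub>R b" "- \<Omega>" x] dist_h(1)[of x k] by simp
            then have "?d (x + h k *\<^sub>R b) \<le> \<epsilon>" using False h(2)[of k] by (simp add: K_def)
            then show ?thesis using F0[of "x + h k *\<^sub>R b"] F0K[OF False] by (simp add: u_def)
          qed
          moreover have "H' (?d x) = 0" using False \<epsilon> by (intro H(4)) (simp add: K_def)
          ultimately show ?thesis by simp
        qed
      qed
      have Bu: "AE x in lborel. norm (u k x) \<le> M * B * indicator K x" for k
      proof (rule AE_I2)
        fix x
        show "norm (u k x) \<le> M * B * indicator K x"
        proof (cases "x \<in> K")
          case True
          have "\<bar>F (x + h k *\<^sub>R b) - F x\<bar> \<le> M * h k" using HL[of "x + h k *\<^sub>R b" x] dist_h(1)[of x k] by (simp add: F_def)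
          then have "\<bar>(F (x + h k *\<^sub>R b) - F x) / h k\<bar> \<le> M" using h(1)[of k] by (simp add: pos_divide_le_eq)
          then have "norm (u k x) \<le> M * B" unfolding u_def norm_mult using fB[of x] M(1) by (intro mult_mono) auto
          then show ?thesis using True by simp
        next
          case False
          have "\<bar>?d (x + h k *\<^sub>R b) - ?d x\<bar> \<le> h k" using infdist_triangle_abs[of "x + h k *\<^sub>R b" "- \<Omega>" x] dist_h(1)[of x k] by simp
          then have "?d (x + h k *\<^sub>R b) \<le> \<epsilon>" using False h(2)[of k] by (simp add: K_def)
          then show ?thesis using F0[of "x + h k *\<^sub>R b"] F0K[OF False] using False by (simp add: u_def)
        qed
      qed
      show "(\<lambda>k. integral\<^sup>L lborel (u k)) \<longlonglongrightarrow> (\<integral>x. H' (?d x) * (E x \<bullet> b) * f x \<partial>lborel)"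
        by (rule integral_dominated_convergence[OF mu mk Du Au Bu])
      show "integrable lborel (\<lambda>x. H' (?d x) * (E x \<bullet> b) * f x)"
        by (rule integrable_dominated_convergence[OF mu mk Du Au Bu])
    qed
    have limv: "(\<lambda>k. integral\<^sup>L lborel (v k)) \<longlonglongrightarrow> (\<integral>x. - (F x * (gradient f x \<bullet> b)) \<partial>lborel)"
    proof (rule integral_dominated_convergence[where w="\<lambda>x. B' * L * indicator K x"])
      show "integrable lborel (\<lambda>x. B' * L * indicator K x)" using indK by simp
      show "v k \<in> borel_measurable lborel" for k unfolding v_def[abs_def] by measurable
      have "gradient f \<in> borel_measurable borel" using continuous_on_gradient[OF f] by (rule borel_measurable_continuous_onI)
      then show "(\<lambda>x. - (F x * (gradient f x \<bullet> b))) \<in> borel_measurable lborel" by measurable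
      show "AE x in lborel. (\<lambda>k. v k x) \<longlonglongrightarrow> - (F x * (gradient f x \<bullet> b))"
      proof (rule AE_I2)
        fix x
        have "(\<lambda>k. - h k) \<longlonglongrightarrow> 0" using tendsto_minus[OF h(3)] by simp
        from gradient_difference_quotient[OF f this, of x b]
        have "(\<lambda>k. (f (x + (- h k) *\<^sub>R b) - f x) / (- h k)) \<longlonglongrightarrow> gradient f x \<bullet> b" using hne by simp
        then have "(\<lambda>k. F x * (- ((f (x + (- h k) *\<^sub>R b) - f x) / (- h k)))) \<longlonglongrightarrow> F x * (- (gradient f x \<bullet> b))"
          by (intro tendsto_mult tendsto_minus tendsto_const)
        then show "(\<lambda>k. v k x) \<longlonglongrightarrow> - (F x * (gradient f x \<bullet> b))" by (simp add: v_def)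
      qed
      show "AE x in lborel. norm (v k x) \<le> B' * L * indicator K x" for k
      proof (rule AE_I2)
        fix x
        show "norm (v k x) \<le> B' * L * indicator K x"
        proof (cases "x \<in> K")
          case True
          have "\<bar>f (x - h k *\<^sub>R b) - f x\<bar> \<le> L * h k" using L(2)[of "x - h k *\<^sub>R b" x] dist_h(2)[of x k] by simp
          then have "\<bar>(f (x - h k *\<^sub>R b) - f x) / h k\<bar> \<le> L" using h(1)[of k] by (simp add: pos_divide_le_eq)
          then have "norm (v k x) \<le> B' * L" unfolding v_def norm_mult using B'(2)[OF True] B'(1) by (intro mult_mono) auto
          then show ?thesis using True by simp
        qed (simp add: v_def F0K)
      qed
    qed
    have "(\<integral>x. H' (?d x) * (E x \<bullet> b) * f x \<partial>lborel) = (\<integral>x. - (F x * (gradient f x \<bullet> b)) \<partial>lborel)"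
      using LIMSEQ_unique[OF limu] limv unfolding uv by blast
    then show "integrable lborel (\<lambda>x. H' (?d x) * (E x \<bullet> b) * f x) \<and>
       (\<integral>x. H' (?d x) * (E x \<bullet> b) * f x \<partial>lborel) = - (\<integral>x. H (?d x) * (gradient f x \<bullet> b) \<partial>lborel)"
      using intu by (simp add: F_def)
  qed
qed

end

lemma (in chart) N_lipschitz_ball:
  obtains L where "L > 0" "\<And>z w. z \<in> ball y r \<Longrightarrow> w \<in> ball y r \<Longrightarrow> norm (N z - N w) \<le> L * norm (z - w)"
proof -
  obtain M where M: "M > 0" "\<And>x. x \<in> cball y r \<Longrightarrow> norm (\<Sum>b\<in>Basis. norm (DN x b)) \<le> M"
    by (rule bounded_image_compact_le[of "cball y r" "\<lambda>x. \<Sum>b\<in>Basis. norm (DN x b)"], simp,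
        intro continuous_intros continuous_on_DN, rule that)
  have "norm (N z - N w) \<le> M * norm (z - w)" if "z \<in> ball y r" "w \<in> ball y r" for z w
  proof (rule differentiable_bound[where S="ball y r" and f'=DN])
    show "(N has_derivative DN x) (at x within ball y r)" for x
      using N_deriv has_derivative_at_withinI by blast
    fix x assume x: "x \<in> ball y r"
    show "onorm (DN x) \<le> M"
    proof (rule onorm_bound)
      fix h
      have lin: "linear (DN x)" using N_deriv has_derivative_linear by blast
      have "DN x h = (\<Sum>b\<in>Basis. (h \<bullet> b) *\<^sub>R DN x b)"
        by (subst euclidean_representation[of h, symmetric]) (simp only: linear_sum[OF lin] linear_scale[OF lin])
      then have "norm (DN x h) \<le> (\<Sum>b\<in>Basis. norm ((h \<bullet> b) *\<^sub>R DN x b))" by (simp only: norm_sum)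
      also have "\<dots> \<le> (\<Sum>b\<in>Basis. norm h * norm (DN x b))"
        by (intro sum_mono) (auto intro!: mult_right_mono Basis_le_norm)
      also have "\<dots> = (\<Sum>b\<in>Basis. norm (DN x b)) * norm h" by (simp add: sum_distrib_left[symmetric] mult.commute)
      also have "\<dots> \<le> M * norm h" using M(2)[of x] x by (intro mult_right_mono) auto
      finally show "norm (DN x h) \<le> M * norm h" .
    qed (use M in simp)
  qed (use that in auto)
  then show ?thesis using that M(1) by blast
qed

section \<open>The cut-off of 1 / t and the divergence theorem tested with it\<close>

text \<open>It vanishes up to \<open>\<epsilon>\<close> and is \<open>1 / t\<close> from
  \<open>2 * \<epsilon>\<close> on. The function \<open>1 / t\<close> is the borderline
  non-integrable singularity on layers, and its derivative has the order that the normal error can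
  absorb.\<close>

definition profile :: "real \<Rightarrow> real \<Rightarrow> real" where
  "profile \<epsilon> t = step (t / \<epsilon> - 1) / t"

text \<open>The derivative of \<open>profile \<epsilon>\<close>. The second expression is zero for
  \<open>t \<le> \<epsilon>\<close> as well, at \<open>t = 0\<close> by the convention for division
  by zero; the case distinction makes this visible.\<close>

definition dprofile :: "real \<Rightarrow> real \<Rightarrow> real" where
  "dprofile \<epsilon> t = (if t \<le> \<epsilon> then 0 else dstep (t / \<epsilon> - 1) / (\<epsilon> * t) - step (t / \<epsilon> - 1) / t\<^sup>2)"

text \<open>The derivative is the difference of two nonnegative terms. The first is bounded by 18
  and the second by 1, both times the inverse square of \<open>t\<close>; hence 18 for the upper
  bound and 19 for the absolute value.\<close>

lemma profile_props:
  assumes \<epsilon>: "\<epsilon> > 0"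
  shows "t \<le> \<epsilon> \<Longrightarrow> profile \<epsilon> t = 0" "t \<le> \<epsilon> \<Longrightarrow> dprofile \<epsilon> t = 0" "0 \<le> profile \<epsilon> t"
    "(profile \<epsilon> has_real_derivative dprofile \<epsilon> t) (at t)" "continuous_on UNIV (dprofile \<epsilon>)"
    "t > 0 \<Longrightarrow> dprofile \<epsilon> t \<le> 18 / t\<^sup>2" "t > 0 \<Longrightarrow> \<bar>dprofile \<epsilon> t\<bar> \<le> 19 / t\<^sup>2" "t \<ge> 2 * \<epsilon> \<Longrightarrow> profile \<epsilon> t = 1 / t"
proof -
  have le: "t / \<epsilon> - 1 \<le> 0" if "t \<le> \<epsilon>" for t using that \<epsilon> by (simp add: field_simps)
  show p0: "profile \<epsilon> t = 0" if "t \<le> \<epsilon>" for t using step_props(1)[OF le[OF that]] by (simp add: profile_def)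
  show "dprofile \<epsilon> t = 0" if "t \<le> \<epsilon>" using that by (simp add: dprofile_def)
  show "0 \<le> profile \<epsilon> t"
  proof (cases "t \<le> \<epsilon>")
    case True
    then show ?thesis by (simp add: p0)
  next
    case False
    then show ?thesis using \<epsilon> step_props(3) by (simp add: profile_def)
  qed
  have d: "((\<lambda>t. step (t / \<epsilon> - 1) / t) has_real_derivative (dstep (t / \<epsilon> - 1) / (\<epsilon> * t) - step (t / \<epsilon> - 1) / t\<^sup>2)) (at t)"
    if t: "t > 0" for t
  proof -
    have "((\<lambda>t. step (t / \<epsilon> - 1)) has_real_derivative dstep (t / \<epsilon> - 1) * (1 / \<epsilon>)) (at t)"
      by (rule DERIV_chain2[OF step_deriv]) (use \<epsilon> in \<open>auto intro!: derivative_eq_intros\<close>)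
    from DERIV_divide[OF this DERIV_ident] have
      "((\<lambda>t. step (t / \<epsilon> - 1) / t) has_real_derivative (dstep (t / \<epsilon> - 1) * (1 / \<epsilon>) * t - step (t / \<epsilon> - 1) * 1) / (t * t)) (at t)"
      using t by simp
    moreover have "(dstep (t / \<epsilon> - 1) * (1 / \<epsilon>) * t - step (t / \<epsilon> - 1) * 1) / (t * t) = dstep (t / \<epsilon> - 1) / (\<epsilon> * t) - step (t / \<epsilon> - 1) / t\<^sup>2"
      using t \<epsilon> by (simp add: field_simps power2_eq_square)
    ultimately show ?thesis by simp
  qed
  have z: "dstep (t / \<epsilon> - 1) / (\<epsilon> * t) - step (t / \<epsilon> - 1) / t\<^sup>2 = 0" if "t \<le> \<epsilon>" for t
    using le[OF that] step_props(1) dstep_eq_0 by simp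
  have eq: "dprofile \<epsilon> t = dstep (t / \<epsilon> - 1) / (\<epsilon> * t) - step (t / \<epsilon> - 1) / t\<^sup>2" for t
    using z[of t] by (simp add: dprofile_def)
  show "(profile \<epsilon> has_real_derivative dprofile \<epsilon> t) (at t)"
  proof (cases "t > 0")
    case True
    then show ?thesis using d unfolding eq profile_def[abs_def] by blast
  next
    case False
    have "((\<lambda>t::real. 0) has_real_derivative 0) (at t)" by simp
    then have "(profile \<epsilon> has_real_derivative 0) (at t)"
      by (rule has_field_derivative_transform_within_open[where S="{..<\<epsilon>}"]) (use False \<epsilon> p0 in auto)
    then show ?thesis using False \<epsilon> by (simp add: dprofile_def)
  qed
  show "continuous_on UNIV (dprofile \<epsilon>)"
  proof -
    have "continuous_on {..<\<epsilon>} (dprofile \<epsilon>)"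
      by (rule continuous_on_eq[OF continuous_on_const[of _ 0]]) (auto simp: dprofile_def)
    moreover have "continuous_on {0<..} (dprofile \<epsilon>)"
      unfolding eq[abs_def] using \<epsilon>
      by (intro continuous_intros continuous_on_compose2[OF continuous_on_dstep[of UNIV]] continuous_on_compose2[OF continuous_on_step[of UNIV]]) auto
    ultimately have "continuous_on ({..<\<epsilon>} \<union> {0<..}) (dprofile \<epsilon>)"
      by (intro continuous_on_open_Un) auto
    moreover have "{..<\<epsilon>} \<union> {0<..} = UNIV" using \<epsilon> by force
    ultimately show ?thesis by simp
  qed
  \<comment> \<open>The term is active only for \<open>t\<close> below
    \<open>2 * \<epsilon>\<close>, where \<open>1 / \<epsilon>\<close> is less than
    \<open>2 / t\<close>. Together with \<open>dstep \<le> 9\<close> this gives 18.\<close>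
  have up: "dstep (t / \<epsilon> - 1) / (\<epsilon> * t) \<le> 18 / t\<^sup>2" if t: "t > 0" for t
  proof (cases "t / \<epsilon> - 1 \<ge> 1")
    case True
    then show ?thesis using dstep_eq_0 by simp
  next
    case False
    then have "t < 2 * \<epsilon>" using \<epsilon> by (simp add: field_simps)
    have "dstep (t / \<epsilon> - 1) / (\<epsilon> * t) \<le> 9 / (\<epsilon> * t)"
      using dstep_le t \<epsilon> by (intro divide_right_mono) auto
    also have "\<dots> \<le> 18 / t\<^sup>2"
      using \<open>t < 2 * \<epsilon>\<close> t \<epsilon> by (simp add: field_simps power2_eq_square)
    finally show ?thesis .
  qed
  have lo: "0 \<le> dstep (t / \<epsilon> - 1) / (\<epsilon> * t)" "0 \<le> step (t / \<epsilon> - 1) / t\<^sup>2" "step (t / \<epsilon> - 1) / t\<^sup>2 \<le> 1 / t\<^sup>2" if "t > 0" for t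
    using that \<epsilon> dstep_nonneg step_props(3,4) by (auto intro!: divide_right_mono)
  show "dprofile \<epsilon> t \<le> 18 / t\<^sup>2" if "t > 0" unfolding eq using up[OF that] lo[OF that] by linarith
  show "\<bar>dprofile \<epsilon> t\<bar> \<le> 19 / t\<^sup>2" if "t > 0"
  proof -
    have "18 / t\<^sup>2 + 1 / t\<^sup>2 = 19 / t\<^sup>2" by (simp flip: add_divide_distrib)
    moreover have "0 \<le> 18 / t\<^sup>2" by simp
    ultimately show ?thesis unfolding eq using up[OF that] lo[OF that] by (smt (verit))
  qed
  show "profile \<epsilon> t = 1 / t" if "t \<ge> 2 * \<epsilon>"
  proof -
    have "t / \<epsilon> - 1 \<ge> 1" using that \<epsilon> by (simp add: field_simps)
    then show ?thesis using step_props(2) by (simp add: profile_def)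
  qed
qed

text \<open>The deviation of the inner product from 1 is quadratic in the distance of the unit
  vectors. This square compensates the inverse square in \<open>dprofile\<close>.\<close>

lemma one_minus_inner_unit:
  fixes e n :: "'a::real_inner"
  assumes "norm e = 1" "norm n = 1"
  shows "1 - e \<bullet> n = (norm (e - n))\<^sup>2 / 2"
proof -
  have "e \<bullet> e = 1" "n \<bullet> n = 1" using assms by (simp_all add: norm_eq_1)
  then show ?thesis by (simp add: power2_norm_eq_inner inner_diff_left inner_diff_right inner_commute[of n e])
qed

context C2_domain begin

text \<open>Minus the divergence of the localised normal field, \<open>\<psi>\<close> times
  \<open>chart_normal \<nu> \<gamma>\<close>.\<close>

definition chart_source :: "('a \<Rightarrow> real) \<Rightarrow> 'a \<Rightarrow> ('a \<Rightarrow> real) \<Rightarrow> 'a \<Rightarrow> real" where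
  "chart_source \<psi> \<nu> \<gamma> x = - (gradient \<psi> x \<bullet> chart_normal \<nu> \<gamma> x + \<psi> x * chart_div \<nu> \<gamma> x)"

lemma profile_bdist_continuous:
  assumes "\<epsilon> > 0"
  shows "continuous_on A (\<lambda>x. profile \<epsilon> (bdist \<Omega> x))" "continuous_on A (\<lambda>x. dprofile \<epsilon> (bdist \<Omega> x))"
proof -
  have "continuous_on UNIV (profile \<epsilon>)"
    by (intro continuous_at_imp_continuous_on ballI DERIV_isCont[OF profile_props(4)[OF assms]])
  then show "continuous_on A (\<lambda>x. profile \<epsilon> (bdist \<Omega> x))"
    by (rule continuous_on_compose2) (auto intro!: continuous_intros)
  show "continuous_on A (\<lambda>x. dprofile \<epsilon> (bdist \<Omega> x))"
    by (rule continuous_on_compose2[OF profile_props(5)[OF assms]]) (auto intro!: continuous_intros)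
qed

lemma superlevel_compact: "\<epsilon> > 0 \<Longrightarrow> compact {x. bdist \<Omega> x \<ge> \<epsilon>}"
  by (rule compact_superlevel_bdist(1)[OF bounded_\<Omega> not_UNIV])

lemma profile_integrable:
  fixes f :: "'a \<Rightarrow> real"
  assumes \<epsilon>: "\<epsilon> > 0" and f: "continuous_on UNIV f"
  shows "integrable lborel (\<lambda>x. profile \<epsilon> (bdist \<Omega> x) * f x)" "integrable lborel (\<lambda>x. dprofile \<epsilon> (bdist \<Omega> x) * f x)"
  by (rule integrable_lborel_compact_support[OF superlevel_compact[OF \<epsilon>]],
      auto intro!: continuous_intros profile_bdist_continuous \<epsilon> continuous_on_subset[OF f] simp: profile_props(1,2)[OF \<epsilon>])+

text \<open>Testing \<open>weak_chain_rule\<close> with the components of the localised normal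
  produces the factor \<open>E \<bullet> N\<close> where 1 is wanted. Near the boundary
  \<open>E x\<close> is the normal at a nearest point, so the Lipschitz bound for \<open>N\<close>
  makes the replacement cost bounded uniformly in \<open>\<epsilon>\<close>.\<close>

lemma local_divergence_bound:
  assumes c: "chart \<Omega> y r \<nu> \<gamma>" and \<psi>: "C_diff 2 \<psi>" "\<And>x. \<psi> x \<ge> 0" "\<And>x. \<psi> x \<le> 1" "\<And>x. x \<notin> cball y (r / 2) \<Longrightarrow> \<psi> x = 0"
  obtains C where "\<And>\<epsilon>. \<epsilon> > 0 \<Longrightarrow> (\<integral>x. dprofile \<epsilon> (bdist \<Omega> x) * \<psi> x \<partial>lborel)
      \<le> (\<integral>x. profile \<epsilon> (bdist \<Omega> x) * chart_source \<psi> \<nu> \<gamma> x \<partial>lborel) + C"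
proof -
  interpret c: chart \<Omega> y r \<nu> \<gamma> by fact
  let ?d = "bdist \<Omega>"
  have r: "r > 0" by (rule c.r_pos)
  obtain L where L: "L > 0" "\<And>z w. z \<in> ball y r \<Longrightarrow> w \<in> ball y r \<Longrightarrow> norm (c.N z - c.N w) \<le> L * norm (z - w)"
    by (rule c.N_lipschitz_ball, rule that)
  \<comment> \<open>Close to the boundary the cost is 18/d^2 times L^2 d^2 / 2, giving
    \<open>9 * L\<^sup>2\<close>. At distance at least \<open>r / 2\<close> the nearest point may
    leave the chart; then 18 divided by the square of \<open>r / 2\<close>, times the trivial bound
    2, gives \<open>144 / r\<^sup>2\<close>.\<close>
  define C0 where "C0 = 9 * L\<^sup>2 + 144 / r\<^sup>2"
  have C0: "9 * L\<^sup>2 \<le> C0" "144 / r\<^sup>2 \<le> C0" "0 \<le> C0" using r by (auto simp: C0_def)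
  have \<psi>1: "C_diff (Suc 0) \<psi>" using \<psi>(1) C_diff_mono[of 2 \<psi> 1] by simp
  have \<psi>c: "continuous_on A \<psi>" for A by (rule C_diff_continuous_on[OF \<psi>(1)])
  define f where "f b x = \<psi> x * (c.N x \<bullet> b)" for b x
  have fd: "(f b has_derivative (\<lambda>v. \<psi> x * (c.DN x v \<bullet> b) + (gradient \<psi> x \<bullet> v) * (c.N x \<bullet> b))) (at x)" for b x
    unfolding f_def by (intro has_derivative_mult has_derivative_gradient[OF \<psi>1] has_derivative_inner_left c.N_deriv)
  have fC: "C_diff (Suc 0) (f b)" for b
    by (rule C_diff_Suc0_I[OF fd])
      (intro continuous_intros \<psi>c c.continuous_on_DN c.continuous_on_N continuous_on_gradient[OF \<psi>1])
  have fg: "gradient (f b) x \<bullet> v = \<psi> x * (c.DN x v \<bullet> b) + (gradient \<psi> x \<bullet> v) * (c.N x \<bullet> b)" for b x v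
  proof -
    have "f b differentiable (at x)" by (rule differentiableI[OF fd])
    from trans[OF sym[OF GDERIV_gradient(2)[OF this, of v]] sym[OF fun_cong[OF frechet_derivative_at[OF fd[of b x]], of v]]]
    show ?thesis .
  qed
  have f0: "f b x = 0" if "x \<notin> cball y (r / 2)" for b x using \<psi>(4)[OF that] by (simp add: f_def)
  have src: "(\<Sum>b\<in>Basis. gradient (f b) x \<bullet> b) = - chart_source \<psi> \<nu> \<gamma> x" for x
    by (simp add: fg chart_source_def chart_div_def sum.distrib sum_distrib_left euclidean_inner[of "gradient \<psi> x" "c.N x"])
  have "(\<integral>x. dprofile \<epsilon> (?d x) * \<psi> x \<partial>lborel)
      \<le> (\<integral>x. profile \<epsilon> (?d x) * chart_source \<psi> \<nu> \<gamma> x \<partial>lborel) + C0 * measure lborel (closure \<Omega>)" if \<epsilon>: "\<epsilon> > 0" for \<epsilon>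
  proof -
    note pp = profile_props[OF \<epsilon>]
    obtain E where Em: "E \<in> borel_measurable lborel"
      and E: "AE x in lborel. ?d x \<ge> \<epsilon> / 2 \<longrightarrow> norm (E x) = 1 \<and> (\<forall>y\<in>- \<Omega>. ?d x = dist x y \<longrightarrow> E x = (x - y) /\<^sub>R ?d x)"
      and W: "\<And>f S b. C_diff (Suc 0) f \<Longrightarrow> compact S \<Longrightarrow> (\<And>x. x \<notin> S \<Longrightarrow> f x = 0) \<Longrightarrow> b \<in> Basis \<Longrightarrow>
       integrable lborel (\<lambda>x. dprofile \<epsilon> (?d x) * (E x \<bullet> b) * f x) \<and>
       (\<integral>x. dprofile \<epsilon> (?d x) * (E x \<bullet> b) * f x \<partial>lborel) = - (\<integral>x. profile \<epsilon> (?d x) * (gradient f x \<bullet> b) \<partial>lborel)"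
      apply (rule weak_chain_rule[OF \<epsilon> pp(4,5,1,2)], assumption, assumption)
      subgoal premises q
        by (rule that, rule q, rule q, rule q, assumption+)
      done
    note Wb = W[OF fC compact_cball f0]
    have EN: "(\<Sum>b\<in>Basis. dprofile \<epsilon> (?d x) * (E x \<bullet> b) * f b x) = dprofile \<epsilon> (?d x) * \<psi> x * (E x \<bullet> c.N x)" for x
      by (simp add: f_def euclidean_inner[of "E x" "c.N x"] sum_distrib_left mult_ac)
    have i1: "integrable lborel (\<lambda>x. dprofile \<epsilon> (?d x) * \<psi> x * (E x \<bullet> c.N x))"
      unfolding EN[symmetric] by (rule Bochner_Integration.integrable_sum) (use Wb in blast)
    have gi: "integrable lborel (\<lambda>x. profile \<epsilon> (?d x) * (gradient (f b) x \<bullet> b))" for b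
      by (rule profile_integrable[OF \<epsilon>]) (intro continuous_intros continuous_on_gradient[OF fC])
    have "(\<integral>x. dprofile \<epsilon> (?d x) * \<psi> x * (E x \<bullet> c.N x) \<partial>lborel) =
        (\<Sum>b\<in>Basis. \<integral>x. dprofile \<epsilon> (?d x) * (E x \<bullet> b) * f b x \<partial>lborel)"
      unfolding EN[symmetric] by (rule Bochner_Integration.integral_sum) (use Wb in blast)
    also have "\<dots> = (\<Sum>b\<in>Basis. - (\<integral>x. profile \<epsilon> (?d x) * (gradient (f b) x \<bullet> b) \<partial>lborel))"
      by (intro sum.cong refl) (use Wb in blast)
    also have "\<dots> = - (\<integral>x. (\<Sum>b\<in>Basis. profile \<epsilon> (?d x) * (gradient (f b) x \<bullet> b)) \<partial>lborel)"
      using gi by (simp add: sum_negf Bochner_Integration.integral_sum)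
    also have "\<dots> = (\<integral>x. profile \<epsilon> (?d x) * chart_source \<psi> \<nu> \<gamma> x \<partial>lborel)"
      by (simp add: sum_distrib_left[symmetric] src)
    finally have id: "(\<integral>x. dprofile \<epsilon> (?d x) * \<psi> x * (E x \<bullet> c.N x) \<partial>lborel) =
        (\<integral>x. profile \<epsilon> (?d x) * chart_source \<psi> \<nu> \<gamma> x \<partial>lborel)" .
    have i2: "integrable lborel (\<lambda>x. dprofile \<epsilon> (?d x) * \<psi> x)" by (rule profile_integrable(2)[OF \<epsilon> \<psi>c])
    have ind: "integrable lborel (\<lambda>x. C0 * indicator (closure \<Omega>) x)"
      using integrable_indicator_compact[OF compact_closure_\<Omega>] by simp
    have "(\<integral>x. dprofile \<epsilon> (?d x) * \<psi> x \<partial>lborel) - (\<integral>x. dprofile \<epsilon> (?d x) * \<psi> x * (E x \<bullet> c.N x) \<partial>lborel) =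
        (\<integral>x. dprofile \<epsilon> (?d x) * \<psi> x - dprofile \<epsilon> (?d x) * \<psi> x * (E x \<bullet> c.N x) \<partial>lborel)"
      by (rule Bochner_Integration.integral_diff[symmetric, OF i2 i1])
    also have "\<dots> \<le> (\<integral>x. C0 * indicator (closure \<Omega>) x \<partial>lborel)"
    proof (rule integral_mono_AE[OF Bochner_Integration.integrable_diff[OF i2 i1] ind])
      show "AE x in lborel. dprofile \<epsilon> (?d x) * \<psi> x - dprofile \<epsilon> (?d x) * \<psi> x * (E x \<bullet> c.N x) \<le> C0 * indicator (closure \<Omega>) x"
        using E
      proof eventually_elim
        case (elim x)
        show ?case
        proof (cases "?d x \<le> \<epsilon> \<or> \<psi> x = 0")
          case True
          then show ?thesis using pp(2)[of "?d x"] C0(3) by auto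
        next
          case False
          then have dx: "?d x > \<epsilon>" and \<psi>x: "\<psi> x \<noteq> 0" by auto
          have d0: "?d x > 0" using dx \<epsilon> by linarith
          then have x\<Omega>: "x \<in> \<Omega>" using bdist_outside[of x] by fastforce
          have xc: "x \<in> cball y (r / 2)" using \<psi>(4)[of x] \<psi>x by blast
          have E1: "norm (E x) = 1" and Ey: "\<And>z. z \<in> - \<Omega> \<Longrightarrow> ?d x = dist x z \<Longrightarrow> E x = (x - z) /\<^sub>R ?d x"
            using elim dx \<epsilon> by auto
          have om: "1 - E x \<bullet> c.N x = (norm (E x - c.N x))\<^sup>2 / 2" by (rule one_minus_inner_unit[OF E1 c.norm_N])
          let ?q = "dprofile \<epsilon> (?d x)"
          have "?q * (1 - E x \<bullet> c.N x) \<le> C0"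
          proof (cases "?d x < r / 2")
            case True
            obtain z where z: "z \<in> - \<Omega>" "?d x = dist x z" using nearest_point_exists[OF closed_Compl] .
            have "dist y z \<le> dist y x + dist x z" by (rule dist_triangle)
            then have zb: "z \<in> ball y r" using xc True z(2) by simp
            have xb: "x \<in> ball y r" using xc r by simp
            \<comment> \<open>The ball around \<open>x\<close> that reaches \<open>z\<close> lies in
              \<open>\<Omega>\<close>, so the inner normal at \<open>z\<close> points to
              \<open>x\<close>. This is the same unit vector as \<open>E x\<close>.\<close>
            have "c.N z = (x - z) /\<^sub>R norm (x - z)"
              by (rule c.nearest_normal(2)[OF zb]) (use z x\<Omega> ball_infdist_subset[of x \<Omega>] in auto)
            then have "E x = c.N z" using Ey[OF z] z(2) by (simp add: dist_norm)
            then have "norm (E x - c.N x) \<le> L * ?d x"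
              using L(2)[OF zb xb] z(2) by (simp add: dist_norm norm_minus_commute)
            then have "(norm (E x - c.N x))\<^sup>2 \<le> (L * ?d x)\<^sup>2" by (rule power_mono) simp
            then have b: "1 - E x \<bullet> c.N x \<le> L\<^sup>2 * (?d x)\<^sup>2 / 2" unfolding om by (simp add: power_mult_distrib)
            have nn: "0 \<le> 1 - E x \<bullet> c.N x" unfolding om by simp
            have "?q * (1 - E x \<bullet> c.N x) \<le> 18 / (?d x)\<^sup>2 * (1 - E x \<bullet> c.N x)"
              using pp(6)[OF d0] nn by (rule mult_right_mono)
            also have "\<dots> \<le> 18 / (?d x)\<^sup>2 * (L\<^sup>2 * (?d x)\<^sup>2 / 2)" using b by (rule mult_left_mono) simp
            also have "\<dots> = 9 * L\<^sup>2" using d0 by simp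
            finally show ?thesis using C0(1) by linarith
          next
            case False
            have "norm (E x - c.N x) \<le> 2" using norm_triangle_ineq4[of "E x" "c.N x"] E1 by simp
            then have "(norm (E x - c.N x))\<^sup>2 \<le> 2\<^sup>2" by (rule power_mono) simp
            then have b: "1 - E x \<bullet> c.N x \<le> 2" unfolding om by simp
            have nn: "0 \<le> 1 - E x \<bullet> c.N x" unfolding om by simp
            have "(r / 2)\<^sup>2 \<le> (?d x)\<^sup>2" using False r by (intro power_mono) auto
            then have "18 / (?d x)\<^sup>2 \<le> 18 / (r / 2)\<^sup>2" using r by (intro divide_left_mono) (auto simp: zero_less_power2 d0[THEN less_imp_neq, symmetric])
            then have "?q \<le> 72 / r\<^sup>2" using pp(6)[OF d0] by (simp add: power_divide)
            then have "?q * (1 - E x \<bullet> c.N x) \<le> 72 / r\<^sup>2 * (1 - E x \<bullet> c.N x)" using nn by (rule mult_right_mono)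
            also have "\<dots> \<le> 72 / r\<^sup>2 * 2" using b by (rule mult_left_mono) simp
            finally show ?thesis using C0(2) by simp
          qed
          then have "\<psi> x * (?q * (1 - E x \<bullet> c.N x)) \<le> 1 * C0"
            using \<psi>(2,3)[of x] C0(3) by (meson mult_left_mono mult_right_mono order_trans)
          moreover have "indicator (closure \<Omega>) x = (1::real)" using x\<Omega> closure_subset by (auto simp: indicator_def)
          ultimately show ?thesis by (simp add: algebra_simps)
        qed
      qed
    qed
    also have "\<dots> = C0 * measure lborel (closure \<Omega>)" by simp
    finally show ?thesis using id by linarith
  qed
  then show ?thesis using that by blast
qed

text \<open>The local sources are added. Their sum \<open>h\<close> depends on the partition inside
  the domain, but on the boundary the normals of all charts agree and the gradients of the partition
  cancel, which leaves only the curvature.\<close>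

lemma divergence_bound:
  assumes n: "DIM('a) \<ge> 2"
  obtains h C where "continuous_on UNIV (h :: 'a \<Rightarrow> real)"
    "\<And>p. p \<in> frontier \<Omega> \<Longrightarrow> h p = real (DIM('a) - 1) * mean_curvature \<Omega> p"
    "\<And>\<epsilon>. \<epsilon> > 0 \<Longrightarrow> (\<integral>x. dprofile \<epsilon> (bdist \<Omega> x) \<partial>lborel) \<le> (\<integral>x. profile \<epsilon> (bdist \<Omega> x) * h x \<partial>lborel) + C"
proof -
  let ?d = "bdist \<Omega>"
  obtain m :: nat and y r \<nu> \<gamma> \<psi> V where ch: "\<And>j. j < m \<Longrightarrow> chart \<Omega> (y j) (r j) (\<nu> j) (\<gamma> j)" "\<And>j. j < m \<Longrightarrow> y j \<in> frontier \<Omega>"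
    and \<psi>: "\<And>j. j < m \<Longrightarrow> C_diff 2 (\<psi> j)" "\<And>j x. j < m \<Longrightarrow> \<psi> j x \<ge> 0" "\<And>j x. j < m \<Longrightarrow> \<psi> j x \<le> 1"
    "\<And>j x. j < m \<Longrightarrow> x \<notin> cball (y j) (r j / 2) \<Longrightarrow> \<psi> j x = 0"
    and V: "open V" "frontier \<Omega> \<subseteq> V" "\<And>x. x \<in> V \<Longrightarrow> (\<Sum>j<m. \<psi> j x) = (1::real)"
    and S: "\<And>x. (\<Sum>j<m. \<psi> j x) \<ge> 0" "\<And>x. (\<Sum>j<m. \<psi> j x) \<le> 1"
    by (rule partition_atlas, rule that)
  obtain \<delta> where \<delta>: "\<delta> > 0" "\<And>x. x \<in> \<Omega> \<Longrightarrow> ?d x < \<delta> \<Longrightarrow> x \<in> V"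
    by (rule frontier_neighbourhood[OF V(1,2)], rule that)
  have "\<forall>j. \<exists>C. j < m \<longrightarrow> (\<forall>\<epsilon>>0. (\<integral>x. dprofile \<epsilon> (?d x) * \<psi> j x \<partial>lborel)
      \<le> (\<integral>x. profile \<epsilon> (?d x) * chart_source (\<psi> j) (\<nu> j) (\<gamma> j) x \<partial>lborel) + C)"
  proof
    fix j
    show "\<exists>C. j < m \<longrightarrow> (\<forall>\<epsilon>>0. (\<integral>x. dprofile \<epsilon> (?d x) * \<psi> j x \<partial>lborel)
      \<le> (\<integral>x. profile \<epsilon> (?d x) * chart_source (\<psi> j) (\<nu> j) (\<gamma> j) x \<partial>lborel) + C)"
    proof (cases "j < m")
      case True
      obtain C where "\<And>\<epsilon>. \<epsilon> > 0 \<Longrightarrow> (\<integral>x. dprofile \<epsilon> (?d x) * \<psi> j x \<partial>lborel)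
          \<le> (\<integral>x. profile \<epsilon> (?d x) * chart_source (\<psi> j) (\<nu> j) (\<gamma> j) x \<partial>lborel) + C"
        by (rule local_divergence_bound[OF ch(1)[OF True] \<psi>(1-4)[OF True]], assumption, rule that)
      then show ?thesis by blast
    qed simp
  qed
  then obtain C where C: "\<And>j \<epsilon>. j < m \<Longrightarrow> \<epsilon> > 0 \<Longrightarrow> (\<integral>x. dprofile \<epsilon> (?d x) * \<psi> j x \<partial>lborel)
      \<le> (\<integral>x. profile \<epsilon> (?d x) * chart_source (\<psi> j) (\<nu> j) (\<gamma> j) x \<partial>lborel) + C j" by metis
  define h where "h x = (\<Sum>j<m. chart_source (\<psi> j) (\<nu> j) (\<gamma> j) x)" for x
  have \<psi>1: "C_diff (Suc 0) (\<psi> j)" if "j < m" for j using \<psi>(1)[OF that] C_diff_mono[of 2 "\<psi> j" 1] by simp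
  have \<psi>c: "continuous_on A (\<psi> j)" if "j < m" for A j using C_diff_continuous_on[OF \<psi>(1)[OF that]] .
  have sc: "continuous_on A (chart_source (\<psi> j) (\<nu> j) (\<gamma> j))" if j: "j < m" for A j
    unfolding chart_source_def[abs_def]
    by (intro continuous_intros continuous_on_gradient[OF \<psi>1[OF j]] \<psi>c[OF j]
        chart.continuous_on_N[OF ch(1)[OF j]] chart.continuous_on_div[OF ch(1)[OF j]])
  have hc: "continuous_on UNIV h" unfolding h_def[abs_def] by (intro continuous_on_sum sc) simp
  have hH: "h p = real (DIM('a) - 1) * mean_curvature \<Omega> p" if p: "p \<in> frontier \<Omega>" for p
  proof -
    have pV: "p \<in> V" using V(2) p by blast
    obtain j0 where j0: "j0 < m" "\<psi> j0 p \<noteq> 0"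
    proof -
      have "(\<Sum>j<m. \<psi> j p) \<noteq> 0" using V(3)[OF pV] by simp
      then show ?thesis using that by (meson sum.not_neutral_contains_not_neutral lessThan_iff)
    qed
    define n where "n = chart_normal (\<nu> j0) (\<gamma> j0) p"
    have inball: "p \<in> ball (y j) (r j)" if "j < m" "p \<in> cball (y j) (r j / 2)" for j
      using that chart.r_pos[OF ch(1)[OF that(1)]] by simp
    have pb0: "p \<in> ball (y j0) (r j0)" using inball[OF j0(1)] \<psi>(4)[OF j0(1), of p] j0(2) by blast
    have src: "chart_source (\<psi> j) (\<nu> j) (\<gamma> j) p = - (gradient (\<psi> j) p \<bullet> n) + real (DIM('a) - 1) * mean_curvature \<Omega> p * \<psi> j p"
      if j: "j < m" for j
    proof (cases "p \<in> cball (y j) (r j / 2)")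
      case True
      then have pb: "p \<in> ball (y j) (r j)" using inball[OF j] by blast
      have "chart_normal (\<nu> j) (\<gamma> j) p = n"
        unfolding n_def by (rule charts_normal_eq[OF ch(1)[OF j] ch(1)[OF j0(1)] p pb pb0])
      moreover have "chart_div (\<nu> j) (\<gamma> j) p = - (real (DIM('a) - 1) * mean_curvature \<Omega> p)"
        using chart.mean_curvature_eq[OF ch(1)[OF j] p pb] n by simp
      ultimately show ?thesis by (simp add: chart_source_def mult.commute)
    next
      case False
      have "gradient (\<psi> j) p = 0" by (rule gradient_zero_outside[OF closed_cball \<psi>(4)[OF j] False])
      then show ?thesis using \<psi>(4)[OF j False] by (simp add: chart_source_def)
    qed
    \<comment> \<open>The partition sums to the constant 1 near \<open>p\<close>, so its derivative
      vanishes there.\<close>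
    have g0: "(\<Sum>j<m. gradient (\<psi> j) p \<bullet> v) = 0" for v
    proof -
      have "((\<lambda>x. \<Sum>j<m. \<psi> j x) has_derivative (\<lambda>v. \<Sum>j<m. gradient (\<psi> j) p \<bullet> v)) (at p)"
        by (rule has_derivative_sum) (use has_derivative_gradient[OF \<psi>1] in simp)
      moreover have "((\<lambda>x. \<Sum>j<m. \<psi> j x) has_derivative (\<lambda>v. 0)) (at p)"
      proof (rule has_derivative_transform_within_open[OF _ V(1) pV])
        show "((\<lambda>x. 1::real) has_derivative (\<lambda>v. 0)) (at p)" by simp
      qed (simp add: V(3))
      ultimately have "(\<lambda>v. \<Sum>j<m. gradient (\<psi> j) p \<bullet> v) = (\<lambda>v. 0)" by (rule has_derivative_unique)
      then show ?thesis by (rule fun_cong)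
    qed
    have "h p = (\<Sum>j<m. - (gradient (\<psi> j) p \<bullet> n) + real (DIM('a) - 1) * mean_curvature \<Omega> p * \<psi> j p)"
      unfolding h_def by (intro sum.cong refl src) simp
    also have "\<dots> = real (DIM('a) - 1) * mean_curvature \<Omega> p * (\<Sum>j<m. \<psi> j p)"
      using g0[of n] by (simp add: sum.distrib sum_negf sum_distrib_left sum_subtractf)
    finally show ?thesis using V(3)[OF pV] by simp
  qed
  \<comment> \<open>The partition may fail to sum to 1 inside the domain only at distance at least
    \<open>\<delta>\<close>, where \<open>dprofile\<close> is at most
    \<open>19 / \<delta>\<^sup>2\<close> in absolute value; outside the domain
    \<open>dprofile\<close> vanishes.\<close>
  define C' where "C' = (\<Sum>j<m. C j) + 19 / \<delta>\<^sup>2 * measure lborel (closure \<Omega>)"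
  have "(\<integral>x. dprofile \<epsilon> (?d x) \<partial>lborel) \<le> (\<integral>x. profile \<epsilon> (?d x) * h x \<partial>lborel) + C'" if \<epsilon>: "\<epsilon> > 0" for \<epsilon>
  proof -
    note pp = profile_props[OF \<epsilon>]
    have i0: "integrable lborel (\<lambda>x. dprofile \<epsilon> (?d x))"
      using profile_integrable(2)[OF \<epsilon> continuous_on_const[of UNIV 1]] by simp
    have ij: "integrable lborel (\<lambda>x. dprofile \<epsilon> (?d x) * \<psi> j x)" if "j < m" for j
      by (rule profile_integrable(2)[OF \<epsilon> \<psi>c[OF that]])
    have isum: "integrable lborel (\<lambda>x. \<Sum>j<m. dprofile \<epsilon> (?d x) * \<psi> j x)"
      by (rule Bochner_Integration.integrable_sum) (use ij in simp)
    have ind: "integrable lborel (\<lambda>x. 19 / \<delta>\<^sup>2 * indicator (closure \<Omega>) x)"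
      using integrable_indicator_compact[OF compact_closure_\<Omega>] by simp
    have "(\<integral>x. dprofile \<epsilon> (?d x) \<partial>lborel) - (\<integral>x. (\<Sum>j<m. dprofile \<epsilon> (?d x) * \<psi> j x) \<partial>lborel) =
        (\<integral>x. dprofile \<epsilon> (?d x) - (\<Sum>j<m. dprofile \<epsilon> (?d x) * \<psi> j x) \<partial>lborel)"
      by (rule Bochner_Integration.integral_diff[symmetric, OF i0 isum])
    also have "\<dots> \<le> (\<integral>x. 19 / \<delta>\<^sup>2 * indicator (closure \<Omega>) x \<partial>lborel)"
    proof (rule integral_mono[OF Bochner_Integration.integrable_diff[OF i0 isum] ind])
      fix x
      have eq: "dprofile \<epsilon> (?d x) - (\<Sum>j<m. dprofile \<epsilon> (?d x) * \<psi> j x) = dprofile \<epsilon> (?d x) * (1 - (\<Sum>j<m. \<psi> j x))"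
        by (simp add: sum_distrib_left right_diff_distrib)
      show "dprofile \<epsilon> (?d x) - (\<Sum>j<m. dprofile \<epsilon> (?d x) * \<psi> j x) \<le> 19 / \<delta>\<^sup>2 * indicator (closure \<Omega>) x"
      proof (cases "x \<in> \<Omega>")
        case True
        have ind1: "indicator (closure \<Omega>) x = (1::real)" using True closure_subset by (auto simp: indicator_def)
        show ?thesis
        proof (cases "?d x < \<delta>")
          case True
          then have "(\<Sum>j<m. \<psi> j x) = 1" using \<delta>(2) \<open>x \<in> \<Omega>\<close> V(3) by blast
          then show ?thesis unfolding eq ind1 by simp
        next
          case False
          then have d0: "?d x > 0" using \<delta>(1) by linarith
          have "\<delta>\<^sup>2 \<le> (?d x)\<^sup>2" using False \<delta>(1) by (intro power_mono) auto
          then have "19 / (?d x)\<^sup>2 \<le> 19 / \<delta>\<^sup>2" using \<delta>(1) d0 by (intro divide_left_mono) auto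
          then have "\<bar>dprofile \<epsilon> (?d x)\<bar> \<le> 19 / \<delta>\<^sup>2" using pp(7)[OF d0] by linarith
          moreover have "\<bar>1 - (\<Sum>j<m. \<psi> j x)\<bar> \<le> 1" using S[of x] by simp
          ultimately have "\<bar>dprofile \<epsilon> (?d x)\<bar> * \<bar>1 - (\<Sum>j<m. \<psi> j x)\<bar> \<le> 19 / \<delta>\<^sup>2 * 1"
            by (intro mult_mono) auto
          then show ?thesis unfolding eq ind1 by (simp flip: abs_mult)
        qed
      next
        case False
        then show ?thesis using pp(2)[of 0] \<epsilon> by (simp add: bdist_outside)
      qed
    qed
    also have "\<dots> = 19 / \<delta>\<^sup>2 * measure lborel (closure \<Omega>)" by simp
    finally have 1: "(\<integral>x. dprofile \<epsilon> (?d x) \<partial>lborel) \<le> (\<integral>x. (\<Sum>j<m. dprofile \<epsilon> (?d x) * \<psi> j x) \<partial>lborel) + 19 / \<delta>\<^sup>2 * measure lborel (closure \<Omega>)"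
      by linarith
    have "(\<integral>x. (\<Sum>j<m. dprofile \<epsilon> (?d x) * \<psi> j x) \<partial>lborel) = (\<Sum>j<m. \<integral>x. dprofile \<epsilon> (?d x) * \<psi> j x \<partial>lborel)"
      by (rule Bochner_Integration.integral_sum) (use ij in simp)
    also have "\<dots> \<le> (\<Sum>j<m. (\<integral>x. profile \<epsilon> (?d x) * chart_source (\<psi> j) (\<nu> j) (\<gamma> j) x \<partial>lborel) + C j)"
      by (intro sum_mono C \<epsilon>) simp
    also have "\<dots> = (\<integral>x. (\<Sum>j<m. profile \<epsilon> (?d x) * chart_source (\<psi> j) (\<nu> j) (\<gamma> j) x) \<partial>lborel) + (\<Sum>j<m. C j)"
      unfolding sum.distrib
      by (subst Bochner_Integration.integral_sum) (use profile_integrable(1)[OF \<epsilon> sc] in auto)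
    also have "(\<integral>x. (\<Sum>j<m. profile \<epsilon> (?d x) * chart_source (\<psi> j) (\<nu> j) (\<gamma> j) x) \<partial>lborel) = (\<integral>x. profile \<epsilon> (?d x) * h x \<partial>lborel)"
      by (simp add: h_def sum_distrib_left)
    finally show ?thesis using 1 by (simp add: C'_def)
  qed
  then show ?thesis using that[OF hc hH] by blast
qed

section \<open>Positivity of the area and logarithmic divergence\<close>

lemma surface_measure_pos: "integral\<^sup>L \<sigma> (\<lambda>_. 1 :: real) > 0"
proof -
  obtain y where y: "y \<in> frontier \<Omega>" using frontier_ne by blast
  obtain r \<nu> \<gamma> where c: "chart \<Omega> y r \<nu> \<gamma>" by (rule C2_boundary_chart[OF open_\<Omega> C2 y])
  interpret c: chart \<Omega> y r \<nu> \<gamma> by fact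
  have yb: "y \<in> ball y r" using c.r_pos by simp
  have Gy: "c.G y = 0" using c.frontier_iff[OF yb] y by simp
  \<comment> \<open>The point at half the height of the slab on the line through \<open>y\<close>.
    It projects to \<open>y\<close>, so a small ball around it stays in the slab and projects into
    the chart ball, where the area density is at least 1.\<close>
  define x0 where "x0 = y + (1 / 2 - y \<bullet> \<nu>) *\<^sub>R \<nu>"
  have Gx0: "c.G x0 = 1 / 2 - y \<bullet> \<nu>" unfolding x0_def c.G_shift Gy by simp
  have x0: "x0 \<bullet> \<nu> = 1 / 2" using c.norm_\<nu> by (simp add: x0_def inner_add_left dot_square_norm)
  have Px0: "c.P x0 = y" unfolding c.P_eq Gx0 by (simp add: x0_def flip: scaleR_add_left)
  define U where "U = {x. 0 < x \<bullet> \<nu>} \<inter> {x. x \<bullet> \<nu> < 1} \<inter> c.P -` ball y r"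
  have "open U" unfolding U_def
    by (intro open_Int open_Collect_less continuous_intros open_vimage c.continuous_on_P) auto
  moreover have "x0 \<in> U" using x0 Px0 yb by (simp add: U_def)
  ultimately obtain e where e: "e > 0" "ball x0 e \<subseteq> U" unfolding open_contains_ball by blast
  have "0 < emeasure lborel (ball x0 e)" using content_ball_pos[OF e(1), of x0]
    by (auto simp: measure_def zero_less_iff_neq_zero)
  also have "\<dots> = (\<integral>\<^sup>+x. indicator (ball x0 e) x \<partial>lborel)" by simp
  also have "\<dots> \<le> (\<integral>\<^sup>+x. indicator (slab \<nu>) x * (ennreal (norm (c.a x)) * indicator (ball y r) (c.P x)) \<partial>lborel)"
  proof (rule nn_integral_mono)
    fix x
    show "(indicator (ball x0 e) x :: ennreal) \<le> indicator (slab \<nu>) x * (ennreal (norm (c.a x)) * indicator (ball y r) (c.P x))"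
    proof (cases "x \<in> ball x0 e")
      case True
      then have "x \<in> U" using e(2) by blast
      then show ?thesis using True c.norm_a_ge_1[of x] by (simp add: U_def slab_def)
    qed simp
  qed
  also have "\<dots> = (\<integral>\<^sup>+x. indicator (ball y r) x \<partial>chart_measure \<nu> \<gamma>)"
    by (rule c.nn_integral_chart_measure[symmetric], rule borel_measurable_indicator) simp
  also have "\<dots> = (\<integral>\<^sup>+x. indicator (ball y r) x \<partial>\<sigma>)"
    by (rule nn_integral_surface_measure[OF c y, symmetric], rule borel_measurable_indicator) auto
  also have "\<dots> \<le> (\<integral>\<^sup>+x. ennreal 1 \<partial>\<sigma>)" by (intro nn_integral_mono) (auto simp: indicator_def)
  also have "\<dots> = ennreal (integral\<^sup>L \<sigma> (\<lambda>_. 1))"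
    by (rule nn_integral_eq_integral[OF integrable_surface_measure]) auto
  finally show ?thesis by simp
qed

text \<open>By the fundamental theorem and Fubini the integral equals, up to terms independent of
  \<open>\<epsilon>\<close>, minus the integral of \<open>dprofile \<epsilon> t * layer p t\<close>.
  The layer integral is comparable to \<open>M * t\<close> and the derivative is -1/t^2 beyond
  \<open>2 * \<epsilon>\<close>, so a logarithm appears.\<close>

lemma profile_integral_diverges:
  assumes p: "continuous_on UNIV p" and m: "integral\<^sup>L \<sigma> p > 0"
  shows "\<exists>\<epsilon>>0. (\<integral>x. profile \<epsilon> (bdist \<Omega> x) * p x \<partial>lborel) > C"
proof -
  let ?d = "bdist \<Omega>"
  define M where "M = integral\<^sup>L \<sigma> p"
  have M: "M > 0" using m by (simp add: M_def)
  have pm [measurable]: "p \<in> borel_measurable borel" using p by (rule borel_measurable_continuous_onI)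
  have "M / 2 < integral\<^sup>L \<sigma> p" "integral\<^sup>L \<sigma> p < 3 * M / 2" using M unfolding M_def by linarith+
  then have "eventually (\<lambda>t. layer p t / t > M / 2) (at_right 0)" "eventually (\<lambda>t. layer p t / t < 3 * M / 2) (at_right 0)"
    by (simp_all only: order_tendstoD[OF layer_limit[OF p]])
  then have "eventually (\<lambda>t. layer p t / t > M / 2 \<and> layer p t / t < 3 * M / 2) (at_right 0)" by (rule eventually_conj)
  then obtain \<delta>0 where \<delta>0: "\<delta>0 > 0" "\<And>t. 0 < t \<Longrightarrow> t < \<delta>0 \<Longrightarrow> layer p t / t > M / 2 \<and> layer p t / t < 3 * M / 2"
    unfolding eventually_at_right_field by auto
  define \<delta> where "\<delta> = \<delta>0 / 2"
  have \<delta>: "\<delta> > 0" using \<delta>0(1) by (simp add: \<delta>_def)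
  have lay: "M / 2 * t \<le> layer p t" "layer p t \<le> 3 * M / 2 * t" if "0 < t" "t \<le> \<delta>" for t
    using \<delta>0(2)[of t] that \<delta>0(1) by (simp_all add: \<delta>_def pos_less_divide_eq pos_divide_less_eq less_imp_le)
  obtain B where B: "B > 0" "\<And>x. x \<in> closure \<Omega> \<Longrightarrow> norm (p x) \<le> B"
    by (rule bounded_image_compact_le[OF compact_closure_\<Omega>, of p], rule continuous_on_subset[OF p], simp, rule that)
  define R where "R = (\<integral>x. indicator (\<Omega> \<inter> {x. ?d x \<ge> \<delta>}) x * (p x / ?d x) \<partial>lborel)"
  \<comment> \<open>Only half of the limit \<open>M\<close> is used for the logarithm, which
    suffices for divergence. The constant \<open>27 * M / 2\<close> is the contribution of the
    transition zone between \<open>\<epsilon>\<close> and \<open>2 * \<epsilon>\<close>.\<close>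
  have key: "(\<integral>x. profile \<epsilon> (?d x) * p x \<partial>lborel) \<ge> R + layer p \<delta> / \<delta> + M / 2 * ln (\<delta> / (2 * \<epsilon>)) - 27 * M / 2"
    if \<epsilon>: "0 < \<epsilon>" "2 * \<epsilon> < \<delta>" for \<epsilon>
  proof -
    note pp = profile_props[OF \<epsilon>(1)]
    have dpm [measurable]: "dprofile \<epsilon> \<in> borel_measurable borel" using pp(5) by (rule borel_measurable_continuous_onI)
    have prm [measurable]: "profile \<epsilon> \<in> borel_measurable borel"
      by (intro borel_measurable_continuous_onI continuous_at_imp_continuous_on ballI DERIV_isCont[OF pp(4)])
    obtain Q where Q: "Q > 0" "\<And>t. t \<in> {0..\<delta>} \<Longrightarrow> norm (dprofile \<epsilon> t) \<le> Q"
      by (rule bounded_image_compact_le[of "{0..\<delta>}" "dprofile \<epsilon>"], simp, rule continuous_on_subset[OF pp(5)], simp, rule that)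
    \<comment> \<open>The double integrand: integrating in \<open>x\<close> first gives the layer
      integral weighted by \<open>dprofile\<close>, integrating in \<open>t\<close> first gives an
      increment of \<open>profile\<close>.\<close>
    define \<Psi> where "\<Psi> x t = indicator (\<Omega> \<inter> {z. ?d z < t}) x * (indicator {0<..\<delta>} t * dprofile \<epsilon> t * p x)" for x t
    have \<Psi>_eq: "\<Psi> x t = (if x \<in> \<Omega> \<and> ?d x < t \<and> 0 < t \<and> t \<le> \<delta> then dprofile \<epsilon> t * p x else 0)" for x t
      by (auto simp: \<Psi>_def indicator_def)
    have \<Psi>i: "integrable (lborel \<Otimes>\<^sub>M lborel) (\<lambda>(x, t). \<Psi> x t)"
    proof (rule integrableI_bounded_set[where A="closure \<Omega> \<times> {0..\<delta>}" and B="Q * B"])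
      show "(\<lambda>(x, t). \<Psi> x t) \<in> borel_measurable (lborel \<Otimes>\<^sub>M lborel)"
        unfolding \<Psi>_eq by measurable
      have cm: "closure \<Omega> \<in> sets lborel" by simp
      show "closure \<Omega> \<times> {0..\<delta>} \<in> sets (lborel \<Otimes>\<^sub>M lborel)" by (intro pair_measureI) (use cm in auto)
      have "emeasure (lborel \<Otimes>\<^sub>M lborel) (closure \<Omega> \<times> {0..\<delta>}) = emeasure lborel (closure \<Omega>) * emeasure lborel {0..\<delta>}"
        by (rule lborel.emeasure_pair_measure_Times) auto
      also have "\<dots> < \<infinity>" using emeasure_bounded_finite[OF bounded_closure[OF bounded_\<Omega>]] emeasure_bounded_finite[of "{0..\<delta>}"] by (simp add: ennreal_mult_less_top)
      finally show "emeasure (lborel \<Otimes>\<^sub>M lborel) (closure \<Omega> \<times> {0..\<delta>}) < \<infinity>" .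
      show "AE z in lborel \<Otimes>\<^sub>M lborel. z \<in> closure \<Omega> \<times> {0..\<delta>} \<longrightarrow> norm (case z of (x, t) \<Rightarrow> \<Psi> x t) \<le> Q * B"
      proof (rule AE_I2, clarify)
        fix x t assume "x \<in> closure \<Omega>" "t \<in> {0..\<delta>}"
        then have "norm (dprofile \<epsilon> t * p x) \<le> Q * B" unfolding norm_mult using Q B by (intro mult_mono) auto
        then show "norm (\<Psi> x t) \<le> Q * B" using Q(1) B(1) by (simp add: \<Psi>_eq)
      qed
      show "AE z in lborel \<Otimes>\<^sub>M lborel. z \<notin> closure \<Omega> \<times> {0..\<delta>} \<longrightarrow> (case z of (x, t) \<Rightarrow> \<Psi> x t) = 0"
        using closure_subset[of \<Omega>] by (intro AE_I2) (auto simp: \<Psi>_eq split: if_splits)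
    qed
    define a where "a t = (\<integral>x. \<Psi> x t \<partial>lborel)" for t
    have a_eq: "a t = indicator {0<..\<delta>} t * dprofile \<epsilon> t * layer p t" for t
    proof -
      have "a t = (\<integral>x. (indicator {0<..\<delta>} t * dprofile \<epsilon> t) * (indicator (\<Omega> \<inter> {z. ?d z < t}) x * p x) \<partial>lborel)"
        unfolding a_def \<Psi>_def by (simp add: mult_ac)
      then show ?thesis by (simp only: integral_mult_right_zero layer_def)
    qed
    have ai: "integrable lborel a" unfolding a_def[abs_def] by (rule lborel_pair.integrable_snd[OF \<Psi>i])
    have inner: "(\<integral>t. \<Psi> x t \<partial>lborel) = indicator (\<Omega> \<inter> {z. ?d z < \<delta>}) x * ((1 / \<delta> - profile \<epsilon> (?d x)) * p x)" for x
    proof (cases "x \<in> \<Omega> \<and> ?d x < \<delta>")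
      case True
      have d0: "0 \<le> ?d x" by (rule infdist_nonneg)
      have "(\<integral>t. \<Psi> x t \<partial>lborel) = (\<integral>t. p x * (dprofile \<epsilon> t * indicator {?d x..\<delta>} t) \<partial>lborel)"
      proof (rule integral_cong_AE)
        show "\<Psi> x \<in> borel_measurable lborel" unfolding \<Psi>_eq[abs_def] by measurable
        show "(\<lambda>t. p x * (dprofile \<epsilon> t * indicator {?d x..\<delta>} t)) \<in> borel_measurable lborel" by measurable
        have "AE t in lborel. t \<noteq> ?d x" by (rule AE_lborel_singleton)
        then show "AE t in lborel. \<Psi> x t = p x * (dprofile \<epsilon> t * indicator {?d x..\<delta>} t)"
          by eventually_elim (use True d0 in \<open>auto simp: \<Psi>_eq indicator_def\<close>)
      qed
      also have "\<dots> = p x * (\<integral>t. dprofile \<epsilon> t * indicator {?d x..\<delta>} t \<partial>lborel)" by simp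
      also have "(\<integral>t. dprofile \<epsilon> t * indicator {?d x..\<delta>} t \<partial>lborel) = profile \<epsilon> \<delta> - profile \<epsilon> (?d x)"
        by (rule integral_FTC_Icc_real) (use True pp(4,5) in \<open>auto simp: continuous_on_eq_continuous_at\<close>)
      also have "profile \<epsilon> \<delta> = 1 / \<delta>" using pp(8)[of \<delta>] \<epsilon> by simp
      finally show ?thesis using True by (simp add: mult.commute)
    next
      case False
      then have "\<Psi> x t = 0" for t by (auto simp: \<Psi>_eq)
      then show ?thesis using False by (auto simp: indicator_def)
    qed
    have fub: "(\<integral>t. a t \<partial>lborel) = (\<integral>x. indicator (\<Omega> \<inter> {z. ?d z < \<delta>}) x * ((1 / \<delta> - profile \<epsilon> (?d x)) * p x) \<partial>lborel)"
      unfolding a_def inner[symmetric] by (rule lborel_pair.Fubini_integral[OF \<Psi>i])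
    have pi: "integrable lborel (\<lambda>x. profile \<epsilon> (?d x) * p x)" by (rule profile_integrable(1)[OF \<epsilon>(1) p])
    have i1: "integrable lborel (\<lambda>x. indicator (\<Omega> \<inter> {z. ?d z < \<delta>}) x * ((1 / \<delta> - profile \<epsilon> (?d x)) * p x))"
    proof (rule layer_integrable)
      show "continuous_on UNIV (\<lambda>x. (1 / \<delta> - profile \<epsilon> (?d x)) * p x)"
        using \<delta> by (intro continuous_intros profile_bdist_continuous \<epsilon> p)
    qed
    have i2: "integrable lborel (\<lambda>x. indicator (\<Omega> \<inter> {z. ?d z < \<delta>}) x * p x)" by (rule layer_integrable[OF p])
    have i3: "integrable lborel (\<lambda>x. indicator (\<Omega> \<inter> {x. ?d x \<ge> \<delta>}) x * (p x / ?d x))"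
    proof -
      have "integrable lborel (\<lambda>x. indicator {x. ?d x \<ge> \<delta>} x *\<^sub>R (p x / max \<delta> (?d x)))"
        by (rule borel_integrable_compact[OF superlevel_compact[OF \<delta>]])
          (intro continuous_intros continuous_on_subset[OF p], use \<delta> in auto)
      moreover have "indicator {x. ?d x \<ge> \<delta>} x *\<^sub>R (p x / max \<delta> (?d x)) = indicator (\<Omega> \<inter> {x. ?d x \<ge> \<delta>}) x * (p x / ?d x)" for x
        using \<delta> bdist_outside[of x] by (auto simp: indicator_def max_def)
      ultimately show ?thesis by simp
    qed
    \<comment> \<open>For distances below \<open>\<delta>\<close> the profile is its value
      \<open>1 / \<delta>\<close> at the end minus its increment; beyond \<open>\<delta>\<close> it
      is already \<open>1 / d\<close>. Only the increment depends on
      \<open>\<epsilon>\<close>.\<close>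
    have split: "profile \<epsilon> (?d x) * p x = (1 / \<delta>) * (indicator (\<Omega> \<inter> {z. ?d z < \<delta>}) x * p x)
        - indicator (\<Omega> \<inter> {z. ?d z < \<delta>}) x * ((1 / \<delta> - profile \<epsilon> (?d x)) * p x)
        + indicator (\<Omega> \<inter> {x. ?d x \<ge> \<delta>}) x * (p x / ?d x)" for x
    proof (cases "x \<in> \<Omega>")
      case True
      then show ?thesis using pp(8)[of "?d x"] \<epsilon> by (cases "?d x < \<delta>") (auto simp: algebra_simps)
    next
      case False
      then show ?thesis using pp(1)[of "?d x"] \<epsilon> by (simp add: bdist_outside)
    qed
    have "(\<integral>x. profile \<epsilon> (?d x) * p x \<partial>lborel) = 1 / \<delta> * layer p \<delta> - (\<integral>t. a t \<partial>lborel) + R"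
      unfolding split fub R_def layer_def using i1 i2 i3 by simp
    moreover have "(\<integral>t. a t \<partial>lborel) \<le> 27 * M / 2 - M / 2 * ln (\<delta> / (2 * \<epsilon>))"
    proof -
      have ln: "(\<integral>t. 1 / t * indicator {2 * \<epsilon>..\<delta>} t \<partial>lborel) = ln \<delta> - ln (2 * \<epsilon>)"
        by (rule integral_FTC_Icc_real) (use \<epsilon> in \<open>auto intro!: derivative_eq_intros continuous_intros simp: divide_inverse\<close>)
      have lni: "integrable lborel (\<lambda>t. 1 / t * indicator {2 * \<epsilon>..\<delta>} t)"
        using borel_integrable_compact[of "{2 * \<epsilon>..\<delta>}" "\<lambda>t. 1 / t"] \<epsilon>
        by (simp add: mult.commute continuous_on_divide)
      have in1: "integrable lborel (\<lambda>t. 27 * M / (2 * \<epsilon>) * indicator {\<epsilon>..2 * \<epsilon>} t)"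
        by (rule integrable_mult_right[OF integrable_indicator_compact]) simp
      note in2 = integrable_mult_right[OF lni, of "M / 2"]
      \<comment> \<open>In the transition zone \<open>dprofile\<close> is at most
        \<open>9 / (\<epsilon> * t)\<close> and the layer integral at most
        \<open>3 * M / 2 * t\<close>. The product is a constant, integrated over an interval of
        length \<open>\<epsilon>\<close>.\<close>
      let ?u = "\<lambda>t. 27 * M / (2 * \<epsilon>) * indicator {\<epsilon>..2 * \<epsilon>} t - M / 2 * (1 / t * indicator {2 * \<epsilon>..\<delta>} t)"
      have "(\<integral>t. a t \<partial>lborel) \<le> (\<integral>t. ?u t \<partial>lborel)"
      proof (rule integral_mono_AE[OF ai])
        show "integrable lborel ?u" by (rule Bochner_Integration.integrable_diff[OF in1 in2])
        have "AE t in lborel. t \<noteq> 2 * \<epsilon>" by (rule AE_lborel_singleton)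
        then show "AE t in lborel. a t \<le> ?u t"
        proof eventually_elim
          case (elim t)
          consider "t \<le> \<epsilon>" | "\<epsilon> < t" "t < 2 * \<epsilon>" | "2 * \<epsilon> < t" "t \<le> \<delta>" | "\<delta> < t" using elim by linarith
          then show ?case
          proof cases
            case 1
            have "27 * M / (2 * \<epsilon>) \<ge> 0" using M \<epsilon> by simp
            then have "?u t \<ge> 0" using 1 \<epsilon> M by (auto simp: indicator_def)
            then show ?thesis using pp(2)[OF 1] by (simp add: a_eq)
          next
            case 2
            have t: "0 < t" "t \<le> \<delta>" using 2 \<epsilon> by auto
            have l: "0 \<le> layer p t" "layer p t \<le> 3 * M / 2 * t" using lay[OF t] M t mult_pos_pos[of "M / 2" t] by auto
            have "dprofile \<epsilon> t \<le> 9 / (\<epsilon> * t)"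
            proof -
              have "dstep (t / \<epsilon> - 1) / (\<epsilon> * t) \<le> 9 / (\<epsilon> * t)" using dstep_le t \<epsilon> by (intro divide_right_mono) auto
              moreover have "0 \<le> step (t / \<epsilon> - 1) / t\<^sup>2" using step_props(3) by simp
              ultimately show ?thesis using 2 by (simp add: dprofile_def)
            qed
            then have "dprofile \<epsilon> t * layer p t \<le> 9 / (\<epsilon> * t) * layer p t" using l(1) by (rule mult_right_mono)
            also have "\<dots> \<le> 9 / (\<epsilon> * t) * (3 * M / 2 * t)" using l(2) t \<epsilon> by (intro mult_left_mono) auto
            also have "\<dots> = 27 * M / (2 * \<epsilon>)" using t by (simp add: field_simps)
            finally show ?thesis using 2 t by (simp add: a_eq indicator_def)
          next
            case 3
            have t: "0 < t" "t \<le> \<delta>" using 3 \<epsilon> by auto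
            have "t / \<epsilon> - 1 \<ge> 1" using 3 \<epsilon> by (simp add: field_simps)
            then have "dprofile \<epsilon> t = - (1 / t\<^sup>2)"
              using dstep_eq_0 step_props(2) 3 \<epsilon> by (simp add: dprofile_def)
            then have "dprofile \<epsilon> t * layer p t = - (1 / t\<^sup>2 * layer p t)" by simp
            also have "\<dots> \<le> - (1 / t\<^sup>2 * (M / 2 * t))" using lay(1)[OF t] by (intro le_imp_neg_le mult_left_mono) auto
            also have "1 / t\<^sup>2 * (M / 2 * t) = M / 2 * (1 / t)" using t by (simp add: power2_eq_square)
            finally show ?thesis using 3 t \<epsilon> by (simp add: a_eq indicator_def)
          next
            case 4
            then show ?thesis using \<epsilon> by (simp add: a_eq indicator_def)
          qed
        qed
      qed
      also have "\<dots> = 27 * M / (2 * \<epsilon>) * \<epsilon> - M / 2 * (ln \<delta> - ln (2 * \<epsilon>))"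
        unfolding Bochner_Integration.integral_diff[OF in1 in2] integral_mult_right_zero ln using \<epsilon> by simp
      also have "\<dots> = 27 * M / 2 - M / 2 * ln (\<delta> / (2 * \<epsilon>))"
        using \<epsilon> \<delta> by (simp add: ln_div)
      finally show ?thesis .
    qed
    ultimately show ?thesis by simp
  qed
  \<comment> \<open>The value the logarithm must take to exceed the bound. Taking at least 1
    guarantees \<open>exp X > 1\<close>, hence \<open>2 * \<epsilon> < \<delta>\<close>.\<close>
  define X where "X = max 1 ((C - R - layer p \<delta> / \<delta> + 27 * M / 2 + 1) / (M / 2))"
  define \<epsilon> where "\<epsilon> = \<delta> / (2 * exp X)"
  have X: "X \<ge> 1" "(C - R - layer p \<delta> / \<delta> + 27 * M / 2 + 1) / (M / 2) \<le> X" by (auto simp: X_def)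
  have "exp X > 1" using X(1) by simp
  then have \<epsilon>: "0 < \<epsilon>" "2 * \<epsilon> < \<delta>" using \<delta> by (auto simp: \<epsilon>_def field_simps)
  have "ln (\<delta> / (2 * \<epsilon>)) = X" using \<delta> by (simp add: \<epsilon>_def)
  moreover have "C - R - layer p \<delta> / \<delta> + 27 * M / 2 + 1 \<le> X * (M / 2)" using X(2) M by (subst (asm) pos_divide_le_eq) auto
  ultimately have "(\<integral>x. profile \<epsilon> (?d x) * p x \<partial>lborel) > C" using key[OF \<epsilon>] by (simp add: mult.commute)
  then show ?thesis using \<epsilon>(1) by blast
qed

end

section \<open>Sharpness\<close>

lemma le_of_le_add_mult:
  fixes a b C :: real
  assumes "\<And>e. e > 0 \<Longrightarrow> a \<le> b + e * C" "C \<ge> 0"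
  shows "a \<le> b"
proof (rule field_le_epsilon)
  fix e :: real assume e: "0 < e"
  have "a \<le> b + e / (C + 1) * C" using assms(1)[of "e / (C + 1)"] assms(2) e by simp
  moreover have "e / (C + 1) * C \<le> e" using assms(2) e by (simp add: field_simps)
  ultimately show "a \<le> b + e" by linarith
qed

lemma profile_le_inverse: "t > 0 \<Longrightarrow> profile \<epsilon> t \<le> 1 / t"
  unfolding profile_def using step_props(4) by (intro divide_right_mono) auto

context C2_domain begin

text \<open>The Hardy inequality tested with functions approximating \<open>d\<^sup>s\<^sup>-\<^sup>1 \<cdot> profile \<epsilon> d\<close>, for which
  \<open>\<bar>\<nabla>u\<bar> d\<^sup>1\<^sup>-\<^sup>s - (s - 1) \<bar>u\<bar> d\<^sup>-\<^sup>s\<close> is exactly \<open>dprofile \<epsilon> d\<close>.\<close>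

lemma hardy_tested:
  assumes H: "\<And>u. u \<in> Cc_infinity \<Omega> \<Longrightarrow>
      weighted_grad_L1 \<Omega> (s - 1) u \<ge> (s - 1) * weighted_L1 \<Omega> s u + c * weighted_L1 \<Omega> q u"
    and s: "s \<ge> 2" and \<epsilon>: "\<epsilon> > 0"
  shows "c * (\<integral>x. profile \<epsilon> (bdist \<Omega> x) * clamped_powr \<Omega> (\<epsilon> / 2) (s - 1 - q) x \<partial>lborel)
    \<le> (\<integral>x. dprofile \<epsilon> (bdist \<Omega> x) \<partial>lborel)"
proof -
  let ?d = "bdist \<Omega>"
  note pp = profile_props[OF \<epsilon>]
  define K where "K = {x. ?d x \<ge> \<epsilon> / 2}"
  have K: "compact K" unfolding K_def using superlevel_compact[of "\<epsilon> / 2"] \<epsilon> by simp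
  define W where "W = clamped_powr \<Omega> (\<epsilon> / 2)"
  have Wc: "continuous_on A (W p)" for p A unfolding W_def using continuous_on_clamped_powr[of "\<epsilon> / 2"] \<epsilon> by simp
  have W0: "W p x > 0" for p x using \<epsilon> by (simp add: W_def clamped_powr_def max_def)
  have Wmult: "W p x * W p' x = W (p + p') x" for p p' x by (simp add: W_def clamped_powr_def powr_add)
  \<comment> \<open>Clamping at \<open>\<epsilon> / 2\<close> makes the powers harmless near 0. It
    changes nothing in \<open>F\<close>, since the profile vanishes up to
    \<open>\<epsilon>\<close>.\<close>
  define F where "F t = profile \<epsilon> t * (max (\<epsilon> / 2) t) powr (s - 1)" for t
  define F' where "F' t = dprofile \<epsilon> t * (max (\<epsilon> / 2) t) powr (s - 1)
      + (s - 1) * (profile \<epsilon> t * (max (\<epsilon> / 2) t) powr (s - 2))" for t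
  have F0: "F t = 0" if "t \<le> \<epsilon>" for t using pp(1)[OF that] by (simp add: F_def)
  have F1: "(F has_real_derivative F' t) (at t)" for t
  proof (cases "t < \<epsilon>")
    case True
    have "F' t = 0" using pp(1,2)[of t] True by (simp add: F'_def)
    moreover have "(F has_real_derivative 0) (at t)"
    proof (rule has_field_derivative_transform_within[OF DERIV_const[of 0]])
      show "\<epsilon> - t > 0" using True by simp
      show "t \<in> UNIV" by simp
      fix z assume "dist z t < \<epsilon> - t"
      then show "0 = F z" using F0[of z] by (simp add: dist_real_def)
    qed
    ultimately show ?thesis by simp
  next
    case False
    then have t: "t > 0" "t > \<epsilon> / 2" using \<epsilon> by auto
    have "((\<lambda>t. profile \<epsilon> t * t powr (s - 1)) has_real_derivative
        dprofile \<epsilon> t * t powr (s - 1) + (s - 1) * t powr (s - 1 - 1) * profile \<epsilon> t) (at t)"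
      by (rule DERIV_mult[OF pp(4) has_real_derivative_powr[OF t(1)]])
    moreover have "dprofile \<epsilon> t * t powr (s - 1) + (s - 1) * t powr (s - 1 - 1) * profile \<epsilon> t = F' t"
      using t by (simp add: F'_def max_def)
    ultimately have "((\<lambda>t. profile \<epsilon> t * t powr (s - 1)) has_real_derivative F' t) (at t)" by simp
    then show ?thesis
    proof (rule has_field_derivative_transform_within)
      show "t \<in> UNIV" by simp
      show "t - \<epsilon> / 2 > 0" using t by simp
      fix z assume "dist z t < t - \<epsilon> / 2"
      then have "z > \<epsilon> / 2" unfolding dist_real_def by linarith
      then show "profile \<epsilon> z * z powr (s - 1) = F z" by (simp add: F_def max_def)
    qed
  qed
  have profc: "continuous_on UNIV (profile \<epsilon>)"
    by (intro continuous_at_imp_continuous_on ballI DERIV_isCont[OF pp(4)])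
  have F2: "continuous_on UNIV F'"
    unfolding F'_def using \<epsilon> by (intro continuous_intros pp(5) profc) auto
  \<comment> \<open>Up to a positive power of \<open>t\<close>, the derivative is
    \<open>dstep / \<epsilon> + (s - 2) * profile\<close>. This is where \<open>s \<ge> 2\<close>
    enters: \<open>F\<close> is increasing, so \<open>F'\<close> itself bounds the gradient.\<close>
  have F3: "F' t \<ge> 0" for t
  proof (cases "t \<le> \<epsilon>")
    case True
    then show ?thesis using pp(1,2)[of t] by (simp add: F'_def)
  next
    case False
    then have t: "t > 0" "t > \<epsilon> / 2" using \<epsilon> by auto
    have "dprofile \<epsilon> t * t = dstep (t / \<epsilon> - 1) / \<epsilon> - profile \<epsilon> t"
      using False t by (simp add: dprofile_def profile_def field_simps power2_eq_square)
    then have "dprofile \<epsilon> t * t + (s - 1) * profile \<epsilon> t = dstep (t / \<epsilon> - 1) / \<epsilon> + (s - 2) * profile \<epsilon> t"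
      by (simp add: algebra_simps)
    also have "\<dots> \<ge> 0" using dstep_nonneg[of "t / \<epsilon> - 1"] pp(3)[of t] s \<epsilon> by simp
    finally have "0 \<le> t powr (s - 2) * (dprofile \<epsilon> t * t + (s - 1) * profile \<epsilon> t)" by simp
    also have "\<dots> = F' t"
    proof -
      have "t powr (s - 1) = t powr (s - 2) * t" using powr_add[of t "s - 2" 1] t by simp
      then show ?thesis using t by (simp add: F'_def max_def algebra_simps)
    qed
    finally show ?thesis .
  qed
  have Fc: "continuous_on UNIV F" by (intro continuous_at_imp_continuous_on ballI DERIV_isCont[OF F1])
  have Fdc: "continuous_on A (\<lambda>x. F (?d x))" "continuous_on A (\<lambda>x. F' (?d x))" for A
    by (rule continuous_on_compose2[OF Fc] continuous_on_compose2[OF F2]; auto intro!: continuous_intros)+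
  have dK: "?d x \<le> \<epsilon>" if "x \<notin> K" for x using that \<epsilon> by (simp add: K_def)
  have Fk: "F (?d x) = 0" "F' (?d x) = 0" if "x \<notin> K" for x
    using F0[OF dK[OF that]] pp(1,2)[OF dK[OF that]] by (simp_all add: F'_def)
  have i1: "integrable lborel (\<lambda>x. F' (?d x) * W p x)" and i2: "integrable lborel (\<lambda>x. F (?d x) * W p x)" for p
    by (rule integrable_lborel_compact_support[OF K]; (intro continuous_intros Fdc Wc | simp add: Fk))+
  have i3: "integrable lborel (\<lambda>x. indicator K x * W p x)" for p
    using borel_integrable_compact[OF K Wc[of K p]] by simp
  define A where "A p = (\<integral>x. indicator K x * W p x \<partial>lborel)" for p
  have A0: "A p \<ge> 0" for p unfolding A_def using W0 by (intro integral_nonneg_AE AE_I2) (simp add: less_imp_le)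
  define I1 where "I1 = (\<integral>x. F' (?d x) * W (1 - s) x \<partial>lborel)"
  define I2 where "I2 p = (\<integral>x. F (?d x) * W (- p) x \<partial>lborel)" for p
  \<comment> \<open>All approximation errors are \<open>e\<close> times weighted volumes of the
    fixed compact set \<open>K\<close>, independent of the approximating function. They disappear as
    \<open>e\<close> tends to 0.\<close>
  have est: "(s - 1) * I2 s + c * I2 q \<le> I1 + e * (A (1 - s) + (s - 1) * A (- s) + \<bar>c\<bar> * A (- q))" if e: "e > 0" for e
  proof -
    obtain u where u: "u \<in> Cc_infinity \<Omega>" "\<And>x. \<bar>u x - F (?d x)\<bar> \<le> e"
      "\<And>x. ?d x < \<epsilon> / 2 \<Longrightarrow> u x = 0" "\<And>x. norm (gradient u x) \<le> F' (?d x) + e"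
      by (rule smooth_approximation[OF bounded_\<Omega> not_UNIV \<epsilon> e F1 F2 F3 F0], assumption, rule that)
    have uK: "u x = 0" if "x \<notin> K" for x using u(3)[of x] that by (simp add: K_def)
    have gK: "gradient u x = 0" if "x \<notin> K" for x
      by (rule gradient_zero_outside[OF compact_imp_closed[OF K] uK that])
    have inO: "x \<in> \<Omega> \<and> ?d x \<ge> \<epsilon> / 2" if "x \<in> K" for x
      using that \<epsilon> bdist_outside[of x] by (cases "x \<in> \<Omega>") (auto simp: K_def)
    have Cu: "C_diff (Suc 0) u" by (rule Cc_infinityD(1)[OF u(1)])
    have uc: "continuous_on S u" for S by (rule C_diff_continuous_on[OF Cu])
    have L: "weighted_L1 \<Omega> p u = (\<integral>x. \<bar>u x\<bar> * W (- p) x \<partial>lborel)" for p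
      unfolding W_def by (rule weighted_L1_clamped) (use uK inO in metis)
    have G: "weighted_grad_L1 \<Omega> (s - 1) u = (\<integral>x. norm (gradient u x) * W (1 - s) x \<partial>lborel)"
      unfolding W_def using weighted_grad_L1_clamped[of u \<Omega> "\<epsilon> / 2" "s - 1"] gK inO by (metis minus_diff_eq)
    have iu: "integrable lborel (\<lambda>x. \<bar>u x\<bar> * W p x)" for p
      by (rule integrable_lborel_compact_support[OF K]) (intro continuous_intros uc Wc, simp add: uK)
    have ig: "integrable lborel (\<lambda>x. norm (gradient u x) * W p x)" for p
      by (rule integrable_lborel_compact_support[OF K]) (intro continuous_intros continuous_on_gradient[OF Cu] Wc, simp add: gK)
    have ie: "integrable lborel (\<lambda>x. e * (indicator K x * W p x))" for p using i3 by simp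
    have g: "weighted_grad_L1 \<Omega> (s - 1) u \<le> I1 + e * A (1 - s)"
    proof -
      have "weighted_grad_L1 \<Omega> (s - 1) u \<le> (\<integral>x. F' (?d x) * W (1 - s) x + e * (indicator K x * W (1 - s) x) \<partial>lborel)"
        unfolding G
      proof (rule integral_mono[OF ig Bochner_Integration.integrable_add[OF i1 ie]])
        fix x
        show "norm (gradient u x) * W (1 - s) x \<le> F' (?d x) * W (1 - s) x + e * (indicator K x * W (1 - s) x)"
        proof (cases "x \<in> K")
          case True
          then show ?thesis using mult_right_mono[OF u(4)[of x] less_imp_le[OF W0[of "1 - s" x]]]
            by (simp add: distrib_right)
        next
          case False
          then show ?thesis by (simp add: gK Fk)
        qed
      qed
      then show ?thesis unfolding I1_def A_def Bochner_Integration.integral_add[OF i1 ie] by simp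
    qed
    have l: "\<bar>weighted_L1 \<Omega> p u - I2 p\<bar> \<le> e * A (- p)" for p
    proof -
      have "\<bar>weighted_L1 \<Omega> p u - I2 p\<bar> = \<bar>\<integral>x. \<bar>u x\<bar> * W (- p) x - F (?d x) * W (- p) x \<partial>lborel\<bar>"
        unfolding L I2_def Bochner_Integration.integral_diff[OF iu i2] ..
      also have "\<dots> \<le> (\<integral>x. \<bar>\<bar>u x\<bar> * W (- p) x - F (?d x) * W (- p) x\<bar> \<partial>lborel)"
        using integral_norm_bound[of lborel "\<lambda>x. \<bar>u x\<bar> * W (- p) x - F (?d x) * W (- p) x"] by simp
      also have "\<dots> \<le> (\<integral>x. e * (indicator K x * W (- p) x) \<partial>lborel)"
      proof (rule integral_mono[OF integrable_abs[OF Bochner_Integration.integrable_diff[OF iu i2]] ie])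
        fix x
        show "\<bar>\<bar>u x\<bar> * W (- p) x - F (?d x) * W (- p) x\<bar> \<le> e * (indicator K x * W (- p) x)"
        proof (cases "x \<in> K")
          case True
          have "F (?d x) \<ge> 0" using pp(3) by (simp add: F_def)
          then have "\<bar>\<bar>u x\<bar> - F (?d x)\<bar> \<le> e" using u(2)[of x] by linarith
          then have "\<bar>\<bar>u x\<bar> - F (?d x)\<bar> * W (- p) x \<le> e * W (- p) x"
            using less_imp_le[OF W0] by (rule mult_right_mono)
          moreover have "\<bar>\<bar>u x\<bar> * W (- p) x - F (?d x) * W (- p) x\<bar> = \<bar>\<bar>u x\<bar> - F (?d x)\<bar> * W (- p) x"
            using W0[of "- p" x] by (simp flip: left_diff_distrib add: abs_mult)
          ultimately show ?thesis using True by simp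
        next
          case False
          then show ?thesis by (simp add: uK Fk)
        qed
      qed
      also have "\<dots> = e * A (- p)" unfolding A_def by simp
      finally show ?thesis .
    qed
    have "(s - 1) * (I2 s - e * A (- s)) \<le> (s - 1) * weighted_L1 \<Omega> s u"
      using l[of s] s by (intro mult_left_mono) auto
    moreover have "c * I2 q - c * weighted_L1 \<Omega> q u \<le> \<bar>c\<bar> * (e * A (- q))"
    proof -
      have "c * I2 q - c * weighted_L1 \<Omega> q u \<le> \<bar>c\<bar> * \<bar>weighted_L1 \<Omega> q u - I2 q\<bar>"
        using abs_ge_self[of "c * (I2 q - weighted_L1 \<Omega> q u)"]
        unfolding abs_mult abs_minus_commute[of "I2 q"] by (simp add: right_diff_distrib)
      also have "\<dots> \<le> \<bar>c\<bar> * (e * A (- q))" by (intro mult_left_mono l) simp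
      finally show ?thesis .
    qed
    ultimately show ?thesis using H[OF u(1)] g by (simp add: algebra_simps)
  qed
  have "(s - 1) * I2 s + c * I2 q \<le> I1"
    by (rule le_of_le_add_mult[OF est]) (use A0 s in auto)
  \<comment> \<open>Differentiating the power factor of \<open>F\<close> reproduces the Hardy term
    exactly, and only the derivative of the profile survives.\<close>
  moreover have "I1 - (s - 1) * I2 s = (\<integral>x. dprofile \<epsilon> (?d x) \<partial>lborel)"
  proof -
    have Fw: "F (?d x) = profile \<epsilon> (?d x) * W (s - 1) x"
      "F' (?d x) = dprofile \<epsilon> (?d x) * W (s - 1) x + (s - 1) * (profile \<epsilon> (?d x) * W (s - 2) x)" for x
      by (simp_all add: F_def F'_def W_def clamped_powr_def)
    have "F' (?d x) * W (1 - s) x - (s - 1) * (F (?d x) * W (- s) x) = dprofile \<epsilon> (?d x)" for x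
    proof -
      have "W 0 x = 1" using \<epsilon> by (simp add: W_def clamped_powr_def max_def)
      then have "W (s - 1) x * W (1 - s) x = 1" "W (s - 2) x * W (1 - s) x = W (- 1) x" "W (s - 1) x * W (- s) x = W (- 1) x"
        by (simp_all add: Wmult)
      then have "dprofile \<epsilon> (?d x) * (W (s - 1) x * W (1 - s) x) + (s - 1) * profile \<epsilon> (?d x) * (W (s - 2) x * W (1 - s) x)
          - (s - 1) * profile \<epsilon> (?d x) * (W (s - 1) x * W (- s) x) = dprofile \<epsilon> (?d x)" by simp
      then show ?thesis by (simp add: Fw distrib_right mult.assoc)
    qed
    then show ?thesis unfolding I1_def I2_def
      using Bochner_Integration.integral_diff[OF i1 integrable_mult_right[OF i2], of "1 - s" "s - 1" "- s"] by simp
  qed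
  moreover have "I2 q = (\<integral>x. profile \<epsilon> (?d x) * W (s - 1 - q) x \<partial>lborel)"
  proof -
    have "F (?d x) * W (- q) x = profile \<epsilon> (?d x) * W (s - 1 - q) x" for x
      using Wmult[of "s - 1" x "- q"] by (simp add: F_def W_def clamped_powr_def mult.assoc)
    then show ?thesis by (simp add: I2_def)
  qed
  ultimately show ?thesis by (simp add: W_def)
qed

text \<open>Near the boundary \<open>c * d powr (s - 1 - q)\<close> exceeds the bounded source
  \<open>h\<close> by at least 1. The tested inequality and the divergence bound would then bound
  the integral of the profile uniformly in \<open>\<epsilon>\<close>, against its divergence for
  \<open>p = 1\<close>.\<close>

lemma no_singular_improvement:
  assumes n: "DIM('a) \<ge> 2" and s: "s \<ge> 2" and c: "c > 0" and q: "q > s - 1"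
    and H: "\<And>u. u \<in> Cc_infinity \<Omega> \<Longrightarrow>
      weighted_grad_L1 \<Omega> (s - 1) u \<ge> (s - 1) * weighted_L1 \<Omega> s u + c * weighted_L1 \<Omega> q u"
  shows False
proof -
  let ?d = "bdist \<Omega>"
  obtain h C where h: "continuous_on UNIV (h :: 'a \<Rightarrow> real)"
    and D: "\<And>\<epsilon>. \<epsilon> > 0 \<Longrightarrow> (\<integral>x. dprofile \<epsilon> (?d x) \<partial>lborel) \<le> (\<integral>x. profile \<epsilon> (?d x) * h x \<partial>lborel) + C"
    by (rule divergence_bound[OF n], rule that)
  obtain B where B: "B > 0" "\<And>x. x \<in> closure \<Omega> \<Longrightarrow> norm (h x) \<le> B"
    by (rule bounded_image_compact_le[OF compact_closure_\<Omega>, of h], rule continuous_on_subset[OF h], simp, rule that)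
  \<comment> \<open>The distance at which \<open>c * t powr (s - 1 - q)\<close> equals
    \<open>B + 1\<close>; the exponent is negative, so the value is larger for smaller
    \<open>t\<close>.\<close>
  define \<delta> where "\<delta> = (c / (B + 1)) powr (1 / (q - s + 1))"
  have \<delta>: "\<delta> > 0" using c B(1) by (simp add: \<delta>_def)
  have large: "c * t powr (s - 1 - q) \<ge> B + 1" if "0 < t" "t \<le> \<delta>" for t
  proof -
    have "\<delta> powr (s - 1 - q) \<le> t powr (s - 1 - q)" using that q by (intro powr_mono2') auto
    moreover have "\<delta> powr (s - 1 - q) = (B + 1) / c"
    proof -
      have "1 / (q - s + 1) * (s - 1 - q) = - 1" using q by (simp add: field_simps)
      then have "\<delta> powr (s - 1 - q) = (c / (B + 1)) powr (- 1)" unfolding \<delta>_def powr_powr by (simp only:)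
      then show ?thesis using c B(1) by (simp add: powr_minus_divide)
    qed
    ultimately have "c * ((B + 1) / c) \<le> c * t powr (s - 1 - q)" using c by (intro mult_left_mono) auto
    then show ?thesis using c by simp
  qed
  \<comment> \<open>Farther than \<open>\<delta>\<close> from the boundary the profile is at most
    \<open>1 / \<delta>\<close>, so the missing domination costs at most
    \<open>(B + 1) / \<delta>\<close> pointwise on the closure of the domain.\<close>
  define C' where "C' = C + (B + 1) / \<delta> * measure lborel (closure \<Omega>)"
  have "(\<integral>x. profile \<epsilon> (?d x) * 1 \<partial>lborel) \<le> C'" if \<epsilon>: "\<epsilon> > 0" for \<epsilon>
  proof -
    note pp = profile_props[OF \<epsilon>]
    let ?W = "clamped_powr \<Omega> (\<epsilon> / 2) (s - 1 - q)"
    have Wc: "continuous_on UNIV ?W" by (rule continuous_on_clamped_powr) (use \<epsilon> in simp)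
    note i1 = profile_integrable(1)[OF \<epsilon> continuous_on_const[of UNIV 1]]
    note i2 = profile_integrable(1)[OF \<epsilon> Wc]
    note i3 = profile_integrable(1)[OF \<epsilon> h]
    have ind: "integrable lborel (\<lambda>x. (B + 1) / \<delta> * indicator (closure \<Omega>) x)"
      using integrable_indicator_compact[OF compact_closure_\<Omega>] by simp
    note i2c = integrable_mult_right[OF i2, of c]
    note id = Bochner_Integration.integrable_diff[OF i2c i3]
    have "(\<integral>x. profile \<epsilon> (?d x) * 1 \<partial>lborel)
        \<le> (\<integral>x. c * (profile \<epsilon> (?d x) * ?W x) - profile \<epsilon> (?d x) * h x + (B + 1) / \<delta> * indicator (closure \<Omega>) x \<partial>lborel)"
    proof (rule integral_mono[OF i1 Bochner_Integration.integrable_add[OF id ind]])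
      fix x
      let ?p = "profile \<epsilon> (?d x)"
      show "?p * 1 \<le> c * (?p * ?W x) - ?p * h x + (B + 1) / \<delta> * indicator (closure \<Omega>) x"
      proof (cases "?d x \<le> \<epsilon>")
        case True
        then show ?thesis using pp(1)[OF True] B(1) \<delta> by simp
      next
        case False
        then have d0: "?d x > 0" "?d x > \<epsilon> / 2" using \<epsilon> by auto
        then have x: "x \<in> closure \<Omega>" using bdist_outside[of x] closure_subset[of \<Omega>] by fastforce
        have W: "?W x = ?d x powr (s - 1 - q)" using d0 by (simp add: clamped_powr_def)
        have hB: "h x \<le> B" using B(2)[OF x] by simp
        show ?thesis
        proof (cases "?d x \<le> \<delta>")
          case True
          have "1 \<le> c * ?W x - h x" using large[OF d0(1) True] hB unfolding W by linarith
          then have "?p * 1 \<le> ?p * (c * ?W x - h x)" using pp(3) by (rule mult_left_mono)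
          moreover have "(B + 1) / \<delta> * indicator (closure \<Omega>) x \<ge> 0" using B(1) \<delta> by simp
          ultimately show ?thesis by (simp add: algebra_simps)
        next
          case False
          have "?p \<le> 1 / ?d x" by (rule profile_le_inverse[OF d0(1)])
          also have "\<dots> \<le> 1 / \<delta>" using False \<delta> by (intro divide_left_mono) auto
          finally have "?p * (B + 1) \<le> 1 / \<delta> * (B + 1)" using B(1) by (intro mult_right_mono) auto
          moreover have "?p * h x \<le> ?p * B" using hB pp(3) by (rule mult_left_mono)
          moreover have "0 \<le> c * (?p * ?W x)" using c pp(3)[of "?d x"] by (simp add: W)
          ultimately show ?thesis using x by (simp add: algebra_simps)
        qed
      qed
    qed
    also have "\<dots> = c * (\<integral>x. profile \<epsilon> (?d x) * ?W x \<partial>lborel) - (\<integral>x. profile \<epsilon> (?d x) * h x \<partial>lborel)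
        + (B + 1) / \<delta> * measure lborel (closure \<Omega>)"
      unfolding Bochner_Integration.integral_add[OF id ind] Bochner_Integration.integral_diff[OF i2c i3]
        integral_mult_right_zero by simp
    also have "\<dots> \<le> C'" using hardy_tested[OF H s \<epsilon>] D[OF \<epsilon>] unfolding C'_def by linarith
    finally show ?thesis .
  qed
  moreover obtain \<epsilon> where "\<epsilon> > 0" "(\<integral>x. profile \<epsilon> (?d x) * 1 \<partial>lborel) > C'"
    using profile_integral_diverges[OF continuous_on_const[of UNIV 1] surface_measure_pos, of C'] by blast
  ultimately show False by (meson not_less)
qed

text \<open>The continuous source \<open>h\<close> restricts to a multiple of the mean curvature on
  the boundary, so no comparison of charts at varying points is required.\<close>

lemma mean_curvature_continuous:
  assumes n: "DIM('a) \<ge> 2"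
  shows "continuous_on (frontier \<Omega>) (mean_curvature \<Omega>)"
proof -
  obtain h where h: "continuous_on UNIV (h :: 'a \<Rightarrow> real)"
    "\<And>p. p \<in> frontier \<Omega> \<Longrightarrow> h p = real (DIM('a) - 1) * mean_curvature \<Omega> p"
    by (rule divergence_bound[OF n], rule that)
  have "continuous_on (frontier \<Omega>) (\<lambda>p. h p / real (DIM('a) - 1))"
    by (intro continuous_intros continuous_on_subset[OF h(1)]) (use n in auto)
  then show ?thesis
    by (rule continuous_on_cong[THEN iffD1, OF refl, rotated]) (use h(2) n in simp)
qed

lemma inf_mean_curvature_attained:
  assumes n: "DIM('a) \<ge> 2"
  obtains y0 where "y0 \<in> frontier \<Omega>" "inf_mean_curvature \<Omega> = ereal (mean_curvature \<Omega> y0)"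
proof -
  obtain y0 where y0: "y0 \<in> frontier \<Omega>" "\<And>y. y \<in> frontier \<Omega> \<Longrightarrow> mean_curvature \<Omega> y0 \<le> mean_curvature \<Omega> y"
    using continuous_attains_inf[OF compact_frontier frontier_ne mean_curvature_continuous[OF n]] by blast
  have "inf_mean_curvature \<Omega> = ereal (mean_curvature \<Omega> y0)"
    unfolding inf_mean_curvature_def
    by (rule INF_eqI) (use y0 in auto)
  then show ?thesis using y0(1) that by blast
qed

text \<open>With \<open>q = s - 1\<close> the weight in the tested inequality is 1, so the integrals
  of \<open>profile \<epsilon> d * (B - h)\<close> are bounded in \<open>\<epsilon>\<close>. They
  would diverge if \<open>B - h\<close> had positive integral over the boundary, hence
  \<open>B\<close> is at most the mean of \<open>h\<close>.\<close>

lemma L1_hardy_constant_le: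
  assumes n: "DIM('a) \<ge> 2" and s: "s \<ge> 2" and H: "\<And>u. u \<in> Cc_infinity \<Omega> \<Longrightarrow> L1_hardy \<Omega> s (ereal B) u"
  shows "B \<le> real (DIM('a) - 1) / measure \<sigma> (frontier \<Omega>) * (LINT y:frontier \<Omega>|\<sigma>. mean_curvature \<Omega> y)"
proof -
  let ?d = "bdist \<Omega>" and ?m = "real (DIM('a) - 1)"
  obtain h C where h: "continuous_on UNIV (h :: 'a \<Rightarrow> real)"
    "\<And>p. p \<in> frontier \<Omega> \<Longrightarrow> h p = ?m * mean_curvature \<Omega> p"
    and D: "\<And>\<epsilon>. \<epsilon> > 0 \<Longrightarrow> (\<integral>x. dprofile \<epsilon> (?d x) \<partial>lborel) \<le> (\<integral>x. profile \<epsilon> (?d x) * h x \<partial>lborel) + C"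
    by (rule divergence_bound[OF n], rule that)
  have H': "weighted_grad_L1 \<Omega> (s - 1) u \<ge> (s - 1) * weighted_L1 \<Omega> s u + B * weighted_L1 \<Omega> (s - 1) u"
    if "u \<in> Cc_infinity \<Omega>" for u using H[OF that] by (simp add: L1_hardy_def)
  have cB: "continuous_on UNIV (\<lambda>x. B - h x)" by (intro continuous_intros h)
  have bd: "(\<integral>x. profile \<epsilon> (?d x) * (B - h x) \<partial>lborel) \<le> C" if \<epsilon>: "\<epsilon> > 0" for \<epsilon>
  proof -
    have W: "clamped_powr \<Omega> (\<epsilon> / 2) (s - 1 - (s - 1)) x = 1" for x
      using \<epsilon> by (simp add: clamped_powr_def max_def)
    have t: "B * (\<integral>x. profile \<epsilon> (?d x) * 1 \<partial>lborel) \<le> (\<integral>x. dprofile \<epsilon> (?d x) \<partial>lborel)"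
      using hardy_tested[OF H' s \<epsilon>] by (simp only: W)
    note i1 = profile_integrable(1)[OF \<epsilon> continuous_on_const[of UNIV 1]]
    note i2 = profile_integrable(1)[OF \<epsilon> h(1)]
    have "(\<integral>x. profile \<epsilon> (?d x) * (B - h x) \<partial>lborel) = (\<integral>x. B * (profile \<epsilon> (?d x) * 1) - profile \<epsilon> (?d x) * h x \<partial>lborel)"
      by (simp add: algebra_simps)
    also have "\<dots> = B * (\<integral>x. profile \<epsilon> (?d x) * 1 \<partial>lborel) - (\<integral>x. profile \<epsilon> (?d x) * h x \<partial>lborel)"
      unfolding Bochner_Integration.integral_diff[OF integrable_mult_right[OF i1] i2] integral_mult_right_zero ..
    finally show ?thesis using t D[OF \<epsilon>] by linarith
  qed
  have "\<not> integral\<^sup>L \<sigma> (\<lambda>x. B - h x) > 0"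
    using profile_integral_diverges[OF cB, of C] bd by (meson not_less)
  moreover have i1: "integrable \<sigma> (\<lambda>_. 1 :: real)" and ih: "integrable \<sigma> h"
    by (intro integrable_surface_measure h continuous_on_const)+
  have "integral\<^sup>L \<sigma> (\<lambda>x. B - h x) = integral\<^sup>L \<sigma> (\<lambda>x. B * 1) - integral\<^sup>L \<sigma> h"
    using Bochner_Integration.integral_diff[OF integrable_mult_right[OF i1, of B] ih] by simp
  ultimately have le: "B * integral\<^sup>L \<sigma> (\<lambda>_. 1 :: real) \<le> integral\<^sup>L \<sigma> h"
    unfolding integral_mult_right_zero by linarith
  have sp: "space \<sigma> = UNIV" using sets_eq_imp_space_eq[OF sets_surface_measure] by simp
  have m1: "integral\<^sup>L \<sigma> (\<lambda>_. 1 :: real) = measure \<sigma> (frontier \<Omega>)"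
  proof -
    have "integral\<^sup>L \<sigma> (\<lambda>_. 1 :: real) = integral\<^sup>L \<sigma> (indicator (frontier \<Omega>))"
    proof (rule integral_cong_AE)
      show "indicator (frontier \<Omega>) \<in> borel_measurable \<sigma>"
        using frontier_borel by (intro borel_measurable_indicator) (simp add: sets_surface_measure)
      show "AE x in \<sigma>. (1 :: real) = indicator (frontier \<Omega>) x" using AE_frontier by eventually_elim simp
    qed simp
    then show ?thesis by (simp add: sp)
  qed
  have m2: "integral\<^sup>L \<sigma> h = ?m * (LINT y:frontier \<Omega>|\<sigma>. mean_curvature \<Omega> y)"
  proof -
    have "integral\<^sup>L \<sigma> h = integral\<^sup>L \<sigma> (\<lambda>y. indicator (frontier \<Omega>) y * h y)"
    proof (rule integral_cong_AE)
      show "h \<in> borel_measurable \<sigma>" using ih by simp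
      then show "(\<lambda>y. indicator (frontier \<Omega>) y * h y) \<in> borel_measurable \<sigma>"
        using frontier_borel by (intro borel_measurable_times borel_measurable_indicator) (simp_all add: sets_surface_measure)
      show "AE x in \<sigma>. h x = indicator (frontier \<Omega>) x * h x" using AE_frontier by eventually_elim simp
    qed
    also have "\<dots> = (\<integral>y. ?m * (indicator (frontier \<Omega>) y *\<^sub>R mean_curvature \<Omega> y) \<partial>\<sigma>)"
      by (intro Bochner_Integration.integral_cong refl) (auto simp: h(2) indicator_def)
    finally show ?thesis by (simp add: set_lebesgue_integral_def)
  qed
  have "measure \<sigma> (frontier \<Omega>) > 0" using surface_measure_pos m1 by simp
  then show ?thesis using le unfolding m1 m2 by (simp add: pos_le_divide_eq)
qed

text \<open>Positive curvature makes the remainder in the Hardy inequality nonnegative, which bounds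
  the quotients below. A larger infimum would be an improvement with the more singular exponent
  \<open>q = s\<close>, which is impossible.\<close>

lemma hardy_quotient_inf:
  assumes n: "DIM('a) \<ge> 2" and s: "s \<ge> 2" and H: "\<And>y. y \<in> frontier \<Omega> \<Longrightarrow> mean_curvature \<Omega> y > 0"
  shows "Cc_infinity \<Omega> - {\<lambda>_. 0} \<noteq> {}"
    and "(INF u\<in>Cc_infinity \<Omega> - {\<lambda>_. 0}. weighted_grad_L1 \<Omega> (s - 1) u / weighted_L1 \<Omega> s u) = s - 1"
proof -
  let ?X = "Cc_infinity \<Omega> - {\<lambda>_. 0}"
  let ?R = "\<lambda>u. weighted_grad_L1 \<Omega> (s - 1) u / weighted_L1 \<Omega> s u"
  have pos: "weighted_L1 \<Omega> p u > 0" if "u \<in> ?X" for p u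
    using weighted_L1_pos[OF open_\<Omega> not_UNIV] that by blast
  have zero: "weighted_L1 \<Omega> p (\<lambda>_. 0) = 0" "weighted_grad_L1 \<Omega> p (\<lambda>_. 0) \<ge> 0" for p
    unfolding weighted_L1_def weighted_grad_L1_def set_lebesgue_integral_def
    by (auto intro!: integral_nonneg_AE AE_I2)
  show ne: "?X \<noteq> {}"
  proof
    assume "?X = {}"
    then have u0: "u = (\<lambda>_. 0)" if "u \<in> Cc_infinity \<Omega>" for u using that by blast
    show False
    \<comment> \<open>If there were only the zero test function, the improved inequality would hold
      trivially with constant 1.\<close>
    proof (rule no_singular_improvement[OF n s, of 1 s])
      fix u assume "u \<in> Cc_infinity \<Omega>"
      from u0[OF this] show "weighted_grad_L1 \<Omega> (s - 1) u \<ge> (s - 1) * weighted_L1 \<Omega> s u + 1 * weighted_L1 \<Omega> s u"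
        by (simp add: zero)
    qed simp_all
  qed
  have lower: "?R u \<ge> s - 1" if u: "u \<in> ?X" for u
  proof -
    have "L1_hardy \<Omega> s (ereal (real (DIM('a) - 1)) * inf_mean_curvature \<Omega>) u"
      by (rule L1_hardy_inf_mean_curvature[OF open_\<Omega> not_UNIV C2 frontier_ne n]) (use u s in auto)
    moreover obtain y0 where y0: "y0 \<in> frontier \<Omega>" "inf_mean_curvature \<Omega> = ereal (mean_curvature \<Omega> y0)"
      by (rule inf_mean_curvature_attained[OF n], rule that)
    ultimately have "weighted_grad_L1 \<Omega> (s - 1) u \<ge> (s - 1) * weighted_L1 \<Omega> s u
        + real (DIM('a) - 1) * mean_curvature \<Omega> y0 * weighted_L1 \<Omega> (s - 1) u"
      by (simp add: L1_hardy_def)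
    moreover have "real (DIM('a) - 1) * mean_curvature \<Omega> y0 * weighted_L1 \<Omega> (s - 1) u \<ge> 0"
      by (intro mult_nonneg_nonneg weighted_L1_nonneg) (use H[OF y0(1)] in auto)
    ultimately show ?thesis using pos[OF u, of s] by (simp add: pos_le_divide_eq)
  qed
  have bdd: "bdd_below (?R ` ?X)" using lower by (intro bdd_belowI2[of _ "s - 1"]) auto
  have ge: "(INF u\<in>?X. ?R u) \<ge> s - 1" by (rule cINF_greatest[OF ne lower])
  moreover have "\<not> (INF u\<in>?X. ?R u) > s - 1"
  proof
    assume gt: "(INF u\<in>?X. ?R u) > s - 1"
    let ?c = "(INF u\<in>?X. ?R u) - (s - 1)"
    show False
    proof (rule no_singular_improvement[OF n s, of ?c s])
      show "?c > 0" "s > s - 1" using gt by simp_all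
      fix u assume u: "u \<in> Cc_infinity \<Omega>"
      show "weighted_grad_L1 \<Omega> (s - 1) u \<ge> (s - 1) * weighted_L1 \<Omega> s u + ?c * weighted_L1 \<Omega> s u"
      proof (cases "u = (\<lambda>_. 0)")
        case True
        then show ?thesis by (simp add: zero)
      next
        case False
        then have uX: "u \<in> ?X" using u by simp
        have "(INF u\<in>?X. ?R u) \<le> ?R u" by (rule cINF_lower[OF bdd uX])
        then have "(INF u\<in>?X. ?R u) * weighted_L1 \<Omega> s u \<le> weighted_grad_L1 \<Omega> (s - 1) u"
          using pos[OF uX, of s] by (simp only: pos_le_divide_eq)
        then show ?thesis by (simp add: left_diff_distrib)
      qed
    qed
  qed
  ultimately show "(INF u\<in>?X. ?R u) = s - 1" by linarith
qed

text \<open>The supremum of the admissible constants is admissible, because for each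
  \<open>u\<close> the condition is a closed half-line in \<open>B\<close>. The set contains the
  curvature bound and is bounded above by the quotient of any nonzero test function.\<close>

lemma best_L1_hardy_constant:
  assumes n: "DIM('a) \<ge> 2" and s: "s \<ge> 2" and ne: "Cc_infinity \<Omega> - {\<lambda>_. 0} \<noteq> {}"
  obtains B where "\<forall>u\<in>Cc_infinity \<Omega>. L1_hardy \<Omega> s (ereal B) u"
    "\<forall>B'. (\<forall>u\<in>Cc_infinity \<Omega>. L1_hardy \<Omega> s (ereal B') u) \<longrightarrow> B' \<le> B"
    "ereal (real (DIM('a) - 1)) * inf_mean_curvature \<Omega> \<le> ereal B"
proof -
  define A where "A = {B. \<forall>u\<in>Cc_infinity \<Omega>. L1_hardy \<Omega> s (ereal B) u}"
  have hardy: "L1_hardy \<Omega> s (ereal B) u \<longleftrightarrow>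
      (s - 1) * weighted_L1 \<Omega> s u + B * weighted_L1 \<Omega> (s - 1) u \<le> weighted_grad_L1 \<Omega> (s - 1) u" for B u
    by (simp add: L1_hardy_def)
  obtain y0 where y0: "inf_mean_curvature \<Omega> = ereal (mean_curvature \<Omega> y0)"
    by (rule inf_mean_curvature_attained[OF n], rule that)
  have yA: "real (DIM('a) - 1) * mean_curvature \<Omega> y0 \<in> A"
    unfolding A_def using L1_hardy_inf_mean_curvature[OF open_\<Omega> not_UNIV C2 frontier_ne n, of _ s] s
    by (simp add: y0)
  obtain v where v: "v \<in> Cc_infinity \<Omega>" "v \<noteq> (\<lambda>_. 0)" using ne by blast
  have vp: "weighted_L1 \<Omega> (s - 1) v > 0" by (rule weighted_L1_pos[OF open_\<Omega> not_UNIV v])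
  have bdd: "bdd_above A"
  proof (rule bdd_aboveI)
    fix B assume "B \<in> A"
    then have "(s - 1) * weighted_L1 \<Omega> s v + B * weighted_L1 \<Omega> (s - 1) v \<le> weighted_grad_L1 \<Omega> (s - 1) v"
      using v(1) by (simp add: A_def hardy)
    then show "B \<le> (weighted_grad_L1 \<Omega> (s - 1) v - (s - 1) * weighted_L1 \<Omega> s v) / weighted_L1 \<Omega> (s - 1) v"
      using vp by (simp add: pos_le_divide_eq)
  qed
  show ?thesis
  proof (rule that)
    show "ereal (real (DIM('a) - 1)) * inf_mean_curvature \<Omega> \<le> ereal (Sup A)"
      using cSup_upper[OF yA bdd] by (simp add: y0)
    show "\<forall>B'. (\<forall>u\<in>Cc_infinity \<Omega>. L1_hardy \<Omega> s (ereal B') u) \<longrightarrow> B' \<le> Sup A"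
      using cSup_upper[OF _ bdd] by (simp add: A_def)
    show "\<forall>u\<in>Cc_infinity \<Omega>. L1_hardy \<Omega> s (ereal (Sup A)) u"
    proof
      fix u assume u: "u \<in> Cc_infinity \<Omega>"
      show "L1_hardy \<Omega> s (ereal (Sup A)) u"
      proof (cases "u = (\<lambda>_. 0)")
        case True
        have "L1_hardy \<Omega> s (ereal (real (DIM('a) - 1) * mean_curvature \<Omega> y0)) u" using yA u by (simp add: A_def)
        then show ?thesis unfolding hardy True by (simp add: weighted_L1_def)
      next
        case False
        have up: "weighted_L1 \<Omega> (s - 1) u > 0" by (rule weighted_L1_pos[OF open_\<Omega> not_UNIV u False])
        have "Sup A \<le> (weighted_grad_L1 \<Omega> (s - 1) u - (s - 1) * weighted_L1 \<Omega> s u) / weighted_L1 \<Omega> (s - 1) u"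
        proof (rule cSup_least)
          show "A \<noteq> {}" using yA by blast
          fix B assume "B \<in> A"
          then have "(s - 1) * weighted_L1 \<Omega> s u + B * weighted_L1 \<Omega> (s - 1) u \<le> weighted_grad_L1 \<Omega> (s - 1) u"
            using u by (simp add: A_def hardy)
          then show "B \<le> (weighted_grad_L1 \<Omega> (s - 1) u - (s - 1) * weighted_L1 \<Omega> s u) / weighted_L1 \<Omega> (s - 1) u"
            using up by (simp add: pos_le_divide_eq)
        qed
        then show ?thesis using up by (simp add: hardy pos_le_divide_eq)
      qed
    qed
  qed
qed

end

theorem theoremI:
  assumes "CARD('n::finite) \<ge> 2"
  shows
    "(\<forall>\<Omega> :: (real ^ 'n) set.
        domain \<Omega> \<and> \<Omega> \<noteq> UNIV \<and> C2_boundary \<Omega> \<and> interior_sphere_condition \<Omega> \<longrightarrow>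
        (\<exists>B::ereal. B \<ge> ereal (real CARD('n) - 1) * inf_mean_curvature \<Omega> \<and>
           (\<forall>u\<in>Cc_infinity \<Omega>. \<forall>s\<ge>1. L1_hardy \<Omega> s B u)))
     \<and>
     (\<forall>(\<Omega> :: (real ^ 'n) set) (s::real).
        s \<ge> 2 \<and> domain \<Omega> \<and> bounded \<Omega> \<and> C2_boundary \<Omega> \<and>
        (\<forall>y\<in>frontier \<Omega>. mean_curvature \<Omega> y > 0) \<longrightarrow>
        (INF u\<in>Cc_infinity \<Omega> - {\<lambda>_. 0}.
           weighted_grad_L1 \<Omega> (s - 1) u / weighted_L1 \<Omega> s u) = s - 1
        \<and>
        (\<forall>q>s - 1. \<not> (\<exists>c>0. \<forall>u\<in>Cc_infinity \<Omega>.
           weighted_grad_L1 \<Omega> (s - 1) u \<ge>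
             (s - 1) * weighted_L1 \<Omega> s u + c * weighted_L1 \<Omega> q u))
        \<and>
        (\<exists>y0\<in>frontier \<Omega>. inf_mean_curvature \<Omega> = ereal (mean_curvature \<Omega> y0))
        \<and>
        (\<exists>B::real.
           (\<forall>u\<in>Cc_infinity \<Omega>. L1_hardy \<Omega> s (ereal B) u) \<and>
           (\<forall>B'::real. (\<forall>u\<in>Cc_infinity \<Omega>. L1_hardy \<Omega> s (ereal B') u) \<longrightarrow> B' \<le> B) \<and>
           ereal (real CARD('n) - 1) * inf_mean_curvature \<Omega> \<le> ereal B \<and>
           B \<le> (real CARD('n) - 1) / measure (surface_measure \<Omega>) (frontier \<Omega>) *
                 (LINT y:frontier \<Omega>|surface_measure \<Omega>. mean_curvature \<Omega> y)))"
proof (intro conjI allI impI)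
  have n: "DIM(real ^ 'n) \<ge> 2" using assms by simp
  \<comment> \<open>The statement subtracts in the reals, whereas curvature sums are indexed by
    natural subtraction; the two agree because the dimension is at least 2.\<close>
  have m: "real CARD('n) - 1 = real (DIM(real ^ 'n) - 1)" using assms by (simp add: of_nat_diff)
  fix \<Omega> :: "(real ^ 'n) set"
  {
    assume "domain \<Omega> \<and> \<Omega> \<noteq> UNIV \<and> C2_boundary \<Omega> \<and> interior_sphere_condition \<Omega>"
    then have \<Omega>: "open \<Omega>" "\<Omega> \<noteq> UNIV" "C2_boundary \<Omega>" "frontier \<Omega> \<noteq> {}"
      using frontier_not_empty by (auto simp: domain_def)
    show "\<exists>B::ereal. B \<ge> ereal (real CARD('n) - 1) * inf_mean_curvature \<Omega> \<and>
        (\<forall>u\<in>Cc_infinity \<Omega>. \<forall>s\<ge>1. L1_hardy \<Omega> s B u)"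
      unfolding m using L1_hardy_inf_mean_curvature[OF \<Omega> n] by blast
  }
  fix s :: real
  assume asm: "s \<ge> 2 \<and> domain \<Omega> \<and> bounded \<Omega> \<and> C2_boundary \<Omega> \<and> (\<forall>y\<in>frontier \<Omega>. mean_curvature \<Omega> y > 0)"
  then have s: "s \<ge> 2" and H: "\<And>y. y \<in> frontier \<Omega> \<Longrightarrow> mean_curvature \<Omega> y > 0" by auto
  interpret C2_domain \<Omega> using asm by unfold_locales (auto simp: domain_def)
  note quotient = hardy_quotient_inf[OF n s H]
  show "(INF u\<in>Cc_infinity \<Omega> - {\<lambda>_. 0}. weighted_grad_L1 \<Omega> (s - 1) u / weighted_L1 \<Omega> s u) = s - 1"
    by (rule quotient(2))
  show "\<not> (\<exists>c>0. \<forall>u\<in>Cc_infinity \<Omega>. weighted_grad_L1 \<Omega> (s - 1) u \<ge>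
      (s - 1) * weighted_L1 \<Omega> s u + c * weighted_L1 \<Omega> q u)" if "q > s - 1" for q
    using no_singular_improvement[OF n s _ that] by blast
  show "\<exists>y0\<in>frontier \<Omega>. inf_mean_curvature \<Omega> = ereal (mean_curvature \<Omega> y0)"
    using inf_mean_curvature_attained[OF n] by blast
  obtain B where B: "\<forall>u\<in>Cc_infinity \<Omega>. L1_hardy \<Omega> s (ereal B) u"
    "\<forall>B'. (\<forall>u\<in>Cc_infinity \<Omega>. L1_hardy \<Omega> s (ereal B') u) \<longrightarrow> B' \<le> B"
    "ereal (real (DIM(real ^ 'n) - 1)) * inf_mean_curvature \<Omega> \<le> ereal B"
    by (rule best_L1_hardy_constant[OF n s quotient(1)])
  show "\<exists>B::real. (\<forall>u\<in>Cc_infinity \<Omega>. L1_hardy \<Omega> s (ereal B) u) \<and>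
      (\<forall>B'::real. (\<forall>u\<in>Cc_infinity \<Omega>. L1_hardy \<Omega> s (ereal B') u) \<longrightarrow> B' \<le> B) \<and>
      ereal (real CARD('n) - 1) * inf_mean_curvature \<Omega> \<le> ereal B \<and>
      B \<le> (real CARD('n) - 1) / measure (surface_measure \<Omega>) (frontier \<Omega>) *
        (LINT y:frontier \<Omega>|surface_measure \<Omega>. mean_curvature \<Omega> y)"
    unfolding m using B L1_hardy_constant_le[OF n s bspec[OF B(1)]] by blast
qed

end
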